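(* Let $N\ge 2$, $p>1$, let $\Omega\subset\mathbb{R}^N$ be a bounded domain with smooth boundary, let $k:\bar\Omega\to\,]0,+\infty[$ be continuous, and let $A:\bar\Omega\times\mathbb{R}^N\to\mathbb{R}$ be a continuous function with continuous gradient $a(x,\xi):=\nabla_\xi A(x,\xi)$ satisfying the structure conditions $(\alpha_1)$–$(\alpha_5)$ listed in the context, with constants $\Lambda_1,\Lambda_2>0$ from $(\alpha_5)$. Let $f:\mathbb{R}\to\mathbb{R}$ be a continuous function such that $$|f(t)|\le a_1+a_2|t|^{q-1}\qquad\text{for all } t\in\mathbb{R},$$ for some constants $a_1,a_2\ge 0$ and some $q$ with $1<q<pN/(N-p)$ if $p<N$, and $1<q<+\infty$ if $p\ge N$. Put $F(s):=\int_0^s f(t)\,dt$ and let $\tau,\kappa,G_1,G_2$ be the constants defined in the context. Assume that: (i) $F(s)\ge 0$ for every $s>0$; (ii) $\displaystyle\lim_{|t|\to\infty}\frac{f(t)}{|t|^{p-1}}=0$; (iii) there are positive constants $\gamma$ and $\delta$, with $\delta>\gamma\kappa$, such that $$\frac{F(\delta)}{\delta^p}>a_1\frac{G_1}{\gamma^{p-1}}+a_2G_2\gamma^{q-p}.$$ Then for each $$\lambda\in\left]\frac{2^p(2^N-1)\Lambda_2}{\tau^p\min_{x\in\bar\Omega}k(x)}\cdot\frac{\delta^p}{F(\delta)}\,,\ \frac{2^p(2^N-1)\Lambda_2}{\tau^p\min_{x\in\bar\Omega}k(x)}\cdot\frac{1}{a_1\frac{G_1}{\gamma^{p-1}}+a_2G_2\gamma^{q-p}}\right[$$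 the Dirichlet problem $$-\operatorname{div}(a(x,\nabla u))=\lambda k(x)f(u)\ \text{ in }\Omega,\qquad u=0\ \text{ on }\partial\Omega,$$ possesses at least three (distinct) weak solutions in $W^{1,p}_0(\Omega)$.
   Context: Structure conditions on $A$ and $a=\nabla_\xi A$: $(\alpha_1)$ $A(x,0)=0$ for all $x\in\Omega$. $(\alpha_2)$ There is a constant $c>0$ such that $|a(x,\xi)|\le c(1+|\xi|^{p-1})$ for all $x\in\Omega$, $\xi\in\mathbb{R}^N$. $(\alpha_3)$ ($p$-uniform convexity) There is a constant $k_0>0$ such that $A\left(x,\frac{\xi+\eta}{2}\right)\le\frac12A(x,\xi)+\frac12A(x,\eta)-k_0|\xi-\eta|^p$ for all $x\in\bar\Omega$, $\xi,\eta\in\mathbb{R}^N$. $(\alpha_4)$ ($p$-subhomogeneity) $0\le a(x,\xi)\cdot\xi\le pA(x,\xi)$ for all $x\in\bar\Omega$, $\xi\in\mathbb{R}^N$. $(\alpha_5)$ There are constants $\Lambda_1,\Lambda_2>0$ such that $\Lambda_1|\xi|^p\le A(x,\xi)\le\Lambda_2|\xi|^p$ for all $x\in\bar\Omega$, $\xi\in\mathbb{R}^N$. Space and embedding constants: $X:=W^{1,p}_0(\Omega)$ is endowed with the norm $\|u\|:=\left(\int_\Omega|\nabla u(x)|^p\,dx\right)^{1/p}$. For an exponent $s\in\{1,q\}$, $c_s$ denotes a positive constant such that $\|u\|_{L^s(\Omega)}\le c_s\|u\|$ for all $u\in X$ (it exists by the Sobolev embedding theorem). Geometric constants: $\tau:=\sup_{x\in\Omega}\operatorname{dist}(x,\partial\Omega)$;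 $\omega_\tau:=\tau^N\frac{\pi^{N/2}}{\Gamma(1+N/2)}$ is the Lebesgue measure of the $N$-dimensional ball of radius $\tau$; $\|k\|_\infty:=\max_{x\in\bar\Omega}|k(x)|$; $$\kappa:=\left(\frac{2^{N-p}}{\omega_\tau(2^N-1)\Lambda_1}\right)^{1/p}\tau,$$ $$G_1:=\left(\frac{2^p(2^N-1)\Lambda_2}{\tau^p\min_{x\in\bar\Omega}k(x)}\right)\frac{\|k\|_\infty c_1}{\Lambda_1^{1/p}},\qquad G_2:=\left(\frac{2^p(2^N-1)\Lambda_2}{\tau^p\min_{x\in\bar\Omega}k(x)}\right)\frac{\|k\|_\infty c_q^q}{q\,\Lambda_1^{q/p}}.$$ Weak solution: $u\in X$ is a weak solution of the Dirichlet problem if $$\int_\Omega a(x,\nabla u(x))\cdot\nabla v(x)\,dx=\lambda\int_\Omega k(x)f(u(x))v(x)\,dx\qquad\text{for every } v\in X.$$ The notation $]\alpha,\beta[$ means the open interval with endpoints $\alpha,\beta$. *)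

theory Defs
  imports "HOL-Analysis.Analysis"
begin

text \<open>\<open>Ck_on m S f\<close>: all partial derivatives of \<open>f\<close> up to order \<open>m\<close> exist and are continuous
  on the open set \<open>S\<close>.\<close>

primrec Ck_on :: "nat \<Rightarrow> 'a set \<Rightarrow> ('a::euclidean_space \<Rightarrow> real) \<Rightarrow> bool" where
  "Ck_on 0 S f \<longleftrightarrow> continuous_on S f"
| "Ck_on (Suc m) S f \<longleftrightarrow>
     (\<forall>x\<in>S. f differentiable (at x)) \<and>
     (\<forall>b\<in>Basis. Ck_on m S (\<lambda>x. frechet_derivative f (at x) b))"

definition smooth :: "('a::euclidean_space \<Rightarrow> real) \<Rightarrow> bool" where
  "smooth f \<longleftrightarrow> (\<forall>m. Ck_on m UNIV f)"

text \<open>Near each boundary point the domain is the set of points lying strictly above the graph of a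
  smooth function over a hyperplane. The hyperplane is the orthogonal complement of the unit vector
  \<open>e\<close>, and \<open>x - (x \<bullet> e) *\<^sub>R e\<close> is the projection of \<open>x\<close> to it; only the values of \<open>g\<close> on that
  hyperplane matter.\<close>

definition smooth_boundary :: "'a::euclidean_space set \<Rightarrow> bool" where
  "smooth_boundary \<Omega> \<longleftrightarrow>
     (\<forall>x0\<in>frontier \<Omega>. \<exists>r>0. \<exists>e g. norm e = 1 \<and> smooth g \<and>
        \<Omega> \<inter> ball x0 r = {x \<in> ball x0 r. g (x - (x \<bullet> e) *\<^sub>R e) < x \<bullet> e})"

definition smooth_bounded_domain :: "'a::euclidean_space set \<Rightarrow> bool" where
  "smooth_bounded_domain \<Omega> \<longleftrightarrow>
     \<Omega> \<noteq> {} \<and> open \<Omega> \<and> connected \<Omega> \<and> bounded \<Omega> \<and> smooth_boundary \<Omega>"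

text \<open>Elements of function spaces are represented by total functions of which only the values
  almost everywhere on \<open>\<Omega>\<close> matter; equality of elements is equality almost everywhere
  on \<open>\<Omega>\<close>.\<close>

definition in_Lp ::
  "'a::euclidean_space set \<Rightarrow> real \<Rightarrow> ('a \<Rightarrow> 'b::euclidean_space) \<Rightarrow> bool" where
  "in_Lp \<Omega> s u \<longleftrightarrow> u \<in> borel_measurable (lebesgue_on \<Omega>) \<and>
     integrable (lebesgue_on \<Omega>) (\<lambda>x. norm (u x) powr s)"

definition Lp_norm ::
  "'a::euclidean_space set \<Rightarrow> real \<Rightarrow> ('a \<Rightarrow> 'b::euclidean_space) \<Rightarrow> real" where
  "Lp_norm \<Omega> s u = (LINT x|lebesgue_on \<Omega>. norm (u x) powr s) powr (1 / s)"

definition locally_integrable ::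
  "'a::euclidean_space set \<Rightarrow> ('a \<Rightarrow> 'b::euclidean_space) \<Rightarrow> bool" where
  "locally_integrable \<Omega> u \<longleftrightarrow>
     (\<forall>K. compact K \<and> K \<subseteq> \<Omega> \<longrightarrow> integrable (lebesgue_on K) u)"

definition test_functions :: "'a::euclidean_space set \<Rightarrow> ('a \<Rightarrow> real) set" where
  "test_functions \<Omega> =
     {\<phi>. smooth \<phi> \<and> compact (closure {x. \<phi> x \<noteq> 0}) \<and> closure {x. \<phi> x \<noteq> 0} \<subseteq> \<Omega>}"

definition has_weak_gradient ::
  "'a::euclidean_space set \<Rightarrow> ('a \<Rightarrow> real) \<Rightarrow> ('a \<Rightarrow> 'a) \<Rightarrow> bool" where
  "has_weak_gradient \<Omega> u g \<longleftrightarrow> locally_integrable \<Omega> u \<and> locally_integrable \<Omega> g \<and>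
     (\<forall>\<phi>\<in>test_functions \<Omega>. \<forall>b\<in>Basis.
        (LINT x|lebesgue_on \<Omega>. u x * frechet_derivative \<phi> (at x) b) =
        - (LINT x|lebesgue_on \<Omega>. (g x \<bullet> b) * \<phi> x))"

text \<open>The weak gradient is unique up to null sets; an arbitrary representative is chosen.\<close>

definition weak_grad :: "'a::euclidean_space set \<Rightarrow> ('a \<Rightarrow> real) \<Rightarrow> 'a \<Rightarrow> 'a" where
  "weak_grad \<Omega> u = (SOME g. has_weak_gradient \<Omega> u g)"

definition W1p :: "'a::euclidean_space set \<Rightarrow> real \<Rightarrow> ('a \<Rightarrow> real) set" where
  "W1p \<Omega> p = {u. in_Lp \<Omega> p u \<and> (\<exists>g. has_weak_gradient \<Omega> u g \<and> in_Lp \<Omega> p g)}"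

definition W1p_norm :: "'a::euclidean_space set \<Rightarrow> real \<Rightarrow> ('a \<Rightarrow> real) \<Rightarrow> real" where
  "W1p_norm \<Omega> p u =
     (Lp_norm \<Omega> p u powr p + Lp_norm \<Omega> p (weak_grad \<Omega> u) powr p) powr (1 / p)"

definition W1p_0 :: "'a::euclidean_space set \<Rightarrow> real \<Rightarrow> ('a \<Rightarrow> real) set" where
  "W1p_0 \<Omega> p =
     {u \<in> W1p \<Omega> p. \<forall>\<epsilon>>0. \<exists>\<phi>\<in>test_functions \<Omega>. W1p_norm \<Omega> p (\<lambda>x. u x - \<phi> x) < \<epsilon>}"

definition W1p_0_norm :: "'a::euclidean_space set \<Rightarrow> real \<Rightarrow> ('a \<Rightarrow> real) \<Rightarrow> real" where
  "W1p_0_norm \<Omega> p u = (LINT x|lebesgue_on \<Omega>. norm (weak_grad \<Omega> u x) powr p) powr (1 / p)"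

text \<open>The inequality between norms is read in \<open>[0, \<infinity>]\<close>, so it includes membership in
  \<open>L\<^sup>s(\<Omega>)\<close>; without this, the Bochner integral of a non-integrable function would be
  \<open>0\<close>.\<close>

definition embedding_constant :: "'a::euclidean_space set \<Rightarrow> real \<Rightarrow> real \<Rightarrow> real \<Rightarrow> bool" where
  "embedding_constant \<Omega> p s c \<longleftrightarrow>
     c > 0 \<and> (\<forall>u\<in>W1p_0 \<Omega> p. in_Lp \<Omega> s u \<and> Lp_norm \<Omega> s u \<le> c * W1p_0_norm \<Omega> p u)"

text \<open>Integrability of both integrands is part of the definition, for the same reason.\<close>

definition weak_solution ::
  "'a::euclidean_space set \<Rightarrow> real \<Rightarrow> ('a \<Rightarrow> 'a \<Rightarrow> 'a) \<Rightarrow> ('a \<Rightarrow> real) \<Rightarrow> (real \<Rightarrow> real) \<Rightarrow>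
   real \<Rightarrow> ('a \<Rightarrow> real) \<Rightarrow> bool" where
  "weak_solution \<Omega> p a k f \<mu> u \<longleftrightarrow> u \<in> W1p_0 \<Omega> p \<and>
     (\<forall>v\<in>W1p_0 \<Omega> p.
        integrable (lebesgue_on \<Omega>) (\<lambda>x. a x (weak_grad \<Omega> u x) \<bullet> weak_grad \<Omega> v x) \<and>
        integrable (lebesgue_on \<Omega>) (\<lambda>x. k x * f (u x) * v x) \<and>
        (LINT x|lebesgue_on \<Omega>. a x (weak_grad \<Omega> u x) \<bullet> weak_grad \<Omega> v x) =
        \<mu> * (LINT x|lebesgue_on \<Omega>. k x * f (u x) * v x))"

text \<open>The oriented integral, so that \<open>primitive f s\<close> is the negative of the integral over
  \<open>[s, 0]\<close> for \<open>s < 0\<close>.\<close>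

definition primitive :: "(real \<Rightarrow> real) \<Rightarrow> real \<Rightarrow> real" where
  "primitive f s = (LBINT t=ereal 0..ereal s. f t)"

text \<open>On a bounded nonempty domain and for continuous positive \<open>k\<close>, the suprema and infima below
  are over bounded nonempty sets of reals, and those over the closure are attained.\<close>

definition inradius :: "'a::euclidean_space set \<Rightarrow> real" where
  "inradius \<Omega> = (SUP x\<in>\<Omega>. infdist x (frontier \<Omega>))"

definition ball_volume :: "'a::euclidean_space set \<Rightarrow> real" where
  "ball_volume \<Omega> =
     inradius \<Omega> ^ DIM('a) * (pi powr (real DIM('a) / 2) / Gamma (1 + real DIM('a) / 2))"

definition min_on_closure :: "'a::euclidean_space set \<Rightarrow> ('a \<Rightarrow> real) \<Rightarrow> real" where
  "min_on_closure \<Omega> k = (INF x\<in>closure \<Omega>. k x)"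

definition max_norm :: "'a::euclidean_space set \<Rightarrow> ('a \<Rightarrow> real) \<Rightarrow> real" where
  "max_norm \<Omega> k = (SUP x\<in>closure \<Omega>. \<bar>k x\<bar>)"

definition kappa :: "'a::euclidean_space set \<Rightarrow> real \<Rightarrow> real \<Rightarrow> real" where
  "kappa \<Omega> p \<Lambda>1 =
     (2 powr (real DIM('a) - p) / (ball_volume \<Omega> * (2 ^ DIM('a) - 1) * \<Lambda>1)) powr (1 / p)
       * inradius \<Omega>"

definition prefactor ::
  "'a::euclidean_space set \<Rightarrow> real \<Rightarrow> ('a \<Rightarrow> real) \<Rightarrow> real \<Rightarrow> real" where
  "prefactor \<Omega> p k \<Lambda>2 =
     2 powr p * (2 ^ DIM('a) - 1) * \<Lambda>2 / (inradius \<Omega> powr p * min_on_closure \<Omega> k)"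

definition G1 ::
  "'a::euclidean_space set \<Rightarrow> real \<Rightarrow> ('a \<Rightarrow> real) \<Rightarrow> real \<Rightarrow> real \<Rightarrow> real \<Rightarrow> real" where
  "G1 \<Omega> p k \<Lambda>1 \<Lambda>2 c1 =
     prefactor \<Omega> p k \<Lambda>2 * (max_norm \<Omega> k * c1 / \<Lambda>1 powr (1 / p))"

definition G2 ::
  "'a::euclidean_space set \<Rightarrow> real \<Rightarrow> real \<Rightarrow> ('a \<Rightarrow> real) \<Rightarrow> real \<Rightarrow> real \<Rightarrow> real \<Rightarrow> real" where
  "G2 \<Omega> p q k \<Lambda>1 \<Lambda>2 cq =
     prefactor \<Omega> p k \<Lambda>2 * (max_norm \<Omega> k * cq powr q / (q * \<Lambda>1 powr (q / p)))"

end

theory Submission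
  imports Defs
begin

text \<open>Let \<open>\<Phi>(u) = \<integral> A(x, \<nabla>u)\<close>, \<open>\<Psi>(u) = \<integral> k F(u)\<close> and \<open>J = \<Phi> - \<mu>\<Psi>\<close>. The upper bound on \<open>\<mu>\<close> and the embedding
  constants give \<open>J \<ge> \<rho> > 0\<close> on a shell around the level \<open>\<Phi> = \<gamma>\<^sup>p\<close>, while \<open>J(0) = 0\<close>. The lower bound
  on \<open>\<mu>\<close> gives \<open>J(v) < 0\<close> for a smoothed tent \<open>v\<close> of height \<open>\<delta>\<close> over an almost largest inscribed ball,
  and \<open>\<delta> > \<gamma>\<kappa>\<close> puts \<open>v\<close> outside the shell. So \<open>J\<close> has a minimum inside the shell, a minimum outside it
  and a mountain pass point at a level at least \<open>\<rho>\<close>.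

  The three points are found in the finite-dimensional spaces spanned by the first \<open>n\<close> members of a
  sequence of test functions that is dense in \<open>C\<^sup>1\<close>, where sublevel sets of \<open>J\<close> are compact.
  Sublinearity of \<open>f\<close> makes \<open>J\<close> coercive, so each of the three sequences is bounded and, by Rellich's
  theorem, has a subsequence \<open>w\<^sub>n\<close> that converges in \<open>L\<^sup>p\<close>. Strong convergence of the gradients needs no weak
  compactness: testing the equation of \<open>w\<^sub>n\<close> with \<open>w\<^sub>m - w\<^sub>n\<close> (\<open>m \<le> n\<close>), uniform convexity bounds
  \<open>\<integral> |\<nabla>w\<^sub>m - \<nabla>w\<^sub>n|\<^sup>p\<close> by \<open>\<Phi>(w\<^sub>m) - \<Phi>(w\<^sub>n)\<close> plus a term that the \<open>L\<^sup>p\<close> convergence makes small. In the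
  limit the values of \<open>\<Phi>\<close> and \<open>J\<close> still separate the three solutions.\<close>

section \<open>Smooth functions and test functions\<close>

text \<open>The explicit constants belong to the tent of height \<delta> that is constant on a half
  ball and has slope 2\<delta>/\<tau> on the surrounding annulus. Its p-energy is
  (2\<delta>/\<tau>)^p times the volume of the annulus, which is 2^N - 1 times the volume of the
  half ball where F(u) = F(\<delta>) is certain. The quotient gives \<open>prefactor\<close>, and
  \<open>kappa\<close> is what makes \<Lambda>1 times this energy exceed \<gamma>^p. Both conditions
  are strict, so they survive a slightly smaller ball and smoothing.

  Galerkin spaces are used because minimisation and the minimax argument in the Sobolev space itself
  would call for weak compactness or a Palais-Smale condition. The price is that a Galerkin solution
  may be tested only with elements of its own space, which forces the order m \<le> n when w_m and
  w_n are compared. The resulting one-sided estimate is enough once the values \<Phi>(w_n) converge,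
  and one more subsequence arranges this. The barrier has positive width so that the separation of
  the values of \<Phi> does not collapse in the limit.\<close>

lemma Ck_on_imp_continuous_on: "Ck_on m S f \<Longrightarrow> continuous_on S f"
proof (cases m)
  case (Suc n)
  assume "Ck_on m S f"
  then show ?thesis
    by (auto simp: Suc intro!: continuous_at_imp_continuous_on differentiable_imp_continuous_within)
qed simp

lemma Ck_on_SucD: "Ck_on (Suc m) S f \<Longrightarrow> Ck_on m S f"
proof (induction m arbitrary: f)
  case 0
  then show ?case using Ck_on_imp_continuous_on by (metis Ck_on.simps(1))
next
  case (Suc m)
  then show ?case by (metis Ck_on.simps(2))
qed

lemma Ck_on_cong:
  assumes "open S"
  shows "\<lbrakk>Ck_on m S f; \<And>x. x \<in> S \<Longrightarrow> f x = g x\<rbrakk> \<Longrightarrow> Ck_on m S g"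
proof (induction m arbitrary: f g)
  case 0
  then show ?case by (auto cong: continuous_on_cong_simp)
next
  case (Suc m)
  have fd: "(f has_derivative frechet_derivative f (at x)) (at x)" if "x \<in> S" for x
    using Suc.prems(1) that by (simp add: frechet_derivative_works)
  have gd: "(g has_derivative frechet_derivative f (at x)) (at x)" if "x \<in> S" for x
    using has_derivative_transform_within_open[OF fd[OF that] assms that] Suc.prems(2) by auto
  have eq: "frechet_derivative g (at x) = frechet_derivative f (at x)" if "x \<in> S" for x
    using frechet_derivative_at[OF gd[OF that]] by simp
  have "Ck_on m S (\<lambda>x. frechet_derivative g (at x) b)" if "b \<in> Basis" for b
  proof (rule Suc.IH)
    show "Ck_on m S (\<lambda>x. frechet_derivative f (at x) b)" using Suc.prems(1) that by simp
  qed (simp add: eq)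
  then show ?case using gd by (auto simp: differentiable_def)
qed

text \<open>\<open>frechet_derivative\<close> is a choice term; this rule lets the derivative be
  supplied in whatever form calculus produces it. On an open set the replacement passes through all
  higher derivatives.\<close>

lemma Ck_on_SucI:
  assumes "open S" "\<And>x. x \<in> S \<Longrightarrow> (f has_derivative D x) (at x)"
    and "\<And>b. b \<in> Basis \<Longrightarrow> Ck_on m S (\<lambda>x. D x b)"
  shows "Ck_on (Suc m) S f"
proof -
  have "Ck_on m S (\<lambda>x. frechet_derivative f (at x) b)" if "b \<in> Basis" for b
    by (rule Ck_on_cong[OF assms(1) assms(3)[OF that]]) (simp add: frechet_derivative_at[OF assms(2), symmetric])
  then show ?thesis using assms(2) by (auto simp: differentiable_def)
qed

lemma Ck_on_has_derivative:
  "\<lbrakk>Ck_on (Suc m) S f; x \<in> S\<rbrakk> \<Longrightarrow> (f has_derivative frechet_derivative f (at x)) (at x)"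
  by (simp add: frechet_derivative_works)

lemma Ck_on_const: "Ck_on m S (\<lambda>x. c)"
  by (induction m arbitrary: c) (auto simp: frechet_derivative_const)

lemma Ck_on_bounded_linear:
  assumes "open S" "bounded_linear f"
  shows "Ck_on m S f"
proof (cases m)
  case 0
  then show ?thesis by (simp add: assms(2) linear_continuous_on)
next
  case (Suc n)
  show ?thesis unfolding Suc
    by (rule Ck_on_SucI[OF assms(1) bounded_linear_imp_has_derivative[OF assms(2)]]) (rule Ck_on_const)
qed

lemma Ck_on_add:
  assumes "open S"
  shows "\<lbrakk>Ck_on m S f; Ck_on m S g\<rbrakk> \<Longrightarrow> Ck_on m S (\<lambda>x. f x + g x)"
proof (induction m arbitrary: f g)
  case 0
  then show ?case by (auto intro: continuous_intros)
next
  case (Suc m)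
  note hd = Ck_on_has_derivative[OF Suc.prems(1)] Ck_on_has_derivative[OF Suc.prems(2)]
  show ?case
    by (rule Ck_on_SucI[OF assms has_derivative_add[OF hd]], assumption, assumption)
      (use Suc in auto)
qed

lemma Ck_on_mult:
  assumes "open S"
  shows "\<lbrakk>Ck_on m S f; Ck_on m S g\<rbrakk> \<Longrightarrow> Ck_on m S (\<lambda>x. f x * g x)"
proof (induction m arbitrary: f g)
  case 0
  then show ?case by (auto intro: continuous_intros)
next
  case (Suc m)
  note hd = Ck_on_has_derivative[OF Suc.prems(1)] Ck_on_has_derivative[OF Suc.prems(2)]
  show ?case
    by (rule Ck_on_SucI[OF assms has_derivative_mult[OF hd]], assumption, assumption)
      (use Suc Ck_on_SucD[OF Suc.prems(1)] Ck_on_SucD[OF Suc.prems(2)] in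
        \<open>auto intro!: Ck_on_add[OF assms]\<close>)
qed

lemma Ck_on_sum:
  assumes "open S" "\<And>i. i \<in> I \<Longrightarrow> Ck_on m S (f i)"
  shows "Ck_on m S (\<lambda>x. \<Sum>i\<in>I. f i x)"
  using assms(2) by (induction I rule: infinite_finite_induct) (auto intro: Ck_on_const Ck_on_add[OF assms(1)])

lemma Ck_on_prod:
  assumes "open S" "\<And>i. i \<in> I \<Longrightarrow> Ck_on m S (f i)"
  shows "Ck_on m S (\<lambda>x. \<Prod>i\<in>I. f i x)"
  using assms(2) by (induction I rule: infinite_finite_induct) (auto intro: Ck_on_const Ck_on_mult[OF assms(1)])

text \<open>With an outer function on the line, the chain rule yields the product of a scalar
  composition with a partial derivative of g, so the induction stays within products and
  compositions.\<close>

lemma Ck_on_compose: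
  fixes h :: "real \<Rightarrow> real"
  assumes "open S" "open T"
  shows "\<lbrakk>Ck_on m T h; Ck_on m S g; g ` S \<subseteq> T\<rbrakk> \<Longrightarrow> Ck_on m S (\<lambda>x. h (g x))"
proof (induction m arbitrary: h g)
  case 0
  then show ?case by (auto intro: continuous_on_compose2)
next
  case (Suc m)
  define h' where "h' y = frechet_derivative h (at y) 1" for y
  have lin: "frechet_derivative h (at y) v = h' y * v" if "y \<in> T" for y v
    using has_derivative_linear[OF Ck_on_has_derivative[OF Suc.prems(1) that]]
    unfolding h'_def by (metis linear_scale mult.commute mult.right_neutral real_scaleR_def)
  have "Ck_on m T h'" using Suc.prems(1) unfolding h'_def by auto
  then have 1: "Ck_on m S (\<lambda>x. h' (g x))"
    using Suc.IH Ck_on_SucD[OF Suc.prems(2)] Suc.prems(3) by blast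
  show ?case
  proof (rule Ck_on_SucI[OF assms(1)])
    fix x assume x: "x \<in> S"
    then have "g x \<in> T" using Suc.prems(3) by auto
    from has_derivative_compose[OF Ck_on_has_derivative[OF Suc.prems(2) x] Ck_on_has_derivative[OF Suc.prems(1) this]]
    show "((\<lambda>x. h (g x)) has_derivative (\<lambda>v. h' (g x) * frechet_derivative g (at x) v)) (at x)"
      by (simp add: lin[OF \<open>g x \<in> T\<close>])
  next
    fix b :: 'a assume "b \<in> Basis"
    then show "Ck_on m S (\<lambda>x. h' (g x) * frechet_derivative g (at x) b)"
      using Suc.prems(2) by (intro Ck_on_mult[OF assms(1)] 1) auto
  qed
qed

lemma Ck_on_real_SucI:
  fixes f :: "real \<Rightarrow> real"
  assumes "open S" "\<And>x. x \<in> S \<Longrightarrow> (f has_real_derivative f' x) (at x)" "Ck_on m S f'"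
  shows "Ck_on (Suc m) S f"
  using assms by (intro Ck_on_SucI[OF assms(1), where D="\<lambda>x. (*) (f' x)"])
    (auto simp: has_field_derivative_def)

text \<open>Differentiability is local. The rule glues the radial profile of the tent, a power times
  a cutoff on the positive axis, to zero on the rest of the line.\<close>

lemma Ck_on_Un: "\<lbrakk>open S; open T; Ck_on m S f; Ck_on m T f\<rbrakk> \<Longrightarrow> Ck_on m (S \<union> T) f"
  by (induction m arbitrary: f) (auto intro: continuous_on_open_Un)

lemma Ck_on_exp: "Ck_on m UNIV (exp :: real \<Rightarrow> real)"
  by (induction m) (auto intro!: continuous_intros Ck_on_real_SucI DERIV_exp simp del: Ck_on.simps(2))

lemma Ck_on_powr: "Ck_on m {0<..} (\<lambda>x::real. x powr r)"
proof (induction m arbitrary: r)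
  case 0
  show ?case by (auto intro!: continuous_intros)
next
  case (Suc m)
  show ?case
    by (rule Ck_on_real_SucI[where f'="\<lambda>x. r * x powr (r - 1)"])
      (auto intro!: has_real_derivative_powr Ck_on_mult Ck_on_const Suc)
qed

text \<open>The derivatives of \<open>exp(-1/t)\<close>, extended by \<open>0\<close>, are linear combinations of this family.\<close>

definition flat_exp :: "nat \<Rightarrow> real \<Rightarrow> real" where
  "flat_exp k t = (if t > 0 then exp (- 1 / t) / t ^ k else 0)"

text \<open>From the right, the substitution s = 1/t turns this into the decay of s^k e^(-s) at
  infinity.\<close>

lemma flat_exp_tendsto_0: "(flat_exp k \<longlongrightarrow> 0) (at 0)"
proof -
  have "((\<lambda>t::real. inverse t ^ k / exp (inverse t)) \<longlongrightarrow> 0) (at_right 0)"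
    by (rule filterlim_compose[OF tendsto_power_div_exp_0 filterlim_inverse_at_top_right])
  moreover have "eventually (\<lambda>t. inverse t ^ k / exp (inverse t) = flat_exp k t) (at_right 0)"
    by (auto simp: eventually_at_filter flat_exp_def exp_minus field_simps)
  ultimately have "(flat_exp k \<longlongrightarrow> 0) (at_right 0)"
    by (rule Lim_transform_eventually)
  moreover have "(flat_exp k \<longlongrightarrow> 0) (at_left 0)"
    by (rule Lim_transform_eventually[OF tendsto_const]) (auto simp: eventually_at_filter flat_exp_def)
  ultimately show ?thesis by (simp add: filterlim_split_at)
qed

lemma flat_exp_deriv:
  "(flat_exp k has_real_derivative flat_exp (k + 2) t - real k * flat_exp (k + 1) t) (at t)"
proof -
  consider "t > 0" | "t < 0" | "t = 0" by linarith
  then show ?thesis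
  proof cases
    case 1
    have "((\<lambda>t. exp (- 1 / t) / t ^ k) has_real_derivative flat_exp (k + 2) t - real k * flat_exp (k + 1) t) (at t)"
      using 1 by (auto intro!: derivative_eq_intros simp: flat_exp_def)
        (cases k; auto simp: field_simps power2_eq_square)
    then show ?thesis
      by (rule has_field_derivative_transform_within[where d=t]) (use 1 in \<open>auto simp: flat_exp_def dist_real_def\<close>)
  next
    case 2
    have "((\<lambda>t. 0) has_real_derivative 0) (at t)" by auto
    then have "(flat_exp k has_real_derivative 0) (at t)"
      by (rule has_field_derivative_transform_within[where d="-t"]) (use 2 in \<open>auto simp: flat_exp_def dist_real_def\<close>)
    then show ?thesis using 2 by (simp add: flat_exp_def)
  next
    case 3
    \<comment> \<open>The difference quotient at 0 is the next member
      \<open>flat_exp (Suc k)\<close> of the family.\<close>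
    have "((\<lambda>h. (flat_exp k (0 + h) - flat_exp k 0) / h) \<longlongrightarrow> 0) (at 0)"
      by (rule Lim_transform_eventually[OF flat_exp_tendsto_0[of "Suc k"]])
        (auto simp: flat_exp_def eventually_at_filter)
    then show ?thesis using 3 by (simp add: DERIV_def flat_exp_def)
  qed
qed

lemma Ck_on_flat_exp: "Ck_on m UNIV (flat_exp k)"
proof (induction m arbitrary: k)
  case 0
  then show ?case
    using flat_exp_deriv by (auto intro!: DERIV_continuous_on[of _ _ "\<lambda>t. flat_exp (k + 2) t - real k * flat_exp (k + 1) t"])
next
  case (Suc m)
  have "Ck_on m UNIV (\<lambda>t. flat_exp (k + 2) t + (- real k) * flat_exp (k + 1) t)"
    by (intro Ck_on_add Ck_on_mult Ck_on_const Suc open_UNIV)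
  then show ?case
    by (intro Ck_on_real_SucI[OF open_UNIV flat_exp_deriv]) simp
qed

lemma flat_exp_nonneg: "flat_exp k t \<ge> 0"
  and flat_exp_pos_iff: "flat_exp k t > 0 \<longleftrightarrow> t > 0"
  and flat_exp_eq_0_iff: "flat_exp k t = 0 \<longleftrightarrow> t \<le> 0"
  by (auto simp: flat_exp_def)

section \<open>Calculus of smooth functions\<close>

lemma smoothD: "smooth f \<Longrightarrow> Ck_on m UNIV f"
  by (simp add: smooth_def)

lemma smooth_has_derivative: "smooth f \<Longrightarrow> (f has_derivative frechet_derivative f (at x)) (at x)"
  using Ck_on_has_derivative[OF smoothD] by blast

lemma smooth_continuous_on: "smooth f \<Longrightarrow> continuous_on S f"
  using Ck_on_imp_continuous_on[OF smoothD] continuous_on_subset by blast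

lemma smooth_deriv_continuous_on:
  "smooth f \<Longrightarrow> b \<in> Basis \<Longrightarrow> continuous_on S (\<lambda>x. frechet_derivative f (at x) b)"
  using smoothD[of f "Suc 0"] continuous_on_subset[OF _ subset_UNIV] by auto

lemma smooth_const: "smooth (\<lambda>x. c)"
  and smooth_add: "smooth f \<Longrightarrow> smooth g \<Longrightarrow> smooth (\<lambda>x. f x + g x)"
  and smooth_mult: "smooth f \<Longrightarrow> smooth g \<Longrightarrow> smooth (\<lambda>x. f x * g x)"
  and smooth_sum: "(\<And>i. i \<in> I \<Longrightarrow> smooth (F i)) \<Longrightarrow> smooth (\<lambda>x. \<Sum>i\<in>I. F i x)"
  and smooth_prod: "(\<And>i. i \<in> I \<Longrightarrow> smooth (F i)) \<Longrightarrow> smooth (\<lambda>x. \<Prod>i\<in>I. F i x)"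
  and smooth_compose: "smooth (h :: real \<Rightarrow> real) \<Longrightarrow> smooth f \<Longrightarrow> smooth (\<lambda>x. h (f x))"
  and smooth_bounded_linear: "bounded_linear l \<Longrightarrow> smooth l"
  and smooth_exp: "smooth (exp :: real \<Rightarrow> real)"
  and smooth_flat_exp: "smooth (flat_exp k)"
  by (simp_all add: smooth_def Ck_on_const Ck_on_add Ck_on_mult Ck_on_sum Ck_on_prod
      Ck_on_bounded_linear Ck_on_exp Ck_on_flat_exp Ck_on_compose[OF open_UNIV open_UNIV])

lemma smooth_diff: "smooth f \<Longrightarrow> smooth g \<Longrightarrow> smooth (\<lambda>x. f x - g x)"
  using smooth_add[of f "\<lambda>x. (- 1) * g x"] smooth_mult[OF smooth_const, of g "- 1"] by simp

lemma smooth_minus: "smooth f \<Longrightarrow> smooth (\<lambda>x. - f x)"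
  using smooth_mult[OF smooth_const, of f "- 1"] by simp

lemma smooth_inner: "smooth (\<lambda>x. x \<bullet> c)"
  by (intro smooth_bounded_linear bounded_linear_inner_left)

text \<open>The squared norm is a polynomial in the coordinates, so radial functions built on it
  need no special treatment at the centre.\<close>

lemma smooth_norm_square: "smooth (\<lambda>x. (norm (x - c))\<^sup>2)"
proof -
  have "(norm (x - c))\<^sup>2 = (\<Sum>b\<in>Basis. (x \<bullet> b - c \<bullet> b) * (x \<bullet> b - c \<bullet> b))" for x :: 'a
    
    unfolding power2_norm_eq_inner by (subst euclidean_inner) (simp add: inner_diff_left)
  then show ?thesis
    by (simp only:) (intro smooth_sum smooth_mult smooth_diff smooth_inner smooth_const)
qed

section \<open>The space of test functions\<close>

lemma test_functionsI:
  assumes "smooth \<phi>" "compact K" "K \<subseteq> \<Omega>" "\<And>x. x \<notin> K \<Longrightarrow> \<phi> x = 0"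
  shows "\<phi> \<in> test_functions \<Omega>"
proof -
  have sub: "closure {x. \<phi> x \<noteq> 0} \<subseteq> K"
    using assms(2,4) by (intro closure_minimal compact_imp_closed) auto
  then have "compact (closure {x. \<phi> x \<noteq> 0})"
    using assms(2) closed_closure compact_Int_closed[of K "closure {x. \<phi> x \<noteq> 0}"] by (simp add: inf.absorb2)
  then show ?thesis using sub assms by (auto simp: test_functions_def)
qed

lemma test_functions_0: "(\<lambda>x. 0) \<in> test_functions \<Omega>"
  by (rule test_functionsI[of _ "{}"]) (auto intro: smooth_const)

lemma test_functions_add:
  assumes "f \<in> test_functions \<Omega>" "g \<in> test_functions \<Omega>"
  shows "(\<lambda>x. f x + g x) \<in> test_functions \<Omega>"
proof (rule test_functionsI)
  let ?K = "closure {x. f x \<noteq> 0} \<union> closure {x. g x \<noteq> 0}"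
  show "compact ?K" "?K \<subseteq> \<Omega>" "smooth (\<lambda>x. f x + g x)"
    using assms by (auto simp: test_functions_def intro: smooth_add)
  show "f x + g x = 0" if "x \<notin> ?K" for x
  proof -
    have "f x = 0" using that closure_subset[of "{x. f x \<noteq> 0}"] by blast
    moreover have "g x = 0" using that closure_subset[of "{x. g x \<noteq> 0}"] by blast
    ultimately show ?thesis by simp
  qed
qed

lemma test_functions_cmult:
  assumes "f \<in> test_functions \<Omega>"
  shows "(\<lambda>x. c * f x) \<in> test_functions \<Omega>"
proof (rule test_functionsI)
  let ?K = "closure {x. f x \<noteq> 0}"
  show "compact ?K" "?K \<subseteq> \<Omega>" "smooth (\<lambda>x. c * f x)"
    using assms by (auto simp: test_functions_def intro: smooth_mult smooth_const)
  show "c * f x = 0" if "x \<notin> ?K" for x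
  proof -
    have "f x = 0" using that closure_subset[of "{x. f x \<noteq> 0}"] by blast
    then show ?thesis by simp
  qed
qed

lemma test_functions_diff:
  "\<lbrakk>f \<in> test_functions \<Omega>; g \<in> test_functions \<Omega>\<rbrakk> \<Longrightarrow> (\<lambda>x. f x - g x) \<in> test_functions \<Omega>"
  using test_functions_add[of f \<Omega> "\<lambda>x. (- 1) * g x"] test_functions_cmult[of g \<Omega> "-1"] by simp

lemma test_functions_sum:
  "(\<And>i. i \<in> I \<Longrightarrow> F i \<in> test_functions \<Omega>) \<Longrightarrow> (\<lambda>x. \<Sum>i\<in>I. c i * F i x) \<in> test_functions \<Omega>"
proof (induction I rule: infinite_finite_induct)
  case (insert i I)
  then have "(\<lambda>x. c i * F i x + (\<Sum>i\<in>I. c i * F i x)) \<in> test_functions \<Omega>"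
    by (intro test_functions_add test_functions_cmult) auto
  then show ?case using insert.hyps by simp
qed (auto intro: test_functions_0)

text \<open>P is positive exactly in the open box, where 1 - exp(-jP) increases to 1; outside it
  stays 0. Smooth cutoffs thus arise without mollification. The bound by 1 is there for dominated
  convergence.\<close>

lemma box_indicator_approx:
  fixes a b :: "'a::euclidean_space"
  assumes "cbox a b \<subseteq> \<Omega>"
  obtains \<phi> :: "nat \<Rightarrow> 'a \<Rightarrow> real" where "\<And>j. \<phi> j \<in> test_functions \<Omega>" "\<And>j x. 0 \<le> \<phi> j x \<and> \<phi> j x \<le> 1"
    "\<And>j x. x \<notin> box a b \<Longrightarrow> \<phi> j x = 0" "\<And>x. (\<lambda>j. \<phi> j x) \<longlonglongrightarrow> indicator (box a b) x"
proof
  define P :: "'a \<Rightarrow> real" where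
    "P x = (\<Prod>i\<in>Basis. flat_exp 0 (x \<bullet> i - a \<bullet> i) * flat_exp 0 (b \<bullet> i - x \<bullet> i))" for x
  define \<phi> where "\<phi> j x = 1 - exp (- (real j * P x))" for j x
  have P0: "P x \<ge> 0" for x by (auto simp: P_def intro!: prod_nonneg mult_nonneg_nonneg flat_exp_nonneg)
  have Pout: "P x = 0" if "x \<notin> box a b" for x
    using that by (auto simp: P_def mem_box not_less flat_exp_eq_0_iff)
  have Pin: "P x > 0" if "x \<in> box a b" for x
    using that by (auto simp: P_def mem_box intro!: prod_pos mult_pos_pos simp: flat_exp_pos_iff)
  have smP: "smooth P" unfolding P_def
    by (intro smooth_prod smooth_mult smooth_compose[OF smooth_flat_exp] smooth_diff smooth_inner smooth_const)
  have sm: "smooth (\<phi> j)" for j unfolding \<phi>_def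
    by (intro smooth_diff smooth_const smooth_compose[OF smooth_exp] smooth_minus smooth_mult smP)
  show out: "\<phi> j x = 0" if "x \<notin> box a b" for j x using Pout[OF that] by (simp add: \<phi>_def)
  show "\<phi> j \<in> test_functions \<Omega>" for j
    by (rule test_functionsI[OF sm compact_cbox assms]) (use out box_subset_cbox in blast)
  show "0 \<le> \<phi> j x \<and> \<phi> j x \<le> 1" for j x using P0[of x] by (auto simp: \<phi>_def)
  show "(\<lambda>j. \<phi> j x) \<longlonglongrightarrow> indicator (box a b) x" for x
  proof (cases "x \<in> box a b")
    case True
    have "filterlim (\<lambda>j. P x * real j) at_top sequentially"
      by (rule filterlim_tendsto_pos_mult_at_top[OF tendsto_const Pin[OF True] filterlim_real_sequentially])
    then have "(\<lambda>j. exp (- (real j * P x))) \<longlonglongrightarrow> 0"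
      by (intro filterlim_compose[OF exp_at_bot]) (simp add: filterlim_uminus_at_top mult.commute)
    from tendsto_diff[OF tendsto_const this, of 1] show ?thesis using True by (simp add: \<phi>_def)
  qed (simp add: out)
qed

section \<open>Gradients and weak gradients of test functions\<close>

text \<open>The vector that represents the derivative. Unlike \<open>weak_grad\<close>, which is a
  choice, it is an explicit and continuous representative of the gradient of a test
  function.\<close>

definition grad :: "('a::euclidean_space \<Rightarrow> real) \<Rightarrow> 'a \<Rightarrow> 'a" where
  "grad \<phi> x = (\<Sum>b\<in>Basis. frechet_derivative \<phi> (at x) b *\<^sub>R b)"

lemma frechet_derivative_eq_grad:
  assumes "smooth \<phi>"
  shows "frechet_derivative \<phi> (at x) v = grad \<phi> x \<bullet> v"
proof -
  have l: "linear (frechet_derivative \<phi> (at x))"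
    by (rule has_derivative_linear[OF smooth_has_derivative[OF assms]])
  have "frechet_derivative \<phi> (at x) v = frechet_derivative \<phi> (at x) (\<Sum>b\<in>Basis. (v \<bullet> b) *\<^sub>R b)"
    by (simp add: euclidean_representation)
  also have "\<dots> = (\<Sum>b\<in>Basis. (v \<bullet> b) * frechet_derivative \<phi> (at x) b)"
    by (simp add: linear_sum[OF l] linear_scale[OF l])
  also have "\<dots> = grad \<phi> x \<bullet> v"
    unfolding grad_def inner_sum_left by (intro sum.cong) (auto simp: inner_commute)
  finally show ?thesis .
qed

lemma smooth_has_grad:
  assumes "smooth \<phi>"
  shows "(\<phi> has_derivative (\<lambda>v. grad \<phi> x \<bullet> v)) (at x)"
proof -
  have "frechet_derivative \<phi> (at x) = (\<lambda>v. grad \<phi> x \<bullet> v)"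
    by (rule ext) (rule frechet_derivative_eq_grad[OF assms])
  then show ?thesis using smooth_has_derivative[OF assms, of x] by metis
qed

lemma grad_unique:
  assumes "(\<phi> has_derivative (\<lambda>v. g \<bullet> v)) (at x)"
  shows "grad \<phi> x = g"
  unfolding grad_def frechet_derivative_at[OF assms, symmetric] by (rule euclidean_representation)

lemma grad_continuous_on: "smooth \<phi> \<Longrightarrow> continuous_on S (grad \<phi>)"
  unfolding grad_def by (intro continuous_intros smooth_deriv_continuous_on)

lemma grad_diff: "smooth f \<Longrightarrow> smooth g \<Longrightarrow> grad (\<lambda>x. f x - g x) x = grad f x - grad g x"
  by (rule grad_unique) (auto intro!: derivative_eq_intros smooth_has_grad simp: inner_diff_left)

lemma grad_sum:
  assumes "\<And>i. i \<in> I \<Longrightarrow> smooth (F i)"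
  shows "grad (\<lambda>x. \<Sum>i\<in>I. c i * F i x) x = (\<Sum>i\<in>I. c i *\<^sub>R grad (F i) x)"
proof (rule grad_unique)
  have "((\<lambda>x. \<Sum>i\<in>I. c i * F i x) has_derivative (\<lambda>v. \<Sum>i\<in>I. c i * (grad (F i) x \<bullet> v))) (at x)"
    by (intro has_derivative_sum has_derivative_mult_right smooth_has_grad assms)
  then show "((\<lambda>x. \<Sum>i\<in>I. c i * F i x) has_derivative (\<lambda>v. (\<Sum>i\<in>I. c i *\<^sub>R grad (F i) x) \<bullet> v)) (at x)"
    by (simp add: inner_sum_left)
qed

lemma test_functions_smooth: "\<phi> \<in> test_functions \<Omega> \<Longrightarrow> smooth \<phi>"
  by (simp add: test_functions_def)

lemma test_functions_mult_smooth:
  assumes "f \<in> test_functions \<Omega>" "smooth g"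
  shows "(\<lambda>x. g x * f x) \<in> test_functions \<Omega>"
proof (rule test_functionsI)
  let ?K = "closure {x. f x \<noteq> 0}"
  show "compact ?K" "?K \<subseteq> \<Omega>" "smooth (\<lambda>x. g x * f x)"
    using assms by (auto simp: test_functions_def intro: smooth_mult)
  show "g x * f x = 0" if "x \<notin> ?K" for x
  proof -
    have "f x = 0" using that closure_subset[of "{x. f x \<noteq> 0}"] by blast
    then show ?thesis by simp
  qed
qed

lemma test_functions_support:
  assumes "\<phi> \<in> test_functions \<Omega>"
  obtains K where "compact K" "K \<subseteq> \<Omega>" "\<And>x. x \<notin> K \<Longrightarrow> \<phi> x = 0" "\<And>x. x \<notin> K \<Longrightarrow> grad \<phi> x = 0"
proof
  let ?K = "closure {x. \<phi> x \<noteq> 0}"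
  show "compact ?K" "?K \<subseteq> \<Omega>" using assms by (auto simp: test_functions_def)
  show 0: "\<phi> x = 0" if "x \<notin> ?K" for x using that closure_subset[of "{x. \<phi> x \<noteq> 0}"] by blast
  show "grad \<phi> x = 0" if "x \<notin> ?K" for x
  proof (rule grad_unique)
    have "(\<phi> has_derivative (\<lambda>v. 0)) (at x)"
    proof (rule has_derivative_transform_within_open)
      show "((\<lambda>x. 0) has_derivative (\<lambda>v. 0)) (at x)" by simp
      show "open (- ?K)" "x \<in> - ?K" using that by auto
      show "0 = \<phi> y" if "y \<in> - ?K" for y using 0[of y] that by simp
    qed
    then show "(\<phi> has_derivative (\<lambda>v. 0 \<bullet> v)) (at x)" by simp
  qed
qed

lemma test_functions_outside:
  assumes "\<phi> \<in> test_functions \<Omega>" "x \<notin> \<Omega>"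
  shows "\<phi> x = 0" "grad \<phi> x = 0"
proof -
  obtain K where "K \<subseteq> \<Omega>" "\<And>x. x \<notin> K \<Longrightarrow> \<phi> x = 0" "\<And>x. x \<notin> K \<Longrightarrow> grad \<phi> x = 0"
    using test_functions_support[OF assms(1)] by metis
  then show "\<phi> x = 0" "grad \<phi> x = 0" using assms(2) by blast+
qed

lemma test_functions_bounded:
  assumes "\<phi> \<in> test_functions \<Omega>"
  obtains B where "B > 0" "\<And>x. \<bar>\<phi> x\<bar> \<le> B" "\<And>x. norm (grad \<phi> x) \<le> B"
proof -
  obtain K where K: "compact K" "\<And>x. x \<notin> K \<Longrightarrow> \<phi> x = 0" "\<And>x. x \<notin> K \<Longrightarrow> grad \<phi> x = 0"
    using test_functions_support[OF assms] by metis
  have "bounded (\<phi> ` K)" "bounded (grad \<phi> ` K)"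
    using K(1) smooth_continuous_on[OF test_functions_smooth[OF assms]]
      grad_continuous_on[OF test_functions_smooth[OF assms]] by (metis compact_continuous_image compact_imp_bounded)+
  then obtain B1 B2 where B: "B1 > 0" "B2 > 0" "\<And>x. x \<in> K \<Longrightarrow> norm (\<phi> x) \<le> B1" "\<And>x. x \<in> K \<Longrightarrow> norm (grad \<phi> x) \<le> B2"
    unfolding bounded_pos by fastforce
  show thesis
  proof (rule that[of "max B1 B2"])
    show "max B1 B2 > 0" using B by auto
    show "\<bar>\<phi> x\<bar> \<le> max B1 B2" for x using B(1) B(3)[of x] K(2)[of x] by (cases "x \<in> K") auto
    show "norm (grad \<phi> x) \<le> max B1 B2" for x using B(1) B(4)[of x] K(3)[of x] by (cases "x \<in> K") auto
  qed
qed

text \<open>The definitions integrate over \<open>lebesgue_on \<Omega>\<close>, whereas translation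
  invariance and Fubini are used for \<open>lborel\<close>. For Borel functions that vanish outside
  the set nothing is lost in passing between the two.\<close>

lemma integral_lebesgue_on_eq_lborel:
  fixes f :: "'a::euclidean_space \<Rightarrow> 'b::{banach, second_countable_topology}"
  assumes "f \<in> borel_measurable borel" "\<And>x. x \<notin> S \<Longrightarrow> f x = 0" "S \<in> sets lebesgue"
  shows "integral\<^sup>L (lebesgue_on S) f = integral\<^sup>L lborel f"
    and "integrable (lebesgue_on S) f \<longleftrightarrow> integrable lborel f"
proof -
  have eq: "(\<lambda>x. indicator S x *\<^sub>R f x) = f" using assms(2) by (auto simp: indicator_def fun_eq_iff)
  show "integral\<^sup>L (lebesgue_on S) f = integral\<^sup>L lborel f"
    using assms(1,3) by (simp add: integral_restrict_space eq integral_completion)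
  show "integrable (lebesgue_on S) f \<longleftrightarrow> integrable lborel f"
    using assms(1,3) by (simp add: integrable_restrict_space eq integrable_completion)
qed

lemma integrable_lebesgue_on_compact:
  fixes f :: "'a::euclidean_space \<Rightarrow> 'b::{banach, second_countable_topology}"
  assumes "compact K" "continuous_on K f"
  shows "integrable (lebesgue_on K) f"
proof -
  have "integrable lborel (\<lambda>x. indicator K x *\<^sub>R f x)"
    by (rule borel_integrable_compact[OF assms])
  then have "integrable lebesgue (\<lambda>x. indicator K x *\<^sub>R f x)"
    using integrable_completion[of "\<lambda>x. indicator K x *\<^sub>R f x" lborel] borel_measurable_integrable by blast
  moreover have "K \<in> sets lebesgue" using assms(1) by (simp add: borel_compact)
  ultimately show ?thesis by (simp add: integrable_restrict_space)
qed

lemma integrable_lborel_compact_support: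
  fixes f :: "'a::euclidean_space \<Rightarrow> 'b::{banach, second_countable_topology}"
  assumes "compact K" "continuous_on K f" "\<And>x. x \<notin> K \<Longrightarrow> f x = 0"
  shows "integrable lborel f"
proof -
  have eq: "(\<lambda>x. indicator K x *\<^sub>R f x) = f" using assms(3) by (auto simp: indicator_def fun_eq_iff)
  show ?thesis using borel_integrable_compact[OF assms(1,2)] by (simp add: eq)
qed

lemma integral_lborel_translate:
  fixes f :: "'a::euclidean_space \<Rightarrow> 'b::{banach, second_countable_topology}"
  assumes "f \<in> borel_measurable borel"
  shows "integral\<^sup>L lborel (\<lambda>x. f (x + c)) = integral\<^sup>L lborel f"
proof -
  have "integral\<^sup>L lborel f = integral\<^sup>L (distr lborel borel ((+) c)) f"
    by (simp add: lborel_distr_plus)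
  also have "\<dots> = integral\<^sup>L lborel (\<lambda>x. f (c + x))"
    by (rule integral_distr) (use assms in auto)
  finally show ?thesis by (simp add: add.commute)
qed

lemma nn_integral_lborel_translate:
  fixes f :: "'a::euclidean_space \<Rightarrow> ennreal"
  assumes "f \<in> borel_measurable borel"
  shows "(\<integral>\<^sup>+x. f (x + c) \<partial>lborel) = integral\<^sup>N lborel f"
proof -
  have "integral\<^sup>N lborel f = integral\<^sup>N (distr lborel borel ((+) c)) f"
    by (simp add: lborel_distr_plus)
  also have "\<dots> = (\<integral>\<^sup>+x. f (c + x) \<partial>lborel)"
    by (rule nn_integral_distr) (use assms in auto)
  finally show ?thesis by (simp add: add.commute)
qed

lemma test_function_lipschitz:
  assumes "smooth \<phi>" "\<And>x. norm (grad \<phi> x) \<le> B"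
  shows "\<bar>\<phi> x - \<phi> y\<bar> \<le> B * norm (x - y)"
proof -
  have "norm (\<phi> x - \<phi> y) \<le> B * norm (x - y)"
  proof (rule differentiable_bound[of UNIV])
    show "(\<phi> has_derivative (\<lambda>v. grad \<phi> x \<bullet> v)) (at x)" for x by (rule smooth_has_grad[OF assms(1)])
    show "onorm (\<lambda>v. grad \<phi> x \<bullet> v) \<le> B" for x
    proof (rule onorm_bound)
      show "0 \<le> B" using assms(2)[of x] norm_ge_zero[of "grad \<phi> x"] by linarith
      show "norm (grad \<phi> x \<bullet> v) \<le> B * norm v" for v
        using Cauchy_Schwarz_ineq2[of "grad \<phi> x" v] mult_right_mono[OF assms(2)[of x] norm_ge_zero[of v]]
        unfolding real_norm_def by linarith
    qed
  qed auto
  then show ?thesis by simp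
qed

text \<open>By translation invariance every difference quotient has integral 0, and dominated
  convergence passes to the derivative. This takes the place of the divergence theorem.\<close>

lemma integral_partial_derivative_eq_0:
  assumes \<phi>: "\<phi> \<in> test_functions \<Omega>" and b: "b \<in> Basis"
  shows "(LINT x|lborel. grad \<phi> x \<bullet> b) = 0"
proof -
  note sm = test_functions_smooth[OF \<phi>]
  obtain K where K: "compact K" "\<And>x. x \<notin> K \<Longrightarrow> \<phi> x = 0"
    using test_functions_support[OF \<phi>] by metis
  obtain R where R: "\<And>x. x \<in> K \<Longrightarrow> norm x \<le> R"
    using compact_imp_bounded[OF K(1)] unfolding bounded_iff by blast
  obtain B where B: "B > 0" "\<And>x. norm (grad \<phi> x) \<le> B" using test_functions_bounded[OF \<phi>] by metis
  define h where "h n = 1 / (real n + 1)" for n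
  have h: "h n > 0" "h n \<le> 1" for n by (auto simp: h_def)
  have hlim: "h \<longlonglongrightarrow> 0" unfolding h_def using LIMSEQ_inverse_real_of_nat by (simp add: inverse_eq_divide add.commute)
  have int: "integrable lborel \<phi>"
    by (rule integrable_lborel_compact_support[OF K(1) smooth_continuous_on[OF sm] K(2)])
  have [measurable]: "\<phi> \<in> borel_measurable borel"
    by (rule borel_measurable_continuous_onI[OF smooth_continuous_on[OF sm]])
  have [measurable]: "grad \<phi> \<in> borel_measurable borel"
    by (rule borel_measurable_continuous_onI[OF grad_continuous_on[OF sm]])
  have int2: "integrable lborel (\<lambda>x. \<phi> (x + c))" for c
  proof (rule integrable_lborel_compact_support)
    show "compact ((\<lambda>x. x - c) ` K)" by (intro compact_continuous_image continuous_intros K)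
    show "\<phi> (x + c) = 0" if "x \<notin> (\<lambda>x. x - c) ` K" for x
      using that K(2)[of "x + c"] by (metis add_diff_cancel_right' image_eqI)
    show "continuous_on ((\<lambda>x. x - c) ` K) (\<lambda>x. \<phi> (x + c))"
      by (intro continuous_on_compose2[OF smooth_continuous_on[OF sm, of UNIV]] continuous_intros) auto
  qed
  have zero: "(LINT x|lborel. (\<phi> (x + h n *\<^sub>R b) - \<phi> x) / h n) = 0" for n
    using int int2 by (simp add: integral_lborel_translate)
  have "(\<lambda>n. LINT x|lborel. (\<phi> (x + h n *\<^sub>R b) - \<phi> x) / h n) \<longlonglongrightarrow> (LINT x|lborel. grad \<phi> x \<bullet> b)"
  \<comment> \<open>The shifts have length \<open>h n\<close> \<le> 1, so the quotient vanishes
    outside the ball of radius R + 1; inside, the Lipschitz constant B bounds it.\<close>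
  proof (rule integral_dominated_convergence[where w="\<lambda>x. indicator (cball 0 (R + 1)) x * B"])
    show "integrable lborel (\<lambda>x::'a. indicator (cball 0 (R + 1)) x * B)"
      using borel_integrable_compact[OF compact_cball, of _ _ "\<lambda>x. B"] by simp
    have "(\<lambda>n. (\<phi> (x + h n *\<^sub>R b) - \<phi> x) / h n) \<longlonglongrightarrow> grad \<phi> x \<bullet> b" for x
    proof -
      have "((\<lambda>t. \<phi> (x + t *\<^sub>R b)) has_derivative (\<lambda>t. grad \<phi> x \<bullet> (t *\<^sub>R b))) (at 0)"
        by (rule has_derivative_compose[where f="\<lambda>t. x + t *\<^sub>R b" and g=\<phi>])
          (auto intro!: derivative_eq_intros smooth_has_grad[OF sm])
      then have "((\<lambda>t. \<phi> (x + t *\<^sub>R b)) has_real_derivative (grad \<phi> x \<bullet> b)) (at 0)"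
        by (simp add: has_field_derivative_def mult_commute_abs)
      then have "((\<lambda>t. (\<phi> (x + t *\<^sub>R b) - \<phi> x) / t) \<longlongrightarrow> grad \<phi> x \<bullet> b) (at 0)"
        by (simp add: DERIV_def)
      then show ?thesis
        by (rule filterlim_compose) (use h hlim in \<open>auto simp: filterlim_at less_imp_neq[symmetric] intro!: always_eventually\<close>)
    qed
    then show "AE x in lborel. (\<lambda>n. (\<phi> (x + h n *\<^sub>R b) - \<phi> x) / h n) \<longlonglongrightarrow> grad \<phi> x \<bullet> b" by simp
    have "norm ((\<phi> (x + h n *\<^sub>R b) - \<phi> x) / h n) \<le> indicator (cball 0 (R + 1)) x * B" for n x
    proof (cases "x \<in> cball 0 (R + 1)")
      case True
      have "\<bar>\<phi> (x + h n *\<^sub>R b) - \<phi> x\<bar> \<le> B * norm (x + h n *\<^sub>R b - x)"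
        by (rule test_function_lipschitz[OF sm B(2)])
      then have "\<bar>\<phi> (x + h n *\<^sub>R b) - \<phi> x\<bar> \<le> B * h n" using h[of n] b by simp
      then show ?thesis using True h[of n] by (simp add: field_simps)
    next
      case False
      have "norm x \<le> norm (x + h n *\<^sub>R b) + norm (h n *\<^sub>R b)"
        using norm_triangle_ineq4[of "x + h n *\<^sub>R b" "h n *\<^sub>R b"] by simp
      then have "norm (x + h n *\<^sub>R b) > R" "norm x > R" using False h[of n] b by auto
      then have "\<phi> (x + h n *\<^sub>R b) = 0" "\<phi> x = 0" using R K(2) by (meson not_le)+
      then show ?thesis using False by simp
    qed
    then show "AE x in lborel. norm ((\<phi> (x + h n *\<^sub>R b) - \<phi> x) / h n) \<le> indicator (cball 0 (R + 1)) x * B" for n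
      by simp
  qed auto
  then show ?thesis unfolding zero by (simp add: LIMSEQ_const_iff)
qed

lemma grad_mult: "smooth f \<Longrightarrow> smooth g \<Longrightarrow> grad (\<lambda>x. f x * g x) x = f x *\<^sub>R grad g x + g x *\<^sub>R grad f x"
  by (rule grad_unique)
    (auto intro!: derivative_eq_intros smooth_has_grad simp: inner_add_left algebra_simps)

text \<open>Leibniz' rule for the product with a test function turns the vanishing integral of its
  partial derivatives into integration by parts; the product has compact support, so no boundary
  term arises.\<close>

lemma has_weak_gradient_test_function:
  assumes \<Omega>: "open \<Omega>" and w: "w \<in> test_functions \<Omega>"
  shows "has_weak_gradient \<Omega> w (grad w)"
  unfolding has_weak_gradient_def locally_integrable_def
proof (intro conjI allI ballI impI)
  note sw = test_functions_smooth[OF w]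
  show "integrable (lebesgue_on K) w" "integrable (lebesgue_on K) (grad w)" if "compact K \<and> K \<subseteq> \<Omega>" for K
    using that by (auto intro!: integrable_lebesgue_on_compact smooth_continuous_on grad_continuous_on sw)
  fix \<phi> and b :: 'a assume \<phi>: "\<phi> \<in> test_functions \<Omega>" and b: "b \<in> Basis"
  note s\<phi> = test_functions_smooth[OF \<phi>]
  have [measurable]: "w \<in> borel_measurable borel" "\<phi> \<in> borel_measurable borel"
    "grad w \<in> borel_measurable borel" "grad \<phi> \<in> borel_measurable borel"
    by (auto intro!: borel_measurable_continuous_onI smooth_continuous_on grad_continuous_on sw s\<phi>)
  obtain K where K: "compact K" "\<And>x. x \<notin> K \<Longrightarrow> \<phi> x = 0" "\<And>x. x \<notin> K \<Longrightarrow> grad \<phi> x = 0"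
    using test_functions_support[OF \<phi>] by metis
  have i1: "integrable lborel (\<lambda>x. w x * (grad \<phi> x \<bullet> b))"
    by (rule integrable_lborel_compact_support[OF K(1)])
      (intro continuous_on_mult continuous_on_inner continuous_on_const smooth_continuous_on[OF sw]
        smooth_continuous_on[OF s\<phi>] grad_continuous_on[OF sw] grad_continuous_on[OF s\<phi>], simp add: K)
  have i2: "integrable lborel (\<lambda>x. (grad w x \<bullet> b) * \<phi> x)"
    by (rule integrable_lborel_compact_support[OF K(1)])
      (intro continuous_on_mult continuous_on_inner continuous_on_const smooth_continuous_on[OF sw]
        smooth_continuous_on[OF s\<phi>] grad_continuous_on[OF sw] grad_continuous_on[OF s\<phi>], simp add: K)
  have "0 = (LINT x|lborel. grad (\<lambda>x. w x * \<phi> x) x \<bullet> b)"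
    by (rule integral_partial_derivative_eq_0[OF test_functions_mult_smooth[OF \<phi> sw] b, symmetric])
  also have "\<dots> = (LINT x|lborel. w x * (grad \<phi> x \<bullet> b) + (grad w x \<bullet> b) * \<phi> x)"
    unfolding grad_mult[OF sw s\<phi>] by (simp add: inner_add_left mult.commute)
  also have "\<dots> = (LINT x|lborel. w x * (grad \<phi> x \<bullet> b)) + (LINT x|lborel. (grad w x \<bullet> b) * \<phi> x)"
    by (rule Bochner_Integration.integral_add[OF i1 i2])
  finally have "(LINT x|lborel. w x * (grad \<phi> x \<bullet> b)) = - (LINT x|lborel. (grad w x \<bullet> b) * \<phi> x)" by simp
  moreover have "(LINT x|lebesgue_on \<Omega>. w x * frechet_derivative \<phi> (at x) b) = (LINT x|lborel. w x * (grad \<phi> x \<bullet> b))"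
    unfolding frechet_derivative_eq_grad[OF s\<phi>]
    by (rule integral_lebesgue_on_eq_lborel) (use \<Omega> test_functions_outside[OF w] test_functions_outside[OF \<phi>] in auto)
  moreover have "(LINT x|lebesgue_on \<Omega>. (grad w x \<bullet> b) * \<phi> x) = (LINT x|lborel. (grad w x \<bullet> b) * \<phi> x)"
    by (rule integral_lebesgue_on_eq_lborel) (use \<Omega> test_functions_outside[OF w] test_functions_outside[OF \<phi>] in auto)
  ultimately show "(LINT x|lebesgue_on \<Omega>. w x * frechet_derivative \<phi> (at x) b) = - (LINT x|lebesgue_on \<Omega>. (grad w x \<bullet> b) * \<phi> x)"
    by simp
qed

section \<open>The oriented primitive\<close>

lemma primitive_has_derivative:
  assumes "continuous_on UNIV f"
  shows "(primitive f has_real_derivative f s) (at s)"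
proof -
  \<comment> \<open>Both 0 and s lie in the interior of the interval from a to b, so the derivative
    within it is the full derivative.\<close>
  define a where "a = - \<bar>s\<bar> - 1"
  define b where "b = \<bar>s\<bar> + 1"
  have "((\<lambda>u. LBINT y=ereal 0..ereal u. f y) has_vector_derivative f s) (at s within {a..b})"
    by (rule interval_integral_FTC2[of a 0 b f s]) (auto simp: a_def b_def intro: continuous_on_subset[OF assms])
  then show ?thesis
    unfolding primitive_def[abs_def] has_real_derivative_iff_has_vector_derivative
    using at_within_Icc_at[of a s b] by (simp add: a_def b_def)
qed

lemma primitive_0: "primitive f 0 = 0"
  by (simp add: primitive_def)

section \<open>Smooth approximations of a tent function\<close>

lemma Ck_on_subset: "Ck_on m S f \<Longrightarrow> T \<subseteq> S \<Longrightarrow> Ck_on m T f"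
  by (induction m arbitrary: f) (auto intro: continuous_on_subset)

lemma smooth_primitive:
  assumes "smooth f"
  shows "smooth (primitive f)"
  unfolding smooth_def
proof
  fix m
  have "Ck_on (Suc m) UNIV (primitive f)"
    by (rule Ck_on_real_SucI[OF open_UNIV primitive_has_derivative smoothD[OF assms]])
      (rule smooth_continuous_on[OF assms])
  then show "Ck_on m UNIV (primitive f)" by (rule Ck_on_SucD)
qed

text \<open>The tent is radial. As a function of \<sigma> = |x - x0|^2 its derivative is a multiple
  of the derivative of the square root times the indicator of the interval from (\<rho>/2)^2 to
  \<rho>^2, and only this indicator is smoothed. Using \<sigma> instead of the norm avoids the
  singularity at x0, and the gradient norm remains a constant times the cutoff, so the p-energy has
  an explicit limit.\<close>

lemma tent_functions:
  fixes x0 :: "'a::euclidean_space"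
  assumes sub: "cball x0 \<rho> \<subseteq> \<Omega>" and \<rho>: "\<rho> > 0" and \<delta>: "\<delta> > 0" and p: "p > 0"
  obtains v :: "nat \<Rightarrow> 'a \<Rightarrow> real" where "\<And>j. v j \<in> test_functions \<Omega>" "\<And>j x. v j x \<ge> 0"
    "\<And>j x. x \<in> cball x0 (\<rho> / 2) \<Longrightarrow> v j x = \<delta>"
    "(\<lambda>j. LINT x|lborel. norm (grad (v j) x) powr p)
      \<longlonglongrightarrow> (2 * \<delta> / \<rho>) powr p * measure lborel (ball x0 \<rho> - cball x0 (\<rho> / 2))"
proof -
  define \<alpha> where "\<alpha> = (\<rho> / 2)\<^sup>2"
  define \<beta> where "\<beta> = \<rho>\<^sup>2"
  have ab: "0 < \<alpha>" "\<alpha> < \<beta>" using \<rho> by (auto simp: \<alpha>_def \<beta>_def power_divide)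
  obtain \<psi> :: "nat \<Rightarrow> real \<Rightarrow> real" where \<psi>: "\<And>j. \<psi> j \<in> test_functions UNIV"
      "\<And>j x. 0 \<le> \<psi> j x \<and> \<psi> j x \<le> 1" "\<And>j x. x \<notin> box \<alpha> \<beta> \<Longrightarrow> \<psi> j x = 0"
      "\<And>x. (\<lambda>j. \<psi> j x) \<longlonglongrightarrow> indicator (box \<alpha> \<beta>) x"
    using box_indicator_approx[of \<alpha> \<beta> UNIV] by blast
  \<comment> \<open>\<open>\<sigma> powr (-1/2) / 2\<close> is the derivative of the square root of
    \<sigma>.\<close>
  define H where "H j \<sigma> = \<psi> j \<sigma> * (\<sigma> powr (-1/2) / 2)" for j \<sigma>
  have smH: "smooth (H j)" for j
    unfolding smooth_def
  proof
    fix m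
    have "Ck_on m ({0<..} \<union> {..<\<alpha>}) (H j)"
    proof (rule Ck_on_Un)
      have "Ck_on m {0<..} (\<lambda>\<sigma>. \<psi> j \<sigma> * (\<sigma> powr (-1/2) * (1 / 2)))"
        by (intro Ck_on_mult Ck_on_const Ck_on_powr Ck_on_subset[OF smoothD[OF test_functions_smooth[OF \<psi>(1)]]]) auto
      then show "Ck_on m {0<..} (H j)" unfolding H_def[abs_def] by simp
      show "Ck_on m {..<\<alpha>} (H j)"
        by (rule Ck_on_cong[OF _ Ck_on_const[of _ _ 0]]) (auto simp: H_def intro!: \<psi>(3))
    qed auto
    moreover have "{0<..} \<union> {..<\<alpha>} = UNIV" using ab by auto
    ultimately show "Ck_on m UNIV (H j)" by simp
  qed
  have contH: "continuous_on S (H j)" for S j by (rule smooth_continuous_on[OF smH])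
  have derP: "(primitive (H j) has_real_derivative H j s) (at s)" for j s
    by (rule primitive_has_derivative[OF contH])
  have H0: "H j s \<ge> 0" for j s unfolding H_def using \<psi>(2) by auto
  have Pmono: "primitive (H j) s \<le> primitive (H j) t" if "s \<le> t" for j s t
    by (rule DERIV_nonneg_imp_nondecreasing[OF that]) (use derP H0 in blast)
  have Pconst1: "primitive (H j) s = primitive (H j) \<alpha>" if "s \<le> \<alpha>" for j s
  proof (rule antisym[OF Pmono[OF that] DERIV_nonpos_imp_nonincreasing[OF that]])
    fix x assume "x \<le> \<alpha>"
    then have "H j x = 0" using \<psi>(3)[of x j] by (simp add: H_def box_real)
    then show "\<exists>y. (primitive (H j) has_real_derivative y) (at x) \<and> y \<le> 0" using derP[of j x] by auto
  qed
  have Pconst2: "primitive (H j) s = primitive (H j) \<beta>" if "s \<ge> \<beta>" for j s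
  proof (rule antisym[OF DERIV_nonpos_imp_nonincreasing[OF that] Pmono[OF that]])
    fix x assume "\<beta> \<le> x"
    then have "H j x = 0" using \<psi>(3)[of x j] by (simp add: H_def box_real)
    then show "\<exists>y. (primitive (H j) has_real_derivative y) (at x) \<and> y \<le> 0" using derP[of j x] by auto
  qed
  \<comment> \<open>The total rise of the profile; dividing by it gives every tent the exact height
    \<delta>. Its limit is \<rho> - \<rho>/2.\<close>
  define I where "I j = primitive (H j) \<beta> - primitive (H j) \<alpha>" for j
  have Ieq: "I j = (LINT s|lborel. indicator {\<alpha>..\<beta>} s *\<^sub>R H j s)" for j
    unfolding I_def using ab
    by (intro integral_FTC_atLeastAtMost[symmetric] contH)
      (auto intro!: has_vector_derivative_at_within derP[unfolded has_real_derivative_iff_has_vector_derivative])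
  have lim: "(LINT s|lborel. indicator {\<alpha>..\<beta>} s *\<^sub>R (s powr (-1/2) / 2)) = sqrt \<beta> - sqrt \<alpha>"
  proof (rule integral_FTC_atLeastAtMost)
    show "continuous_on {\<alpha>..\<beta>} (\<lambda>s. s powr (-1/2) / 2)"
      using ab by (auto intro!: continuous_intros)
    fix s assume "\<alpha> \<le> s" "s \<le> \<beta>"
    then have "s > 0" using ab by linarith
    then have "(sqrt has_real_derivative s powr (-1/2) / 2) (at s)"
      by (auto intro!: derivative_eq_intros simp: powr_minus powr_half_sqrt divide_simps)
    then show "(sqrt has_vector_derivative s powr (-1/2) / 2) (at s within {\<alpha>..\<beta>})"
      by (simp add: has_vector_derivative_at_within has_real_derivative_iff_has_vector_derivative)
  qed (use ab in auto)
  have [measurable]: "\<psi> j \<in> borel_measurable borel" for j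
    by (intro borel_measurable_continuous_onI smooth_continuous_on test_functions_smooth[OF \<psi>(1)])
  have "(\<lambda>j. LINT s|lborel. indicator {\<alpha>..\<beta>} s *\<^sub>R H j s) \<longlonglongrightarrow> (LINT s|lborel. indicator {\<alpha>..\<beta>} s *\<^sub>R (s powr (-1/2) / 2))"
  proof (rule integral_dominated_convergence[where w="\<lambda>s. indicator {\<alpha>..\<beta>} s *\<^sub>R (s powr (-1/2) / 2)"])
    show "integrable lborel (\<lambda>s. indicator {\<alpha>..\<beta>} s *\<^sub>R (s powr (-1/2) / 2))"
      using ab by (intro borel_integrable_compact) (auto intro!: continuous_intros)
    show "AE s in lborel. (\<lambda>j. indicator {\<alpha>..\<beta>} s *\<^sub>R H j s) \<longlonglongrightarrow> indicator {\<alpha>..\<beta>} s *\<^sub>R (s powr (-1/2) / 2)"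
      using AE_lborel_singleton[of \<alpha>] AE_lborel_singleton[of \<beta>]
    proof eventually_elim
      case (elim s)
      have "(\<lambda>j. indicator {\<alpha>..\<beta>} s *\<^sub>R H j s) \<longlonglongrightarrow> indicator {\<alpha>..\<beta>} s *\<^sub>R (indicator (box \<alpha> \<beta>) s * (s powr (-1/2) / 2))"
        unfolding H_def by (intro tendsto_intros \<psi>)
      also have "indicator {\<alpha>..\<beta>} s *\<^sub>R (indicator (box \<alpha> \<beta>) s * (s powr (-1/2) / 2)) = indicator {\<alpha>..\<beta>} s *\<^sub>R (s powr (-1/2) / 2)"
        using elim by (auto simp: indicator_def box_real)
      finally show ?case .
    qed
    have "H j s \<le> s powr (-1/2) / 2" for j s
      using mult_right_mono[of "\<psi> j s" 1 "s powr (-1/2) / 2"] \<psi>(2) by (simp add: H_def)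
    then show "AE s in lborel. norm (indicator {\<alpha>..\<beta>} s *\<^sub>R H j s) \<le> indicator {\<alpha>..\<beta>} s *\<^sub>R (s powr (-1/2) / 2)" for j
      using H0 by (auto simp: indicator_def)
  qed (auto simp: H_def)
  then have Ilim: "I \<longlonglongrightarrow> \<rho> / 2"
    unfolding Ieq[symmetric] lim using \<rho> by (simp add: \<alpha>_def \<beta>_def real_sqrt_divide)
  then have "eventually (\<lambda>j. I j > \<rho> / 4) sequentially"
    by (rule order_tendstoD) (use \<rho> in auto)
  \<comment> \<open>Finitely many terms are dropped so that I stays away from 0.\<close>
  then obtain J where J: "\<And>j. j \<ge> J \<Longrightarrow> I j > \<rho> / 4" by (auto simp: eventually_sequentially)
  have Ipos: "I (j + J) > 0" for j using J[of "j + J"] \<rho> by auto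
  define v where "v j x = \<delta> / I (j + J) * (primitive (H (j + J)) \<beta> - primitive (H (j + J)) ((norm (x - x0))\<^sup>2))" for j x
  have vout: "v j x = 0" if "x \<notin> cball x0 \<rho>" for j x
  proof -
    have "(norm (x - x0))\<^sup>2 \<ge> \<beta>" unfolding \<beta>_def using that \<rho>
      by (intro power_mono) (auto simp: dist_norm norm_minus_commute)
    from Pconst2[OF this] show ?thesis by (simp add: v_def)
  qed
  have gradv: "grad (v j) x = (- (\<delta> / I (j + J)) * H (j + J) ((norm (x - x0))\<^sup>2) * 2) *\<^sub>R (x - x0)" for j x
  proof (rule grad_unique)
    have 1: "((\<lambda>x. (norm (x - x0))\<^sup>2) has_derivative (\<lambda>h. 2 * ((x - x0) \<bullet> h))) (at x)"
      unfolding power2_norm_eq_inner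
      by (auto intro!: derivative_eq_intros simp: inner_commute)
    have 2: "((\<lambda>x. primitive (H (j + J)) ((norm (x - x0))\<^sup>2)) has_derivative
        (\<lambda>h. H (j + J) ((norm (x - x0))\<^sup>2) * (2 * ((x - x0) \<bullet> h)))) (at x)"
      using has_derivative_compose[OF 1 derP[unfolded has_field_derivative_def]] .
    show "(v j has_derivative (\<lambda>h. ((- (\<delta> / I (j + J)) * H (j + J) ((norm (x - x0))\<^sup>2) * 2) *\<^sub>R (x - x0)) \<bullet> h)) (at x)"
      unfolding v_def[abs_def]
      using has_derivative_mult_right[OF has_derivative_diff[OF has_derivative_const 2], of "\<delta> / I (j + J)"]
      by (rule has_derivative_eq_rhs) (simp add: fun_eq_iff)
  qed
  \<comment> \<open>The factor 2|x - x0| from the inner derivative cancels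
    \<open>\<sigma> powr (-1/2) / 2\<close>.\<close>
  have ngradv: "norm (grad (v j) x) = \<delta> / I (j + J) * \<psi> (j + J) ((norm (x - x0))\<^sup>2)" for j x
  proof (cases "x = x0")
    case True
    then show ?thesis unfolding gradv using ab \<psi>(3)[of 0] by (simp add: box_real)
  next
    case False
    then have n: "norm (x - x0) > 0" by simp
    have "((norm (x - x0))\<^sup>2) powr (-1/2) = 1 / norm (x - x0)"
      using n by (simp add: powr_minus powr_half_sqrt inverse_eq_divide)
    then show ?thesis
      unfolding gradv H_def using n Ipos[of j] \<delta> \<psi>(2) by (simp add: abs_mult)
  qed
  show thesis
  proof (rule that)
    show "v j \<in> test_functions \<Omega>" for j
    proof (rule test_functionsI[OF _ compact_cball sub vout])
      show "smooth (v j)" unfolding v_def[abs_def]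
        by (intro smooth_mult smooth_const smooth_diff smooth_compose[OF smooth_primitive[OF smH]] smooth_norm_square)
    qed
    show "v j x \<ge> 0" for j x
    proof (cases "(norm (x - x0))\<^sup>2 \<le> \<beta>")
      case True
      then show ?thesis unfolding v_def using Pmono Ipos[of j] \<delta> by auto
    next
      case False
      then show ?thesis using Pconst2[of "(norm (x - x0))\<^sup>2" "j + J"] by (simp add: v_def)
    qed
    show "v j x = \<delta>" if "x \<in> cball x0 (\<rho> / 2)" for j x
    proof -
      have "(norm (x - x0))\<^sup>2 \<le> \<alpha>" unfolding \<alpha>_def using that \<rho>
        by (intro power_mono) (auto simp: dist_norm norm_minus_commute)
      from Pconst1[OF this, of "j + J"] show ?thesis using Ipos[of j] by (simp add: v_def I_def)
    qed
    let ?A = "ball x0 \<rho> - cball x0 (\<rho> / 2)"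
    have inA: "(norm (x - x0))\<^sup>2 \<in> box \<alpha> \<beta> \<longleftrightarrow> x \<in> ?A" for x
      unfolding \<alpha>_def \<beta>_def box_real greaterThanLessThan_iff
      using power2_less_imp_less[of "\<rho> / 2" "norm (x - x0)"] power2_less_imp_less[of "norm (x - x0)" \<rho>]
        power_strict_mono[of "\<rho> / 2" "norm (x - x0)" 2] power_strict_mono[of "norm (x - x0)" \<rho> 2] \<rho>
      by (auto simp: dist_norm norm_minus_commute)
    have Afin: "emeasure lborel ?A < \<infinity>"
      using emeasure_mono[of ?A "ball x0 \<rho>" lborel] emeasure_lborel_ball_finite[of x0 \<rho>] by (auto simp: top.not_eq_extremum)
    have "(\<lambda>j. LINT x|lborel. (\<psi> (j + J) ((norm (x - x0))\<^sup>2)) powr p) \<longlonglongrightarrow> (LINT x|lborel. indicator ?A x)"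
    proof (rule integral_dominated_convergence[where w="\<lambda>x. indicator ?A x"])
      show "integrable lborel (indicator ?A :: 'a \<Rightarrow> real)" using Afin by simp
      have "(\<lambda>j. (\<psi> (j + J) ((norm (x - x0))\<^sup>2)) powr p) \<longlonglongrightarrow> indicator ?A x" for x
      proof (cases "x \<in> ?A")
        case True
        have "(\<lambda>j. (\<psi> (j + J) ((norm (x - x0))\<^sup>2)) powr p) \<longlonglongrightarrow> 1 powr p"
          using LIMSEQ_ignore_initial_segment[OF \<psi>(4), of J "(norm (x - x0))\<^sup>2"] inA[of x] True
          by (intro tendsto_intros) auto
        then show ?thesis using True by simp
      next
        case False
        then have "\<psi> (j + J) ((norm (x - x0))\<^sup>2) = 0" for j using inA[of x] by (intro \<psi>(3)) simp
        then show ?thesis using False p by simp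
      qed
      then show "AE x in lborel. (\<lambda>j. (\<psi> (j + J) ((norm (x - x0))\<^sup>2)) powr p) \<longlonglongrightarrow> indicator ?A x" by simp
      have "norm ((\<psi> (j + J) ((norm (x - x0))\<^sup>2)) powr p) \<le> indicator ?A x" for j x
        using inA[of x] \<psi>(3)[of "(norm (x - x0))\<^sup>2"] \<psi>(2)[of "j + J" "(norm (x - x0))\<^sup>2"] p powr_mono2[of p "\<psi> (j + J) ((norm (x - x0))\<^sup>2)" 1]
        by (cases "x \<in> ?A") auto
      then show "AE x in lborel. norm ((\<psi> (j + J) ((norm (x - x0))\<^sup>2)) powr p) \<le> indicator ?A x" for j by simp
    qed (auto intro!: borel_measurable_indicator)
    then have "(\<lambda>j. (\<delta> / I (j + J)) powr p * (LINT x|lborel. (\<psi> (j + J) ((norm (x - x0))\<^sup>2)) powr p)) \<longlonglongrightarrow> (\<delta> / (\<rho> / 2)) powr p * (LINT x|lborel. indicator ?A x)"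
      using \<rho> \<delta> by (intro tendsto_intros LIMSEQ_ignore_initial_segment[OF Ilim]) auto
    moreover have "(LINT x|lborel. norm (grad (v j) x) powr p) = (\<delta> / I (j + J)) powr p * (LINT x|lborel. (\<psi> (j + J) ((norm (x - x0))\<^sup>2)) powr p)" for j
    proof -
      have "(\<delta> / I (j + J) * \<psi> (j + J) ((norm (x - x0))\<^sup>2)) powr p = (\<delta> / I (j + J)) powr p * \<psi> (j + J) ((norm (x - x0))\<^sup>2) powr p" for x
        by (rule powr_mult)
      then show ?thesis unfolding ngradv by simp
    qed
    ultimately show "(\<lambda>j. LINT x|lborel. norm (grad (v j) x) powr p) \<longlonglongrightarrow> (2 * \<delta> / \<rho>) powr p * measure lborel ?A"
      by (simp add: mult.commute)
  qed
qed

section \<open>Uniqueness of the weak gradient\<close>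

lemma AE_lebesgue_on_iff:
  "S \<in> sets lebesgue \<Longrightarrow> (AE x in lebesgue_on S. P x) \<longleftrightarrow> (AE x in lebesgue. x \<in> S \<longrightarrow> P x)"
  by (simp add: AE_restrict_space_iff)

lemma integrable_test_function_mult:
  fixes g :: "'a::euclidean_space \<Rightarrow> 'b::euclidean_space"
  assumes g: "locally_integrable \<Omega> g" and \<Omega>: "open \<Omega>" and \<phi>: "\<phi> \<in> test_functions \<Omega>"
  shows "integrable (lebesgue_on \<Omega>) (\<lambda>x. \<phi> x *\<^sub>R g x)"
proof -
  obtain K where K: "compact K" "K \<subseteq> \<Omega>" "\<And>x. x \<notin> K \<Longrightarrow> \<phi> x = 0"
    using test_functions_support[OF \<phi>] by metis
  have [measurable]: "K \<in> sets lebesgue" using K(1) by (simp add: borel_compact)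
  obtain B where B: "B > 0" "\<And>x. \<bar>\<phi> x\<bar> \<le> B" using test_functions_bounded[OF \<phi>] by metis
  have [measurable]: "\<phi> \<in> borel_measurable lebesgue"
    using borel_measurable_continuous_onI[OF smooth_continuous_on[OF test_functions_smooth[OF \<phi>]]]
    by (simp add: measurable_completion)
  have "integrable (lebesgue_on K) g" using g K unfolding locally_integrable_def by blast
  then have i: "integrable lebesgue (\<lambda>x. indicator K x *\<^sub>R g x)" by (simp add: integrable_restrict_space)
  have "integrable lebesgue (\<lambda>x. \<phi> x *\<^sub>R (indicator K x *\<^sub>R g x))"
  proof (rule Bochner_Integration.integrable_bound[OF integrable_mult_right[OF integrable_norm[OF i], of B]])
    show "(\<lambda>x. \<phi> x *\<^sub>R (indicator K x *\<^sub>R g x)) \<in> borel_measurable lebesgue"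
      by (intro borel_measurable_scaleR borel_measurable_integrable[OF i]) measurable
    have "norm (\<phi> x *\<^sub>R y) \<le> norm (B * norm y)" for x and y :: 'b
      using mult_right_mono[OF B(2)[of x] norm_ge_zero[of y]] B(1) by simp
    then show "AE x in lebesgue. norm (\<phi> x *\<^sub>R (indicator K x *\<^sub>R g x)) \<le> norm (B * norm (indicator K x *\<^sub>R g x))"
      by blast
  qed
  also have "(\<lambda>x. \<phi> x *\<^sub>R (indicator K x *\<^sub>R g x)) = (\<lambda>x. indicator \<Omega> x *\<^sub>R (\<phi> x *\<^sub>R g x))"
    using K by (auto simp: fun_eq_iff indicator_def)
  finally show ?thesis using \<Omega> by (simp add: integrable_restrict_space)
qed

text \<open>The smooth approximations of the box indicator carry the hypothesis from test functions
  to boxes; h restricted to the closed box is the integrable majorant.\<close>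

lemma integral_box_eq_0_of_test_functions:
  fixes h :: "'a::euclidean_space \<Rightarrow> real"
  assumes h: "locally_integrable \<Omega> h" and \<Omega>: "open \<Omega>" and ab: "cbox a b \<subseteq> \<Omega>"
    and 0: "\<And>\<phi>. \<phi> \<in> test_functions \<Omega> \<Longrightarrow> (LINT x|lebesgue_on \<Omega>. h x * \<phi> x) = 0"
  shows "integrable lebesgue (\<lambda>x. indicator (box a b) x * h x)"
    and "(LINT x|lebesgue. indicator (box a b) x * h x) = 0"
proof -
  obtain \<phi> where \<phi>: "\<And>j. \<phi> j \<in> test_functions \<Omega>" "\<And>j x. 0 \<le> \<phi> j x \<and> \<phi> j x \<le> 1"
    "\<And>j x. x \<notin> box a b \<Longrightarrow> \<phi> j x = 0" "\<And>x. (\<lambda>j. \<phi> j x) \<longlonglongrightarrow> indicator (box a b) x"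
    using box_indicator_approx[OF ab] by blast
  have [measurable]: "\<phi> j \<in> borel_measurable lebesgue" for j
    using borel_measurable_continuous_onI[OF smooth_continuous_on[OF test_functions_smooth[OF \<phi>(1)]]]
    by (simp add: measurable_completion)
  have "integrable (lebesgue_on (cbox a b)) h" using h ab unfolding locally_integrable_def by simp
  then have i: "integrable lebesgue (\<lambda>x. indicator (cbox a b) x * h x)" by (simp add: integrable_restrict_space)
  then have [measurable]: "(\<lambda>x. indicator (cbox a b) x * h x) \<in> borel_measurable lebesgue" by (rule borel_measurable_integrable)
  have eq1: "indicator (box a b) x * (indicator (cbox a b) x * h x) = indicator (box a b) x * h x" for x
    using box_subset_cbox[of a b] by (auto simp: indicator_def)
  have eq2: "\<phi> j x * (indicator (cbox a b) x * h x) = indicator \<Omega> x * (h x * \<phi> j x)" for j x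
    using \<phi>(3)[of x j] box_subset_cbox[of a b] ab by (cases "x \<in> box a b") (auto simp: indicator_def)
  have i2: "integrable lebesgue (\<lambda>x. indicator (box a b) x * (indicator (cbox a b) x * h x))"
    using integrable_mult_indicator[OF _ i, of "box a b"] by simp
  then show "integrable lebesgue (\<lambda>x. indicator (box a b) x * h x)" unfolding eq1 .
  have "(\<lambda>j. LINT x|lebesgue. \<phi> j x * (indicator (cbox a b) x * h x))
      \<longlonglongrightarrow> (LINT x|lebesgue. indicator (box a b) x * (indicator (cbox a b) x * h x))"
  proof (rule integral_dominated_convergence[where w="\<lambda>x. \<bar>indicator (cbox a b) x * h x\<bar>"])
    show "integrable lebesgue (\<lambda>x. \<bar>indicator (cbox a b) x * h x\<bar>)" using i by (rule integrable_abs)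
    show "AE x in lebesgue. (\<lambda>j. \<phi> j x * (indicator (cbox a b) x * h x)) \<longlonglongrightarrow> indicator (box a b) x * (indicator (cbox a b) x * h x)"
      by (intro AE_I2 tendsto_intros \<phi>)
    have "norm (\<phi> j x * (indicator (cbox a b) x * h x)) \<le> \<bar>indicator (cbox a b) x * h x\<bar>" for j x
      using mult_right_mono[of "\<phi> j x" 1 "\<bar>indicator (cbox a b) x * h x\<bar>"] \<phi>(2)[of j x] by (simp add: abs_mult)
    then show "AE x in lebesgue. norm (\<phi> j x * (indicator (cbox a b) x * h x)) \<le> \<bar>indicator (cbox a b) x * h x\<bar>" for j
      by simp
  qed (use borel_measurable_integrable[OF i2] in auto)
  moreover have "(LINT x|lebesgue. \<phi> j x * (indicator (cbox a b) x * h x)) = 0" for j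
    unfolding eq2 using 0[OF \<phi>(1), of j] \<Omega> by (simp add: integral_restrict_space)
  ultimately show "(LINT x|lebesgue. indicator (box a b) x * h x) = 0"
    by (simp add: eq1 LIMSEQ_const_iff)
qed

text \<open>A function whose integrals over all boxes vanish is zero almost everywhere by the
  Lebesgue differentiation theorem. Countably many boxes exhaust the open set.\<close>

lemma AE_eq_0_of_test_functions:
  fixes h :: "'a::euclidean_space \<Rightarrow> real"
  assumes h: "locally_integrable \<Omega> h" and \<Omega>: "open \<Omega>"
    and 0: "\<And>\<phi>. \<phi> \<in> test_functions \<Omega> \<Longrightarrow> (LINT x|lebesgue_on \<Omega>. h x * \<phi> x) = 0"
  shows "AE x in lebesgue_on \<Omega>. h x = 0"
proof -
  have box0: "AE x in lebesgue. x \<in> cbox a b \<longrightarrow> h x = 0" if ab: "cbox a b \<subseteq> \<Omega>" for a b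
  proof -
    \<comment> \<open>Cutting off at one box makes g integrable over every other box, as the
      differentiation theorem requires; its integral there is one over an intersection of boxes,
      which is again a box.\<close>
    define g where "g x = indicator (box a b) x * h x" for x
    have ig: "integrable lebesgue g"
      unfolding g_def[abs_def] by (rule integral_box_eq_0_of_test_functions[OF h \<Omega> ab 0])
    have igs: "set_integrable lebesgue S g" if "S \<in> sets lebesgue" for S
      unfolding set_integrable_def using integrable_mult_indicator[OF that ig] .
    have zero: "integral (cbox c d) g = 0" for c d
    proof -
      have "integral (cbox c d) g = (LINT x:cbox c d|lebesgue. g x)"
        by (rule set_lebesgue_integral_eq_integral(2)[symmetric]) (rule igs, simp)
      also have "\<dots> = (LINT x|lebesgue. indicator (box a b \<inter> box c d) x * h x)"
        unfolding set_lebesgue_integral_def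
      proof (rule integral_cong_AE)
        show "(\<lambda>x. indicat_real (cbox c d) x *\<^sub>R g x) \<in> borel_measurable lebesgue"
          using igs[of "cbox c d"] unfolding set_integrable_def by auto
        have eq: "(\<lambda>x. indicator (box a b \<inter> box c d) x * h x) = (\<lambda>x. indicator (box c d) x *\<^sub>R g x)"
          by (auto simp: g_def fun_eq_iff indicator_def)
        show "(\<lambda>x. indicator (box a b \<inter> box c d) x * h x) \<in> borel_measurable lebesgue"
          unfolding eq using igs[of "box c d"] unfolding set_integrable_def by auto
        have "negligible (cbox c d - box c d)" by (rule negligible_frontier_interval)
        then have "AE x in lebesgue. x \<notin> cbox c d - box c d"
          unfolding negligible_iff_null_sets by (rule AE_not_in)
        then show "AE x in lebesgue. indicat_real (cbox c d) x *\<^sub>R g x = indicator (box a b \<inter> box c d) x * h x"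
          by eventually_elim (use box_subset_cbox[of c d] in \<open>auto simp: g_def indicator_def\<close>)
      qed
      also have "\<dots> = 0"
      proof (cases "box a b \<inter> box c d = {}")
        case False
        obtain a' b' where e: "box a b \<inter> box c d = box a' b'" by (rule that) (rule box_Int_box)
        then have "cbox a' b' \<subseteq> cbox a b"
        proof -
          have "box a' b' \<noteq> {}" "box a b \<noteq> {}" "box a' b' \<subseteq> box a b" using e False by auto
          then show ?thesis using closure_mono[of "box a' b'" "box a b"] by (simp add: closure_box)
        qed
        then have "(LINT x|lebesgue. indicator (box a' b') x * h x) = 0"
          by (intro integral_box_eq_0_of_test_functions[OF h \<Omega> _ 0]) (use ab in auto)
        then show ?thesis by (simp add: e)
      qed simp
      finally show ?thesis .
    qed
    have "g integrable_on cbox c d" for c d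
      by (rule set_lebesgue_integral_eq_integral(1)) (rule igs, simp)
    from integrable_ccontinuous_explicit[OF this] obtain N where N: "negligible N"
      "\<And>x e. \<lbrakk>x \<notin> N; 0 < e\<rbrakk> \<Longrightarrow> \<exists>d>0. \<forall>r. 0 < r \<and> r < d \<longrightarrow> norm(integral (cbox x (x + r *\<^sub>R One)) g /\<^sub>R r ^ DIM('a) - g x) < e"
      by blast
    have g0: "g x = 0" if notin: "x \<notin> N" for x
    proof (rule ccontr)
      assume "g x \<noteq> 0"
      then obtain d where d: "d > 0" "\<forall>r. 0 < r \<and> r < d \<longrightarrow> norm(integral (cbox x (x + r *\<^sub>R One)) g /\<^sub>R r ^ DIM('a) - g x) < \<bar>g x\<bar>"
        using N(2)[OF notin, of "\<bar>g x\<bar>"] by auto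
      then show False using dense[OF d(1)] zero by auto
    qed
    have "AE x in lebesgue. x \<notin> N \<union> (cbox a b - box a b)"
      using negligible_Un[OF N(1) negligible_frontier_interval[of a b]] by (simp only: negligible_iff_null_sets AE_not_in)
    then show ?thesis
    proof eventually_elim
      case (elim x)
      then show ?case using g0[of x] by (auto simp: g_def)
    qed
  qed
  obtain D where D: "countable D" "D \<subseteq> Pow \<Omega>" "\<And>X. X \<in> D \<Longrightarrow> \<exists>a b. X = cbox a b" "\<Union> D = \<Omega>"
    using open_countable_Union_open_cbox[OF \<Omega>] by metis
  have "AE x in lebesgue. x \<in> X \<longrightarrow> h x = 0" if "X \<in> D" for X
    using D(2) D(3)[OF that] that box0 by blast
  then have "AE x in lebesgue. \<forall>X\<in>D. x \<in> X \<longrightarrow> h x = 0"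
    unfolding AE_ball_countable[OF D(1)] by blast
  then have "AE x in lebesgue. x \<in> \<Omega> \<longrightarrow> h x = 0"
    by eventually_elim (use D(4) in blast)
  then show ?thesis using \<Omega> by (simp add: AE_lebesgue_on_iff)
qed

lemma test_functions_partial_derivative:
  assumes \<phi>: "\<phi> \<in> test_functions \<Omega>" and b: "b \<in> Basis"
  shows "(\<lambda>x. frechet_derivative \<phi> (at x) b) \<in> test_functions \<Omega>"
proof -
  obtain K where K: "compact K" "K \<subseteq> \<Omega>" "\<And>x. x \<notin> K \<Longrightarrow> grad \<phi> x = 0"
    using test_functions_support[OF \<phi>] by metis
  have "smooth (\<lambda>x. frechet_derivative \<phi> (at x) b)"
    unfolding smooth_def
  proof
    fix m show "Ck_on m UNIV (\<lambda>x. frechet_derivative \<phi> (at x) b)"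
      using smoothD[OF test_functions_smooth[OF \<phi>], of "Suc m"] b by simp
  qed
  then show ?thesis
    using K by (intro test_functionsI[of _ K])
      (auto simp: frechet_derivative_eq_grad[OF test_functions_smooth[OF \<phi>]])
qed

text \<open>With u = u' it shows that the choice made in \<open>weak_grad\<close> does not matter up
  to null sets. Allowing u and u' to agree only almost everywhere shows later that equal elements of
  the Sobolev space have equal energies.\<close>

lemma weak_gradient_unique:
  assumes \<Omega>: "open \<Omega>" and g: "has_weak_gradient \<Omega> u g" "has_weak_gradient \<Omega> u' g'"
    and uu': "AE x in lebesgue_on \<Omega>. u x = u' x"
  shows "AE x in lebesgue_on \<Omega>. g x = g' x"
proof -
  have lg: "locally_integrable \<Omega> g" "locally_integrable \<Omega> g'" and lu: "locally_integrable \<Omega> u" "locally_integrable \<Omega> u'"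
    using g by (auto simp: has_weak_gradient_def)
  have "AE x in lebesgue_on \<Omega>. (g x - g' x) \<bullet> b = 0" if b: "b \<in> Basis" for b
  proof (rule AE_eq_0_of_test_functions[OF _ \<Omega>])
    show "locally_integrable \<Omega> (\<lambda>x. (g x - g' x) \<bullet> b)"
      using lg by (auto simp: locally_integrable_def)
    fix \<phi> assume \<phi>: "\<phi> \<in> test_functions \<Omega>"
    have i: "integrable (lebesgue_on \<Omega>) (\<lambda>x. (g x \<bullet> b) * \<phi> x)" "integrable (lebesgue_on \<Omega>) (\<lambda>x. (g' x \<bullet> b) * \<phi> x)"
      using integrable_inner_left[OF integrable_test_function_mult[OF lg(1) \<Omega> \<phi>], of b]
        integrable_inner_left[OF integrable_test_function_mult[OF lg(2) \<Omega> \<phi>], of b] by (simp_all add: mult.commute)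
    have "(LINT x|lebesgue_on \<Omega>. ((g x - g' x) \<bullet> b) * \<phi> x)
       = (LINT x|lebesgue_on \<Omega>. (g x \<bullet> b) * \<phi> x) - (LINT x|lebesgue_on \<Omega>. (g' x \<bullet> b) * \<phi> x)"
      by (simp add: inner_diff_left left_diff_distrib Bochner_Integration.integral_diff[OF i])
    also have "\<dots> = - (LINT x|lebesgue_on \<Omega>. u x * frechet_derivative \<phi> (at x) b)
        + (LINT x|lebesgue_on \<Omega>. u' x * frechet_derivative \<phi> (at x) b)"
      using g \<phi> b by (simp add: has_weak_gradient_def)
    also have "(LINT x|lebesgue_on \<Omega>. u x * frechet_derivative \<phi> (at x) b) = (LINT x|lebesgue_on \<Omega>. u' x * frechet_derivative \<phi> (at x) b)"
    proof (rule integral_cong_AE)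
      show "(\<lambda>x. u x * frechet_derivative \<phi> (at x) b) \<in> borel_measurable (lebesgue_on \<Omega>)"
        "(\<lambda>x. u' x * frechet_derivative \<phi> (at x) b) \<in> borel_measurable (lebesgue_on \<Omega>)"
        using integrable_test_function_mult[OF lu(1) \<Omega> test_functions_partial_derivative[OF \<phi> b]]
          integrable_test_function_mult[OF lu(2) \<Omega> test_functions_partial_derivative[OF \<phi> b]]
        by (auto dest!: borel_measurable_integrable simp: mult.commute)
      show "AE x in lebesgue_on \<Omega>. u x * frechet_derivative \<phi> (at x) b = u' x * frechet_derivative \<phi> (at x) b"
        using uu' by eventually_elim simp
    qed
    finally show "(LINT x|lebesgue_on \<Omega>. ((g x - g' x) \<bullet> b) * \<phi> x) = 0" by simp
  qed
  then have "AE x in lebesgue_on \<Omega>. \<forall>b\<in>Basis. (g x - g' x) \<bullet> b = 0"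
    by (intro AE_finite_allI) auto
  then show ?thesis
    by eventually_elim (auto simp: euclidean_eq_iff[of "g _"] inner_diff_left)
qed

section \<open>Completeness of \<open>L\<^sup>p\<close>\<close>

lemma powr_add_le:
  fixes a b p :: real
  assumes "a \<ge> 0" "b \<ge> 0" "p > 0"
  shows "(a + b) powr p \<le> 2 powr p * (a powr p + b powr p)"
proof -
  have "(a + b) powr p \<le> (2 * max a b) powr p" using assms by (intro powr_mono2) auto
  also have "\<dots> = 2 powr p * max a b powr p" using assms by (simp add: powr_mult)
  also have "\<dots> \<le> 2 powr p * (a powr p + b powr p)"
    by (intro mult_left_mono) (auto simp: max_def)
  finally show ?thesis .
qed

lemma norm_add_powr_le:
  "p > 0 \<Longrightarrow> norm (x + y) powr p \<le> 2 powr p * (norm x powr p + norm y powr p)"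
  by (rule order_trans[OF powr_mono2[OF _ _ norm_triangle_ineq] powr_add_le]) auto

lemma norm_diff_powr_le:
  "p > 0 \<Longrightarrow> norm (x - y) powr p \<le> 2 powr p * (norm x powr p + norm y powr p)"
  using norm_add_powr_le[of p x "- y"] by simp

text \<open>Bounding both factors by the larger of a and b gives a form of Young's inequality
  without conjugate exponents.\<close>

lemma Young_powr:
  fixes a b p :: real
  assumes "a \<ge> 0" "b \<ge> 0" "p > 1"
  shows "a powr (p - 1) * b \<le> a powr p + b powr p"
proof (cases "b \<le> a")
  case True
  have "a powr (p - 1) * b \<le> a powr (p - 1) * a powr 1" using True assms by (intro mult_left_mono) auto
  also have "\<dots> = a powr p" by (simp only: powr_add[symmetric]) simp
  finally show ?thesis by (smt (verit) powr_ge_zero)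
next
  case False
  have "a powr (p - 1) * b \<le> b powr (p - 1) * b powr 1"
    using False assms by (intro mult_mono powr_mono2) auto
  also have "\<dots> = b powr p" by (simp only: powr_add[symmetric]) simp
  finally show ?thesis by (smt (verit) powr_ge_zero)
qed

lemma integrable_norm_diff_powr:
  fixes f g :: "'a \<Rightarrow> 'b::euclidean_space"
  assumes [measurable]: "f \<in> borel_measurable M" "g \<in> borel_measurable M"
    and i: "integrable M (\<lambda>x. norm (f x) powr p)" "integrable M (\<lambda>x. norm (g x) powr p)" and p: "p > 0"
  shows "integrable M (\<lambda>x. norm (f x - g x) powr p)"
proof (rule Bochner_Integration.integrable_bound)
  show "integrable M (\<lambda>x. 2 powr p * (norm (f x) powr p + norm (g x) powr p))"
    using i by auto
  show "AE x in M. norm (norm (f x - g x) powr p) \<le> norm (2 powr p * (norm (f x) powr p + norm (g x) powr p))"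
    using norm_diff_powr_le[OF p] by (auto simp: add_nonneg_nonneg)
qed measurable

text \<open>The integral of the sum is the sum of the integrals, read in \<open>ennreal\<close>; it
  is finite, so the sum is finite almost everywhere.\<close>

lemma AE_summable_of_integrals:
  fixes D :: "nat \<Rightarrow> 'a \<Rightarrow> real"
  assumes i: "\<And>k. integrable M (D k)" and nn: "\<And>k x. D k x \<ge> 0" and s: "summable (\<lambda>k. LINT x|M. D k x)"
  shows "AE x in M. summable (\<lambda>k. D k x)" "integrable M (\<lambda>x. \<Sum>k. D k x)"
proof -
  note [measurable] = borel_measurable_integrable[OF i]
  have "(\<integral>\<^sup>+x. (\<Sum>k. ennreal (D k x)) \<partial>M) = (\<Sum>k. \<integral>\<^sup>+x. ennreal (D k x) \<partial>M)"
    by (rule nn_integral_suminf) measurable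
  also have "\<dots> = (\<Sum>k. ennreal (LINT x|M. D k x))"
    by (simp add: nn_integral_eq_integral[OF i] nn)
  also have "\<dots> \<noteq> \<infinity>"
    by (subst suminf_ennreal2[OF _ s]) (simp_all add: nn integral_nonneg_AE)
  finally have "AE x in M. (\<Sum>k. ennreal (D k x)) \<noteq> \<infinity>"
    by (rule nn_integral_PInf_AE[rotated]) measurable
  then show ae: "AE x in M. summable (\<lambda>k. D k x)"
    by eventually_elim (use nn in \<open>auto intro: summable_suminf_not_top\<close>)
  show "integrable M (\<lambda>x. \<Sum>k. D k x)"
    by (rule integrable_suminf[OF i]) (use ae s nn in auto)
qed

lemma Cauchy_subsequence_fast:
  fixes d :: "nat \<Rightarrow> nat \<Rightarrow> real"
  assumes C: "\<And>e. e > 0 \<Longrightarrow> \<exists>N. \<forall>m\<ge>N. \<forall>n\<ge>N. d m n < e" and c: "\<And>k::nat. c k > 0"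
  obtains r :: "nat \<Rightarrow> nat" where "strict_mono r" "\<And>k. d (r (Suc k)) (r k) < c k"
proof -
  obtain N where N: "\<And>k m n. m \<ge> N k \<Longrightarrow> n \<ge> N k \<Longrightarrow> d m n < c k"
    using C[OF c] by metis
  \<comment> \<open>Going beyond both the previous index and the next threshold gives strict growth
    and smallness at once.\<close>
  define r where "r = rec_nat (N 0) (\<lambda>k rk. Suc (max rk (N (Suc k))))"
  have r: "r 0 = N 0" "r (Suc k) = Suc (max (r k) (N (Suc k)))" for k by (simp_all add: r_def)
  have "strict_mono r" by (rule strict_monoI_Suc) (simp add: r)
  moreover have rN: "r k \<ge> N k" for k by (cases k) (auto simp: r)
  then have "d (r (Suc k)) (r k) < c k" for k
    using \<open>strict_mono r\<close> by (intro N) (auto simp: strict_mono_Suc_iff intro: order_trans[OF rN less_imp_le])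
  ultimately show thesis by (rule that)
qed

lemma geometric_steps_bound:
  fixes f :: "nat \<Rightarrow> 'b::real_normed_vector"
  assumes "\<And>k. norm (f (Suc k) - f k) \<le> B / 2 ^ k"
  shows "norm (f n - f m) \<le> 4 * B / 2 ^ min m n"
proof -
  have B: "B \<ge> 0" using order_trans[OF norm_ge_zero assms[of 0]] by simp
  \<comment> \<open>Keeping the exact partial sum 2 - 2/2^j of the geometric series closes the
    induction.\<close>
  have le: "norm (f (m + j) - f m) \<le> (2 - 2 / 2 ^ j) * B / 2 ^ m" for m j
  proof (induction j)
    case (Suc j)
    have "norm (f (m + Suc j) - f m) \<le> norm (f (Suc (m + j)) - f (m + j)) + norm (f (m + j) - f m)"
      using norm_triangle_ineq[of "f (Suc (m + j)) - f (m + j)" "f (m + j) - f m"] by simp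
    also have "\<dots> \<le> B / 2 ^ (m + j) + (2 - 2 / 2 ^ j) * B / 2 ^ m" using assms[of "m + j"] Suc by linarith
    also have "\<dots> = (2 - 2 / 2 ^ Suc j) * B / 2 ^ m" by (simp add: field_simps power_add)
    finally show ?case .
  qed simp
  have le2: "norm (f (m + j) - f m) \<le> 4 * B / 2 ^ m" for m j
  proof -
    have "(2 - 2 / 2 ^ j) * B / 2 ^ m \<le> 4 * B / 2 ^ m"
      using B by (intro divide_right_mono mult_right_mono) (auto simp: field_simps)
    then show ?thesis using le[of m j] by linarith
  qed
  show ?thesis
  proof (cases "m \<le> n")
    case True
    then show ?thesis using le2[of m "n - m"] by (simp add: min_def)
  next
    case False
    then show ?thesis using le2[of n "m - n"] by (simp add: min_def norm_minus_commute)
  qed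
qed

text \<open>The Riesz-Fischer argument. Besides the limit it yields one integrable majorant H for
  the p-th powers of the whole subsequence, by which the nonlinear integrals later pass to the
  limit.\<close>

lemma Lp_complete:
  fixes f :: "nat \<Rightarrow> 'a \<Rightarrow> 'b::euclidean_space"
  assumes p: "p > 0"
    and fm[measurable]: "\<And>n. f n \<in> borel_measurable M" and fi: "\<And>n. integrable M (\<lambda>x. norm (f n x) powr p)"
    and C: "\<And>e. e > 0 \<Longrightarrow> \<exists>N. \<forall>m\<ge>N. \<forall>n\<ge>N. (LINT x|M. norm (f m x - f n x) powr p) < e"
  obtains r g H where "strict_mono r" "g \<in> borel_measurable M" "integrable M H"
    "AE x in M. (\<lambda>n. f (r n) x) \<longlonglongrightarrow> g x" "AE x in M. \<forall>n. norm (f (r n) x) powr p \<le> H x"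
    "integrable M (\<lambda>x. norm (g x) powr p)" "AE x in M. norm (g x) powr p \<le> H x"
    "(\<lambda>n. LINT x|M. norm (f (r n) x - g x) powr p) \<longlonglongrightarrow> 0"
proof -
  \<comment> \<open>The first factor compensates the weight 2^(pk) in D, so the integral of D k is
    at most 2^(-k). Pointwise, D k \<le> S then says that the k-th step is at most
    \<open>S x powr (1 / p) / 2 ^ k\<close>.\<close>
  define c where "c k = (2 powr p) powr (- real k) / 2 ^ k" for k :: nat
  have c: "c k > 0" for k by (simp add: c_def)
  define d where "d m n = (LINT x|M. norm (f m x - f n x) powr p)" for m n
  obtain r :: "nat \<Rightarrow> nat" where r: "strict_mono r" "\<And>k. d (r (Suc k)) (r k) < c k"
    using Cauchy_subsequence_fast[of d c, OF C[folded d_def] c] by metis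
  define D where "D k x = (2 powr p) powr real k * norm (f (r (Suc k)) x - f (r k) x) powr p" for k x
  have Di: "integrable M (D k)" for k
    unfolding D_def[abs_def] by (intro integrable_mult_right integrable_norm_diff_powr fm fi p)
  have D0: "D k x \<ge> 0" for k x by (simp add: D_def)
  have sD: "summable (\<lambda>k. LINT x|M. D k x)"
  proof (rule summable_comparison_test')
    show "summable (\<lambda>k. (1 / 2 :: real) ^ k)" by (rule summable_geometric) simp
    fix k :: nat
    have "(LINT x|M. D k x) = (2 powr p) powr real k * (LINT x|M. norm (f (r (Suc k)) x - f (r k) x) powr p)"
      by (simp add: D_def)
    also have "\<dots> \<le> (2 powr p) powr real k * c k" using r(2)[of k] unfolding d_def by (intro mult_left_mono) auto
    also have "\<dots> = (1 / 2) ^ k" by (simp add: c_def powr_minus power_divide)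
    finally show "norm (LINT x|M. D k x) \<le> (1 / 2) ^ k" using D0 by (simp add: integral_nonneg_AE)
  qed
  define S where "S x = (\<Sum>k. D k x)" for x
  have aeS: "AE x in M. summable (\<lambda>k. D k x)" and Si: "integrable M S"
    unfolding S_def[abs_def] using AE_summable_of_integrals[OF Di D0 sD] by auto
  have bnd: "norm (f (r n) x - f (r m) x) \<le> 4 * (S x powr (1 / p)) / 2 ^ min m n" if "summable (\<lambda>k. D k x)" for x n m
  proof (rule geometric_steps_bound)
    fix k
    have "D k x \<le> S x" unfolding S_def using sum_le_suminf[OF that, of "{k}"] D0 by auto
    then have "D k x powr (1 / p) \<le> S x powr (1 / p)" using p D0 by (intro powr_mono2) auto
    moreover have "D k x powr (1 / p) = 2 ^ k * norm (f (r (Suc k)) x - f (r k) x)"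
      using p by (simp add: D_def powr_mult powr_powr powr_realpow)
    ultimately show "norm (f (r (Suc k)) x - f (r k) x) \<le> S x powr (1 / p) / 2 ^ k"
      by (simp add: field_simps)
  qed
  define g where "g x = lim (\<lambda>n. f (r n) x)" for x
  have gm[measurable]: "g \<in> borel_measurable M" unfolding g_def by measurable
  have lim: "(\<lambda>n. f (r n) x) \<longlonglongrightarrow> g x" if sx: "summable (\<lambda>k. D k x)" for x
  proof -
    have "Cauchy (\<lambda>n. f (r n) x)"
    proof (rule metric_CauchyI)
      fix e :: real assume e: "e > 0"
      have "(\<lambda>n. 4 * (S x powr (1 / p)) / 2 ^ n) \<longlonglongrightarrow> 0"
        by (rule LIMSEQ_divide_realpow_zero) simp
      then have "eventually (\<lambda>n. 4 * (S x powr (1 / p)) / 2 ^ n < e) sequentially"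
        using e by (rule order_tendstoD)
      then obtain N where N: "\<And>n. n \<ge> N \<Longrightarrow> 4 * (S x powr (1 / p)) / 2 ^ n < e" by (auto simp: eventually_sequentially)
      show "\<exists>N. \<forall>m\<ge>N. \<forall>n\<ge>N. dist (f (r m) x) (f (r n) x) < e"
      proof (intro exI[of _ N] allI impI)
        fix m n assume "m \<ge> N" "n \<ge> N"
        then show "dist (f (r m) x) (f (r n) x) < e"
          using bnd[OF sx, of m n] N[of "min n m"] by (simp add: dist_norm)
      qed
    qed
    then show ?thesis unfolding g_def by (simp add: Cauchy_convergent_iff convergent_LIMSEQ_iff)
  qed
  define H where "H x = 2 powr p * (norm (f (r 0) x) powr p + 4 powr p * S x)" for x
  have Hi: "integrable M H" unfolding H_def[abs_def] using fi Si by auto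
  have le: "norm (f (r n) x) powr p \<le> H x" if sx: "summable (\<lambda>k. D k x)" for x n
  proof -
    have S0: "S x \<ge> 0" unfolding S_def by (rule suminf_nonneg[OF sx]) (rule D0)
    have "norm (f (r n) x) \<le> norm (f (r 0) x) + 4 * S x powr (1 / p)"
      using bnd[OF sx, of n 0] norm_triangle_sub[of "f (r n) x" "f (r 0) x"] by simp
    then have "norm (f (r n) x) powr p \<le> (norm (f (r 0) x) + 4 * S x powr (1 / p)) powr p"
      using p by (intro powr_mono2) auto
    also have "\<dots> \<le> 2 powr p * (norm (f (r 0) x) powr p + (4 * S x powr (1 / p)) powr p)"
      using p by (intro powr_add_le) auto
    also have "(4 * S x powr (1 / p)) powr p = 4 powr p * S x"
      using p S0 by (simp add: powr_mult powr_powr)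
    finally show ?thesis by (simp add: H_def)
  qed
  have gle: "norm (g x) powr p \<le> H x" if sx: "summable (\<lambda>k. D k x)" for x
    by (rule LIMSEQ_le_const2[OF tendsto_powr'[OF tendsto_norm[OF lim[OF sx]] tendsto_const]]) (use p le[OF sx] in auto)
  have gi: "integrable M (\<lambda>x. norm (g x) powr p)"
    by (rule Bochner_Integration.integrable_bound[OF Hi]) (use aeS gle in \<open>auto elim!: eventually_mono intro: order_trans[OF _ abs_ge_self]\<close>)
  have "(\<lambda>n. LINT x|M. norm (f (r n) x - g x) powr p) \<longlonglongrightarrow> (LINT x|M. 0)"
  proof (rule integral_dominated_convergence[where w="\<lambda>x. 2 powr p * (H x + H x)"])
    show "integrable M (\<lambda>x. 2 powr p * (H x + H x))" using Hi by auto
    show "AE x in M. (\<lambda>n. norm (f (r n) x - g x) powr p) \<longlonglongrightarrow> 0"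
      using aeS
    proof eventually_elim
      case (elim x)
      have "(\<lambda>n. norm (f (r n) x - g x) powr p) \<longlonglongrightarrow> 0 powr p"
        by (rule tendsto_powr'[OF _ tendsto_const]) (use lim[OF elim] p in \<open>auto simp: LIM_zero_iff tendsto_norm_zero_iff\<close>)
      then show ?case by simp
    qed
    show "AE x in M. norm (norm (f (r n) x - g x) powr p) \<le> 2 powr p * (H x + H x)" for n
      using aeS
    proof eventually_elim
      case (elim x)
      have "norm (f (r n) x - g x) powr p \<le> 2 powr p * (norm (f (r n) x) powr p + norm (g x) powr p)"
        by (rule norm_diff_powr_le[OF p])
      also have "\<dots> \<le> 2 powr p * (H x + H x)" using le[OF elim, of n] gle[OF elim] by (intro mult_left_mono add_mono) auto
      finally show ?case by simp
    qed
  qed auto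
  then have L: "(\<lambda>n. LINT x|M. norm (f (r n) x - g x) powr p) \<longlonglongrightarrow> 0" by simp
  show thesis
    by (rule that[OF r(1) gm Hi _ _ gi _ L]) (use aeS lim le gle in \<open>auto elim!: eventually_mono\<close>)
qed

section \<open>Cell averages\<close>

text \<open>Tychonoff's theorem. A zero bound pins a coordinate to 0, so the statement also covers
  boxes in the finite-dimensional coefficient spaces.\<close>

lemma compact_coordinate_box: "compact {c :: nat \<Rightarrow> real. \<forall>i. \<bar>c i\<bar> \<le> R i}"
proof -
  have "compactin (product_topology (\<lambda>i. euclidean) UNIV) (PiE UNIV (\<lambda>i. {- R i..R i}))"
    by (simp add: compactin_PiE)
  then have "compact (PiE UNIV (\<lambda>i. {- R i..R i}))"
    by (simp add: euclidean_product_topology)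
  moreover have "PiE UNIV (\<lambda>i. {- R i..R i}) = {c. \<forall>i. \<bar>c i\<bar> \<le> R i}"
    by (auto simp: PiE_UNIV_domain abs_le_iff minus_le_iff)
  ultimately show ?thesis by simp
qed

text \<open>Sequential compactness of a box in the product space, whose convergence is
  coordinatewise, takes the place of a diagonal argument.\<close>

lemma simultaneous_convergent_subsequence:
  fixes a :: "nat \<Rightarrow> nat \<Rightarrow> real"
  assumes "\<And>n i. \<bar>a n i\<bar> \<le> R i"
  obtains r l where "strict_mono r" "\<And>i. (\<lambda>n. a (r n) i) \<longlonglongrightarrow> l i"
proof -
  have "seq_compact {c :: nat \<Rightarrow> real. \<forall>i. \<bar>c i\<bar> \<le> R i}"
    using compact_coordinate_box by (rule compact_imp_seq_compact)
  then obtain l r where r: "strict_mono (r :: nat \<Rightarrow> nat)" "(a \<circ> r) \<longlonglongrightarrow> l"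
    using assms unfolding seq_compact_def by blast
  have "continuous_on UNIV (\<lambda>c :: nat \<Rightarrow> real. c i)" for i by (rule continuous_on_product_coordinates)
  then have "isCont (\<lambda>c :: nat \<Rightarrow> real. c i) l" for i
    unfolding continuous_on_eq_continuous_at[OF open_UNIV] by blast
  then have "(\<lambda>n. a (r n) i) \<longlonglongrightarrow> l i" for i
    using isCont_tendsto_compose[of l "\<lambda>c. c i" "a \<circ> r"] r(2) by (simp add: o_def)
  then show thesis using that r(1) by blast
qed

text \<open>This is Young's inequality for s and m^(p-1) with exponents p and p/(p-1),
  rearranged.\<close>

lemma powr_above_tangent:
  fixes s m p :: real
  assumes "s \<ge> 0" "m \<ge> 0" "p > 1"
  shows "m powr p + p * m powr (p - 1) * (s - m) \<le> s powr p"
proof -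
  have c: "1 / p + 1 / (p / (p - 1)) = 1" using assms by (simp add: field_simps)
  have "s * m powr (p - 1) \<le> s powr p / p + (m powr (p - 1)) powr (p / (p - 1)) / (p / (p - 1))"
    using assms by (intro Youngs_inequality[OF _ _ c]) (auto simp: field_simps)
  also have "(m powr (p - 1)) powr (p / (p - 1)) = m powr p" using assms by (simp add: powr_powr)
  finally have "p * (s * m powr (p - 1)) \<le> p * (s powr p / p + m powr p / (p / (p - 1)))"
    using assms by (intro mult_left_mono) auto
  also have "\<dots> = s powr p + (p - 1) * m powr p" using assms by (simp add: field_simps)
  finally have 1: "p * (s * m powr (p - 1)) \<le> s powr p + (p - 1) * m powr p" .
  have "m powr (p - 1) * m = m powr p"
    using powr_add[of m "p - 1" 1] assms by (cases "m = 0") (auto simp: powr_one)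
  then have "m powr p + p * m powr (p - 1) * (s - m) = p * (s * m powr (p - 1)) - (p - 1) * m powr p"
    by (simp add: algebra_simps)
  then show ?thesis using 1 by linarith
qed

text \<open>Integrate the tangent inequality at the mean value m of g over S. Since the measure is
  not normalised, the volume appears as the factor v^(p-1).\<close>

lemma Jensen_powr:
  fixes g :: "'a::euclidean_space \<Rightarrow> real"
  assumes S: "S \<in> sets borel" "emeasure lborel S = ennreal v" "v > 0" and p: "p > 1"
    and [measurable]: "g \<in> borel_measurable borel" and g: "\<And>x. 0 \<le> g x" "\<And>x. g x \<le> B"
  shows "(LINT x|lborel. indicator S x * g x) powr p \<le> v powr (p - 1) * (LINT x|lborel. indicator S x * g x powr p)"
proof -
  have Si: "integrable lborel (indicator S :: 'a \<Rightarrow> real)" using S by simp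
  have Sm: "measure lborel S = v" using S by (simp add: measure_def)
  have [measurable]: "S \<in> sets borel" by (rule S(1))
  have i1: "integrable lborel (\<lambda>x. indicator S x * g x)"
    by (rule Bochner_Integration.integrable_bound[OF integrable_mult_right[OF Si, of B]])
      (use g in \<open>auto simp: indicator_def intro!: AE_I2 order_trans[OF _ abs_ge_self]\<close>)
  have i2: "integrable lborel (\<lambda>x. indicator S x * g x powr p)"
    by (rule Bochner_Integration.integrable_bound[OF integrable_mult_right[OF Si, of "B powr p"]])
      (use g p in \<open>auto simp: indicator_def intro!: AE_I2 powr_mono2\<close>)
  define m where "m = (LINT x|lborel. indicator S x * g x) / v"
  have m0: "m \<ge> 0" unfolding m_def using g S(3) by (intro divide_nonneg_pos integral_nonneg_AE) auto
  have "(LINT x|lborel. indicator S x * (m powr p - p * m powr (p - 1) * m) + p * m powr (p - 1) * (indicator S x * g x))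
      \<le> (LINT x|lborel. indicator S x * g x powr p)"
  proof (rule integral_mono)
    show "integrable lborel (\<lambda>x. indicator S x * (m powr p - p * m powr (p - 1) * m) + p * m powr (p - 1) * (indicator S x * g x))"
      using Si i1 by auto
    show "indicator S x * (m powr p - p * m powr (p - 1) * m) + p * m powr (p - 1) * (indicator S x * g x) \<le> indicator S x * g x powr p" for x
      using powr_above_tangent[OF g(1)[of x] m0 p] by (auto simp: indicator_def algebra_simps)
  qed (rule i2)
  also have "(LINT x|lborel. indicator S x * (m powr p - p * m powr (p - 1) * m) + p * m powr (p - 1) * (indicator S x * g x))
      = v * (m powr p - p * m powr (p - 1) * m) + p * m powr (p - 1) * (m * v)"
    using Si i1 S(3) by (simp add: Sm m_def)
  also have "\<dots> = v * m powr p" by (simp add: algebra_simps)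
  finally have "v * m powr p \<le> (LINT x|lborel. indicator S x * g x powr p)" .
  then have "v powr (p - 1) * (v * m powr p) \<le> v powr (p - 1) * (LINT x|lborel. indicator S x * g x powr p)"
    by (intro mult_left_mono) auto
  moreover have "v powr (p - 1) * (v * m powr p) = (v * m) powr p"
    using powr_add[of v "p - 1" 1] S(3) by (simp add: powr_mult powr_one mult_ac)
  ultimately have "(v * m) powr p \<le> v powr (p - 1) * (LINT x|lborel. indicator S x * g x powr p)" by linarith
  moreover have "v * m = (LINT x|lborel. indicator S x * g x)" using S(3) by (simp add: m_def)
  ultimately show ?thesis by simp
qed

text \<open>The increment is the integral of the directional derivative over a segment. Jensen's
  inequality on the unit interval, Fubini's theorem and translation invariance then give the bound.
  Working in \<open>ennreal\<close> spares the integrability conditions of Fubini's theorem.\<close>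

lemma Lp_translate_le:
  fixes \<psi> :: "'a::euclidean_space \<Rightarrow> real"
  assumes \<psi>: "\<psi> \<in> test_functions \<Omega>" and p: "p > 1"
  shows "(\<integral>\<^sup>+x. ennreal (\<bar>\<psi> (x + z) - \<psi> x\<bar> powr p) \<partial>lborel)
    \<le> ennreal (norm z powr p) * (\<integral>\<^sup>+x. ennreal (norm (grad \<psi> x) powr p) \<partial>lborel)"
proof -
  note sm = test_functions_smooth[OF \<psi>]
  obtain B where B: "B > 0" "\<And>x. norm (grad \<psi> x) \<le> B" using test_functions_bounded[OF \<psi>] by metis
  have [measurable]: "grad \<psi> \<in> borel_measurable borel" "\<psi> \<in> borel_measurable borel"
    by (intro borel_measurable_continuous_onI grad_continuous_on smooth_continuous_on sm)+
  define G where "G x t = norm (grad \<psi> (x + t *\<^sub>R z)) * norm z" for x and t :: real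
  have Gb: "0 \<le> G x t" "G x t \<le> B * norm z" for x t unfolding G_def using B by (auto intro: mult_right_mono)
  have Gc: "continuous_on UNIV (G x)" for x
    unfolding G_def by (intro continuous_intros continuous_on_compose2[OF grad_continuous_on[OF sm, of UNIV]]) auto
  have Gm: "G x \<in> borel_measurable borel" for x by (intro borel_measurable_continuous_onI Gc)
  have pt: "ennreal (\<bar>\<psi> (x + z) - \<psi> x\<bar> powr p) \<le> (\<integral>\<^sup>+t. indicator {0..1} t * ennreal (G x t powr p) \<partial>lborel)" for x
  proof -
    have "(LINT t|lborel. indicator {0..1} t *\<^sub>R (grad \<psi> (x + t *\<^sub>R z) \<bullet> z)) = \<psi> (x + 1 *\<^sub>R z) - \<psi> (x + 0 *\<^sub>R z)"
    proof (rule integral_FTC_atLeastAtMost)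
      show "continuous_on {0..1} (\<lambda>t. grad \<psi> (x + t *\<^sub>R z) \<bullet> z)"
        by (intro continuous_intros continuous_on_compose2[OF grad_continuous_on[OF sm, of UNIV]]) auto
      fix t :: real
      have "((\<lambda>t. \<psi> (x + t *\<^sub>R z)) has_derivative (\<lambda>h. grad \<psi> (x + t *\<^sub>R z) \<bullet> (h *\<^sub>R z))) (at t)"
        by (rule has_derivative_compose[where f="\<lambda>t. x + t *\<^sub>R z" and g=\<psi>])
          (auto intro!: derivative_eq_intros smooth_has_grad[OF sm])
      then have "((\<lambda>t. \<psi> (x + t *\<^sub>R z)) has_vector_derivative grad \<psi> (x + t *\<^sub>R z) \<bullet> z) (at t)"
        by (simp add: has_vector_derivative_def mult.commute)
      then show "((\<lambda>t. \<psi> (x + t *\<^sub>R z)) has_vector_derivative grad \<psi> (x + t *\<^sub>R z) \<bullet> z) (at t within {0..1})"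
        by (rule has_vector_derivative_at_within)
    qed simp
    then have e: "\<psi> (x + z) - \<psi> x = (LINT t|lborel. indicator {0..1} t *\<^sub>R (grad \<psi> (x + t *\<^sub>R z) \<bullet> z))" by simp
    have iG: "integrable lborel (\<lambda>t. indicator {0..1} t * G x t)"
      using borel_integrable_compact[of "{0..1::real}" "G x"] continuous_on_subset[OF Gc] by simp
    have iGp: "integrable lborel (\<lambda>t. indicator {0..1} t * G x t powr p)"
    proof -
      have "continuous_on {0..1} (\<lambda>t. G x t powr p)"
        by (intro continuous_on_powr' continuous_on_subset[OF Gc] continuous_on_const) (use Gb p in auto)
      then show ?thesis using borel_integrable_compact[of "{0..1::real}" "\<lambda>t. G x t powr p"] by simp
    qed
    have "\<bar>\<psi> (x + z) - \<psi> x\<bar> \<le> (LINT t|lborel. norm (indicator {0..1} t *\<^sub>R (grad \<psi> (x + t *\<^sub>R z) \<bullet> z)))"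
      unfolding e using integral_norm_bound[of lborel "\<lambda>t. indicator {0..1} t *\<^sub>R (grad \<psi> (x + t *\<^sub>R z) \<bullet> z)"] by simp
    also have "\<dots> \<le> (LINT t|lborel. indicator {0..1} t * G x t)"
    proof (rule Bochner_Integration.integral_mono'[OF iG])
      show "norm (indicator {0..1} t *\<^sub>R (grad \<psi> (x + t *\<^sub>R z) \<bullet> z)) \<le> indicator {0..1} t * G x t" for t
        using Cauchy_Schwarz_ineq2[of "grad \<psi> (x + t *\<^sub>R z)" z] by (auto simp: G_def indicator_def)
    qed (simp add: Gb)
    finally have "\<bar>\<psi> (x + z) - \<psi> x\<bar> powr p \<le> (LINT t|lborel. indicator {0..1} t * G x t) powr p"
      using p by (intro powr_mono2) auto
    also have "\<dots> \<le> 1 powr (p - 1) * (LINT t|lborel. indicator {0..1} t * G x t powr p)"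
      by (rule Jensen_powr[OF _ _ _ p Gm]) (use Gb in auto)
    finally have "ennreal (\<bar>\<psi> (x + z) - \<psi> x\<bar> powr p) \<le> ennreal (LINT t|lborel. indicator {0..1} t * G x t powr p)"
      by (simp add: ennreal_leI)
    also have "\<dots> = (\<integral>\<^sup>+t. ennreal (indicator {0..1} t * G x t powr p) \<partial>lborel)"
      by (rule nn_integral_eq_integral[symmetric, OF iGp]) simp
    finally show ?thesis by (simp add: ennreal_mult' ennreal_indicator)
  qed
  have "(\<integral>\<^sup>+x. ennreal (\<bar>\<psi> (x + z) - \<psi> x\<bar> powr p) \<partial>lborel)
      \<le> (\<integral>\<^sup>+x. (\<integral>\<^sup>+t. indicator {0..1} t * ennreal (G x t powr p) \<partial>lborel) \<partial>lborel)"
    by (rule nn_integral_mono) (rule pt)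
  also have "\<dots> = (\<integral>\<^sup>+t. (\<integral>\<^sup>+x. indicator {0..1} t * ennreal (G x t powr p) \<partial>lborel) \<partial>lborel)"
    unfolding G_def by (rule lborel_pair.Fubini'[symmetric]) measurable
  also have "\<dots> = (\<integral>\<^sup>+t. indicator {0..1::real} t * (ennreal (norm z powr p) * (\<integral>\<^sup>+x. ennreal (norm (grad \<psi> x) powr p) \<partial>lborel)) \<partial>lborel)"
  proof (rule nn_integral_cong)
    fix t :: real
    have "(\<integral>\<^sup>+x. ennreal (G x t powr p) \<partial>lborel) = (\<integral>\<^sup>+x. ennreal (norm z powr p) * ennreal (norm (grad \<psi> (x + t *\<^sub>R z)) powr p) \<partial>lborel)"
      by (simp add: G_def powr_mult ennreal_mult mult.commute)
    also have "\<dots> = ennreal (norm z powr p) * (\<integral>\<^sup>+x. ennreal (norm (grad \<psi> (x + t *\<^sub>R z)) powr p) \<partial>lborel)"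
      by (rule nn_integral_cmult) measurable
    also have "(\<integral>\<^sup>+x. ennreal (norm (grad \<psi> (x + t *\<^sub>R z)) powr p) \<partial>lborel) = (\<integral>\<^sup>+x. ennreal (norm (grad \<psi> x) powr p) \<partial>lborel)"
      by (rule nn_integral_lborel_translate) measurable
    finally have *: "(\<integral>\<^sup>+x. ennreal (G x t powr p) \<partial>lborel) = ennreal (norm z powr p) * (\<integral>\<^sup>+x. ennreal (norm (grad \<psi> x) powr p) \<partial>lborel)" .
    have [measurable]: "(\<lambda>x. G x t) \<in> borel_measurable borel" unfolding G_def by measurable
    show "(\<integral>\<^sup>+x. indicator {0..1} t * ennreal (G x t powr p) \<partial>lborel) = indicator {0..1::real} t * (ennreal (norm z powr p) * (\<integral>\<^sup>+x. ennreal (norm (grad \<psi> x) powr p) \<partial>lborel))"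
      by (simp add: nn_integral_cmult *)
  qed
  also have "\<dots> = ennreal (norm z powr p) * (\<integral>\<^sup>+x. ennreal (norm (grad \<psi> x) powr p) \<partial>lborel)"
    by (subst nn_integral_multc) auto
  finally show ?thesis .
qed

text \<open>For h > 0 this is the integer label of the half-open cube of side h that contains x.
  Describing \<open>cell_set\<close> through equal labels makes its measurability immediate.\<close>

definition cell :: "real \<Rightarrow> 'a::euclidean_space \<Rightarrow> 'a" where
  "cell h x = (\<Sum>b\<in>Basis. of_int \<lfloor>(x \<bullet> b) / h\<rfloor> *\<^sub>R b)"

definition cell_set :: "real \<Rightarrow> 'a::euclidean_space \<Rightarrow> 'a set" where
  "cell_set h x = {y. cell h y = cell h x}"

definition cell_avg :: "real \<Rightarrow> ('a::euclidean_space \<Rightarrow> real) \<Rightarrow> 'a \<Rightarrow> real" where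
  "cell_avg h \<psi> x = (LINT y|lborel. indicator (cell_set h x) y * \<psi> y) / h ^ DIM('a)"

lemma cell_inner: "b \<in> Basis \<Longrightarrow> cell h x \<bullet> b = of_int \<lfloor>(x \<bullet> b) / h\<rfloor>"
  by (simp add: cell_def)

lemma cell_measurable[measurable]: "cell h \<in> borel_measurable borel"
  unfolding cell_def[abs_def] by measurable

lemma cell_set_measurable: "cell_set h x \<in> sets borel"
  unfolding cell_set_def by measurable

lemma mem_cell_set_iff:
  assumes "h > 0"
  shows "y \<in> cell_set h x \<longleftrightarrow> (\<forall>b\<in>Basis. h * (cell h x \<bullet> b) \<le> y \<bullet> b \<and> y \<bullet> b < h * (cell h x \<bullet> b) + h)"
proof -
  have "of_int \<lfloor>(y \<bullet> b) / h\<rfloor> = (of_int n :: real) \<longleftrightarrow> h * of_int n \<le> y \<bullet> b \<and> y \<bullet> b < h * of_int n + h" for b n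
    using assms by (simp add: floor_eq_iff field_simps)
  then show ?thesis
    unfolding cell_set_def mem_Collect_eq by (subst euclidean_eq_iff) (simp add: cell_inner)
qed

lemma emeasure_cell_set:
  assumes h: "h > 0"
  shows "emeasure lborel (cell_set h (x :: 'a::euclidean_space)) = ennreal (h ^ DIM('a))"
proof (rule antisym)
  let ?lo = "h *\<^sub>R cell h x" and ?hi = "h *\<^sub>R cell h x + h *\<^sub>R One"
  have "cell_set h x \<subseteq> cbox ?lo ?hi" by (auto simp: mem_cell_set_iff[OF h] mem_box inner_add_left less_imp_le)
  then have "emeasure lborel (cell_set h x) \<le> emeasure lborel (cbox ?lo ?hi)" by (rule emeasure_mono) simp
  also have "\<dots> = ennreal (h ^ DIM('a))"
    using h by (subst emeasure_lborel_cbox) (auto simp: inner_add_left)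
  finally show "emeasure lborel (cell_set h x) \<le> ennreal (h ^ DIM('a))" .
  have "ennreal (h ^ DIM('a)) = emeasure lborel (box ?lo ?hi)"
    using h by (subst emeasure_lborel_box) (auto simp: inner_add_left)
  also have "box ?lo ?hi \<subseteq> cell_set h x" by (auto simp: mem_cell_set_iff[OF h] mem_box inner_add_left less_imp_le)
  then have "emeasure lborel (box ?lo ?hi) \<le> emeasure lborel (cell_set h x)"
    by (rule emeasure_mono) (simp add: cell_set_measurable)
  finally show "ennreal (h ^ DIM('a)) \<le> emeasure lborel (cell_set h x)" .
qed

lemma cell_set_diameter:
  assumes h: "h > 0" and y: "y \<in> cell_set h (x :: 'a::euclidean_space)"
  shows "norm (y - x) \<le> real DIM('a) * h"
proof -
  have "x \<in> cell_set h x" by (simp add: cell_set_def)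
  then have "\<bar>(y - x) \<bullet> b\<bar> \<le> h" if "b \<in> Basis" for b
    using y that unfolding mem_cell_set_iff[OF h] inner_diff_left by fastforce
  then have "(\<Sum>b\<in>Basis. \<bar>(y - x) \<bullet> b\<bar>) \<le> real DIM('a) * h"
    using sum_bounded_above[of Basis "\<lambda>b. \<bar>(y - x) \<bullet> b\<bar>" h] by simp
  then show ?thesis using norm_le_l1[of "y - x"] by linarith
qed

text \<open>The volume of a ball of radius R = DIM h divided by the volume h^DIM of a cube, times
  R^p, with h^p split off. The \<open>itself\<close> argument supplies the dimension.\<close>

definition cell_const :: "'a::euclidean_space itself \<Rightarrow> real \<Rightarrow> real" where
  "cell_const _ p = unit_ball_vol (real DIM('a)) * real DIM('a) ^ DIM('a) * real DIM('a) powr p"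

text \<open>By Jensen's inequality the deviation from the cube average at x is controlled by the
  mean of |\<psi> y - \<psi> x|^p over the cube. Enlarging the cube to a ball about x makes the set
  of shifts independent of x, so Fubini's theorem reduces the claim to the translation
  estimate.\<close>

lemma cell_Poincare:
  fixes \<psi> :: "'a::euclidean_space \<Rightarrow> real"
  assumes \<psi>: "\<psi> \<in> test_functions \<Omega>" and p: "p > 1" and h: "h > 0"
  shows "(\<integral>\<^sup>+x. ennreal (\<bar>\<psi> x - cell_avg h \<psi> x\<bar> powr p) \<partial>lborel)
    \<le> ennreal (cell_const TYPE('a) p * h powr p) * (\<integral>\<^sup>+x. ennreal (norm (grad \<psi> x) powr p) \<partial>lborel)"
proof -
  note sm = test_functions_smooth[OF \<psi>]
  have [measurable]: "\<psi> \<in> borel_measurable borel"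
    by (intro borel_measurable_continuous_onI smooth_continuous_on sm)
  obtain B where B: "B > 0" "\<And>x. \<bar>\<psi> x\<bar> \<le> B" using test_functions_bounded[OF \<psi>] by metis
  define V where "V = h ^ DIM('a)"
  define R where "R = real DIM('a) * h"
  have V: "V > 0" and R: "R > 0" using h by (auto simp: V_def R_def)
  have [measurable]: "cball (y :: 'a) R \<in> sets borel" for y by simp
  note em = emeasure_cell_set[where 'a='a, OF h, folded V_def]
  define I where "I = (\<integral>\<^sup>+x. ennreal (norm (grad \<psi> x) powr p) \<partial>lborel)"
  have pt: "ennreal (\<bar>\<psi> x - cell_avg h \<psi> x\<bar> powr p)
      \<le> ennreal (1 / V) * (\<integral>\<^sup>+z. indicator (cball 0 R) z * ennreal (\<bar>\<psi> (x + z) - \<psi> x\<bar> powr p) \<partial>lborel)" for x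
  proof -
    let ?S = "cell_set h x"
    have [measurable]: "?S \<in> sets borel" by (rule cell_set_measurable)
    have Si: "integrable lborel (indicator ?S :: 'a \<Rightarrow> real)" using em[of x] by simp
    have Sm: "measure lborel ?S = V" using em[of x] V by (simp add: measure_def)
    have b: "\<bar>\<psi> y - \<psi> x\<bar> \<le> 2 * B" for y using B(2)[of x] B(2)[of y] by linarith
    have i1: "integrable lborel (\<lambda>y. indicator ?S y * \<psi> y)"
      by (rule Bochner_Integration.integrable_bound[OF integrable_mult_right[OF Si, of B]])
        (use B in \<open>auto simp: indicator_def\<close>)
    have i3: "integrable lborel (\<lambda>y. indicator ?S y * \<bar>\<psi> y - \<psi> x\<bar> powr p)"
      by (rule Bochner_Integration.integrable_bound[OF integrable_mult_right[OF Si, of "(2 * B) powr p"]])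
        (use B b p in \<open>auto simp: indicator_def intro!: AE_I2 powr_mono2\<close>)
    have "V * (\<psi> x - cell_avg h \<psi> x) = (LINT y|lborel. indicator ?S y * \<psi> x - indicator ?S y * \<psi> y)"
      using Si i1 V h by (simp add: Sm cell_avg_def V_def field_simps)
    also have "\<bar>\<dots>\<bar> \<le> (LINT y|lborel. \<bar>indicator ?S y * \<psi> x - indicator ?S y * \<psi> y\<bar>)"
      by (rule integral_abs_bound)
    also have "(\<lambda>y. \<bar>indicator ?S y * \<psi> x - indicator ?S y * \<psi> y\<bar>) = (\<lambda>y. indicator ?S y * \<bar>\<psi> y - \<psi> x\<bar>)"
      by (auto simp: indicator_def fun_eq_iff)
    finally have "(V * \<bar>\<psi> x - cell_avg h \<psi> x\<bar>) powr p \<le> (LINT y|lborel. indicator ?S y * \<bar>\<psi> y - \<psi> x\<bar>) powr p"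
      using V p by (intro powr_mono2) (auto simp: abs_mult)
    also have "\<dots> \<le> V powr (p - 1) * (LINT y|lborel. indicator ?S y * \<bar>\<psi> y - \<psi> x\<bar> powr p)"
      by (rule Jensen_powr[OF _ em V p _ _ b]) auto
    finally have 1: "V powr p * \<bar>\<psi> x - cell_avg h \<psi> x\<bar> powr p \<le> V powr (p - 1) * (LINT y|lborel. indicator ?S y * \<bar>\<psi> y - \<psi> x\<bar> powr p)"
      by (simp add: powr_mult)
    have "V powr p = V powr (p - 1) * V" using powr_add[of V "p - 1" 1] V by simp
    with 1 V have "\<bar>\<psi> x - cell_avg h \<psi> x\<bar> powr p \<le> 1 / V * (LINT y|lborel. indicator ?S y * \<bar>\<psi> y - \<psi> x\<bar> powr p)"
      by (simp add: field_simps)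
    then have "ennreal (\<bar>\<psi> x - cell_avg h \<psi> x\<bar> powr p) \<le> ennreal (1 / V) * ennreal (LINT y|lborel. indicator ?S y * \<bar>\<psi> y - \<psi> x\<bar> powr p)"
      using V by (subst ennreal_mult'[symmetric]) (auto intro!: ennreal_leI)
    also have "ennreal (LINT y|lborel. indicator ?S y * \<bar>\<psi> y - \<psi> x\<bar> powr p) = (\<integral>\<^sup>+y. ennreal (indicator ?S y * \<bar>\<psi> y - \<psi> x\<bar> powr p) \<partial>lborel)"
      by (rule nn_integral_eq_integral[symmetric, OF i3]) simp
    also have "\<dots> \<le> (\<integral>\<^sup>+y. indicator (cball x R) y * ennreal (\<bar>\<psi> y - \<psi> x\<bar> powr p) \<partial>lborel)"
      using cell_set_diameter[OF h, of _ x]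
      by (intro nn_integral_mono) (auto simp: indicator_def R_def dist_norm norm_minus_commute)
    also have "\<dots> = (\<integral>\<^sup>+z. indicator (cball x R) (z + x) * ennreal (\<bar>\<psi> (z + x) - \<psi> x\<bar> powr p) \<partial>lborel)"
      by (rule nn_integral_lborel_translate[symmetric]) measurable
    also have "\<dots> = (\<integral>\<^sup>+z. indicator (cball 0 R) z * ennreal (\<bar>\<psi> (x + z) - \<psi> x\<bar> powr p) \<partial>lborel)"
      by (intro nn_integral_cong) (auto simp: indicator_def dist_norm add.commute)
    finally show ?thesis by (simp add: mult_left_mono)
  qed
  have "(\<integral>\<^sup>+x. ennreal (\<bar>\<psi> x - cell_avg h \<psi> x\<bar> powr p) \<partial>lborel)
      \<le> (\<integral>\<^sup>+x. ennreal (1 / V) * (\<integral>\<^sup>+z. indicator (cball 0 R) z * ennreal (\<bar>\<psi> (x + z) - \<psi> x\<bar> powr p) \<partial>lborel) \<partial>lborel)"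
    by (rule nn_integral_mono) (rule pt)
  also have "\<dots> = ennreal (1 / V) * (\<integral>\<^sup>+x. (\<integral>\<^sup>+z. indicator (cball 0 R) z * ennreal (\<bar>\<psi> (x + z) - \<psi> x\<bar> powr p) \<partial>lborel) \<partial>lborel)"
    by (rule nn_integral_cmult) measurable
  also have "(\<integral>\<^sup>+x. (\<integral>\<^sup>+z. indicator (cball 0 R) z * ennreal (\<bar>\<psi> (x + z) - \<psi> x\<bar> powr p) \<partial>lborel) \<partial>lborel)
      = (\<integral>\<^sup>+z. (\<integral>\<^sup>+x. indicator (cball 0 R) z * ennreal (\<bar>\<psi> (x + z) - \<psi> x\<bar> powr p) \<partial>lborel) \<partial>lborel)"
    by (rule lborel_pair.Fubini'[symmetric]) measurable
  also have "\<dots> \<le> (\<integral>\<^sup>+z. indicator (cball (0::'a) R) z * (ennreal (R powr p) * I) \<partial>lborel)"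
  proof (rule nn_integral_mono)
    fix z :: 'a
    have "(\<integral>\<^sup>+x. indicator (cball 0 R) z * ennreal (\<bar>\<psi> (x + z) - \<psi> x\<bar> powr p) \<partial>lborel)
      = indicator (cball 0 R) z * (\<integral>\<^sup>+x. ennreal (\<bar>\<psi> (x + z) - \<psi> x\<bar> powr p) \<partial>lborel)"
      by (rule nn_integral_cmult) measurable
    also have "\<dots> \<le> indicator (cball 0 R) z * (ennreal (norm z powr p) * I)"
      unfolding I_def by (intro mult_left_mono Lp_translate_le[OF \<psi> p]) auto
    also have "\<dots> \<le> indicator (cball 0 R) z * (ennreal (R powr p) * I)"
      using p by (auto simp: indicator_def intro!: mult_right_mono ennreal_leI powr_mono2)
    finally show "(\<integral>\<^sup>+x. indicator (cball 0 R) z * ennreal (\<bar>\<psi> (x + z) - \<psi> x\<bar> powr p) \<partial>lborel)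
      \<le> indicator (cball 0 R) z * (ennreal (R powr p) * I)" .
  qed
  also have "\<dots> = ennreal (unit_ball_vol (real DIM('a)) * R ^ DIM('a)) * (ennreal (R powr p) * I)"
    using R by (subst nn_integral_multc) (auto simp: emeasure_cball)
  finally have "(\<integral>\<^sup>+x. ennreal (\<bar>\<psi> x - cell_avg h \<psi> x\<bar> powr p) \<partial>lborel)
      \<le> ennreal (1 / V) * (ennreal (unit_ball_vol (real DIM('a)) * R ^ DIM('a)) * (ennreal (R powr p) * I))"
    by (simp add: mult_left_mono)
  also have "\<dots> = ennreal (1 / V * (unit_ball_vol (real DIM('a)) * R ^ DIM('a)) * R powr p) * I"
    using V R by (simp add: ennreal_mult'[symmetric] mult.assoc[symmetric])
  also have "1 / V * (unit_ball_vol (real DIM('a)) * R ^ DIM('a)) * R powr p = cell_const TYPE('a) p * h powr p"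
    using h by (simp add: R_def V_def cell_const_def powr_mult power_mult_distrib)
  finally show ?thesis by (simp add: I_def)
qed

section \<open>Compactness and separability of the space of test functions\<close>

lemma test_functions_integrable_powr:
  assumes \<phi>: "\<phi> \<in> test_functions \<Omega>" and p: "p > 0"
  shows "integrable lborel (\<lambda>x. \<bar>\<phi> x\<bar> powr p)" "integrable lborel (\<lambda>x. norm (grad \<phi> x) powr p)"
proof -
  note sm = test_functions_smooth[OF \<phi>]
  obtain K where K: "compact K" "\<And>x. x \<notin> K \<Longrightarrow> \<phi> x = 0" "\<And>x. x \<notin> K \<Longrightarrow> grad \<phi> x = 0"
    using test_functions_support[OF \<phi>] by metis
  show "integrable lborel (\<lambda>x. \<bar>\<phi> x\<bar> powr p)"
    by (rule integrable_lborel_compact_support[OF K(1)])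
      (intro continuous_on_powr' continuous_on_rabs smooth_continuous_on[OF sm] continuous_on_const, use p K in auto)
  show "integrable lborel (\<lambda>x. norm (grad \<phi> x) powr p)"
    by (rule integrable_lborel_compact_support[OF K(1)])
      (intro continuous_on_powr' continuous_on_norm grad_continuous_on[OF sm] continuous_on_const, use p K in auto)
qed

lemma nn_integral_test_functions:
  assumes \<phi>: "\<phi> \<in> test_functions \<Omega>" and p: "p > 0"
  shows "(\<integral>\<^sup>+x. ennreal (\<bar>\<phi> x\<bar> powr p) \<partial>lborel) = ennreal (LINT x|lborel. \<bar>\<phi> x\<bar> powr p)"
    "(\<integral>\<^sup>+x. ennreal (norm (grad \<phi> x) powr p) \<partial>lborel) = ennreal (LINT x|lborel. norm (grad \<phi> x) powr p)"
  by (auto intro!: nn_integral_eq_integral test_functions_integrable_powr[OF assms])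

section \<open>Poincare inequality and Rellich compactness\<close>

lemma Poincare_test_functions:
  fixes \<phi> :: "'a::euclidean_space \<Rightarrow> real"
  assumes \<phi>: "\<phi> \<in> test_functions \<Omega>" and p: "p > 1" and R: "\<Omega> \<subseteq> cball 0 R" "R > 0"
  shows "(LINT x|lborel. \<bar>\<phi> x\<bar> powr p) \<le> (2 * R + 1) powr p * (LINT x|lborel. norm (grad \<phi> x) powr p)"
proof -
  obtain b :: 'a where b: "b \<in> Basis" using nonempty_Basis by blast
  \<comment> \<open>The shift is longer than the diameter of the enclosing ball, so x + z lies
    outside \<Omega> for every x in \<Omega> and |\<phi> x| is itself an increment.\<close>
  define z where "z = (2 * R + 1) *\<^sub>R b"
  have nz: "norm z = 2 * R + 1" using b R by (simp add: z_def)
  have "ennreal (\<bar>\<phi> x\<bar> powr p) \<le> ennreal (\<bar>\<phi> (x + z) - \<phi> x\<bar> powr p)" for x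
  proof (cases "x \<in> \<Omega>")
    case True
    have "norm x \<le> R" using True R by auto
    then have "norm (x + z) > R" using norm_triangle_ineq4[of "x + z" x] nz R by simp
    then have "x + z \<notin> \<Omega>" using R by auto
    then have "\<phi> (x + z) = 0" by (rule test_functions_outside[OF \<phi>])
    then show ?thesis by simp
  qed (simp add: test_functions_outside[OF \<phi>])
  then have "(\<integral>\<^sup>+x. ennreal (\<bar>\<phi> x\<bar> powr p) \<partial>lborel) \<le> (\<integral>\<^sup>+x. ennreal (\<bar>\<phi> (x + z) - \<phi> x\<bar> powr p) \<partial>lborel)"
    by (rule nn_integral_mono)
  also have "\<dots> \<le> ennreal (norm z powr p) * (\<integral>\<^sup>+x. ennreal (norm (grad \<phi> x) powr p) \<partial>lborel)"
    by (rule Lp_translate_le[OF \<phi> p])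
  finally have "ennreal (LINT x|lborel. \<bar>\<phi> x\<bar> powr p) \<le> ennreal ((2 * R + 1) powr p * (LINT x|lborel. norm (grad \<phi> x) powr p))"
    using p by (simp add: nn_integral_test_functions[OF \<phi>] nz ennreal_mult')
  then show ?thesis by (subst (asm) ennreal_le_iff) (auto intro!: mult_nonneg_nonneg integral_nonneg_AE)
qed

lemma grad_diff_powr_le:
  assumes \<phi>: "\<phi> \<in> test_functions \<Omega>" "\<phi>' \<in> test_functions \<Omega>" and p: "p > 0"
  shows "(LINT x|lborel. norm (grad (\<lambda>x. \<phi> x - \<phi>' x) x) powr p)
    \<le> 2 powr p * ((LINT x|lborel. norm (grad \<phi> x) powr p) + (LINT x|lborel. norm (grad \<phi>' x) powr p))"
proof -
  note i = test_functions_integrable_powr(2)[OF _ p]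
  have "(LINT x|lborel. norm (grad (\<lambda>x. \<phi> x - \<phi>' x) x) powr p)
      \<le> (LINT x|lborel. 2 powr p * (norm (grad \<phi> x) powr p + norm (grad \<phi>' x) powr p))"
  proof (rule integral_mono)
    show "norm (grad (\<lambda>x. \<phi> x - \<phi>' x) x) powr p \<le> 2 powr p * (norm (grad \<phi> x) powr p + norm (grad \<phi>' x) powr p)" for x
      unfolding grad_diff[OF test_functions_smooth[OF \<phi>(1)] test_functions_smooth[OF \<phi>(2)]] by (rule norm_diff_powr_le[OF p])
  qed (use i[OF test_functions_diff[OF \<phi>]] i[OF \<phi>(1)] i[OF \<phi>(2)] in auto)
  then show ?thesis using i[OF \<phi>(1)] i[OF \<phi>(2)] by simp
qed

lemma cell_avg_measurable:
  assumes [measurable]: "\<psi> \<in> borel_measurable borel"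
  shows "cell_avg h \<psi> \<in> borel_measurable borel"
proof -
  have "indicator (cell_set h x) y * \<psi> y = (if cell h y = cell h x then \<psi> y else 0)" for x y
    by (simp add: cell_set_def indicator_def)
  then show ?thesis unfolding cell_avg_def[abs_def] by simp
qed

lemma cell_avg_integrable:
  fixes \<psi> :: "'a::euclidean_space \<Rightarrow> real"
  assumes "integrable lborel \<psi>"
  shows "integrable lborel (\<lambda>y. indicator (cell_set h x) y * \<psi> y)"
  using integrable_mult_indicator[OF _ assms, of "cell_set h x"] cell_set_measurable[of h x] by simp

lemma cell_avg_diff:
  assumes "integrable lborel \<phi>" "integrable lborel \<psi>"
  shows "cell_avg h (\<lambda>x. \<phi> x - \<psi> x) x = cell_avg h \<phi> x - cell_avg h \<psi> x"
  using cell_avg_integrable[OF assms(1)] cell_avg_integrable[OF assms(2)]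
  by (simp add: cell_avg_def right_diff_distrib diff_divide_distrib)

lemma cell_avg_bound:
  fixes \<psi> :: "'a::euclidean_space \<Rightarrow> real"
  assumes i: "integrable lborel \<psi>" and h: "h > 0"
  shows "\<bar>cell_avg h \<psi> x\<bar> \<le> (LINT y|lborel. \<bar>\<psi> y\<bar>) / h ^ DIM('a)"
proof -
  have "\<bar>LINT y|lborel. indicator (cell_set h x) y * \<psi> y\<bar> \<le> (LINT y|lborel. \<bar>indicator (cell_set h x) y * \<psi> y\<bar>)"
    by (rule integral_abs_bound)
  also have "\<dots> \<le> (LINT y|lborel. \<bar>\<psi> y\<bar>)"
    by (rule integral_mono) (use i cell_avg_integrable[OF i] in \<open>auto simp: indicator_def\<close>)
  finally show ?thesis using h by (simp add: cell_avg_def abs_divide divide_right_mono)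
qed

lemma test_functions_integrable: "\<phi> \<in> test_functions \<Omega> \<Longrightarrow> integrable lborel \<phi>"
  by (metis integrable_lborel_compact_support smooth_continuous_on test_functions_smooth test_functions_support)

text \<open>Splits the norm into an averaging error of order h^p times the gradient energy, and the
  averages themselves. Since \<psi> vanishes outside \<Omega>, the averages count only on this set
  of finite measure.\<close>

lemma Lp_le_cell_avg:
  fixes \<psi> :: "'a::euclidean_space \<Rightarrow> real"
  assumes \<psi>: "\<psi> \<in> test_functions \<Omega>" and p: "p > 1" and h: "h > 0" and \<Omega>: "open \<Omega>" "bounded \<Omega>"
  shows "integrable lborel (\<lambda>x. indicator \<Omega> x * \<bar>cell_avg h \<psi> x\<bar> powr p)"
    and "(LINT x|lborel. \<bar>\<psi> x\<bar> powr p) \<le> 2 powr p * (cell_const TYPE('a) p * h powr p * (LINT x|lborel. norm (grad \<psi> x) powr p)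
      + (LINT x|lborel. indicator \<Omega> x * \<bar>cell_avg h \<psi> x\<bar> powr p))"
proof -
  have [measurable]: "\<psi> \<in> borel_measurable borel"
    by (intro borel_measurable_continuous_onI smooth_continuous_on test_functions_smooth[OF \<psi>])
  have [measurable]: "cell_avg h \<psi> \<in> borel_measurable borel" by (rule cell_avg_measurable) measurable
  have [measurable]: "\<Omega> \<in> sets borel" using \<Omega> by simp
  define B where "B = (LINT y|lborel. \<bar>\<psi> y\<bar>) / h ^ DIM('a)"
  have fin: "emeasure lborel \<Omega> < \<infinity>" by (rule emeasure_bounded_finite[OF \<Omega>(2)])
  have i\<Omega>: "integrable lborel (indicator \<Omega> :: 'a \<Rightarrow> real)" using fin by simp
  have "\<bar>cell_avg h \<psi> x\<bar> powr p \<le> B powr p" for x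
    using cell_avg_bound[OF test_functions_integrable[OF \<psi>] h, of x] p by (intro powr_mono2) (auto simp: B_def)
  then show i: "integrable lborel (\<lambda>x. indicator \<Omega> x * \<bar>cell_avg h \<psi> x\<bar> powr p)"
    by (intro Bochner_Integration.integrable_bound[OF integrable_mult_right[OF i\<Omega>, of "B powr p"]])
      (auto simp: indicator_def)
  have c0: "cell_const TYPE('a) p \<ge> 0" by (simp add: cell_const_def)
  have "ennreal (LINT x|lborel. \<bar>\<psi> x\<bar> powr p) = (\<integral>\<^sup>+x. ennreal (\<bar>\<psi> x\<bar> powr p) \<partial>lborel)"
    using p by (simp add: nn_integral_test_functions[OF \<psi>])
  also have "\<dots> \<le> (\<integral>\<^sup>+x. ennreal (2 powr p) * (ennreal (\<bar>\<psi> x - cell_avg h \<psi> x\<bar> powr p) + ennreal (indicator \<Omega> x * \<bar>cell_avg h \<psi> x\<bar> powr p)) \<partial>lborel)"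
  proof (rule nn_integral_mono)
    fix x
    have "\<bar>\<psi> x\<bar> powr p \<le> 2 powr p * (\<bar>\<psi> x - cell_avg h \<psi> x\<bar> powr p + indicator \<Omega> x * \<bar>cell_avg h \<psi> x\<bar> powr p)"
    proof (cases "x \<in> \<Omega>")
      case True
      then show ?thesis using norm_add_powr_le[of p "\<psi> x - cell_avg h \<psi> x" "cell_avg h \<psi> x"] p by simp
    next
      case False
      then show ?thesis using p by (simp add: test_functions_outside[OF \<psi>])
    qed
    then show "ennreal (\<bar>\<psi> x\<bar> powr p) \<le> ennreal (2 powr p) * (ennreal (\<bar>\<psi> x - cell_avg h \<psi> x\<bar> powr p) + ennreal (indicator \<Omega> x * \<bar>cell_avg h \<psi> x\<bar> powr p))"
      by (simp add: ennreal_mult'[symmetric] ennreal_plus[symmetric] ennreal_leI del: ennreal_plus)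
  qed
  also have "\<dots> = ennreal (2 powr p) * ((\<integral>\<^sup>+x. ennreal (\<bar>\<psi> x - cell_avg h \<psi> x\<bar> powr p) \<partial>lborel) + (\<integral>\<^sup>+x. ennreal (indicator \<Omega> x * \<bar>cell_avg h \<psi> x\<bar> powr p) \<partial>lborel))"
    by (simp add: nn_integral_cmult nn_integral_add)
  also have "(\<integral>\<^sup>+x. ennreal (indicator \<Omega> x * \<bar>cell_avg h \<psi> x\<bar> powr p) \<partial>lborel) = ennreal (LINT x|lborel. indicator \<Omega> x * \<bar>cell_avg h \<psi> x\<bar> powr p)"
    by (rule nn_integral_eq_integral[OF i]) simp
  also have "(\<integral>\<^sup>+x. ennreal (\<bar>\<psi> x - cell_avg h \<psi> x\<bar> powr p) \<partial>lborel) \<le> ennreal (cell_const TYPE('a) p * h powr p * (LINT x|lborel. norm (grad \<psi> x) powr p))"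
    using cell_Poincare[OF \<psi> p h] p c0 by (simp add: nn_integral_test_functions[OF \<psi>] ennreal_mult')
  finally have "ennreal (LINT x|lborel. \<bar>\<psi> x\<bar> powr p) \<le> ennreal (2 powr p * (cell_const TYPE('a) p * h powr p * (LINT x|lborel. norm (grad \<psi> x) powr p)
      + (LINT x|lborel. indicator \<Omega> x * \<bar>cell_avg h \<psi> x\<bar> powr p)))"
    using c0 by (simp add: ennreal_mult'[symmetric] ennreal_plus[symmetric] add_mono mult_left_mono del: ennreal_plus)
  then show "(LINT x|lborel. \<bar>\<psi> x\<bar> powr p) \<le> 2 powr p * (cell_const TYPE('a) p * h powr p * (LINT x|lborel. norm (grad \<psi> x) powr p)
      + (LINT x|lborel. indicator \<Omega> x * \<bar>cell_avg h \<psi> x\<bar> powr p))"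
    by (subst (asm) ennreal_le_iff) (auto intro!: mult_nonneg_nonneg add_nonneg_nonneg integral_nonneg_AE c0)
qed

text \<open>For a fixed mesh the averages are uniformly bounded and converge at every point along a
  subsequence, hence in L^p over \<Omega>. The averaging error is at most of order h^p, uniformly in
  n, so the mesh is fixed first and the index afterwards.\<close>

theorem Rellich_test_functions:
  fixes \<phi> :: "nat \<Rightarrow> 'a::euclidean_space \<Rightarrow> real"
  assumes \<phi>: "\<And>n. \<phi> n \<in> test_functions \<Omega>" and p: "p > 1" and \<Omega>: "open \<Omega>" "bounded \<Omega>"
    and M: "\<And>n. (LINT x|lborel. norm (grad (\<phi> n) x) powr p) \<le> M"
  obtains r :: "nat \<Rightarrow> nat" where "strict_mono r"
    "\<And>e. e > 0 \<Longrightarrow> \<exists>N. \<forall>m\<ge>N. \<forall>n\<ge>N. (LINT x|lborel. \<bar>\<phi> (r m) x - \<phi> (r n) x\<bar> powr p) < e"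
proof -
  have p0: "p > 0" using p by simp
  obtain R where R: "\<Omega> \<subseteq> cball 0 R" "R > 0"
    using \<Omega>(2) unfolding bounded_pos by (auto simp: subset_iff)
  have fin: "emeasure lborel \<Omega> < \<infinity>" by (rule emeasure_bounded_finite[OF \<Omega>(2)])
  have [measurable]: "\<Omega> \<in> sets borel" using \<Omega> by simp
  have i\<Omega>: "integrable lborel (indicator \<Omega> :: 'a \<Rightarrow> real)" using fin by simp
  define B where "B = measure lborel \<Omega> + (2 * R + 1) powr p * M"
  have L1: "(LINT x|lborel. \<bar>\<phi> n x\<bar>) \<le> B" for n
  proof -
    have "(LINT x|lborel. \<bar>\<phi> n x\<bar>) \<le> (LINT x|lborel. indicator \<Omega> x + \<bar>\<phi> n x\<bar> powr p)"
    proof (rule integral_mono)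
      show "\<bar>\<phi> n x\<bar> \<le> indicator \<Omega> x + \<bar>\<phi> n x\<bar> powr p" for x
      proof (cases "x \<in> \<Omega>")
        case True
        have "\<bar>\<phi> n x\<bar> \<le> 1 + \<bar>\<phi> n x\<bar> powr p"
          using powr_mono[of 1 p "\<bar>\<phi> n x\<bar>"] p by (cases "\<bar>\<phi> n x\<bar> \<le> 1") (auto simp: add_increasing2)
        then show ?thesis using True by simp
      qed (simp add: test_functions_outside[OF \<phi>])
    qed (use i\<Omega> test_functions_integrable[OF \<phi>] test_functions_integrable_powr(1)[OF \<phi> p0] in auto)
    also have "\<dots> = measure lborel \<Omega> + (LINT x|lborel. \<bar>\<phi> n x\<bar> powr p)"
      using i\<Omega> test_functions_integrable_powr(1)[OF \<phi> p0] by simp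
    also have "\<dots> \<le> B" unfolding B_def
      using order_trans[OF Poincare_test_functions[OF \<phi> p R] mult_left_mono[OF M, of "(2 * R + 1) powr p"], of n] by simp
    finally show ?thesis .
  qed
  \<comment> \<open>A countable dense set meets every cube of every mesh, so countably many numbers
    determine all cell averages and one subsequence serves all meshes.\<close>
  obtain D :: "'a set" where D: "countable D" "\<And>X. open X \<Longrightarrow> X \<noteq> {} \<Longrightarrow> \<exists>d\<in>D. d \<in> X"
    using countable_dense_setE by blast
  have Dne: "D \<noteq> {}" using D(2)[OF open_UNIV] by auto
  define y where "y = from_nat_into D"
  have yD: "range y = D" unfolding y_def by (rule range_from_nat_into[OF Dne D(1)])
  define h where "h k = 1 / (real k + 1)" for k
  have h: "h k > 0" for k by (simp add: h_def)
  have rep: "\<exists>j. cell_set (h k) x = cell_set (h k) (y j)" for k x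
  proof -
    let ?lo = "h k *\<^sub>R cell (h k) x"
    have "box ?lo (?lo + h k *\<^sub>R One) \<noteq> {}" using h[of k] by (auto simp: box_ne_empty inner_add_left)
    then obtain d where d: "d \<in> D" "d \<in> box ?lo (?lo + h k *\<^sub>R One)" using D(2)[OF open_box] by blast
    then have "d \<in> cell_set (h k) x" by (auto simp: mem_cell_set_iff[OF h] mem_box inner_add_left less_imp_le)
    then have "cell_set (h k) x = cell_set (h k) d" by (auto simp: cell_set_def)
    then show ?thesis using d(1) yD by (metis imageE)
  qed
  \<comment> \<open>\<open>prod_decode\<close> enumerates the pairs of a mesh and a sample
    point.\<close>
  define a where "a n i = cell_avg (h (fst (prod_decode i))) (\<phi> n) (y (snd (prod_decode i)))" for n i
  have avgB: "\<bar>cell_avg (h k) (\<phi> n) x\<bar> \<le> B / h k ^ DIM('a)" for k n x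
    by (rule order_trans[OF cell_avg_bound[OF test_functions_integrable[OF \<phi>] h] divide_right_mono[OF L1]])
      (use h[of k] in simp)
  obtain r l where r: "strict_mono r" "\<And>i. (\<lambda>n. a (r n) i) \<longlonglongrightarrow> l i"
    using simultaneous_convergent_subsequence[of a "\<lambda>i. B / h (fst (prod_decode i)) ^ DIM('a)"] avgB unfolding a_def by blast
  have conv: "convergent (\<lambda>n. cell_avg (h k) (\<phi> (r n)) x)" for k x
  proof -
    obtain j where j: "cell_set (h k) x = cell_set (h k) (y j)" using rep by blast
    have "cell_avg (h k) (\<phi> n) x = a n (prod_encode (k, j))" for n
      by (simp add: a_def cell_avg_def j)
    then show ?thesis using r(2) by (auto simp: convergent_def)
  qed
  define A where "A k x = lim (\<lambda>n. cell_avg (h k) (\<phi> (r n)) x)" for k x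
  have A: "(\<lambda>n. cell_avg (h k) (\<phi> (r n)) x) \<longlonglongrightarrow> A k x" for k x
    using conv unfolding A_def convergent_LIMSEQ_iff .
  have [measurable]: "\<phi> n \<in> borel_measurable borel" for n
    by (intro borel_measurable_continuous_onI smooth_continuous_on test_functions_smooth[OF \<phi>])
  have [measurable]: "cell_avg h (\<phi> n) \<in> borel_measurable borel" for n h by (rule cell_avg_measurable) measurable
  have [measurable]: "A k \<in> borel_measurable borel" for k by (rule borel_measurable_LIMSEQ_real[OF A]) measurable
  define dd where "dd k n = (LINT x|lborel. indicator \<Omega> x * \<bar>cell_avg (h k) (\<phi> (r n)) x - A k x\<bar> powr p)" for k n
  have AB: "\<bar>A k x\<bar> \<le> B / h k ^ DIM('a)" for k x
    by (rule LIMSEQ_le_const2[OF tendsto_rabs[OF A]]) (use avgB in blast)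
  have bd: "\<bar>cell_avg (h k) (\<phi> (r n)) x - A k x\<bar> powr p \<le> (2 * (B / h k ^ DIM('a))) powr p" for k n x
    using AB[of k x] avgB[of k "r n" x] p by (intro powr_mono2) auto
  have idd: "integrable lborel (\<lambda>x. indicator \<Omega> x * \<bar>cell_avg (h k) (\<phi> (r n)) x - A k x\<bar> powr p)" for k n
    using bd[of k n] by (intro Bochner_Integration.integrable_bound[OF integrable_mult_right[OF i\<Omega>, of "(2 * (B / h k ^ DIM('a))) powr p"]])
      (auto simp: indicator_def)
  have dd0: "dd k \<longlonglongrightarrow> 0" for k
  proof -
    have "(\<lambda>n. LINT x|lborel. indicator \<Omega> x * \<bar>cell_avg (h k) (\<phi> (r n)) x - A k x\<bar> powr p) \<longlonglongrightarrow> (LINT x::'a|lborel. 0)"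
    proof (rule integral_dominated_convergence[where w="\<lambda>x. indicator \<Omega> x * (2 * (B / h k ^ DIM('a))) powr p"])
      show "integrable lborel (\<lambda>x. indicator \<Omega> x * (2 * (B / h k ^ DIM('a))) powr p)" using i\<Omega> by simp
      have "(\<lambda>n. indicator \<Omega> x * \<bar>cell_avg (h k) (\<phi> (r n)) x - A k x\<bar> powr p) \<longlonglongrightarrow> indicator \<Omega> x * 0 powr p" for x
        by (intro tendsto_intros tendsto_powr'[OF _ tendsto_const]) (use A[of k x] p in \<open>auto simp: LIM_zero_iff tendsto_rabs_zero_iff\<close>)
      then show "AE x in lborel. (\<lambda>n. indicator \<Omega> x * \<bar>cell_avg (h k) (\<phi> (r n)) x - A k x\<bar> powr p) \<longlonglongrightarrow> 0" by simp
      show "AE x in lborel. norm (indicator \<Omega> x * \<bar>cell_avg (h k) (\<phi> (r n)) x - A k x\<bar> powr p) \<le> indicator \<Omega> x * (2 * (B / h k ^ DIM('a))) powr p" for n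
        using bd[of k n] by (auto simp: indicator_def)
    qed auto
    then show ?thesis by (simp add: dd_def[abs_def])
  qed
  define Q where "Q = 2 powr p"
  have Q: "Q > 0" by (simp add: Q_def)
  have main: "(LINT x|lborel. \<bar>\<phi> (r m) x - \<phi> (r n) x\<bar> powr p)
      \<le> Q * (cell_const TYPE('a) p * h k powr p * (Q * (M + M)) + Q * (dd k m + dd k n))" for k m n
  proof -
    let ?\<psi> = "\<lambda>x. \<phi> (r m) x - \<phi> (r n) x"
    have \<psi>: "?\<psi> \<in> test_functions \<Omega>" by (rule test_functions_diff[OF \<phi> \<phi>])
    have "(LINT x|lborel. norm (grad ?\<psi> x) powr p) \<le> Q * (M + M)"
      using grad_diff_powr_le[OF \<phi> \<phi> p0, of "r m" "r n"] M[of "r m"] M[of "r n"] Q unfolding Q_def[symmetric]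
      by (meson add_mono mult_left_mono order_trans less_imp_le)
    then have 1: "cell_const TYPE('a) p * h k powr p * (LINT x|lborel. norm (grad ?\<psi> x) powr p) \<le> cell_const TYPE('a) p * h k powr p * (Q * (M + M))"
      by (intro mult_left_mono) (auto simp: cell_const_def)
    have "(LINT x|lborel. indicator \<Omega> x * \<bar>cell_avg (h k) ?\<psi> x\<bar> powr p)
        \<le> (LINT x|lborel. Q * (indicator \<Omega> x * \<bar>cell_avg (h k) (\<phi> (r m)) x - A k x\<bar> powr p + indicator \<Omega> x * \<bar>cell_avg (h k) (\<phi> (r n)) x - A k x\<bar> powr p))"
    proof (rule integral_mono[OF Lp_le_cell_avg(1)[OF \<psi> p h \<Omega>]])
      fix x
      show "indicator \<Omega> x * \<bar>cell_avg (h k) ?\<psi> x\<bar> powr p \<le> Q * (indicator \<Omega> x * \<bar>cell_avg (h k) (\<phi> (r m)) x - A k x\<bar> powr p + indicator \<Omega> x * \<bar>cell_avg (h k) (\<phi> (r n)) x - A k x\<bar> powr p)"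
        using norm_diff_powr_le[OF p0, of "cell_avg (h k) (\<phi> (r m)) x - A k x" "cell_avg (h k) (\<phi> (r n)) x - A k x"]
        by (auto simp: indicator_def Q_def cell_avg_diff[OF test_functions_integrable[OF \<phi>] test_functions_integrable[OF \<phi>]])
    qed (use idd in auto)
    also have "\<dots> = Q * (dd k m + dd k n)" using idd by (simp add: dd_def)
    finally have 2: "(LINT x|lborel. indicator \<Omega> x * \<bar>cell_avg (h k) ?\<psi> x\<bar> powr p) \<le> Q * (dd k m + dd k n)" .
    show ?thesis
      by (rule order_trans[OF Lp_le_cell_avg(2)[OF \<psi> p h[of k] \<Omega>]])
        (use 1 2 Q in \<open>auto simp: Q_def[symmetric] intro!: mult_left_mono add_mono\<close>)
  qed
  show thesis
  proof (rule that[OF r(1)])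
    fix e :: real assume e: "e > 0"
    have "h \<longlonglongrightarrow> 0" unfolding h_def using LIMSEQ_inverse_real_of_nat by (simp add: inverse_eq_divide add.commute)
    then have "(\<lambda>k. Q * (cell_const TYPE('a) p * h k powr p * (Q * (M + M)))) \<longlonglongrightarrow> Q * (cell_const TYPE('a) p * 0 powr p * (Q * (M + M)))"
      using p0 by (intro tendsto_intros tendsto_powr'[OF _ tendsto_const]) (auto simp: h less_imp_le)
    then have "eventually (\<lambda>k. Q * (cell_const TYPE('a) p * h k powr p * (Q * (M + M))) < e / 2) sequentially"
      using e by (intro order_tendstoD) auto
    then obtain k where k: "Q * (cell_const TYPE('a) p * h k powr p * (Q * (M + M))) < e / 2"
      by (auto simp: eventually_sequentially)
    have "eventually (\<lambda>n. dd k n < e / (4 * Q * Q)) sequentially"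
      using e Q by (intro order_tendstoD(2)[OF dd0]) auto
    then obtain N where N: "\<And>n. n \<ge> N \<Longrightarrow> dd k n < e / (4 * Q * Q)" by (auto simp: eventually_sequentially)
    show "\<exists>N. \<forall>m\<ge>N. \<forall>n\<ge>N. (LINT x|lborel. \<bar>\<phi> (r m) x - \<phi> (r n) x\<bar> powr p) < e"
    proof (intro exI allI impI)
      fix m n assume "m \<ge> N" "n \<ge> N"
      then have "dd k m + dd k n < e / (2 * Q * Q)" using N[of m] N[of n] by (simp add: field_simps)
      then have "Q * (Q * (dd k m + dd k n)) < e / 2" using Q by (simp add: field_simps)
      then show "(LINT x|lborel. \<bar>\<phi> (r m) x - \<phi> (r n) x\<bar> powr p) < e"
        using main[of m n k] k by (simp add: distrib_left)
    qed
  qed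
qed

text \<open>Labels of cubes that meet a bounded set have bounded integer coordinates. Finiteness
  makes the tables of values on cubes, used next, a countable set.\<close>

lemma finite_cells:
  assumes h: "h > 0"
  shows "finite (cell h ` (cball 0 R :: 'a::euclidean_space set))"
proof (rule finite_subset)
  define L where "L = \<lceil>\<bar>R\<bar> / h\<rceil> + 1"
  let ?F = "PiE (Basis :: 'a set) (\<lambda>_. {- L..L})"
  show "finite ((\<lambda>n. \<Sum>b\<in>Basis. of_int (n b) *\<^sub>R b) ` ?F)" by (intro finite_imageI finite_PiE) auto
  show "cell h ` (cball 0 R :: 'a set) \<subseteq> (\<lambda>n. \<Sum>b\<in>Basis. of_int (n b) *\<^sub>R b) ` ?F"
  proof (rule image_subsetI)
    fix x :: 'a assume x: "x \<in> cball 0 R"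
    have "\<lfloor>(x \<bullet> b) / h\<rfloor> \<in> {- L..L}" if "b \<in> Basis" for b
    proof -
      have "\<bar>x \<bullet> b\<bar> \<le> \<bar>R\<bar>" using Basis_le_norm[OF that, of x] x by simp
      then have "\<bar>(x \<bullet> b) / h\<bar> \<le> \<bar>R\<bar> / h" using h by (simp add: abs_divide divide_right_mono)
      then show ?thesis unfolding L_def atLeastAtMost_iff by linarith
    qed
    then show "cell h x \<in> (\<lambda>n. \<Sum>b\<in>Basis. of_int (n b) *\<^sub>R b) ` ?F"
      by (intro image_eqI[of _ _ "restrict (\<lambda>b. \<lfloor>(x \<bullet> b) / h\<rfloor>) Basis"]) (auto simp: cell_def)
  qed
qed

text \<open>A description consists of a mesh, a table that assigns to each cube meeting the ball a
  value and a gradient from a countable dense set, and a tolerance. There are countably many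
  descriptions, and for each one that some test function fits, one such function is chosen.
  Functions fitting the same description differ by less than twice the tolerance, so the chosen ones
  are dense in the C^1 sense.\<close>

lemma uniformly_separable_test_functions:
  fixes \<Omega> :: "'a::euclidean_space set"
  obtains e :: "nat \<Rightarrow> 'a \<Rightarrow> real" where "\<And>i. e i \<in> test_functions \<Omega>"
    "\<And>\<phi> \<epsilon>. \<phi> \<in> test_functions \<Omega> \<Longrightarrow> \<epsilon> > 0 \<Longrightarrow>
      \<exists>i. \<forall>x\<in>cball 0 R. \<bar>\<phi> x - e i x\<bar> < \<epsilon> \<and> norm (grad \<phi> x - grad (e i) x) < \<epsilon>"
proof -
  obtain S :: "(real \<times> 'a) set" where S: "countable S" "\<And>X. open X \<Longrightarrow> X \<noteq> {} \<Longrightarrow> \<exists>d\<in>S. d \<in> X"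
    using countable_dense_setE by blast
  define h where "h k = 1 / (real k + 1)" for k
  have h: "h k > 0" for k by (simp add: h_def)
  have hlim: "h \<longlonglongrightarrow> 0" unfolding h_def using LIMSEQ_inverse_real_of_nat by (simp add: inverse_eq_divide add.commute)
  define C where "C k = cell (h k) ` (cball 0 R :: 'a set)" for k
  define P where "P q \<phi> \<longleftrightarrow> \<phi> \<in> test_functions \<Omega> \<and> (\<forall>x\<in>cball 0 R. dist (\<phi> x, grad \<phi> x) (fst (snd q) (cell (h (fst q)) x)) < h (snd (snd q)))"
    for q :: "nat \<times> ('a \<Rightarrow> real \<times> 'a) \<times> nat" and \<phi>
  \<comment> \<open>Descriptions that no test function fits receive the zero function, which keeps
    the whole family among the test functions.\<close>
  define sel where "sel q = (if \<exists>\<phi>. P q \<phi> then SOME \<phi>. P q \<phi> else (\<lambda>_. 0))" for q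
  define Q where "Q = (SIGMA k:UNIV. PiE (C k) (\<lambda>_. S) \<times> (UNIV :: nat set))"
  have "countable (PiE (C k) (\<lambda>_. S))" for k
    unfolding C_def by (intro countable_PiE finite_cells h S(1))
  then have cQ: "countable (sel ` Q)" unfolding Q_def by (intro countable_image countable_SIGMA) auto
  obtain s0 where "s0 \<in> S" using S(2)[OF open_UNIV] by auto
  then have "(0, restrict (\<lambda>_. s0) (C 0), 0) \<in> Q" by (auto simp: Q_def)
  then have neQ: "sel ` Q \<noteq> {}" by auto
  define e where "e = from_nat_into (sel ` Q)"
  have re: "range e = sel ` Q" unfolding e_def by (rule range_from_nat_into[OF neQ cQ])
  have selP: "P q (sel q)" if "P q \<phi>" for q \<phi> using that someI[of "P q" \<phi>] unfolding sel_def by auto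
  have selT: "sel q \<in> test_functions \<Omega>" for q
  proof (cases "\<exists>\<phi>. P q \<phi>")
    case True
    then show ?thesis using selP P_def by blast
  qed (simp add: sel_def test_functions_0)
  show thesis
  proof (rule that)
    show "e i \<in> test_functions \<Omega>" for i using re selT by (metis imageE rangeI)
    fix \<phi> and \<epsilon> :: real assume \<phi>: "\<phi> \<in> test_functions \<Omega>" and \<epsilon>: "\<epsilon> > 0"
    note sm = test_functions_smooth[OF \<phi>]
    define F where "F x = (\<phi> x, grad \<phi> x)" for x
    have "uniformly_continuous_on (cball 0 R) F"
      unfolding F_def by (intro compact_uniformly_continuous compact_cball continuous_on_Pair smooth_continuous_on grad_continuous_on sm)
    \<comment> \<open>Half of \<epsilon>, because \<phi> and the chosen function are each within
      \<open>h j\<close> of the table.\<close>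
    have "eventually (\<lambda>j. h j < \<epsilon> / 2) sequentially" using \<epsilon> by (intro order_tendstoD(2)[OF hlim]) auto
    then obtain j where j: "h j < \<epsilon> / 2" by (auto simp: eventually_sequentially)
    obtain \<eta> where \<eta>: "\<eta> > 0" "\<And>x y. x \<in> cball 0 R \<Longrightarrow> y \<in> cball 0 R \<Longrightarrow> dist y x < \<eta> \<Longrightarrow> dist (F y) (F x) < h j / 2"
      using \<open>uniformly_continuous_on (cball 0 R) F\<close> h[of j] unfolding uniformly_continuous_on_def by (metis half_gt_zero)
    have "(\<lambda>k. real DIM('a) * h k) \<longlonglongrightarrow> real DIM('a) * 0" by (intro tendsto_intros hlim)
    then have "eventually (\<lambda>k. real DIM('a) * h k < \<eta>) sequentially" using \<eta>(1) by (intro order_tendstoD(2)) auto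
    then obtain k where k: "real DIM('a) * h k < \<eta>" by (auto simp: eventually_sequentially)
    \<comment> \<open>For a label c that no point of the ball has, the \<open>SOME\<close> term is
      arbitrary; such labels are cut off by \<open>restrict\<close> below.\<close>
    have "\<exists>s\<in>S. dist (F (SOME x. x \<in> cball 0 R \<and> cell (h k) x = c)) s < h j / 2" for c
      using S(2)[OF open_ball, of "F (SOME x. x \<in> cball 0 R \<and> cell (h k) x = c)" "h j / 2"] h[of j] by auto
    then obtain d where d: "\<And>c. d c \<in> S" "\<And>c. dist (F (SOME x. x \<in> cball 0 R \<and> cell (h k) x = c)) (d c) < h j / 2"
      by metis
    define q where "q = (k, restrict d (C k), j)"
    have q: "q \<in> Q" unfolding q_def Q_def using d(1) by auto
    have P: "P q \<phi>"
      unfolding P_def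
    proof (intro conjI ballI \<phi>)
      fix x :: 'a assume x: "x \<in> cball 0 R"
      define x' where "x' = (SOME x'. x' \<in> cball 0 R \<and> cell (h k) x' = cell (h k) x)"
      have x': "x' \<in> cball 0 R" "cell (h k) x' = cell (h k) x"
        using someI[of "\<lambda>x'. x' \<in> cball 0 R \<and> cell (h k) x' = cell (h k) x" x] x unfolding x'_def by auto
      have "x \<in> cell_set (h k) x'" using x'(2) by (simp add: cell_set_def)
      then have "dist x x' < \<eta>" using cell_set_diameter[OF h, of x k x'] k by (simp add: dist_norm)
      then have "dist (F x) (F x') < h j / 2" by (rule \<eta>(2)[OF x'(1) x])
      moreover have "dist (F x') (d (cell (h k) x)) < h j / 2" using d(2)[of "cell (h k) x"] by (simp add: x'_def)
      ultimately have "dist (F x) (d (cell (h k) x)) < h j" using dist_triangle[of "F x" "d (cell (h k) x)" "F x'"] by linarith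
      then show "dist (\<phi> x, grad \<phi> x) (fst (snd q) (cell (h (fst q)) x)) < h (snd (snd q))"
        using x by (simp add: q_def F_def C_def)
    qed
    obtain i where i: "e i = sel q" using q re by (metis imageI rangeE)
    show "\<exists>i. \<forall>x\<in>cball 0 R. \<bar>\<phi> x - e i x\<bar> < \<epsilon> \<and> norm (grad \<phi> x - grad (e i) x) < \<epsilon>"
    proof (intro exI[of _ i] ballI)
      fix x :: 'a assume x: "x \<in> cball 0 R"
      let ?d = "fst (snd q) (cell (h (fst q)) x)"
      have "dist (\<phi> x, grad \<phi> x) ?d < h j" "dist (e i x, grad (e i) x) ?d < h j"
        using P selP[OF P] x unfolding P_def i by (auto simp: q_def)
      then have "dist (\<phi> x, grad \<phi> x) (e i x, grad (e i) x) < \<epsilon>"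
        using dist_triangle2[of "(\<phi> x, grad \<phi> x)" "(e i x, grad (e i) x)" ?d] j by linarith
      then show "\<bar>\<phi> x - e i x\<bar> < \<epsilon> \<and> norm (grad \<phi> x - grad (e i) x) < \<epsilon>"
        using dist_fst_le[of "(\<phi> x, grad \<phi> x)" "(e i x, grad (e i) x)"] dist_snd_le[of "(\<phi> x, grad \<phi> x)" "(e i x, grad (e i) x)"]
        by (simp add: dist_norm)
    qed
  qed
qed

section \<open>Critical points in finite dimensions\<close>

text \<open>Coefficient vectors of a Galerkin space with index set \<open>I\<close>; \<open>g\<close> is the gradient of \<open>j\<close>.\<close>

locale coefficient_functional =
  fixes I :: "nat set" and j :: "(nat \<Rightarrow> real) \<Rightarrow> real" and g :: "(nat \<Rightarrow> real) \<Rightarrow> nat \<Rightarrow> real"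
    and V :: "(nat \<Rightarrow> real) set"
  assumes finI: "finite I" and V_def: "V = {c. \<forall>i. i \<notin> I \<longrightarrow> c i = 0}"
    and j_cont: "continuous_on V j" and g_cont: "\<And>i. i \<in> I \<Longrightarrow> continuous_on V (\<lambda>c. g c i)"
    and j_deriv: "\<And>c d. c \<in> V \<Longrightarrow> d \<in> V \<Longrightarrow>
      ((\<lambda>s. j (\<lambda>i. c i + s * d i)) has_real_derivative (\<Sum>i\<in>I. g c i * d i)) (at 0)"
    and coercive: "\<And>M. \<exists>R. \<forall>c\<in>V. j c \<le> M \<longrightarrow> (\<forall>i\<in>I. \<bar>c i\<bar> \<le> R)"
begin

lemma V_lin: "c \<in> V \<Longrightarrow> d \<in> V \<Longrightarrow> (\<lambda>i. c i + s * d i) \<in> V"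
  by (simp add: V_def)

text \<open>Coercivity bounds the coordinates in I and the others vanish, so the sublevel set is a
  closed part of a compact box.\<close>

lemma compact_sublevel: "compact {c \<in> V. j c \<le> M}"
proof -
  obtain R where R: "\<And>c i. c \<in> V \<Longrightarrow> j c \<le> M \<Longrightarrow> i \<in> I \<Longrightarrow> \<bar>c i\<bar> \<le> R"
    using coercive by metis
  let ?K = "{c :: nat \<Rightarrow> real. \<forall>i. \<bar>c i\<bar> \<le> (if i \<in> I then \<bar>R\<bar> else 0)}"
  have K: "compact ?K" by (rule compact_coordinate_box)
  have KV: "?K \<subseteq> V" unfolding V_def
  proof (intro subsetI CollectI allI impI)
    fix c :: "nat \<Rightarrow> real" and i assume "c \<in> ?K" "i \<notin> I"
    then show "c i = 0" by (auto dest: spec[of _ i])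
  qed
  have "closed (?K \<inter> j -` {..M})"
    by (intro continuous_closed_preimage continuous_on_subset[OF j_cont KV] compact_imp_closed[OF K] closed_atMost)
  then have "compact (?K \<inter> (?K \<inter> j -` {..M}))" by (rule compact_Int_closed[OF K])
  moreover have "?K \<inter> (?K \<inter> j -` {..M}) = {c \<in> V. j c \<le> M}"
    using KV R by (force simp: V_def intro: order_trans[OF _ abs_ge_self])
  ultimately show ?thesis by simp
qed

lemma continuous_on_line: "continuous_on S (\<lambda>s. (\<lambda>i. c i + s * d i) :: nat \<Rightarrow> real)" for S :: "real set"
  by (intro continuous_on_coordinatewise_then_product continuous_intros)

lemma line_deriv:
  assumes "c \<in> V" "d \<in> V"
  shows "((\<lambda>s. j (\<lambda>i. c i + s * d i)) has_real_derivative (\<Sum>i\<in>I. g (\<lambda>i. c i + s * d i) i * d i)) (at s)"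
proof -
  have e: "(\<lambda>i. (c i + s * d i) + u * d i) = (\<lambda>i. c i + (u + s) * d i)" for u by (simp add: algebra_simps)
  have "((\<lambda>u. j (\<lambda>i. c i + (u + s) * d i)) has_real_derivative (\<Sum>i\<in>I. g (\<lambda>i. c i + s * d i) i * d i)) (at 0)"
    using j_deriv[OF V_lin[OF assms, of s] assms(2)] unfolding e .
  then show ?thesis using DERIV_shift[of "\<lambda>s. j (\<lambda>i. c i + s * d i)" _ 0 s] by simp
qed

lemma critical_of_local_min:
  assumes c: "c \<in> V" and m: "\<And>d. d \<in> V \<Longrightarrow> eventually (\<lambda>s. j c \<le> j (\<lambda>i. c i + s * d i)) (at (0::real))"
    and i: "i \<in> I"
  shows "g c i = 0"
proof -
  \<comment> \<open>The gradient itself as direction makes the directional derivative a sum of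
    squares.\<close>
  define d where "d k = (if k \<in> I then g c k else 0)" for k
  have d: "d \<in> V" by (simp add: V_def d_def)
  from m[OF d] obtain e where e: "e > 0" "\<And>s. s \<noteq> 0 \<Longrightarrow> \<bar>s\<bar> < e \<Longrightarrow> j c \<le> j (\<lambda>i. c i + s * d i)"
    unfolding eventually_at by (auto simp: dist_real_def)
  have "(\<Sum>k\<in>I. g c k * d k) = 0"
  proof (rule DERIV_local_min[OF j_deriv[OF c d] e(1)], intro allI impI)
    fix y :: real assume "\<bar>0 - y\<bar> < e"
    then show "j (\<lambda>i. c i + 0 * d i) \<le> j (\<lambda>i. c i + y * d i)" using e(2)[of y] by (cases "y = 0") auto
  qed
  moreover have "(\<Sum>k\<in>I. g c k * d k) = (\<Sum>k\<in>I. (g c k)\<^sup>2)" by (simp add: d_def power2_eq_square)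
  ultimately show ?thesis using i finI by (simp add: sum_nonneg_eq_0_iff)
qed

text \<open>A minimiser over the points with j \<le> 0 and f \<le> r cannot lie on f = r, where j is
  positive. Near it f stays below r, and points with j > 0 do not compete, so it is a local minimum
  of j. With -f in place of f the same lemma gives a minimum beyond the barrier.\<close>

lemma minimum_below:
  fixes f :: "(nat \<Rightarrow> real) \<Rightarrow> real"
  assumes f: "continuous_on V f" and bar: "\<And>c. c \<in> V \<Longrightarrow> f c = r \<Longrightarrow> j c > 0"
    and a: "a \<in> V" "f a \<le> r" "j a \<le> 0"
  obtains c where "c \<in> V" "f c \<le> r" "j c \<le> j a" "\<And>i. i \<in> I \<Longrightarrow> g c i = 0"
proof -
  let ?K = "{c \<in> V. j c \<le> 0}"
  have fK: "continuous_on ?K f" by (rule continuous_on_subset[OF f]) auto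
  have "closed (?K \<inter> f -` {..r})"
    by (intro continuous_closed_preimage fK compact_imp_closed[OF compact_sublevel] closed_atMost)
  then have "compact (?K \<inter> (?K \<inter> f -` {..r}))" by (rule compact_Int_closed[OF compact_sublevel])
  moreover have "?K \<inter> (?K \<inter> f -` {..r}) = {c \<in> V. j c \<le> 0 \<and> f c \<le> r}" (is "_ = ?L") by auto
  ultimately have "compact ?L" by simp
  moreover have "a \<in> ?L" using a by simp
  moreover have "continuous_on ?L j" by (rule continuous_on_subset[OF j_cont]) auto
  ultimately obtain c where c: "c \<in> ?L" "\<And>y. y \<in> ?L \<Longrightarrow> j c \<le> j y"
    using continuous_attains_inf[of ?L j] by blast
  have cr: "f c < r" using bar[of c] c(1) by fastforce
  have "eventually (\<lambda>s. j c \<le> j (\<lambda>i. c i + s * d i)) (at (0::real))" if d: "d \<in> V" for d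
  proof -
    have "continuous_on UNIV (\<lambda>s. f (\<lambda>i. c i + s * d i))"
      by (rule continuous_on_compose2[OF f continuous_on_line]) (use V_lin c d in auto)
    then have "((\<lambda>s. f (\<lambda>i. c i + s * d i)) \<longlongrightarrow> f (\<lambda>i. c i + 0 * d i)) (at 0)"
      unfolding continuous_on_def by (drule_tac x=0 in bspec) auto
    then have "eventually (\<lambda>s. f (\<lambda>i. c i + s * d i) < r) (at 0)" using cr by (intro order_tendstoD(2)) auto
    then show ?thesis
    proof eventually_elim
      case (elim s)
      have "(\<lambda>i. c i + s * d i) \<in> V" using V_lin c d by auto
      then show ?case using c elim by (cases "j (\<lambda>i. c i + s * d i) \<le> 0") auto
    qed
  qed
  then have "g c i = 0" if "i \<in> I" for i using critical_of_local_min[of c i] c(1) that by blast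
  then show thesis using that[of c] c \<open>a \<in> ?L\<close> by blast
qed

text \<open>The minimax level m is encoded as the infimum of the M for which the sublevel set of M
  joins 0 to v by a path. The intermediate value theorem for f forces every such path across the
  barrier, so m \<ge> \<rho>. If m were not a critical value, a nearly optimal path could be
  deformed to lie below m.\<close>

lemma mountain_pass:
  fixes f :: "(nat \<Rightarrow> real) \<Rightarrow> real"
  assumes f: "continuous_on V f" and r: "f (\<lambda>_. 0) < r" "f v > r" and v: "v \<in> V"
    and bar: "\<And>c. c \<in> V \<Longrightarrow> f c = r \<Longrightarrow> j c \<ge> \<rho>" and \<rho>: "\<rho> > 0"
    and j0: "j (\<lambda>_. 0) \<le> 0" "j v \<le> 0" and M: "\<And>t. t \<in> {0..1} \<Longrightarrow> j (\<lambda>i. t * v i) \<le> M"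
  obtains c where "c \<in> V" "j c \<ge> \<rho>" "j c \<le> M" "\<And>i. i \<in> I \<Longrightarrow> g c i = 0"
proof -
  let ?S = "\<lambda>M. {c \<in> V. j c \<le> M}"
  have zV: "(\<lambda>_. 0) \<in> V" by (simp add: V_def)
  define P where "P M \<longleftrightarrow> path_component (?S M) (\<lambda>_. 0) v" for M
  have seg: "path_component (?S M) a (\<lambda>i. a i + d i)"
    if "a \<in> V" "d \<in> V" "\<And>t. t \<in> {0..1} \<Longrightarrow> j (\<lambda>i. a i + t * d i) \<le> M" for a d M
    unfolding path_component_def
  proof (intro exI conjI)
    show "path (\<lambda>t. (\<lambda>i. a i + t * d i))" unfolding path_def by (rule continuous_on_line)
    show "path_image (\<lambda>t. (\<lambda>i. a i + t * d i)) \<subseteq> ?S M"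
      unfolding path_image_def using that V_lin by auto
  qed (auto simp: pathstart_def pathfinish_def)
  have PM: "P M" unfolding P_def using seg[OF zV v, of M] M by simp
  have Plow: "M' \<ge> \<rho>" if "P M'" for M'
  proof -
    obtain \<gamma> where \<gamma>: "path \<gamma>" "path_image \<gamma> \<subseteq> ?S M'" "pathstart \<gamma> = (\<lambda>_. 0)" "pathfinish \<gamma> = v"
      using \<open>P M'\<close> unfolding P_def path_component_def by blast
    have \<gamma>V: "\<gamma> ` {0..1} \<subseteq> ?S M'" using \<gamma>(2) by (simp add: path_image_def)
    have "continuous_on {0..1} (\<lambda>t. f (\<gamma> t))"
      by (rule continuous_on_compose2[OF f]) (use \<gamma> \<gamma>V in \<open>auto simp: path_def\<close>)
    then obtain t where "t \<in> {0..1}" "f (\<gamma> t) = r"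
      using IVT'[of "\<lambda>t. f (\<gamma> t)" 0 r 1] r \<gamma>(3,4) by (auto simp: pathstart_def pathfinish_def less_imp_le)
    then show ?thesis using bar[of "\<gamma> t"] \<gamma>V by fastforce
  qed
  define m where "m = Inf {M. P M}"
  have bdd: "bdd_below {M. P M}" using Plow by (auto simp: bdd_below_def)
  have m: "m \<ge> \<rho>" "m \<le> M" unfolding m_def using PM Plow bdd by (auto intro!: cInf_greatest cInf_lower)
  have mle: "m \<le> M'" if "P M'" for M' unfolding m_def using that bdd by (auto intro!: cInf_lower)
  have "\<exists>c\<in>V. j c = m \<and> (\<forall>i\<in>I. g c i = 0)"
  proof (rule ccontr)
    assume "\<not> ?thesis"
    then have nc: "\<exists>i\<in>I. g c i \<noteq> 0" if "c \<in> V" "j c = m" for c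
      using that by blast
    define G where "G c = (\<Sum>i\<in>I. (g c i)\<^sup>2)" for c
    let ?K = "?S (m + 1)"
    have K: "compact ?K" by (rule compact_sublevel)
    have cG: "continuous_on ?K G" unfolding G_def
      by (intro continuous_intros continuous_on_subset[OF g_cont]) auto
    have cj: "continuous_on ?K j" by (rule continuous_on_subset[OF j_cont]) auto
    have "?K \<noteq> {}" using zV j0 m \<rho> by (intro ex_in_conv[THEN iffD1] exI[of _ "\<lambda>_. 0"]) auto
    \<comment> \<open>This maximum vanishes only at critical points of level m. Without them it has
      a positive minimum \<sigma> on the compact set, which bounds the squared gradient below on a
      whole band of levels.\<close>
    moreover have "continuous_on ?K (\<lambda>c. max \<bar>j c - m\<bar> (G c))"
      by (intro continuous_intros cG cj)
    ultimately obtain c0 where c0: "c0 \<in> ?K" "\<And>c. c \<in> ?K \<Longrightarrow> max \<bar>j c0 - m\<bar> (G c0) \<le> max \<bar>j c - m\<bar> (G c)"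
      using continuous_attains_inf[OF K] by blast
    define \<sigma> where "\<sigma> = max \<bar>j c0 - m\<bar> (G c0)"
    have \<sigma>: "\<sigma> > 0"
    proof (cases "j c0 = m")
      case True
      then obtain i where "i \<in> I" "g c0 i \<noteq> 0" using nc c0(1) by blast
      then have "G c0 > 0" unfolding G_def using finI by (intro sum_pos2[of _ i]) auto
      then show ?thesis by (simp add: \<sigma>_def)
    qed (auto simp: \<sigma>_def)
    have alt: "G c \<ge> \<sigma>" if "c \<in> V" "j c \<le> m + 1" "\<bar>j c - m\<bar> < \<sigma>" for c
      using c0(2)[of c] that unfolding \<sigma>_def by auto
    \<comment> \<open>On the compact sublevel set one Euler step of gradient descent, with a uniform step size, already
      lowers a path that is nearly optimal; no flow is needed.\<close>
    define \<eta> where "\<eta> s c = (\<lambda>i. c i + s * (if i \<in> I then - g c i else 0))" for s c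
    have dV: "(\<lambda>i. if i \<in> I then - g c i else 0) \<in> V" for c by (simp add: V_def)
    have \<eta>V: "\<eta> s c \<in> V" if "c \<in> V" for s c unfolding \<eta>_def using V_lin[OF that dV] .
    have \<eta>c: "continuous_on (?K \<times> UNIV) (\<lambda>(c, s). \<eta> s c)"
      unfolding \<eta>_def case_prod_unfold
    proof (rule continuous_on_coordinatewise_then_product)
      fix i
      have "continuous_on (?K \<times> UNIV) (\<lambda>x. fst x i)"
        by (rule continuous_on_product_then_coordinatewise[OF continuous_on_fst[OF continuous_on_id]])
      moreover have "continuous_on (?K \<times> (UNIV :: real set)) (\<lambda>x. g (fst x) i)" if "i \<in> I"
        by (rule continuous_on_compose2[OF g_cont[OF that] continuous_on_fst[OF continuous_on_id]]) auto
      ultimately show "continuous_on (?K \<times> UNIV) (\<lambda>x. fst x i + snd x * (if i \<in> I then - g (fst x) i else 0))"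
        by (cases "i \<in> I") (auto intro!: continuous_intros)
    qed
    \<comment> \<open>The negative derivative of j along the descent line; at s = 0 it is the
      squared gradient G. Uniform continuity yields one step size for all c.\<close>
    define W where "W c s = (\<Sum>i\<in>I. g (\<eta> s c) i * g c i)" for c s
    have "continuous_on (?K \<times> {0..1}) (\<lambda>(c, s). W c s)"
      unfolding W_def case_prod_unfold
    proof (intro continuous_on_sum continuous_on_mult)
      fix i assume i: "i \<in> I"
      show "continuous_on (?K \<times> {0..1}) (\<lambda>x. g (\<eta> (snd x) (fst x)) i)"
        by (rule continuous_on_compose2[OF g_cont[OF i] continuous_on_subset[OF \<eta>c[unfolded case_prod_unfold]]]) (use \<eta>V in auto)
      show "continuous_on (?K \<times> {0..1::real}) (\<lambda>x. g (fst x) i)"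
        by (rule continuous_on_compose2[OF g_cont[OF i] continuous_on_fst[OF continuous_on_id]]) auto
    qed
    then have "uniformly_continuous_on (?K \<times> {0..1}) (\<lambda>(c, s). W c s)"
      by (intro compact_uniformly_continuous compact_Times K compact_Icc)
    then have "\<exists>\<tau>>0. \<forall>x\<in>?K \<times> {0..1}. \<forall>y\<in>?K \<times> {0..1}. dist y x < \<tau> \<longrightarrow>
        dist (case y of (c, s) \<Rightarrow> W c s) (case x of (c, s) \<Rightarrow> W c s) < \<sigma> / 2"
      unfolding uniformly_continuous_on_def by (erule_tac x="\<sigma> / 2" in allE) (use \<sigma> in simp)
    then obtain \<tau> where \<tau>: "\<tau> > 0" "\<And>x y. x \<in> ?K \<times> {0..1} \<Longrightarrow> y \<in> ?K \<times> {0..1} \<Longrightarrow> dist y x < \<tau> \<Longrightarrow>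
        dist (case y of (c, s) \<Rightarrow> W c s) (case x of (c, s) \<Rightarrow> W c s) < \<sigma> / 2"
      by blast
    have W0: "W c 0 = G c" for c by (auto simp: W_def G_def \<eta>_def power2_eq_square)
    have Wn: "W c s \<ge> G c - \<sigma> / 2" if "c \<in> ?K" "0 \<le> s" "s \<le> 1" "s < \<tau>" for c s
    proof -
      have "dist (c, s) (c, 0) < \<tau>" using that by (simp add: dist_Pair_Pair)
      then have "\<bar>W c s - G c\<bar> < \<sigma> / 2" using \<tau>(2)[of "(c, 0)" "(c, s)"] that by (simp add: W0 dist_real_def)
      then show ?thesis by linarith
    qed
    have decr: "j (\<eta> s c) \<le> j c - s * (G c - \<sigma> / 2)" if c: "c \<in> ?K" "0 \<le> s" "s \<le> 1" "s < \<tau>" for c s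
    proof (cases "s = 0")
      case False
      let ?d = "\<lambda>i. if i \<in> I then - g c i else 0"
      have "\<exists>z>0. z < s \<and> j (\<eta> s c) - j (\<eta> 0 c) = (s - 0) * (\<Sum>i\<in>I. g (\<eta> z c) i * ?d i)"
        unfolding \<eta>_def by (rule MVT2) (use False c line_deriv[OF _ dV] in auto)
      then obtain z where z: "z > 0" "z < s" "j (\<eta> s c) - j (\<eta> 0 c) = s * (\<Sum>i\<in>I. g (\<eta> z c) i * ?d i)" by auto
      have "(\<Sum>i\<in>I. g (\<eta> z c) i * ?d i) = - W c z" by (simp add: W_def sum_negf)
      moreover have "\<eta> 0 c = c" by (auto simp: \<eta>_def)
      ultimately have "j (\<eta> s c) = j c - s * W c z" using z(3) by simp
      moreover have "s * (G c - \<sigma> / 2) \<le> s * W c z" using Wn[of c z] z c by (intro mult_left_mono) auto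
      ultimately show ?thesis by linarith
    qed (simp add: \<eta>_def)
    \<comment> \<open>The first two bounds keep s inside the range of the uniform estimate. The last
      one gives s\<sigma> \<le> m/2, so that endpoints, where j \<le> 0, cannot be lifted to the
      level m.\<close>
    define s where "s = min (min (1 / 2) (\<tau> / 2)) (m / (2 * \<sigma>))"
    have mpos: "m > 0" using m \<rho> by simp
    have s: "0 < s" "s < 1" "s < \<tau>" "s * \<sigma> \<le> m / 2"
      using \<tau>(1) \<sigma> mpos mult_right_mono[of s "m / (2 * \<sigma>)" \<sigma>] by (auto simp: s_def)
    \<comment> \<open>Near the level m one step lowers j by at least s\<sigma>/2 = 2\<kappa>, so
      points below m + \<kappa> end up below m - \<kappa>.\<close>
    define \<kappa> where "\<kappa> = s * \<sigma> / 4"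
    have \<kappa>: "\<kappa> > 0" using s \<sigma> by (simp add: \<kappa>_def)
    have ks: "4 * \<kappa> = s * \<sigma>" "s * \<sigma> \<le> \<sigma>" using s \<sigma> mult_right_mono[of s 1 \<sigma>] by (auto simp: \<kappa>_def)
    obtain M' where M': "P M'" "M' < m + min \<kappa> 1"
      using cInf_lessD[of "{M. P M}" "m + min \<kappa> 1"] PM \<kappa> unfolding m_def by auto
    have Gnn: "G c \<ge> 0" for c by (simp add: G_def sum_nonneg)
    have new: "j (\<eta> s c) \<le> m - \<kappa>" if c: "c \<in> V" "j c \<le> M'" for c
    proof -
      have cK: "c \<in> ?K" using c M' by auto
      show ?thesis
      proof (cases "j c \<le> m - \<sigma>")
        case True
        \<comment> \<open>Here the gradient may be small, and the step may raise j, but by at most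
          s\<sigma>/2; the distance \<sigma> to the level m absorbs this.\<close>
        have "- s * (G c - \<sigma> / 2) \<le> s * \<sigma> / 2" using mult_nonneg_nonneg[OF less_imp_le[OF s(1)] Gnn[of c]] by (simp add: algebra_simps)
        then show ?thesis using decr[OF cK, of s] s True ks \<kappa> by auto
      next
        case False
        have "\<bar>j c - m\<bar> < \<sigma>" using False c M' ks \<kappa> by auto
        then have "G c \<ge> \<sigma>" using alt cK by blast
        then have "s * (G c - \<sigma> / 2) \<ge> s * (\<sigma> / 2)" using s by (intro mult_left_mono) auto
        moreover have "s * (\<sigma> / 2) = 2 * \<kappa>" by (simp add: \<kappa>_def)
        moreover have "j (\<eta> s c) \<le> j c - s * (G c - \<sigma> / 2)" using decr[OF cK, of s] s by auto
        moreover have "j c < m + \<kappa>" using c M' by auto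
        ultimately show ?thesis by linarith
      qed
    qed
    \<comment> \<open>The deformation moves the endpoints; the segments along which they travel
      reconnect the new path to 0 and v at a low level.\<close>
    have endp: "path_component (?S (m - \<kappa>)) c (\<eta> s c)" if c: "c \<in> V" "j c \<le> 0" for c
      unfolding \<eta>_def
    proof (rule seg[OF c(1)])
      show "(\<lambda>i. s * (if i \<in> I then - g c i else 0)) \<in> V" by (simp add: V_def)
      fix t :: real assume t: "t \<in> {0..1}"
      have ts: "0 \<le> t * s" "t * s \<le> s" using t s by (auto simp: mult_left_le_one_le)
      have cK: "c \<in> ?K" using c mpos by auto
      have ts': "t * s \<le> 1" "t * s < \<tau>" using ts s by linarith+
      have "j (\<eta> (t * s) c) \<le> j c - t * s * (G c - \<sigma> / 2)" by (rule decr[OF cK ts(1) ts'])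
      moreover have "- (t * s * (G c - \<sigma> / 2)) \<le> t * s * \<sigma> / 2" using mult_nonneg_nonneg[OF ts(1) Gnn[of c]] by (simp add: algebra_simps)
      moreover have "t * s * \<sigma> \<le> s * \<sigma>" using ts \<sigma> by (intro mult_right_mono) auto
      ultimately have "j (\<eta> (t * s) c) \<le> m - \<kappa>" using c s ks \<kappa> by linarith
      then show "j (\<lambda>i. c i + t * (s * (if i \<in> I then - g c i else 0))) \<le> m - \<kappa>"
        unfolding \<eta>_def by (simp add: mult.assoc)
    qed
    obtain \<gamma> where \<gamma>: "path \<gamma>" "path_image \<gamma> \<subseteq> ?S M'" "pathstart \<gamma> = (\<lambda>_. 0)" "pathfinish \<gamma> = v"
      using M'(1) unfolding P_def path_component_def by blast
    have \<gamma>K: "path_image \<gamma> \<subseteq> ?K" using \<gamma>(2) M' by auto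
    have "continuous_on (path_image \<gamma>) (\<eta> s)"
    proof -
      have "continuous_on (path_image \<gamma>) (\<lambda>c. case (c, s) of (c, s) \<Rightarrow> \<eta> s c)"
        by (rule continuous_on_compose2[OF \<eta>c]) (use \<gamma>K in \<open>auto intro!: continuous_intros\<close>)
      then show ?thesis by simp
    qed
    then have "path (\<eta> s \<circ> \<gamma>)" by (rule path_continuous_image[OF \<gamma>(1)])
    moreover have "path_image (\<eta> s \<circ> \<gamma>) \<subseteq> ?S (m - \<kappa>)"
      using \<gamma>(2) new \<eta>V unfolding path_image_compose by blast
    ultimately have "path_component (?S (m - \<kappa>)) (\<eta> s (\<lambda>_. 0)) (\<eta> s v)"
      unfolding path_component_def using \<gamma>(3,4) by (intro exI[of _ "\<eta> s \<circ> \<gamma>"]) (auto simp: pathstart_compose pathfinish_compose)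
    then have "P (m - \<kappa>)"
      unfolding P_def using endp[OF zV j0(1)] endp[OF v j0(2)] by (meson path_component_sym path_component_trans)
    then show False using mle \<kappa> by fastforce
  qed
  then show thesis using that m by blast
qed

end

section \<open>The energy functional\<close>

lemma linear_le_powr:
  fixes p \<alpha> \<eta> :: real
  assumes p: "p > 1" and "\<alpha> \<ge> 0" "\<eta> > 0"
  obtains C where "C \<ge> 0" "\<And>t. t \<ge> 0 \<Longrightarrow> \<alpha> * t \<le> \<eta> * t powr p + C"
proof
  \<comment> \<open>Beyond T the power wins, since \<alpha> \<le> \<eta> t^(p-1); up to T the linear
    term is at most \<alpha>T.\<close>
  define T where "T = (\<alpha> / \<eta>) powr (1 / (p - 1))"
  show "\<alpha> * T \<ge> 0" using assms by (simp add: T_def)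
  fix t :: real assume t: "t \<ge> 0"
  show "\<alpha> * t \<le> \<eta> * t powr p + \<alpha> * T"
  proof (cases "t \<le> T")
    case True
    then have "\<alpha> * t \<le> \<alpha> * T" using assms by (intro mult_left_mono) auto
    moreover have "\<eta> * t powr p \<ge> 0" using assms by simp
    ultimately show ?thesis by linarith
  next
    case False
    then have "T powr (p - 1) \<le> t powr (p - 1)" using p by (intro powr_mono2) (auto simp: T_def)
    then have "\<alpha> \<le> \<eta> * t powr (p - 1)" using assms by (simp add: T_def powr_powr field_simps)
    then have "\<alpha> * t \<le> \<eta> * t powr (p - 1) * t" using t by (rule mult_right_mono)
    also have "\<dots> = \<eta> * t powr p"
      using powr_add[of t "p - 1" 1] t by (simp add: powr_one mult.assoc)
    moreover have "\<alpha> * T \<ge> 0" using assms by (simp add: T_def)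
    ultimately show ?thesis by linarith
  qed
qed

lemma le_one_add_powr: "t \<ge> 0 \<Longrightarrow> p \<ge> 1 \<Longrightarrow> t \<le> 1 + t powr p" for t p :: real
  using powr_mono[of 1 p t] by (cases "t \<le> 1") (auto simp: add_increasing2)

lemma powr_le_one_add_powr: "t \<ge> 0 \<Longrightarrow> 0 \<le> q \<Longrightarrow> q \<le> p \<Longrightarrow> t powr q \<le> 1 + t powr p" for t p q :: real
proof (cases "t \<le> 1")
  case False
  then show "q \<le> p \<Longrightarrow> t powr q \<le> 1 + t powr p" using powr_mono[of q p t] by linarith
qed (simp add: powr_le1 add_increasing2)

text \<open>Comparison of derivatives at positive points settles t \<ge> 0, and the reflected
  function t \<mapsto> f(-t) reduces the other sign to this case.\<close>

lemma primitive_bound: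
  assumes fc: "continuous_on UNIV f" and s: "s > 1" and b: "\<beta> \<ge> 0" and fb: "\<And>t. \<bar>f t\<bar> \<le> \<alpha> + \<beta> * \<bar>t\<bar> powr (s - 1)"
  shows "\<bar>primitive f t\<bar> \<le> \<alpha> * \<bar>t\<bar> + \<beta> / s * \<bar>t\<bar> powr s"
proof -
  have pos: "\<bar>primitive g t\<bar> \<le> \<alpha> * t + \<beta> / s * t powr s"
    if gc: "continuous_on UNIV g" and gb: "\<And>t. t \<ge> 0 \<Longrightarrow> \<bar>g t\<bar> \<le> \<alpha> + \<beta> * t powr (s - 1)" and t: "t \<ge> 0" for g t
  proof (cases "t = 0")
    case False
    define B where "B t = \<alpha> * t + \<beta> / s * t powr s" for t
    have dB: "(B has_real_derivative \<alpha> + \<beta> * x powr (s - 1)) (at x)" if "x > 0" for x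
      unfolding B_def[abs_def] using that s by (auto intro!: derivative_eq_intros)
    have cB: "continuous_on {0..t} B"
      unfolding B_def[abs_def] using s by (auto intro!: continuous_intros continuous_on_powr')
    have cP: "continuous_on {0..t} (primitive g)"
      by (rule DERIV_continuous_on) (rule has_field_derivative_at_within[OF primitive_has_derivative[OF gc]])
    have "B 0 - primitive g 0 \<le> B t - primitive g t"
    proof (rule DERIV_nonneg_imp_increasing_open[OF t])
      fix x assume x: "0 < x" "x < t"
      show "\<exists>y. ((\<lambda>x. B x - primitive g x) has_real_derivative y) (at x) \<and> 0 \<le> y"
        using DERIV_diff[OF dB[OF x(1)] primitive_has_derivative[OF gc, of x]] gb[of x] x
        by (intro exI[of _ "\<alpha> + \<beta> * x powr (s - 1) - g x"]) auto
    qed (intro continuous_intros cB cP)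
    moreover have "B 0 + primitive g 0 \<le> B t + primitive g t"
    proof (rule DERIV_nonneg_imp_increasing_open[OF t])
      fix x assume x: "0 < x" "x < t"
      show "\<exists>y. ((\<lambda>x. B x + primitive g x) has_real_derivative y) (at x) \<and> 0 \<le> y"
        using DERIV_add[OF dB[OF x(1)] primitive_has_derivative[OF gc, of x]] gb[of x] x
        by (intro exI[of _ "\<alpha> + \<beta> * x powr (s - 1) + g x"]) auto
    qed (intro continuous_intros cB cP)
    moreover have "B 0 = 0" using s by (simp add: B_def)
    ultimately show ?thesis by (simp add: primitive_0 B_def)
  qed (simp add: primitive_0)
  show ?thesis
  proof (cases "t \<ge> 0")
    case True
    then show ?thesis using pos[OF fc _ True] fb by (auto simp: abs_of_nonneg) (metis abs_of_nonneg)
  next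
    case False
    have c: "continuous_on UNIV (\<lambda>t. f (- t))"
      by (intro continuous_on_compose2[OF fc] continuous_intros) auto
    have "primitive (\<lambda>t. f (- t)) (- t) = - primitive f t"
    proof -
      have "((\<lambda>x. primitive (\<lambda>t. f (- t)) x + primitive f (- x)) has_real_derivative 0) (at x)" for x
        by (rule derivative_eq_intros primitive_has_derivative[OF c] DERIV_chain2[OF primitive_has_derivative[OF fc]] refl | simp)+
      then have "primitive (\<lambda>t. f (- t)) (- t) + primitive f (- (- t)) = primitive (\<lambda>t. f (- t)) 0 + primitive f (- 0)"
        by (intro DERIV_isconst_all) auto
      then show ?thesis by (simp add: primitive_0)
    qed
    moreover have "\<bar>primitive (\<lambda>t. f (- t)) (- t)\<bar> \<le> \<alpha> * (- t) + \<beta> / s * (- t) powr s"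
    proof (rule pos[OF c])
      show "\<bar>f (- t)\<bar> \<le> \<alpha> + \<beta> * t powr (s - 1)" if "t \<ge> 0" for t using fb[of "- t"] that by simp
    qed (use False in simp)
    ultimately show ?thesis using False by simp
  qed
qed

text \<open>The limit controls large |t| and continuity the rest. That \<epsilon> may be arbitrarily
  small lets the energy absorb the nonlinearity in \<open>J_coercive\<close>.\<close>

lemma sublinear_growth:
  fixes f :: "real \<Rightarrow> real"
  assumes fc: "continuous_on UNIV f" and lim: "((\<lambda>t. f t / \<bar>t\<bar> powr (p - 1)) \<longlongrightarrow> 0) at_infinity" and e: "\<epsilon> > 0"
  obtains C where "C \<ge> 0" "\<And>t. \<bar>f t\<bar> \<le> C + \<epsilon> * \<bar>t\<bar> powr (p - 1)"
proof -
  have "eventually (\<lambda>t. \<bar>f t / \<bar>t\<bar> powr (p - 1)\<bar> < \<epsilon>) at_infinity"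
    using tendstoD[OF lim e] by (simp add: dist_real_def)
  then obtain b where b: "\<And>t. norm t \<ge> b \<Longrightarrow> \<bar>f t / \<bar>t\<bar> powr (p - 1)\<bar> < \<epsilon>"
    unfolding eventually_at_infinity by blast
  define T where "T = max b 1"
  have "bounded (f ` {- T..T})"
    by (intro compact_imp_bounded compact_continuous_image continuous_on_subset[OF fc]) auto
  then obtain C where C: "\<And>t. t \<in> {- T..T} \<Longrightarrow> \<bar>f t\<bar> \<le> C"
    unfolding bounded_iff real_norm_def by (meson imageI)
  have "0 \<in> {- T..T}" by (simp add: T_def)
  then have "C \<ge> 0" using order_trans[OF abs_ge_zero C] by blast
  moreover have "\<bar>f t\<bar> \<le> C + \<epsilon> * \<bar>t\<bar> powr (p - 1)" for t
  proof (cases "\<bar>t\<bar> \<le> T")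
    case True
    then have "\<bar>f t\<bar> \<le> C" by (intro C) auto
    then show ?thesis using e by (simp add: add_increasing2)
  next
    case False
    then have pos: "\<bar>t\<bar> powr (p - 1) > 0" by (auto simp: T_def)
    have "\<bar>f t\<bar> / \<bar>t\<bar> powr (p - 1) < \<epsilon>" using b[of t] False by (simp add: T_def abs_divide)
    then have "\<bar>f t\<bar> \<le> \<epsilon> * \<bar>t\<bar> powr (p - 1)" using pos by (simp add: field_simps)
    then show ?thesis using \<open>C \<ge> 0\<close> by linarith
  qed
  ultimately show thesis by (rule that)
qed

text \<open>Continuity of h is given over the closure of \<Omega> only. Extended by 0 from this
  closed set, h becomes a Borel function on the product, which is composed with x \<mapsto> (x, U
  x).\<close>

lemma measurable_Caratheodory:
  fixes h :: "'a::euclidean_space \<Rightarrow> 'b::euclidean_space \<Rightarrow> 'c::euclidean_space"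
  assumes h: "continuous_on (closure \<Omega> \<times> UNIV) (\<lambda>(x, \<xi>). h x \<xi>)"
    and U: "U \<in> borel_measurable (lebesgue_on \<Omega>)"
  shows "(\<lambda>x. h x (U x)) \<in> borel_measurable (lebesgue_on \<Omega>)"
proof -
  have "(\<lambda>z. indicator (closure \<Omega> \<times> UNIV) z *\<^sub>R (\<lambda>(x, \<xi>). h x \<xi>) z) \<in> borel_measurable borel"
    by (rule borel_measurable_continuous_on_indicator[OF _ h]) (auto intro!: borel_closed closed_Times)
  moreover have "(\<lambda>x. (x, U x)) \<in> borel_measurable (lebesgue_on \<Omega>)"
    using id_borel_measurable_lebesgue_on[of \<Omega>] by (intro borel_measurable_Pair U) (simp add: id_def)
  ultimately have "(\<lambda>x. indicator (closure \<Omega> \<times> UNIV) (x, U x) *\<^sub>R (\<lambda>(x, \<xi>). h x \<xi>) (x, U x)) \<in> borel_measurable (lebesgue_on \<Omega>)"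
    by (rule measurable_compose_rev)
  then show ?thesis
    by (rule measurable_cong[THEN iffD1, rotated]) (use closure_subset[of \<Omega>] in \<open>auto simp: space_restrict_space indicator_def\<close>)
qed

lemma borel_measurable_norm_powr:
  fixes U :: "'a \<Rightarrow> 'b::euclidean_space"
  assumes [measurable]: "U \<in> borel_measurable N"
  shows "(\<lambda>x. norm (U x) powr s) \<in> borel_measurable N"
  by measurable

text \<open>The parameter lambda of the problem is called \<mu>. The numerical conditions on it
  enter through the barrier and the function v assumed in
  \<open>three_weak_solutions\<close>.\<close>

locale dirichlet_problem =
  fixes \<Omega> :: "'a::euclidean_space set" and p \<mu> \<Lambda>1 \<Lambda>2 :: real
    and k :: "'a \<Rightarrow> real" and A :: "'a \<Rightarrow> 'a \<Rightarrow> real" and a :: "'a \<Rightarrow> 'a \<Rightarrow> 'a" and f :: "real \<Rightarrow> real"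
  assumes open_\<Omega>: "open \<Omega>" and bounded_\<Omega>: "bounded \<Omega>"
    and p: "p > 1" and \<mu>_pos: "\<mu> > 0"
    and k_cont: "continuous_on (closure \<Omega>) k" and k_pos: "\<forall>x\<in>closure \<Omega>. k x > 0"
    and A_cont: "continuous_on (closure \<Omega> \<times> UNIV) (\<lambda>(x, \<xi>). A x \<xi>)"
    and A_grad: "\<forall>x\<in>closure \<Omega>. \<forall>\<xi>. GDERIV (A x) \<xi> :> a x \<xi>"
    and a_cont: "continuous_on (closure \<Omega> \<times> UNIV) (\<lambda>(x, \<xi>). a x \<xi>)"
    and alpha2: "\<exists>c>0. \<forall>x\<in>\<Omega>. \<forall>\<xi>. norm (a x \<xi>) \<le> c * (1 + norm \<xi> powr (p - 1))"
    and alpha3: "\<exists>k0>0. \<forall>x\<in>closure \<Omega>. \<forall>\<xi> \<eta>.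
        A x ((1/2) *\<^sub>R (\<xi> + \<eta>)) \<le> 1/2 * A x \<xi> + 1/2 * A x \<eta> - k0 * norm (\<xi> - \<eta>) powr p"
    and \<Lambda>: "\<Lambda>1 > 0" "\<Lambda>2 > 0"
    and alpha5: "\<forall>x\<in>closure \<Omega>. \<forall>\<xi>. \<Lambda>1 * norm \<xi> powr p \<le> A x \<xi> \<and> A x \<xi> \<le> \<Lambda>2 * norm \<xi> powr p"
    and f_cont: "continuous_on UNIV f"
    and f_sublinear: "((\<lambda>t. f t / \<bar>t\<bar> powr (p - 1)) \<longlongrightarrow> 0) at_infinity"
begin

abbreviation "M \<equiv> lebesgue_on \<Omega>"

text \<open>The functionals take the gradient as a separate argument: a limit of gradients exists
  before it is known to be a weak gradient, and \<open>weak_grad\<close> would bring in a choice.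
  \<open>L\<close> is the derivative of \<open>J\<close>, so weak solutions are the points where it
  vanishes.\<close>

definition Phi :: "('a \<Rightarrow> 'a) \<Rightarrow> real" where
  "Phi U = (LINT x|M. A x (U x))"

definition J :: "('a \<Rightarrow> real) \<Rightarrow> ('a \<Rightarrow> 'a) \<Rightarrow> real" where
  "J u U = (LINT x|M. A x (U x) - \<mu> * (k x * primitive f (u x)))"

definition L :: "('a \<Rightarrow> real) \<Rightarrow> ('a \<Rightarrow> 'a) \<Rightarrow> ('a \<Rightarrow> real) \<Rightarrow> ('a \<Rightarrow> 'a) \<Rightarrow> real" where
  "L u U v V = (LINT x|M. a x (U x) \<bullet> V x - \<mu> * (k x * f (u x) * v x))"

lemma p0: "p > 0" using p by simp

lemma \<Omega>_closure: "x \<in> \<Omega> \<Longrightarrow> x \<in> closure \<Omega>" using closure_subset by blast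

lemma \<Omega>_lebesgue: "\<Omega> \<in> sets lebesgue" using open_\<Omega> by simp

lemma finite_M: "finite_measure M"
  by (intro finite_measure_lebesgue_on bounded_set_imp_lmeasurable bounded_\<Omega> \<Omega>_lebesgue)

lemma space_M: "space M = \<Omega>" by (simp add: space_restrict_space)

lemma integrable_const_M: "integrable M (\<lambda>x. c :: real)"
  using finite_M by (simp add: finite_measure.integrable_const)

lemma AE_M_I: "(\<And>x. x \<in> \<Omega> \<Longrightarrow> P x) \<Longrightarrow> AE x in M. P x"
  by (rule AE_I2) (simp add: space_M)

lemma k_bounded: obtains K where "K > 0" "\<And>x. x \<in> closure \<Omega> \<Longrightarrow> \<bar>k x\<bar> \<le> K"
proof -
  have "bounded (k ` closure \<Omega>)"
    by (intro compact_imp_bounded compact_continuous_image k_cont) (simp add: compact_closure bounded_\<Omega>)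
  then show thesis using that unfolding bounded_pos by auto
qed

text \<open>Sublinearity at infinity gives growth of order p - 1, so all integrals can be handled in
  L^p; the exponent q enters in the barrier estimate \<open>J_lower_bound\<close>.\<close>

lemma f_bounded: obtains C where "C > 0" "\<And>t. \<bar>f t\<bar> \<le> C * (1 + \<bar>t\<bar> powr (p - 1))"
proof -
  obtain C where C: "C \<ge> 0" "\<And>t. \<bar>f t\<bar> \<le> C + 1 * \<bar>t\<bar> powr (p - 1)"
    using sublinear_growth[OF f_cont f_sublinear, of 1] by auto
  have "\<bar>f t\<bar> \<le> (C + 1) * (1 + \<bar>t\<bar> powr (p - 1))" for t
    using C(2)[of t] mult_nonneg_nonneg[OF C(1) powr_ge_zero[of "\<bar>t\<bar>" "p - 1"]] by (simp add: algebra_simps)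
  then show thesis using that[of "C + 1"] C(1) by auto
qed

lemma primitive_le_powr:
  assumes "\<epsilon> > 0"
  obtains C where "C \<ge> 0" "\<And>t. \<bar>primitive f t\<bar> \<le> C + \<epsilon> * \<bar>t\<bar> powr p"
proof -
  obtain C where C: "C \<ge> 0" "\<And>t. \<bar>f t\<bar> \<le> C + \<epsilon> / 2 * \<bar>t\<bar> powr (p - 1)"
    using sublinear_growth[OF f_cont f_sublinear, of "\<epsilon> / 2"] assms by auto
  obtain C' where C': "C' \<ge> 0" "\<And>t. t \<ge> 0 \<Longrightarrow> C * t \<le> \<epsilon> / 2 * t powr p + C'"
    using linear_le_powr[OF p C(1), of "\<epsilon> / 2"] assms by auto
  have "\<bar>primitive f t\<bar> \<le> C' + \<epsilon> * \<bar>t\<bar> powr p" for t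
  proof -
    have "\<bar>primitive f t\<bar> \<le> C * \<bar>t\<bar> + \<epsilon> / 2 / p * \<bar>t\<bar> powr p"
      by (rule primitive_bound[OF f_cont p _ C(2)]) (use assms in auto)
    moreover have "\<epsilon> / 2 / p * \<bar>t\<bar> powr p \<le> \<epsilon> / 2 * \<bar>t\<bar> powr p"
      using p assms by (intro mult_right_mono) (auto simp: field_simps)
    ultimately show ?thesis using C'(2)[of "\<bar>t\<bar>"] by (simp add: field_simps)
  qed
  then show thesis using that C'(1) by blast
qed

lemma primitive_continuous: "continuous_on S (primitive f)"
  by (rule DERIV_continuous_on) (rule has_field_derivative_at_within[OF primitive_has_derivative[OF f_cont]])

lemma k_measurable: "k \<in> borel_measurable M"
proof -
  have "continuous_on (closure \<Omega> \<times> UNIV) (\<lambda>(x, _ :: real). k x)"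
    unfolding case_prod_unfold by (rule continuous_on_compose2[OF k_cont continuous_on_fst[OF continuous_on_id]]) auto
  from measurable_Caratheodory[OF this, of "\<lambda>_. 0"] show ?thesis by simp
qed

lemma J_measurable:
  assumes "u \<in> borel_measurable M" "U \<in> borel_measurable M"
  shows "(\<lambda>x. A x (U x)) \<in> borel_measurable M" "(\<lambda>x. k x * primitive f (u x)) \<in> borel_measurable M"
    "(\<lambda>x. a x (U x)) \<in> borel_measurable M" "(\<lambda>x. k x * f (u x)) \<in> borel_measurable M"
proof -
  show "(\<lambda>x. A x (U x)) \<in> borel_measurable M" "(\<lambda>x. a x (U x)) \<in> borel_measurable M"
    using measurable_Caratheodory[OF A_cont assms(2)] measurable_Caratheodory[OF a_cont assms(2)] by auto
  have "primitive f \<in> borel_measurable borel" "f \<in> borel_measurable borel"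
    by (intro borel_measurable_continuous_onI primitive_continuous f_cont)+
  then have "(\<lambda>x. primitive f (u x)) \<in> borel_measurable M" "(\<lambda>x. f (u x)) \<in> borel_measurable M"
    using measurable_compose[OF assms(1)] by auto
  then show "(\<lambda>x. k x * primitive f (u x)) \<in> borel_measurable M" "(\<lambda>x. k x * f (u x)) \<in> borel_measurable M"
    using k_measurable by (auto intro: borel_measurable_times)
qed

section \<open>Integrability and pairing estimates\<close>

lemma A_integrable:
  assumes U: "in_Lp \<Omega> p U"
  shows "integrable M (\<lambda>x. A x (U x))"
proof (rule Bochner_Integration.integrable_bound)
  show "integrable M (\<lambda>x. \<Lambda>2 * norm (U x) powr p)" using U by (simp add: in_Lp_def)
  show "(\<lambda>x. A x (U x)) \<in> borel_measurable M" using J_measurable(1)[of "\<lambda>_. 0" U] U by (simp add: in_Lp_def)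
  have "\<bar>A x \<xi>\<bar> \<le> \<Lambda>2 * norm \<xi> powr p" if "x \<in> \<Omega>" for x \<xi>
  proof -
    have "\<Lambda>1 * norm \<xi> powr p \<le> A x \<xi>" "A x \<xi> \<le> \<Lambda>2 * norm \<xi> powr p"
      using alpha5 \<Omega>_closure[OF that] by auto
    moreover have "0 \<le> \<Lambda>1 * norm \<xi> powr p" using \<Lambda> by simp
    ultimately show ?thesis by linarith
  qed
  then show "AE x in M. norm (A x (U x)) \<le> norm (\<Lambda>2 * norm (U x) powr p)"
    using \<Lambda> by (intro AE_M_I) auto
qed

lemma kF_integrable:
  assumes u: "in_Lp \<Omega> p u"
  shows "integrable M (\<lambda>x. k x * primitive f (u x))"
proof -
  obtain K where K: "K > 0" "\<And>x. x \<in> closure \<Omega> \<Longrightarrow> \<bar>k x\<bar> \<le> K" using k_bounded by blast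
  obtain C where C: "C \<ge> 0" "\<And>t. \<bar>primitive f t\<bar> \<le> C + 1 * \<bar>t\<bar> powr p" using primitive_le_powr[of 1] by auto
  show ?thesis
  proof (rule Bochner_Integration.integrable_bound)
    show "integrable M (\<lambda>x. K * (C + \<bar>u x\<bar> powr p))" using u integrable_const_M by (simp add: in_Lp_def)
    show "(\<lambda>x. k x * primitive f (u x)) \<in> borel_measurable M" using J_measurable(2)[of u "\<lambda>_. 0"] u by (simp add: in_Lp_def)
    have "\<bar>k x * primitive f t\<bar> \<le> K * (C + \<bar>t\<bar> powr p)" if "x \<in> \<Omega>" for x t
      unfolding abs_mult using K(1) K(2)[OF \<Omega>_closure[OF that]] C(2)[of t] by (intro mult_mono) auto
    then show "AE x in M. norm (k x * primitive f (u x)) \<le> norm (K * (C + \<bar>u x\<bar> powr p))"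
      using K C by (intro AE_M_I) auto
  qed
qed

text \<open>Young's inequality for ts and d/t^(p-1), once with the given s and once with s = 1. A
  small t makes the part without d as small as desired, at the price of a large factor on d.\<close>

lemma Young_pairing:
  fixes s t d :: real
  assumes "s \<ge> 0" "d \<ge> 0" "t > 0"
  shows "(1 + s powr (p - 1)) * d \<le> t powr p * (1 + s powr p) + 2 * ((1 / t powr (p - 1)) powr p * d powr p)"
proof -
  have Y: "s powr (p - 1) * d \<le> t powr p * s powr p + (1 / t powr (p - 1)) powr p * d powr p" if "s \<ge> 0" for s
  proof -
    have "(t * s) powr (p - 1) * (1 / t powr (p - 1) * d) \<le> (t * s) powr p + (1 / t powr (p - 1) * d) powr p"
      using assms that by (intro Young_powr p) auto
    also have "(t * s) powr (p - 1) * (1 / t powr (p - 1) * d) = s powr (p - 1) * d"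
      using assms by (simp add: powr_mult)
    finally show ?thesis by (simp only: powr_mult)
  qed
  from Y[of 1] Y[OF assms(1)] show ?thesis by (simp add: algebra_simps)
qed

lemma pairing_integrable:
  fixes U :: "'a \<Rightarrow> 'b::euclidean_space" and V :: "'a \<Rightarrow> 'c::euclidean_space"
  assumes U: "in_Lp \<Omega> p U" and V: "in_Lp \<Omega> p V"
  shows "integrable M (\<lambda>x. (1 + norm (U x) powr (p - 1)) * norm (V x))"
proof (rule Bochner_Integration.integrable_bound)
  have m: "U \<in> borel_measurable M" "V \<in> borel_measurable M" using U V by (auto simp: in_Lp_def)
  show "(\<lambda>x. (1 + norm (U x) powr (p - 1)) * norm (V x)) \<in> borel_measurable M"
    by (intro borel_measurable_times borel_measurable_add borel_measurable_norm_powr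
      measurable_compose[OF m(2) borel_measurable_norm] borel_measurable_const m)
  show "integrable M (\<lambda>x. 1 powr p * (1 + norm (U x) powr p) + 2 * ((1 / 1 powr (p - 1)) powr p * norm (V x) powr p))"
    using U V integrable_const_M by (simp add: in_Lp_def)
  show "AE x in M. norm ((1 + norm (U x) powr (p - 1)) * norm (V x)) \<le> norm (1 powr p * (1 + norm (U x) powr p) + 2 * ((1 / 1 powr (p - 1)) powr p * norm (V x) powr p))"
  proof (rule AE_I2)
    fix x
    have nn: "0 \<le> (1 + norm (U x) powr (p - 1)) * norm (V x)" by simp
    have le: "(1 + norm (U x) powr (p - 1)) * norm (V x) \<le> 1 powr p * (1 + norm (U x) powr p) + 2 * ((1 / 1 powr (p - 1)) powr p * norm (V x) powr p)"
      by (rule Young_pairing) auto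
    show "norm ((1 + norm (U x) powr (p - 1)) * norm (V x)) \<le> norm (1 powr p * (1 + norm (U x) powr p) + 2 * ((1 / 1 powr (p - 1)) powr p * norm (V x) powr p))"
      unfolding real_norm_def abs_of_nonneg[OF nn] by (rule order_trans[OF le abs_ge_self])
  qed
qed

text \<open>A substitute for Hoelder's inequality: t is chosen so that the part with U costs at most
  \<epsilon>/2, and \<eta> so that the part with V costs less than \<epsilon>/2.\<close>

lemma pairing_small:
  assumes "\<epsilon> > 0"
  obtains \<eta> where "\<eta> > 0" "\<And>(U :: 'a \<Rightarrow> 'b::euclidean_space) (V :: 'a \<Rightarrow> 'c::euclidean_space).
    in_Lp \<Omega> p U \<Longrightarrow> in_Lp \<Omega> p V \<Longrightarrow> (LINT x|M. norm (U x) powr p) \<le> C \<Longrightarrow> (LINT x|M. norm (V x) powr p) < \<eta> \<Longrightarrow>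
    (LINT x|M. (1 + norm (U x) powr (p - 1)) * norm (V x)) < \<epsilon>"
proof -
  define D where "D = measure lebesgue \<Omega> + \<bar>C\<bar> + 1"
  have D: "D > 0" by (simp add: D_def add_nonneg_pos)
  define t where "t = (\<epsilon> / (2 * D)) powr (1 / p)"
  have t: "t > 0" "t powr p = \<epsilon> / (2 * D)" using assms D p0 by (auto simp: t_def powr_powr)
  define B where "B = (1 / t powr (p - 1)) powr p"
  have B: "B > 0" using t by (simp add: B_def)
  show thesis
  proof (rule that[of "\<epsilon> / (4 * B)"])
    show "\<epsilon> / (4 * B) > 0" using assms B by simp
    fix U :: "'a \<Rightarrow> 'b" and V :: "'a \<Rightarrow> 'c"
    assume U: "in_Lp \<Omega> p U" and V: "in_Lp \<Omega> p V" and UC: "(LINT x|M. norm (U x) powr p) \<le> C"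
      and V\<eta>: "(LINT x|M. norm (V x) powr p) < \<epsilon> / (4 * B)"
    have i: "integrable M (\<lambda>x. norm (U x) powr p)" "integrable M (\<lambda>x. norm (V x) powr p)" using U V by (auto simp: in_Lp_def)
    have m: "measure M \<Omega> = measure lebesgue \<Omega>" using \<Omega>_lebesgue by (simp add: measure_restrict_space)
    have "(LINT x|M. (1 + norm (U x) powr (p - 1)) * norm (V x)) \<le> (LINT x|M. t powr p * (1 + norm (U x) powr p) + 2 * (B * norm (V x) powr p))"
      using i integrable_const_M by (intro integral_mono pairing_integrable[OF U V]) (auto simp: B_def intro!: Young_pairing t)
    also have "\<dots> = t powr p * (measure lebesgue \<Omega> + (LINT x|M. norm (U x) powr p)) + 2 * (B * (LINT x|M. norm (V x) powr p))"
      using i integrable_const_M by (simp add: m space_M)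
    also have "\<dots> < t powr p * D + 2 * (B * (\<epsilon> / (4 * B)))"
      using UC V\<eta> B by (intro add_le_less_mono mult_left_mono mult_strict_left_mono) (auto simp: D_def)
    also have "\<dots> = \<epsilon>" using t D B by (simp add: field_simps)
    finally show "(LINT x|M. (1 + norm (U x) powr (p - 1)) * norm (V x)) < \<epsilon>" .
  qed
qed

text \<open>The flux and the reaction term obey growth bounds of the same shape, so the pairing
  estimates serve both, with one constant.\<close>

lemma a_pairing_bound:
  obtains c where "c > 0"
    "\<And>x \<xi> \<eta>. x \<in> \<Omega> \<Longrightarrow> \<bar>a x \<xi> \<bullet> \<eta>\<bar> \<le> c * ((1 + norm \<xi> powr (p - 1)) * norm \<eta>)"
    "\<And>x t d. x \<in> \<Omega> \<Longrightarrow> \<bar>k x * f t * d\<bar> \<le> c * ((1 + \<bar>t\<bar> powr (p - 1)) * \<bar>d\<bar>)"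
proof -
  obtain c where c: "c > 0" "\<And>x \<xi>. x \<in> \<Omega> \<Longrightarrow> norm (a x \<xi>) \<le> c * (1 + norm \<xi> powr (p - 1))" using alpha2 by blast
  obtain K where K: "K > 0" "\<And>x. x \<in> closure \<Omega> \<Longrightarrow> \<bar>k x\<bar> \<le> K" using k_bounded by blast
  obtain C where C: "C > 0" "\<And>t. \<bar>f t\<bar> \<le> C * (1 + \<bar>t\<bar> powr (p - 1))" using f_bounded by blast
  show thesis
  proof (rule that[of "c + K * C"])
    show "c + K * C > 0" using c K C by (simp add: add_pos_pos)
    fix x \<xi> \<eta> assume x: "x \<in> \<Omega>"
    have "\<bar>a x \<xi> \<bullet> \<eta>\<bar> \<le> norm (a x \<xi>) * norm \<eta>" by (rule Cauchy_Schwarz_ineq2)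
    also have "\<dots> \<le> c * (1 + norm \<xi> powr (p - 1)) * norm \<eta>" by (intro mult_right_mono c x) auto
    also have "\<dots> \<le> (c + K * C) * ((1 + norm \<xi> powr (p - 1)) * norm \<eta>)"
      unfolding mult.assoc[of c] using K C by (intro mult_right_mono) auto
    finally show "\<bar>a x \<xi> \<bullet> \<eta>\<bar> \<le> (c + K * C) * ((1 + norm \<xi> powr (p - 1)) * norm \<eta>)" .
  next
    fix x t d assume x: "x \<in> \<Omega>"
    have "\<bar>k x * f t * d\<bar> \<le> K * (C * (1 + \<bar>t\<bar> powr (p - 1))) * \<bar>d\<bar>"
      unfolding abs_mult using K C \<Omega>_closure[OF x] by (intro mult_mono) auto
    also have "\<dots> \<le> (c + K * C) * ((1 + \<bar>t\<bar> powr (p - 1)) * \<bar>d\<bar>)"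
      unfolding mult.assoc[symmetric] using c by (intro mult_right_mono) auto
    finally show "\<bar>k x * f t * d\<bar> \<le> (c + K * C) * ((1 + \<bar>t\<bar> powr (p - 1)) * \<bar>d\<bar>)" .
  qed
qed

lemma L_integrable:
  fixes u v :: "'a \<Rightarrow> real" and U V :: "'a \<Rightarrow> 'a"
  assumes u: "in_Lp \<Omega> p u" and U: "in_Lp \<Omega> p U" and v: "in_Lp \<Omega> p v" and V: "in_Lp \<Omega> p V"
  shows "integrable M (\<lambda>x. a x (U x) \<bullet> V x)" "integrable M (\<lambda>x. k x * f (u x) * v x)"
proof -
  have m: "u \<in> borel_measurable M" "U \<in> borel_measurable M" "v \<in> borel_measurable M" "V \<in> borel_measurable M"
    using assms by (auto simp: in_Lp_def)
  obtain c where c: "c > 0"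
    "\<And>x \<xi> \<eta>. x \<in> \<Omega> \<Longrightarrow> \<bar>a x \<xi> \<bullet> \<eta>\<bar> \<le> c * ((1 + norm \<xi> powr (p - 1)) * norm \<eta>)"
    "\<And>x t d. x \<in> \<Omega> \<Longrightarrow> \<bar>k x * f t * d\<bar> \<le> c * ((1 + \<bar>t\<bar> powr (p - 1)) * \<bar>d\<bar>)"
    using a_pairing_bound by blast
  show "integrable M (\<lambda>x. a x (U x) \<bullet> V x)"
  proof (rule Bochner_Integration.integrable_bound[OF integrable_mult_right[OF pairing_integrable[OF U V], of c]])
    show "(\<lambda>x. a x (U x) \<bullet> V x) \<in> borel_measurable M"
      by (intro borel_measurable_inner J_measurable(3)[OF m(1,2)] m)
    show "AE x in M. norm (a x (U x) \<bullet> V x) \<le> norm (c * ((1 + norm (U x) powr (p - 1)) * norm (V x)))"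
      using c by (intro AE_M_I) (auto intro!: order_trans[OF c(2)])
  qed
  show "integrable M (\<lambda>x. k x * f (u x) * v x)"
  proof (rule Bochner_Integration.integrable_bound[OF integrable_mult_right[OF pairing_integrable[OF u v], of c]])
    show "(\<lambda>x. k x * f (u x) * v x) \<in> borel_measurable M"
      by (intro borel_measurable_times J_measurable(4)[OF m(1,2)] m)
    show "AE x in M. norm (k x * f (u x) * v x) \<le> norm (c * ((1 + norm (u x) powr (p - 1)) * norm (v x)))"
      using c by (intro AE_M_I) (auto intro!: order_trans[OF c(3)])
  qed
qed

end

lemma borel_measurable_lebesgue_onI: "g \<in> borel_measurable borel \<Longrightarrow> g \<in> borel_measurable (lebesgue_on S)"
  by (intro measurable_restrict_space1) (simp add: measurable_completion)

lemma has_weak_gradient_diff: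
  assumes \<Omega>: "open \<Omega>" and u: "has_weak_gradient \<Omega> u U" and v: "has_weak_gradient \<Omega> v V"
  shows "has_weak_gradient \<Omega> (\<lambda>x. u x - v x) (\<lambda>x. U x - V x)"
proof -
  have l: "locally_integrable \<Omega> u" "locally_integrable \<Omega> U" "locally_integrable \<Omega> v" "locally_integrable \<Omega> V"
    using u v by (auto simp: has_weak_gradient_def)
  show ?thesis
    unfolding has_weak_gradient_def
  proof (intro conjI ballI)
    show "locally_integrable \<Omega> (\<lambda>x. u x - v x)" "locally_integrable \<Omega> (\<lambda>x. U x - V x)"
      using l by (auto simp: locally_integrable_def)
    fix \<phi> b assume \<phi>: "\<phi> \<in> test_functions \<Omega>" and b: "(b :: 'a) \<in> Basis"
    have 1: "integrable (lebesgue_on \<Omega>) (\<lambda>x. u x * frechet_derivative \<phi> (at x) b)"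
      "integrable (lebesgue_on \<Omega>) (\<lambda>x. v x * frechet_derivative \<phi> (at x) b)"
      using integrable_test_function_mult[OF l(1) \<Omega> test_functions_partial_derivative[OF \<phi> b]]
        integrable_test_function_mult[OF l(3) \<Omega> test_functions_partial_derivative[OF \<phi> b]] by (simp_all add: mult.commute)
    have 2: "integrable (lebesgue_on \<Omega>) (\<lambda>x. (U x \<bullet> b) * \<phi> x)" "integrable (lebesgue_on \<Omega>) (\<lambda>x. (V x \<bullet> b) * \<phi> x)"
      using integrable_inner_left[OF integrable_test_function_mult[OF l(2) \<Omega> \<phi>], of b]
        integrable_inner_left[OF integrable_test_function_mult[OF l(4) \<Omega> \<phi>], of b] by (simp_all add: mult.commute)
    show "(LINT x|lebesgue_on \<Omega>. (u x - v x) * frechet_derivative \<phi> (at x) b) = - (LINT x|lebesgue_on \<Omega>. ((U x - V x) \<bullet> b) * \<phi> x)"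
      using u v \<phi> b 1 2 by (simp add: has_weak_gradient_def left_diff_distrib inner_diff_left)
  qed
qed

lemma in_Lp_diff:
  assumes "p > 0" "in_Lp \<Omega> p f" "in_Lp \<Omega> p g"
  shows "in_Lp \<Omega> p (\<lambda>x. f x - g x)"
  using assms integrable_norm_diff_powr[of f "lebesgue_on \<Omega>" g p] by (auto simp: in_Lp_def)

context dirichlet_problem
begin

abbreviation "T \<equiv> test_functions \<Omega>"

lemma in_Lp_test: "\<phi> \<in> T \<Longrightarrow> in_Lp \<Omega> p \<phi>" "\<phi> \<in> T \<Longrightarrow> in_Lp \<Omega> p (grad \<phi>)"
proof -
  assume \<phi>: "\<phi> \<in> T"
  note sm = test_functions_smooth[OF \<phi>]
  have m: "\<phi> \<in> borel_measurable borel" "grad \<phi> \<in> borel_measurable borel"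
    by (intro borel_measurable_continuous_onI smooth_continuous_on grad_continuous_on sm)+
  have "integrable M (\<lambda>x. norm (\<phi> x) powr p)"
    using integral_lebesgue_on_eq_lborel(2)[OF borel_measurable_norm_powr[OF m(1)] _ \<Omega>_lebesgue, of p] p
      test_functions_integrable_powr(1)[OF \<phi> p0] test_functions_outside[OF \<phi>] by simp
  moreover have "integrable M (\<lambda>x. norm (grad \<phi> x) powr p)"
    using integral_lebesgue_on_eq_lborel(2)[OF borel_measurable_norm_powr[OF m(2)] _ \<Omega>_lebesgue, of p] p
      test_functions_integrable_powr(2)[OF \<phi> p0] test_functions_outside[OF \<phi>] by simp
  ultimately show "in_Lp \<Omega> p \<phi>" "in_Lp \<Omega> p (grad \<phi>)"
    using m borel_measurable_lebesgue_onI by (auto simp: in_Lp_def)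
qed

lemma LINT_test:
  assumes \<phi>: "\<phi> \<in> T" and s: "s > 0"
  shows "(LINT x|M. \<bar>\<phi> x\<bar> powr s) = (LINT x|lborel. \<bar>\<phi> x\<bar> powr s)"
    "(LINT x|M. norm (grad \<phi> x) powr s) = (LINT x|lborel. norm (grad \<phi> x) powr s)"
proof -
  note sm = test_functions_smooth[OF \<phi>]
  have m: "\<phi> \<in> borel_measurable borel" "grad \<phi> \<in> borel_measurable borel"
    by (intro borel_measurable_continuous_onI smooth_continuous_on grad_continuous_on sm)+
  show "(LINT x|M. \<bar>\<phi> x\<bar> powr s) = (LINT x|lborel. \<bar>\<phi> x\<bar> powr s)"
    using integral_lebesgue_on_eq_lborel(1)[OF borel_measurable_norm_powr[OF m(1)] _ \<Omega>_lebesgue, of s] s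
      test_functions_outside[OF \<phi>] by simp
  show "(LINT x|M. norm (grad \<phi> x) powr s) = (LINT x|lborel. norm (grad \<phi> x) powr s)"
    using integral_lebesgue_on_eq_lborel(1)[OF borel_measurable_norm_powr[OF m(2)] _ \<Omega>_lebesgue, of s] s
      test_functions_outside[OF \<phi>] by simp
qed

section \<open>Convexity and coercivity\<close>

lemma A_deriv:
  assumes "x \<in> closure \<Omega>"
  shows "((\<lambda>t. A x (\<xi> + t *\<^sub>R d)) has_real_derivative (a x (\<xi> + t *\<^sub>R d) \<bullet> d)) (at t)"
proof -
  have "(A x has_derivative (\<lambda>h. h \<bullet> a x (\<xi> + t *\<^sub>R d))) (at (\<xi> + t *\<^sub>R d))"
    using A_grad assms by (auto simp: gderiv_def)
  then have "((\<lambda>t. A x (\<xi> + t *\<^sub>R d)) has_derivative (\<lambda>h. (h *\<^sub>R d) \<bullet> a x (\<xi> + t *\<^sub>R d))) (at t)"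
    by (intro has_derivative_compose[where f="\<lambda>t. \<xi> + t *\<^sub>R d" and g="A x" and f'="\<lambda>h. h *\<^sub>R d"])
      (auto intro!: derivative_eq_intros)
  then show ?thesis by (simp add: has_field_derivative_def inner_commute mult_commute_abs)
qed

text \<open>Repeated halving by midpoint convexity bounds the difference quotient at 2^(-n) by the
  full increment; the directional derivative is the limit of these quotients.\<close>

lemma A_above_tangent:
  assumes x: "x \<in> closure \<Omega>"
  shows "a x \<xi> \<bullet> d \<le> A x (\<xi> + d) - A x \<xi>"
proof -
  obtain k0 where k0: "k0 > 0" "\<And>\<xi> \<eta>. A x ((1/2) *\<^sub>R (\<xi> + \<eta>)) \<le> 1/2 * A x \<xi> + 1/2 * A x \<eta> - k0 * norm (\<xi> - \<eta>) powr p"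
    using alpha3 x by blast
  have mid: "A x ((1/2) *\<^sub>R (\<xi> + \<eta>)) \<le> 1/2 * A x \<xi> + 1/2 * A x \<eta>" for \<xi> \<eta>
    using k0(2)[of \<xi> \<eta>] mult_nonneg_nonneg[OF less_imp_le[OF k0(1)] powr_ge_zero[of "norm (\<xi> - \<eta>)" p]] by linarith
  define h where "h n = (1 / 2 :: real) ^ n" for n
  have hh: "h n > 0" for n by (simp add: h_def)
  have le: "A x (\<xi> + h n *\<^sub>R d) \<le> A x \<xi> + h n * (A x (\<xi> + d) - A x \<xi>)" for n
  proof (induction n)
    case (Suc n)
    have "\<xi> + h (Suc n) *\<^sub>R d = (1/2) *\<^sub>R (\<xi> + (\<xi> + h n *\<^sub>R d))"
      by (simp add: h_def algebra_simps scaleR_2[symmetric])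
    then have "A x (\<xi> + h (Suc n) *\<^sub>R d) \<le> 1/2 * A x \<xi> + 1/2 * A x (\<xi> + h n *\<^sub>R d)" using mid by simp
    also have "\<dots> \<le> A x \<xi> + h (Suc n) * (A x (\<xi> + d) - A x \<xi>)" using Suc by (simp add: h_def)
    finally show ?case .
  qed (simp add: h_def)
  have "((\<lambda>t. (A x (\<xi> + t *\<^sub>R d) - A x \<xi>) / t) \<longlongrightarrow> a x \<xi> \<bullet> d) (at 0)"
    using A_deriv[OF x, of \<xi> d 0] by (simp add: DERIV_def)
  moreover have "filterlim h (at 0) sequentially"
    unfolding filterlim_at h_def by (auto intro!: LIMSEQ_power_zero)
  ultimately have "(\<lambda>n. (A x (\<xi> + h n *\<^sub>R d) - A x \<xi>) / h n) \<longlonglongrightarrow> a x \<xi> \<bullet> d" by (rule filterlim_compose)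
  moreover have "(A x (\<xi> + h n *\<^sub>R d) - A x \<xi>) / h n \<le> A x (\<xi> + d) - A x \<xi>" for n
    using le[of n] hh[of n] by (simp add: field_simps)
  ultimately show ?thesis by (intro LIMSEQ_le_const2) auto
qed

text \<open>The tangent at \<xi> bounds the value at the midpoint from below and
  \<open>alpha3\<close> bounds it from above; doubling the difference gives the constant 2 k0. This
  estimate yields the strong convergence of gradients.\<close>

lemma Phi_uniformly_convex:
  obtains k0 where "k0 > 0" "\<And>U V. in_Lp \<Omega> p U \<Longrightarrow> in_Lp \<Omega> p V \<Longrightarrow>
    k0 * (LINT x|M. norm (V x - U x) powr p) \<le> (Phi V - Phi U) - (LINT x|M. a x (U x) \<bullet> (V x - U x))"
proof -
  obtain k0 where k0: "k0 > 0" "\<And>x \<xi> \<eta>. x \<in> closure \<Omega> \<Longrightarrow> A x ((1/2) *\<^sub>R (\<xi> + \<eta>)) \<le> 1/2 * A x \<xi> + 1/2 * A x \<eta> - k0 * norm (\<xi> - \<eta>) powr p"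
    using alpha3 by blast
  show thesis
  proof (rule that[of "2 * k0"])
    fix U V :: "'a \<Rightarrow> 'a" assume U: "in_Lp \<Omega> p U" and V: "in_Lp \<Omega> p V"
    have pt: "2 * k0 * norm (\<eta> - \<xi>) powr p \<le> A x \<eta> - A x \<xi> - a x \<xi> \<bullet> (\<eta> - \<xi>)" if "x \<in> \<Omega>" for x \<xi> \<eta>
    proof -
      have e: "\<xi> + (1/2) *\<^sub>R (\<eta> - \<xi>) = (1/2) *\<^sub>R (\<xi> + \<eta>)" by (simp add: algebra_simps scaleR_2[symmetric])
      have "a x \<xi> \<bullet> ((1/2) *\<^sub>R (\<eta> - \<xi>)) \<le> A x ((1/2) *\<^sub>R (\<xi> + \<eta>)) - A x \<xi>"
        using A_above_tangent[OF \<Omega>_closure[OF that], of \<xi> "(1/2) *\<^sub>R (\<eta> - \<xi>)"] unfolding e .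
      then show ?thesis using k0(2)[OF \<Omega>_closure[OF that], of \<xi> \<eta>] by (simp add: norm_minus_commute)
    qed
    have i: "integrable M (\<lambda>x. norm (V x - U x) powr p)" "integrable M (\<lambda>x. a x (U x) \<bullet> (V x - U x))"
      using in_Lp_diff[OF p0 V U] L_integrable(1)[OF in_Lp_test(1)[OF test_functions_0] U in_Lp_test(1)[OF test_functions_0] in_Lp_diff[OF p0 V U]]
      by (auto simp: in_Lp_def)
    have "(LINT x|M. 2 * k0 * norm (V x - U x) powr p) \<le> (LINT x|M. A x (V x) - A x (U x) - a x (U x) \<bullet> (V x - U x))"
      using i A_integrable[OF U] A_integrable[OF V] pt by (intro integral_mono) (auto simp: space_M)
    also have "\<dots> = (Phi V - Phi U) - (LINT x|M. a x (U x) \<bullet> (V x - U x))"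
      using i A_integrable[OF U] A_integrable[OF V] by (simp add: Phi_def)
    finally show "2 * k0 * (LINT x|M. norm (V x - U x) powr p) \<le> (Phi V - Phi U) - (LINT x|M. a x (U x) \<bullet> (V x - U x))"
      by simp
  qed (use k0 in simp)
qed

lemma Phi_bounds:
  assumes U: "in_Lp \<Omega> p U"
  shows "\<Lambda>1 * (LINT x|M. norm (U x) powr p) \<le> Phi U" "Phi U \<le> \<Lambda>2 * (LINT x|M. norm (U x) powr p)"
proof -
  have i: "integrable M (\<lambda>x. norm (U x) powr p)" using U by (simp add: in_Lp_def)
  have "(LINT x|M. \<Lambda>1 * norm (U x) powr p) \<le> Phi U" unfolding Phi_def
    using i alpha5 \<Omega>_closure by (intro integral_mono A_integrable[OF U]) (auto simp: space_M)
  then show "\<Lambda>1 * (LINT x|M. norm (U x) powr p) \<le> Phi U" by simp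
  have "Phi U \<le> (LINT x|M. \<Lambda>2 * norm (U x) powr p)" unfolding Phi_def
    using i alpha5 \<Omega>_closure by (intro integral_mono A_integrable[OF U]) (auto simp: space_M)
  then show "Phi U \<le> \<Lambda>2 * (LINT x|M. norm (U x) powr p)" by simp
qed

lemma J_eq:
  assumes "in_Lp \<Omega> p u" "in_Lp \<Omega> p U"
  shows "J u U = Phi U - \<mu> * (LINT x|M. k x * primitive f (u x))"
  using A_integrable[OF assms(2)] kF_integrable[OF assms(1)] by (simp add: J_def Phi_def)

lemma J_coercive:
  obtains C1 C2 where "C1 > 0" "\<And>\<phi>. \<phi> \<in> T \<Longrightarrow> (LINT x|M. norm (grad \<phi> x) powr p) \<le> C1 * J \<phi> (grad \<phi>) + C2"
proof -
  obtain K where K: "K > 0" "\<And>x. x \<in> closure \<Omega> \<Longrightarrow> \<bar>k x\<bar> \<le> K" using k_bounded by blast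
  obtain R where R: "\<Omega> \<subseteq> cball 0 R" "R > 0"
    using bounded_\<Omega> unfolding bounded_pos by (auto simp: subset_iff)
  define CP where "CP = (2 * R + 1) powr p"
  have CP: "CP > 0" using R by (simp add: CP_def)
  \<comment> \<open>Chosen so that, after Poincare's inequality, the power part of the nonlinear
    term takes exactly half of \<Lambda>1 times the gradient energy.\<close>
  define \<epsilon> where "\<epsilon> = \<Lambda>1 / (2 * \<mu> * K * CP)"
  have \<epsilon>: "\<epsilon> > 0" using \<Lambda> \<mu>_pos K CP by (simp add: \<epsilon>_def)
  obtain C where C: "C \<ge> 0" "\<And>t. \<bar>primitive f t\<bar> \<le> C + \<epsilon> * \<bar>t\<bar> powr p" using primitive_le_powr[OF \<epsilon>] by blast
  define m where "m = measure M \<Omega>"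
  show thesis
  proof (rule that[of "2 / \<Lambda>1" "2 / \<Lambda>1 * (\<mu> * (K * (C * m)))"])
    show "2 / \<Lambda>1 > 0" using \<Lambda> by simp
    fix \<phi> assume \<phi>: "\<phi> \<in> T"
    define N where "N = (LINT x|M. norm (grad \<phi> x) powr p)"
    have i: "integrable M (\<lambda>x. \<bar>\<phi> x\<bar> powr p)" using in_Lp_test(1)[OF \<phi>] by (simp add: in_Lp_def)
    have "(LINT x|M. k x * primitive f (\<phi> x)) \<le> (LINT x|M. K * (C + \<epsilon> * \<bar>\<phi> x\<bar> powr p))"
    proof (rule integral_mono[OF kF_integrable[OF in_Lp_test(1)[OF \<phi>]]])
      show "integrable M (\<lambda>x. K * (C + \<epsilon> * \<bar>\<phi> x\<bar> powr p))" using i integrable_const_M by simp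
      fix x assume "x \<in> space M"
      then have "x \<in> closure \<Omega>" using \<Omega>_closure by (simp add: space_M)
      then have "\<bar>k x * primitive f (\<phi> x)\<bar> \<le> K * (C + \<epsilon> * \<bar>\<phi> x\<bar> powr p)"
        unfolding abs_mult using K C(2)[of "\<phi> x"] by (intro mult_mono) auto
      then show "k x * primitive f (\<phi> x) \<le> K * (C + \<epsilon> * \<bar>\<phi> x\<bar> powr p)" by linarith
    qed
    also have "\<dots> = K * (C * m + \<epsilon> * (LINT x|M. \<bar>\<phi> x\<bar> powr p))"
      using i integrable_const_M by (simp add: m_def space_M)
    also have "\<dots> \<le> K * (C * m + \<epsilon> * (CP * N))"
      using Poincare_test_functions[OF \<phi> p R] K \<epsilon> unfolding N_def LINT_test[OF \<phi> p0] CP_def by (intro mult_left_mono add_left_mono) auto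
    finally have "\<mu> * (LINT x|M. k x * primitive f (\<phi> x)) \<le> \<mu> * (K * (C * m + \<epsilon> * (CP * N)))"
      using \<mu>_pos by (intro mult_left_mono) auto
    also have "\<dots> = \<mu> * (K * (C * m)) + \<Lambda>1 / 2 * N"
      using \<mu>_pos K CP by (simp add: \<epsilon>_def field_simps)
    finally have "J \<phi> (grad \<phi>) \<ge> \<Lambda>1 * N - (\<mu> * (K * (C * m)) + \<Lambda>1 / 2 * N)"
      using Phi_bounds(1)[OF in_Lp_test(2)[OF \<phi>]] unfolding J_eq[OF in_Lp_test[OF \<phi> ]] N_def[symmetric] by linarith
    then show "N \<le> 2 / \<Lambda>1 * J \<phi> (grad \<phi>) + 2 / \<Lambda>1 * (\<mu> * (K * (C * m)))"
      using \<Lambda> by (simp add: field_simps)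
  qed
qed

lemma L_diff:
  assumes "in_Lp \<Omega> p u" "in_Lp \<Omega> p U" "in_Lp \<Omega> p v" "in_Lp \<Omega> p V" "in_Lp \<Omega> p v'" "in_Lp \<Omega> p V'"
  shows "L u U (\<lambda>x. v x - v' x) (\<lambda>x. V x - V' x) = L u U v V - L u U v' V'"
  using L_integrable[OF assms(1-4)] L_integrable[OF assms(1,2,5,6)]
  by (simp add: L_def inner_diff_right right_diff_distrib)

text \<open>Together with linearity in the direction (\<open>L_diff\<close>) this extends a
  vanishing derivative from dense directions to all directions.\<close>

lemma L_continuous:
  assumes u: "in_Lp \<Omega> p u" and U: "in_Lp \<Omega> p U" and \<epsilon>: "\<epsilon> > 0"
  obtains \<eta> where "\<eta> > 0" "\<And>v V. in_Lp \<Omega> p v \<Longrightarrow> in_Lp \<Omega> p V \<Longrightarrow>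
    (LINT x|M. \<bar>v x\<bar> powr p) < \<eta> \<Longrightarrow> (LINT x|M. norm (V x) powr p) < \<eta> \<Longrightarrow> \<bar>L u U v V\<bar> < \<epsilon>"
proof -
  obtain c where c: "c > 0"
    "\<And>x \<xi> \<eta>. x \<in> \<Omega> \<Longrightarrow> \<bar>a x \<xi> \<bullet> \<eta>\<bar> \<le> c * ((1 + norm \<xi> powr (p - 1)) * norm \<eta>)"
    "\<And>x t d. x \<in> \<Omega> \<Longrightarrow> \<bar>k x * f t * d\<bar> \<le> c * ((1 + \<bar>t\<bar> powr (p - 1)) * \<bar>d\<bar>)"
    using a_pairing_bound by blast
  define e where "e = \<epsilon> / (c + \<mu> * c)"
  have e: "e > 0" using \<epsilon> c(1) \<mu>_pos by (simp add: e_def add_pos_pos)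
  obtain \<eta>1 where \<eta>1: "\<eta>1 > 0" "\<And>(U' :: 'a \<Rightarrow> 'a) (V :: 'a \<Rightarrow> 'a). in_Lp \<Omega> p U' \<Longrightarrow> in_Lp \<Omega> p V \<Longrightarrow>
      (LINT x|M. norm (U' x) powr p) \<le> (LINT x|M. norm (U x) powr p) \<Longrightarrow> (LINT x|M. norm (V x) powr p) < \<eta>1 \<Longrightarrow>
      (LINT x|M. (1 + norm (U' x) powr (p - 1)) * norm (V x)) < e"
    by (rule pairing_small[OF e, where ?'b='a and ?'c='a and C="LINT x|M. norm (U x) powr p"]) blast
  obtain \<eta>2 where \<eta>2: "\<eta>2 > 0" "\<And>(u' :: 'a \<Rightarrow> real) (v :: 'a \<Rightarrow> real). in_Lp \<Omega> p u' \<Longrightarrow> in_Lp \<Omega> p v \<Longrightarrow>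
      (LINT x|M. norm (u' x) powr p) \<le> (LINT x|M. norm (u x) powr p) \<Longrightarrow> (LINT x|M. norm (v x) powr p) < \<eta>2 \<Longrightarrow>
      (LINT x|M. (1 + norm (u' x) powr (p - 1)) * norm (v x)) < e"
    by (rule pairing_small[OF e, where ?'b=real and ?'c=real and C="LINT x|M. norm (u x) powr p"]) blast
  show thesis
  proof (rule that[of "min \<eta>1 \<eta>2"])
    fix v V assume v: "in_Lp \<Omega> p v" and V: "in_Lp \<Omega> p (V :: 'a \<Rightarrow> 'a)"
      and s: "(LINT x|M. \<bar>v x\<bar> powr p) < min \<eta>1 \<eta>2" "(LINT x|M. norm (V x) powr p) < min \<eta>1 \<eta>2"
    note i = L_integrable[OF u U v V]
    have "\<bar>LINT x|M. a x (U x) \<bullet> V x\<bar> \<le> (LINT x|M. \<bar>a x (U x) \<bullet> V x\<bar>)" by (rule integral_abs_bound)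
    also have "\<dots> \<le> (LINT x|M. c * ((1 + norm (U x) powr (p - 1)) * norm (V x)))"
      using i pairing_integrable[OF U V] c(2) by (intro integral_mono integrable_abs) (auto simp: space_M)
    also have "\<dots> < c * e" using \<eta>1(2)[OF U V order_refl] s c(1) by simp
    finally have 1: "\<bar>LINT x|M. a x (U x) \<bullet> V x\<bar> < c * e" .
    have "\<bar>LINT x|M. k x * f (u x) * v x\<bar> \<le> (LINT x|M. \<bar>k x * f (u x) * v x\<bar>)" by (rule integral_abs_bound)
    also have "\<dots> \<le> (LINT x|M. c * ((1 + norm (u x) powr (p - 1)) * norm (v x)))"
      using i pairing_integrable[OF u v] c(3) by (intro integral_mono integrable_abs) (auto simp: space_M)
    also have "\<dots> < c * e" using \<eta>2(2)[OF u v order_refl] s c(1) by simp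
    finally have "\<mu> * \<bar>LINT x|M. k x * f (u x) * v x\<bar> < \<mu> * (c * e)" using \<mu>_pos by simp
    then have "\<bar>\<mu> * (LINT x|M. k x * f (u x) * v x)\<bar> < \<mu> * (c * e)" using \<mu>_pos by (simp add: abs_mult)
    moreover have "L u U v V = (LINT x|M. a x (U x) \<bullet> V x) - \<mu> * (LINT x|M. k x * f (u x) * v x)"
      using i by (simp add: L_def)
    moreover have "c * e + \<mu> * (c * e) = \<epsilon>"
    proof -
      have "c + \<mu> * c \<noteq> 0" using c(1) \<mu>_pos by (simp add: add_pos_pos less_imp_neq[symmetric])
      moreover have "c * e + \<mu> * (c * e) = (c + \<mu> * c) * e" by (simp add: algebra_simps)
      ultimately show ?thesis by (simp add: e_def)
    qed
    ultimately show "\<bar>L u U v V\<bar> < \<epsilon>" using 1 by linarith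
  qed (use \<eta>1 \<eta>2 in simp)
qed

text \<open>The measure of \<Omega> is finite. The lemma links the C^1 density of the countable
  family with the L^p continuity in \<open>L_continuous\<close>.\<close>

lemma sup_small_imp_Lp_small:
  assumes "\<eta> > 0"
  obtains s where "s > 0" "\<And>g :: 'a \<Rightarrow> 'b::euclidean_space. in_Lp \<Omega> p g \<Longrightarrow> (\<And>x. x \<in> \<Omega> \<Longrightarrow> norm (g x) < s) \<Longrightarrow> (LINT x|M. norm (g x) powr p) < \<eta>"
proof -
  define m where "m = measure M \<Omega>"
  have m: "m + 1 > 0" by (simp add: m_def add_nonneg_pos)
  define s where "s = (\<eta> / (m + 1)) powr (1 / p)"
  have s: "s > 0" "s powr p = \<eta> / (m + 1)" using assms m p0 by (auto simp: s_def powr_powr)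
  show thesis
  proof (rule that[OF s(1)])
    fix g :: "'a \<Rightarrow> 'b" assume g: "in_Lp \<Omega> p g" "\<And>x. x \<in> \<Omega> \<Longrightarrow> norm (g x) < s"
    have "(LINT x|M. norm (g x) powr p) \<le> (LINT x|M. s powr p)"
      using g p0 integrable_const_M by (intro integral_mono powr_mono2) (auto simp: in_Lp_def space_M less_imp_le)
    also have "\<dots> = m * (\<eta> / (m + 1))" by (simp add: m_def space_M s(2)[unfolded m_def])
    also have "\<dots> < \<eta>" using assms m by (simp add: field_simps)
    finally show "(LINT x|M. norm (g x) powr p) < \<eta>" .
  qed
qed

end

section \<open>Measurability of the chosen weak gradient\<close>

lemma complete_measure_lebesgue_on:
  assumes "S \<in> sets lebesgue"
  shows "complete_measure (lebesgue_on S)"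
proof
  fix A B assume "B \<subseteq> A" "A \<in> null_sets (lebesgue_on S)"
  then have "A \<in> null_sets lebesgue" "A \<subseteq> S" using assms by (auto simp: null_sets_restrict_space)
  then have "B \<in> null_sets lebesgue" using \<open>B \<subseteq> A\<close> null_sets_completion_subset by blast
  then show "B \<in> sets (lebesgue_on S)"
    using \<open>B \<subseteq> A\<close> \<open>A \<subseteq> S\<close> assms by (auto simp: sets_restrict_space_iff)
qed

text \<open>Completeness of the Lebesgue measure is the reason. A weak gradient picked by
  \<open>SOME\<close> is determined only up to null sets and must still be measurable.\<close>

lemma borel_measurable_lebesgue_on_AE:
  fixes f g :: "'a::euclidean_space \<Rightarrow> 'b::euclidean_space"
  assumes S: "S \<in> sets lebesgue" and f: "f \<in> borel_measurable (lebesgue_on S)" and ae: "AE x in lebesgue_on S. f x = g x"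
  shows "g \<in> borel_measurable (lebesgue_on S)"
proof (rule measurableI)
  interpret complete_measure "lebesgue_on S" by (rule complete_measure_lebesgue_on[OF S])
  fix A :: "'b set" assume A: "A \<in> sets borel"
  show "g -` A \<inter> space (lebesgue_on S) \<in> sets (lebesgue_on S)"
  proof (rule in_sets_AE)
    show "AE x in lebesgue_on S. (x \<in> f -` A \<inter> space (lebesgue_on S)) = (x \<in> g -` A \<inter> space (lebesgue_on S))"
      using ae by eventually_elim auto
  qed (use measurable_sets[OF f A] in auto)
qed auto

lemma weak_grad_props:
  assumes \<Omega>: "open \<Omega>" and u: "has_weak_gradient \<Omega> u U" and U: "in_Lp \<Omega> p U"
  shows "has_weak_gradient \<Omega> u (weak_grad \<Omega> u)" "AE x in lebesgue_on \<Omega>. U x = weak_grad \<Omega> u x"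
    "in_Lp \<Omega> p (weak_grad \<Omega> u)"
    "(LINT x|lebesgue_on \<Omega>. norm (weak_grad \<Omega> u x) powr p) = (LINT x|lebesgue_on \<Omega>. norm (U x) powr p)"
proof -
  show h: "has_weak_gradient \<Omega> u (weak_grad \<Omega> u)" using someI[of "has_weak_gradient \<Omega> u", OF u] by (simp add: weak_grad_def)
  show ae: "AE x in lebesgue_on \<Omega>. U x = weak_grad \<Omega> u x" by (rule weak_gradient_unique[OF \<Omega> u h]) simp
  have mU: "U \<in> borel_measurable (lebesgue_on \<Omega>)" using U by (simp add: in_Lp_def)
  have m: "weak_grad \<Omega> u \<in> borel_measurable (lebesgue_on \<Omega>)"
    by (rule borel_measurable_lebesgue_on_AE[OF _ mU ae]) (use \<Omega> in simp)
  have ae': "AE x in lebesgue_on \<Omega>. norm (U x) powr p = norm (weak_grad \<Omega> u x) powr p"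
    using ae by eventually_elim simp
  have "integrable (lebesgue_on \<Omega>) (\<lambda>x. norm (weak_grad \<Omega> u x) powr p)"
    using integrable_cong_AE[OF borel_measurable_norm_powr[OF mU] borel_measurable_norm_powr[OF m] ae'] U by (simp add: in_Lp_def)
  then show "in_Lp \<Omega> p (weak_grad \<Omega> u)" using m by (simp add: in_Lp_def)
  show "(LINT x|lebesgue_on \<Omega>. norm (weak_grad \<Omega> u x) powr p) = (LINT x|lebesgue_on \<Omega>. norm (U x) powr p)"
    by (rule integral_cong_AE[OF borel_measurable_norm_powr[OF m] borel_measurable_norm_powr[OF mU]]) (use ae' in eventually_elim, simp)
qed

lemma Lp_norm_powr: "p > 0 \<Longrightarrow> Lp_norm \<Omega> p u powr p = (LINT x|lebesgue_on \<Omega>. norm (u x) powr p)"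
  by (simp add: Lp_norm_def powr_powr)

context dirichlet_problem
begin

lemma in_Lp_locally_integrable:
  fixes U :: "'a \<Rightarrow> 'b::euclidean_space"
  assumes "in_Lp \<Omega> p U"
  shows "integrable M U" "locally_integrable \<Omega> U"
proof -
  show i: "integrable M U"
  proof (rule Bochner_Integration.integrable_bound)
    show "integrable M (\<lambda>x. 1 + norm (U x) powr p)" using assms integrable_const_M by (simp add: in_Lp_def)
    show "U \<in> borel_measurable M" using assms by (simp add: in_Lp_def)
    show "AE x in M. norm (U x) \<le> norm (1 + norm (U x) powr p)"
      using p le_one_add_powr[of "norm (U _)" p] by (intro AE_M_I) (auto intro: order_trans[OF _ abs_ge_self])
  qed
  show "locally_integrable \<Omega> U" unfolding locally_integrable_def
  proof (intro allI impI, elim conjE)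
    fix K assume K: "compact K" "K \<subseteq> \<Omega>"
    have Ks: "K \<in> sets lebesgue" using K(1) by (simp add: borel_compact)
    have "integrable lebesgue (\<lambda>x. indicator \<Omega> x *\<^sub>R U x)" using i \<Omega>_lebesgue by (simp add: integrable_restrict_space)
    then have "integrable lebesgue (\<lambda>x. indicator K x *\<^sub>R (indicator \<Omega> x *\<^sub>R U x))"
      by (rule integrable_mult_indicator[OF Ks])
    also have "(\<lambda>x. indicator K x *\<^sub>R (indicator \<Omega> x *\<^sub>R U x)) = (\<lambda>x. indicator K x *\<^sub>R U x)"
      using K(2) by (auto simp: indicator_def fun_eq_iff)
    finally show "integrable (lebesgue_on K) U" using Ks by (simp add: integrable_restrict_space)
  qed
qed

text \<open>The Sobolev norm contains \<open>weak_grad\<close> of a difference, which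
  \<open>weak_grad_props\<close> replaces by the given representative. Two halves of \<epsilon>^p
  add up under the p-th root.\<close>

lemma W1p_0_memI:
  assumes u: "in_Lp \<Omega> p u" and U: "in_Lp \<Omega> p U" and g: "has_weak_gradient \<Omega> u U"
    and approx: "\<And>\<epsilon>. \<epsilon> > 0 \<Longrightarrow> \<exists>\<phi>\<in>T. (LINT x|M. \<bar>u x - \<phi> x\<bar> powr p) < \<epsilon> \<and> (LINT x|M. norm (U x - grad \<phi> x) powr p) < \<epsilon>"
  shows "u \<in> W1p_0 \<Omega> p"
  unfolding W1p_0_def W1p_def
proof (intro CollectI conjI exI[of _ U] allI impI u U g)
  fix \<epsilon> :: real assume \<epsilon>: "\<epsilon> > 0"
  then obtain \<phi> where \<phi>: "\<phi> \<in> T" "(LINT x|M. \<bar>u x - \<phi> x\<bar> powr p) < \<epsilon> powr p / 2" "(LINT x|M. norm (U x - grad \<phi> x) powr p) < \<epsilon> powr p / 2"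
    using approx[of "\<epsilon> powr p / 2"] by auto
  have h: "has_weak_gradient \<Omega> (\<lambda>x. u x - \<phi> x) (\<lambda>x. U x - grad \<phi> x)"
    by (rule has_weak_gradient_diff[OF open_\<Omega> g has_weak_gradient_test_function[OF open_\<Omega> \<phi>(1)]])
  have "(LINT x|M. \<bar>u x - \<phi> x\<bar> powr p) + (LINT x|M. norm (weak_grad \<Omega> (\<lambda>x. u x - \<phi> x) x) powr p) < \<epsilon> powr p"
    using \<phi> weak_grad_props(4)[OF open_\<Omega> h in_Lp_diff[OF p0 U in_Lp_test(2)[OF \<phi>(1)]]] by simp
  then have "((LINT x|M. \<bar>u x - \<phi> x\<bar> powr p) + (LINT x|M. norm (weak_grad \<Omega> (\<lambda>x. u x - \<phi> x) x) powr p)) powr (1 / p) < (\<epsilon> powr p) powr (1 / p)"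
    using p0 by (intro powr_less_mono2) (auto intro!: add_nonneg_nonneg)
  then show "\<exists>\<phi>\<in>T. W1p_norm \<Omega> p (\<lambda>x. u x - \<phi> x) < \<epsilon>"
    using \<epsilon> p0 \<phi>(1) by (intro bexI[of _ \<phi>]) (auto simp: W1p_norm_def Lp_norm_powr powr_powr)
qed

lemma W1p_0_approx:
  assumes v: "v \<in> W1p_0 \<Omega> p"
  shows "in_Lp \<Omega> p v" "in_Lp \<Omega> p (weak_grad \<Omega> v)"
    "\<And>\<epsilon>. \<epsilon> > 0 \<Longrightarrow> \<exists>\<phi>\<in>T. (LINT x|M. \<bar>v x - \<phi> x\<bar> powr p) < \<epsilon> \<and> (LINT x|M. norm (weak_grad \<Omega> v x - grad \<phi> x) powr p) < \<epsilon>"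
proof -
  obtain V where V: "has_weak_gradient \<Omega> v V" "in_Lp \<Omega> p V" and Lv: "in_Lp \<Omega> p v"
    using v by (auto simp: W1p_0_def W1p_def)
  note w = weak_grad_props[OF open_\<Omega> V]
  show "in_Lp \<Omega> p v" "in_Lp \<Omega> p (weak_grad \<Omega> v)" by fact+
  fix \<epsilon> :: real assume \<epsilon>: "\<epsilon> > 0"
  obtain \<phi> where \<phi>: "\<phi> \<in> T" "W1p_norm \<Omega> p (\<lambda>x. v x - \<phi> x) < \<epsilon> powr (1 / p)"
  proof -
    have "\<epsilon> powr (1 / p) > 0" using \<epsilon> by simp
    then show ?thesis using v that unfolding W1p_0_def by blast
  qed
  have h: "has_weak_gradient \<Omega> (\<lambda>x. v x - \<phi> x) (\<lambda>x. weak_grad \<Omega> v x - grad \<phi> x)"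
    by (rule has_weak_gradient_diff[OF open_\<Omega> w(1) has_weak_gradient_test_function[OF open_\<Omega> \<phi>(1)]])
  have eq: "(LINT x|M. norm (weak_grad \<Omega> (\<lambda>x. v x - \<phi> x) x) powr p) = (LINT x|M. norm (weak_grad \<Omega> v x - grad \<phi> x) powr p)"
    by (rule weak_grad_props(4)[OF open_\<Omega> h in_Lp_diff[OF p0 w(3) in_Lp_test(2)[OF \<phi>(1)]]])
  define S where "S = (LINT x|M. \<bar>v x - \<phi> x\<bar> powr p) + (LINT x|M. norm (weak_grad \<Omega> v x - grad \<phi> x) powr p)"
  have "S powr (1 / p) < \<epsilon> powr (1 / p)" using \<phi>(2) p0 by (simp add: W1p_norm_def Lp_norm_powr eq S_def)
  then have "S < \<epsilon>" using p0 \<epsilon> by (metis (no_types) not_less powr_mono2 less_imp_le divide_nonneg_pos zero_le_one)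
  moreover have "(LINT x|M. \<bar>v x - \<phi> x\<bar> powr p) \<ge> 0" "(LINT x|M. norm (weak_grad \<Omega> v x - grad \<phi> x) powr p) \<ge> 0"
    by (auto intro!: integral_nonneg_AE)
  ultimately have "(LINT x|M. \<bar>v x - \<phi> x\<bar> powr p) < \<epsilon>" "(LINT x|M. norm (weak_grad \<Omega> v x - grad \<phi> x) powr p) < \<epsilon>"
    unfolding S_def by linarith+
  then show "\<exists>\<phi>\<in>T. (LINT x|M. \<bar>v x - \<phi> x\<bar> powr p) < \<epsilon> \<and> (LINT x|M. norm (weak_grad \<Omega> v x - grad \<phi> x) powr p) < \<epsilon>"
    using \<phi>(1) by blast
qed

text \<open>The derivative vanishes on D. Density in the C^1 sense carries this to all test
  functions, and density of the test functions to the whole space; both steps use continuity of L in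
  the direction.\<close>

lemma weak_solutionI:
  assumes u: "in_Lp \<Omega> p u" and U: "in_Lp \<Omega> p U" and g: "has_weak_gradient \<Omega> u U"
    and approx: "\<And>\<epsilon>. \<epsilon> > 0 \<Longrightarrow> \<exists>\<phi>\<in>T. (LINT x|M. \<bar>u x - \<phi> x\<bar> powr p) < \<epsilon> \<and> (LINT x|M. norm (U x - grad \<phi> x) powr p) < \<epsilon>"
    and dense: "\<And>\<phi> s. \<phi> \<in> T \<Longrightarrow> s > 0 \<Longrightarrow> \<exists>\<psi>\<in>D. \<psi> \<in> T \<and> (\<forall>x\<in>\<Omega>. \<bar>\<phi> x - \<psi> x\<bar> < s \<and> norm (grad \<phi> x - grad \<psi> x) < s)"
    and crit: "\<And>\<psi>. \<psi> \<in> D \<Longrightarrow> L u U \<psi> (grad \<psi>) = 0"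
  shows "weak_solution \<Omega> p a k f \<mu> u"
  unfolding weak_solution_def
proof (intro conjI ballI)
  show "u \<in> W1p_0 \<Omega> p" by (rule W1p_0_memI[OF u U g approx])
  fix v assume v: "v \<in> W1p_0 \<Omega> p"
  note W = W1p_0_approx[OF v]
  note wg = weak_grad_props[OF open_\<Omega> g U]
  note i = L_integrable[OF u wg(3) W(1) W(2)]
  show "integrable M (\<lambda>x. a x (weak_grad \<Omega> u x) \<bullet> weak_grad \<Omega> v x)" "integrable M (\<lambda>x. k x * f (u x) * v x)" by fact+
  have test0: "L u U \<phi> (grad \<phi>) = 0" if \<phi>: "\<phi> \<in> T" for \<phi>
  proof (rule ccontr)
    assume "L u U \<phi> (grad \<phi>) \<noteq> 0"
    \<comment> \<open>The value itself serves as the tolerance: the derivative in the direction of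
      an approximant is 0, so the value would have to be smaller than itself.\<close>
    then have "\<bar>L u U \<phi> (grad \<phi>)\<bar> > 0" by simp
    then obtain \<eta> where \<eta>: "\<eta> > 0" "\<And>v V. in_Lp \<Omega> p v \<Longrightarrow> in_Lp \<Omega> p V \<Longrightarrow>
      (LINT x|M. \<bar>v x\<bar> powr p) < \<eta> \<Longrightarrow> (LINT x|M. norm (V x) powr p) < \<eta> \<Longrightarrow> \<bar>L u U v V\<bar> < \<bar>L u U \<phi> (grad \<phi>)\<bar>"
      by (rule L_continuous[OF u U]) blast
    obtain s1 where s1: "s1 > 0" "\<And>g :: 'a \<Rightarrow> real. in_Lp \<Omega> p g \<Longrightarrow> (\<And>x. x \<in> \<Omega> \<Longrightarrow> norm (g x) < s1) \<Longrightarrow> (LINT x|M. norm (g x) powr p) < \<eta>"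
      by (rule sup_small_imp_Lp_small[OF \<eta>(1), where ?'b=real]) blast
    obtain s2 where s2: "s2 > 0" "\<And>g :: 'a \<Rightarrow> 'a. in_Lp \<Omega> p g \<Longrightarrow> (\<And>x. x \<in> \<Omega> \<Longrightarrow> norm (g x) < s2) \<Longrightarrow> (LINT x|M. norm (g x) powr p) < \<eta>"
      by (rule sup_small_imp_Lp_small[OF \<eta>(1), where ?'b='a]) blast
    obtain \<psi> where \<psi>: "\<psi> \<in> D" "\<psi> \<in> T" "\<And>x. x \<in> \<Omega> \<Longrightarrow> \<bar>\<phi> x - \<psi> x\<bar> < min s1 s2 \<and> norm (grad \<phi> x - grad \<psi> x) < min s1 s2"
      using dense[OF \<phi>, of "min s1 s2"] s1(1) s2(1) by auto
    note ld = in_Lp_diff[OF p0 in_Lp_test(1)[OF \<phi>] in_Lp_test(1)[OF \<psi>(2)]] in_Lp_diff[OF p0 in_Lp_test(2)[OF \<phi>] in_Lp_test(2)[OF \<psi>(2)]]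
    have "(LINT x|M. norm (\<phi> x - \<psi> x) powr p) < \<eta>" by (rule s1(2)[OF ld(1)]) (use \<psi>(3) in force)
    moreover have "(LINT x|M. norm (grad \<phi> x - grad \<psi> x) powr p) < \<eta>" by (rule s2(2)[OF ld(2)]) (use \<psi>(3) in force)
    ultimately have "\<bar>L u U (\<lambda>x. \<phi> x - \<psi> x) (\<lambda>x. grad \<phi> x - grad \<psi> x)\<bar> < \<bar>L u U \<phi> (grad \<phi>)\<bar>"
      using \<eta>(2)[OF ld] by simp
    then show False
      using L_diff[OF u U in_Lp_test[OF \<phi>] in_Lp_test[OF \<psi>(2)]] crit[OF \<psi>(1)] by simp
  qed
  have "L u U v (weak_grad \<Omega> v) = 0"
  proof (rule ccontr)
    assume "L u U v (weak_grad \<Omega> v) \<noteq> 0"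
    then have "\<bar>L u U v (weak_grad \<Omega> v)\<bar> > 0" by simp
    then obtain \<eta> where \<eta>: "\<eta> > 0" "\<And>v' V. in_Lp \<Omega> p v' \<Longrightarrow> in_Lp \<Omega> p V \<Longrightarrow>
      (LINT x|M. \<bar>v' x\<bar> powr p) < \<eta> \<Longrightarrow> (LINT x|M. norm (V x) powr p) < \<eta> \<Longrightarrow> \<bar>L u U v' V\<bar> < \<bar>L u U v (weak_grad \<Omega> v)\<bar>"
      by (rule L_continuous[OF u U]) blast
    obtain \<phi> where \<phi>: "\<phi> \<in> T" "(LINT x|M. \<bar>v x - \<phi> x\<bar> powr p) < \<eta>" "(LINT x|M. norm (weak_grad \<Omega> v x - grad \<phi> x) powr p) < \<eta>"
      using W(3)[OF \<eta>(1)] by blast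
    have "\<bar>L u U (\<lambda>x. v x - \<phi> x) (\<lambda>x. weak_grad \<Omega> v x - grad \<phi> x)\<bar> < \<bar>L u U v (weak_grad \<Omega> v)\<bar>"
      using \<phi> by (intro \<eta>(2) in_Lp_diff[OF p0] W in_Lp_test)
    then show False
      using L_diff[OF u U W(1,2) in_Lp_test[OF \<phi>(1)]] test0[OF \<phi>(1)] by simp
  qed
  then have "(LINT x|M. a x (U x) \<bullet> weak_grad \<Omega> v x) = \<mu> * (LINT x|M. k x * f (u x) * v x)"
    using L_integrable[OF u U W(1,2)] by (simp add: L_def)
  moreover have "(LINT x|M. a x (weak_grad \<Omega> u x) \<bullet> weak_grad \<Omega> v x) = (LINT x|M. a x (U x) \<bullet> weak_grad \<Omega> v x)"
    by (rule integral_cong_AE)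
      (use i L_integrable[OF u U W(1,2)] wg(2) in \<open>auto elim!: eventually_mono\<close>)
  ultimately show "(LINT x|M. a x (weak_grad \<Omega> u x) \<bullet> weak_grad \<Omega> v x) = \<mu> * (LINT x|M. k x * f (u x) * v x)"
    by simp
qed

end

section \<open>Limits of Galerkin approximations\<close>

context dirichlet_problem
begin

lemma A_isCont: "x \<in> \<Omega> \<Longrightarrow> isCont (A x) \<xi>"
  using A_grad \<Omega>_closure[of x] by (auto simp: gderiv_def intro: has_derivative_continuous)

lemma a_isCont:
  assumes "x \<in> \<Omega>"
  shows "isCont (a x) \<xi>"
proof -
  have "continuous_on UNIV (\<lambda>\<xi>. (\<lambda>(x, \<xi>). a x \<xi>) (x, \<xi>))"
    by (rule continuous_on_compose2[OF a_cont]) (use \<Omega>_closure[OF assms] in \<open>auto intro!: continuous_intros\<close>)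
  then show ?thesis by (simp add: continuous_on_eq_continuous_at)
qed

lemma f_isCont: "isCont f t"
  using f_cont by (simp add: continuous_on_eq_continuous_at)

lemma primitive_isCont: "isCont (primitive f) t"
  using primitive_continuous[of UNIV] by (simp add: continuous_on_eq_continuous_at)

text \<open>The integrands grow at most like a constant plus p-th powers, so multiples of H plus
  constants are majorants; pointwise convergence comes from the continuity of A, a and f.\<close>

lemma functionals_tendsto:
  fixes w :: "nat \<Rightarrow> 'a \<Rightarrow> real" and W :: "nat \<Rightarrow> 'a \<Rightarrow> 'a"
  assumes m: "\<And>n. w n \<in> borel_measurable M" "\<And>n. W n \<in> borel_measurable M" "u \<in> borel_measurable M" "U \<in> borel_measurable M"
    and H: "integrable M H"
    and lim: "AE x in M. (\<lambda>n. w n x) \<longlonglongrightarrow> u x" "AE x in M. (\<lambda>n. W n x) \<longlonglongrightarrow> U x"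
    and dom: "AE x in M. \<forall>n. \<bar>w n x\<bar> powr p \<le> H x" "AE x in M. \<forall>n. norm (W n x) powr p \<le> H x"
  shows "(\<lambda>n. Phi (W n)) \<longlonglongrightarrow> Phi U" "(\<lambda>n. J (w n) (W n)) \<longlonglongrightarrow> J u U"
    "\<phi> \<in> T \<Longrightarrow> (\<lambda>n. L (w n) (W n) \<phi> (grad \<phi>)) \<longlonglongrightarrow> L u U \<phi> (grad \<phi>)"
proof -
  obtain K where K: "K > 0" "\<And>x. x \<in> closure \<Omega> \<Longrightarrow> \<bar>k x\<bar> \<le> K" using k_bounded by blast
  obtain C where C: "C \<ge> 0" "\<And>t. \<bar>primitive f t\<bar> \<le> C + 1 * \<bar>t\<bar> powr p" using primitive_le_powr[of 1] by auto
  have A_le: "\<bar>A x \<xi>\<bar> \<le> \<Lambda>2 * norm \<xi> powr p" if "x \<in> \<Omega>" for x \<xi>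
  proof -
    have "\<Lambda>1 * norm \<xi> powr p \<le> A x \<xi>" "A x \<xi> \<le> \<Lambda>2 * norm \<xi> powr p" using alpha5 \<Omega>_closure[OF that] by auto
    moreover have "0 \<le> \<Lambda>1 * norm \<xi> powr p" using \<Lambda> by simp
    ultimately show ?thesis by linarith
  qed
  have kF_le: "\<bar>\<mu> * (k x * primitive f t)\<bar> \<le> \<mu> * (K * (C + \<bar>t\<bar> powr p))" if "x \<in> \<Omega>" for x t
    unfolding abs_mult using K \<Omega>_closure[OF that] C \<mu>_pos by (intro mult_mono) auto
  have inO: "AE x in M. x \<in> \<Omega>" by (rule AE_M_I)
  have all: "AE x in M. x \<in> \<Omega> \<and> (\<lambda>n. w n x) \<longlonglongrightarrow> u x \<and> (\<lambda>n. W n x) \<longlonglongrightarrow> U x \<and> (\<forall>n. \<bar>w n x\<bar> powr p \<le> H x \<and> norm (W n x) powr p \<le> H x)"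
    using inO lim dom by eventually_elim auto
  have mA: "(\<lambda>x. A x (U x)) \<in> borel_measurable M" "\<And>n. (\<lambda>x. A x (W n x)) \<in> borel_measurable M"
    by (intro J_measurable(1)[OF m(3)] m)+
  have mJ: "(\<lambda>x. A x (U x) - \<mu> * (k x * primitive f (u x))) \<in> borel_measurable M"
    "\<And>n. (\<lambda>x. A x (W n x) - \<mu> * (k x * primitive f (w n x))) \<in> borel_measurable M"
    by (intro borel_measurable_diff borel_measurable_times borel_measurable_const mA J_measurable(2)[OF _ m(4)] m)+
  show "(\<lambda>n. Phi (W n)) \<longlonglongrightarrow> Phi U"
    unfolding Phi_def
  proof (rule integral_dominated_convergence[OF mA, where w="\<lambda>x. \<Lambda>2 * H x"])
    show "integrable M (\<lambda>x. \<Lambda>2 * H x)" using H by simp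
    show "AE x in M. (\<lambda>n. A x (W n x)) \<longlonglongrightarrow> A x (U x)"
      using all by eventually_elim (use A_isCont isCont_tendsto_compose in blast)
    show "AE x in M. norm (A x (W n x)) \<le> \<Lambda>2 * H x" for n
      using all
    proof eventually_elim
      case (elim x)
      then have "norm (W n x) powr p \<le> H x" by blast
      then have "\<Lambda>2 * norm (W n x) powr p \<le> \<Lambda>2 * H x" using \<Lambda> by (intro mult_left_mono) auto
      then show ?case using A_le[of x "W n x"] elim by simp
    qed
  qed
  show "(\<lambda>n. J (w n) (W n)) \<longlonglongrightarrow> J u U"
    unfolding J_def
  proof (rule integral_dominated_convergence[OF mJ, where w="\<lambda>x. \<Lambda>2 * H x + \<mu> * (K * (C + H x))"])
    show "integrable M (\<lambda>x. \<Lambda>2 * H x + \<mu> * (K * (C + H x)))" using H integrable_const_M by simp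
    show "AE x in M. (\<lambda>n. A x (W n x) - \<mu> * (k x * primitive f (w n x))) \<longlonglongrightarrow> A x (U x) - \<mu> * (k x * primitive f (u x))"
      using all
    proof eventually_elim
      case (elim x)
      then show ?case
        by (intro tendsto_intros isCont_tendsto_compose[OF A_isCont] isCont_tendsto_compose[OF primitive_isCont]) auto
    qed
    show "AE x in M. norm (A x (W n x) - \<mu> * (k x * primitive f (w n x))) \<le> \<Lambda>2 * H x + \<mu> * (K * (C + H x))" for n
      using all
    proof eventually_elim
      case (elim x)
      then have h: "norm (W n x) powr p \<le> H x" "\<bar>w n x\<bar> powr p \<le> H x" by blast+
      then have "\<Lambda>2 * norm (W n x) powr p \<le> \<Lambda>2 * H x" using \<Lambda> by (intro mult_left_mono) auto
      moreover have "\<mu> * (K * (C + \<bar>w n x\<bar> powr p)) \<le> \<mu> * (K * (C + H x))"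
        using h \<mu>_pos K by (intro mult_left_mono add_left_mono) auto
      ultimately show ?case using A_le[of x "W n x"] kF_le[of x "w n x"] elim unfolding real_norm_def by linarith
    qed
  qed
  assume \<phi>: "\<phi> \<in> T"
  obtain B where B: "B > 0" "\<And>x. \<bar>\<phi> x\<bar> \<le> B" "\<And>x. norm (grad \<phi> x) \<le> B" using test_functions_bounded[OF \<phi>] by metis
  obtain c where c: "c > 0"
    "\<And>x \<xi> \<eta>. x \<in> \<Omega> \<Longrightarrow> \<bar>a x \<xi> \<bullet> \<eta>\<bar> \<le> c * ((1 + norm \<xi> powr (p - 1)) * norm \<eta>)"
    "\<And>x t d. x \<in> \<Omega> \<Longrightarrow> \<bar>k x * f t * d\<bar> \<le> c * ((1 + \<bar>t\<bar> powr (p - 1)) * \<bar>d\<bar>)"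
    using a_pairing_bound by blast
  have mt: "\<phi> \<in> borel_measurable M" "grad \<phi> \<in> borel_measurable M"
    using in_Lp_test[OF \<phi>] by (auto simp: in_Lp_def)
  have mL: "(\<lambda>x. a x (U x) \<bullet> grad \<phi> x - \<mu> * (k x * f (u x) * \<phi> x)) \<in> borel_measurable M"
    "\<And>n. (\<lambda>x. a x (W n x) \<bullet> grad \<phi> x - \<mu> * (k x * f (w n x) * \<phi> x)) \<in> borel_measurable M"
    by (intro borel_measurable_diff borel_measurable_times[OF borel_measurable_const] borel_measurable_times[OF J_measurable(4)[OF _ m(4)]]
      borel_measurable_inner J_measurable(3)[OF m(3)] m mt)+
  show "(\<lambda>n. L (w n) (W n) \<phi> (grad \<phi>)) \<longlonglongrightarrow> L u U \<phi> (grad \<phi>)"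
    unfolding L_def
  proof (rule integral_dominated_convergence[OF mL, where w="\<lambda>x. (c + \<mu> * c) * ((2 + H x) * B)"])
    show "integrable M (\<lambda>x. (c + \<mu> * c) * ((2 + H x) * B))" using H integrable_const_M by simp
    show "AE x in M. (\<lambda>n. a x (W n x) \<bullet> grad \<phi> x - \<mu> * (k x * f (w n x) * \<phi> x)) \<longlonglongrightarrow> a x (U x) \<bullet> grad \<phi> x - \<mu> * (k x * f (u x) * \<phi> x)"
      using all
    proof eventually_elim
      case (elim x)
      then show ?case
        by (intro tendsto_intros isCont_tendsto_compose[OF a_isCont] isCont_tendsto_compose[OF f_isCont]) auto
    qed
    show "AE x in M. norm (a x (W n x) \<bullet> grad \<phi> x - \<mu> * (k x * f (w n x) * \<phi> x)) \<le> (c + \<mu> * c) * ((2 + H x) * B)" for n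
      using all
    proof eventually_elim
      case (elim x)
      have h: "1 + norm (W n x) powr (p - 1) \<le> 2 + H x" "1 + \<bar>w n x\<bar> powr (p - 1) \<le> 2 + H x"
        using powr_le_one_add_powr[of "norm (W n x)" "p - 1" p] powr_le_one_add_powr[of "\<bar>w n x\<bar>" "p - 1" p] p elim
        by (auto intro: order_trans add_left_mono dest!: spec[of _ n])
      have "(1 + norm (W n x) powr (p - 1)) * norm (grad \<phi> x) \<le> (2 + H x) * B"
        using h B by (intro mult_mono) (auto intro: order_trans[OF _ h(1)] add_nonneg_nonneg)
      then have "\<bar>a x (W n x) \<bullet> grad \<phi> x\<bar> \<le> c * ((2 + H x) * B)"
        using c(1) c(2)[of x "W n x" "grad \<phi> x"] elim mult_left_mono[of _ _ c] by (meson less_imp_le order_trans)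
      moreover have "(1 + \<bar>w n x\<bar> powr (p - 1)) * \<bar>\<phi> x\<bar> \<le> (2 + H x) * B"
        using h B by (intro mult_mono) (auto intro: order_trans[OF _ h(1)] add_nonneg_nonneg)
      then have "\<bar>k x * f (w n x) * \<phi> x\<bar> \<le> c * ((2 + H x) * B)"
        using c(1) c(3)[of x "w n x" "\<phi> x"] elim mult_left_mono[of _ _ c] by (meson less_imp_le order_trans)
      then have "\<bar>\<mu> * (k x * f (w n x) * \<phi> x)\<bar> \<le> \<mu> * (c * ((2 + H x) * B))"
        using \<mu>_pos by (simp add: abs_mult)
      moreover have "(c + \<mu> * c) * ((2 + H x) * B) = c * ((2 + H x) * B) + \<mu> * (c * ((2 + H x) * B))" by (simp add: algebra_simps)
      ultimately show ?case unfolding real_norm_def by linarith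
    qed
  qed
qed

text \<open>Integration by parts passes to the limit because \<phi> and its derivative are bounded
  and t \<le> 1 + t^p turns H into a majorant.\<close>

lemma weak_gradient_limit:
  fixes w :: "nat \<Rightarrow> 'a \<Rightarrow> real"
  assumes w: "\<And>n. w n \<in> T" and u: "in_Lp \<Omega> p u" and U: "in_Lp \<Omega> p U"
    and H: "integrable M H"
    and lim: "AE x in M. (\<lambda>n. w n x) \<longlonglongrightarrow> u x" "AE x in M. (\<lambda>n. grad (w n) x) \<longlonglongrightarrow> U x"
    and dom: "AE x in M. \<forall>n. \<bar>w n x\<bar> powr p \<le> H x" "AE x in M. \<forall>n. norm (grad (w n) x) powr p \<le> H x"
  shows "has_weak_gradient \<Omega> u U"
  unfolding has_weak_gradient_def
proof (intro conjI ballI)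
  show "locally_integrable \<Omega> u" "locally_integrable \<Omega> U" using in_Lp_locally_integrable(2) u U by blast+
  fix \<phi> and b :: 'a assume \<phi>: "\<phi> \<in> T" and b: "b \<in> Basis"
  have d\<phi>: "(\<lambda>x. frechet_derivative \<phi> (at x) b) \<in> T" by (rule test_functions_partial_derivative[OF \<phi> b])
  have mt: "\<phi> \<in> borel_measurable M" "(\<lambda>x. frechet_derivative \<phi> (at x) b) \<in> borel_measurable M"
    using in_Lp_test(1)[OF \<phi>] in_Lp_test(1)[OF d\<phi>] by (auto simp: in_Lp_def)
  have m: "u \<in> borel_measurable M" "U \<in> borel_measurable M" "\<And>n. w n \<in> borel_measurable M" "\<And>n. grad (w n) \<in> borel_measurable M"
    using u U in_Lp_test[OF w] by (auto simp: in_Lp_def)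
  obtain B1 where B1: "B1 > 0" "\<And>x. \<bar>\<phi> x\<bar> \<le> B1" using test_functions_bounded[OF \<phi>] by metis
  obtain B2 where B2: "B2 > 0" "\<And>x. \<bar>frechet_derivative \<phi> (at x) b\<bar> \<le> B2" using test_functions_bounded[OF d\<phi>] by metis
  have 1: "(\<lambda>n. LINT x|M. w n x * frechet_derivative \<phi> (at x) b) \<longlonglongrightarrow> (LINT x|M. u x * frechet_derivative \<phi> (at x) b)"
  proof (rule integral_dominated_convergence[where w="\<lambda>x. (1 + H x) * B2"])
    show "integrable M (\<lambda>x. (1 + H x) * B2)" using H integrable_const_M by simp
    show "AE x in M. (\<lambda>n. w n x * frechet_derivative \<phi> (at x) b) \<longlonglongrightarrow> u x * frechet_derivative \<phi> (at x) b"
      using lim(1) by eventually_elim (intro tendsto_intros)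
    show "AE x in M. norm (w n x * frechet_derivative \<phi> (at x) b) \<le> (1 + H x) * B2" for n
      using dom(1)
    proof eventually_elim
      case (elim x)
      have "\<bar>w n x\<bar> \<le> 1 + H x" using le_one_add_powr[of "\<bar>w n x\<bar>" p] p elim by (auto intro: order_trans dest!: spec[of _ n])
      then show ?case unfolding real_norm_def abs_mult using B2 by (intro mult_mono) auto
    qed
  qed (intro borel_measurable_times m mt)+
  have 2: "(\<lambda>n. LINT x|M. (grad (w n) x \<bullet> b) * \<phi> x) \<longlonglongrightarrow> (LINT x|M. (U x \<bullet> b) * \<phi> x)"
  proof (rule integral_dominated_convergence[where w="\<lambda>x. (1 + H x) * B1"])
    show "integrable M (\<lambda>x. (1 + H x) * B1)" using H integrable_const_M by simp
    show "AE x in M. (\<lambda>n. (grad (w n) x \<bullet> b) * \<phi> x) \<longlonglongrightarrow> (U x \<bullet> b) * \<phi> x"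
      using lim(2) by eventually_elim (intro tendsto_intros)
    show "AE x in M. norm ((grad (w n) x \<bullet> b) * \<phi> x) \<le> (1 + H x) * B1" for n
      using dom(2)
    proof eventually_elim
      case (elim x)
      have "norm (grad (w n) x) \<le> 1 + H x" using le_one_add_powr[of "norm (grad (w n) x)" p] p elim by (auto intro: order_trans dest!: spec[of _ n])
      then have "\<bar>grad (w n) x \<bullet> b\<bar> \<le> 1 + H x" using Basis_le_norm[OF b, of "grad (w n) x"] by linarith
      then show ?case unfolding real_norm_def abs_mult using B1 by (intro mult_mono) auto
    qed
  qed (intro borel_measurable_times borel_measurable_inner borel_measurable_const m mt)+
  have "(LINT x|M. w n x * frechet_derivative \<phi> (at x) b) = - (LINT x|M. (grad (w n) x \<bullet> b) * \<phi> x)" for n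
    using has_weak_gradient_test_function[OF open_\<Omega> w] \<phi> b by (simp add: has_weak_gradient_def)
  then have "(\<lambda>n. LINT x|M. w n x * frechet_derivative \<phi> (at x) b) \<longlonglongrightarrow> - (LINT x|M. (U x \<bullet> b) * \<phi> x)"
    using tendsto_minus[OF 2] by simp
  then show "(LINT x|M. u x * frechet_derivative \<phi> (at x) b) = - (LINT x|M. (U x \<bullet> b) * \<phi> x)"
    using LIMSEQ_unique[OF 1] by blast
qed

text \<open>Compactness in two stages: Rellich's theorem makes the functions converge, and testing
  with their differences upgrades this to the gradients. The hypotheses on E say that the spaces are
  nested, closed under differences and jointly dense in the C^1 sense.\<close>

theorem galerkin_limit:
  fixes w :: "nat \<Rightarrow> 'a \<Rightarrow> real" and E :: "nat \<Rightarrow> ('a \<Rightarrow> real) set"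
  assumes ET: "\<And>n \<phi>. \<phi> \<in> E n \<Longrightarrow> \<phi> \<in> T" and mono: "\<And>m n. m \<le> n \<Longrightarrow> E m \<subseteq> E n"
    and diff: "\<And>n \<phi> \<psi>. \<phi> \<in> E n \<Longrightarrow> \<psi> \<in> E n \<Longrightarrow> (\<lambda>x. \<phi> x - \<psi> x) \<in> E n"
    and dense: "\<And>\<phi> s. \<phi> \<in> T \<Longrightarrow> s > 0 \<Longrightarrow> \<exists>n. \<exists>\<psi>\<in>E n. \<forall>x\<in>\<Omega>. \<bar>\<phi> x - \<psi> x\<bar> < s \<and> norm (grad \<phi> x - grad \<psi> x) < s"
    and wE: "\<And>n. w n \<in> E n" and crit: "\<And>n \<phi>. \<phi> \<in> E n \<Longrightarrow> L (w n) (grad (w n)) \<phi> (grad \<phi>) = 0"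
    and JB: "\<And>n. J (w n) (grad (w n)) \<le> B"
  obtains u U r where "weak_solution \<Omega> p a k f \<mu> u" "has_weak_gradient \<Omega> u U" "in_Lp \<Omega> p u" "in_Lp \<Omega> p U" "strict_mono (r :: nat \<Rightarrow> nat)"
    "(\<lambda>n. J (w (r n)) (grad (w (r n)))) \<longlonglongrightarrow> J u U" "(\<lambda>n. Phi (grad (w (r n)))) \<longlonglongrightarrow> Phi U"
proof -
  have wT: "w n \<in> T" for n by (rule ET[OF wE])
  obtain C1 C2 where C12: "C1 > 0" "\<And>\<phi>. \<phi> \<in> T \<Longrightarrow> (LINT x|M. norm (grad \<phi> x) powr p) \<le> C1 * J \<phi> (grad \<phi>) + C2"
    using J_coercive by blast
  define N where "N = C1 * B + C2"
  have gN: "(LINT x|M. norm (grad (w n) x) powr p) \<le> N" for n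
    using C12(2)[OF wT, of n] mult_left_mono[OF JB[of n] less_imp_le[OF C12(1)]] by (simp add: N_def)
  then have gN': "(LINT x|lborel. norm (grad (w n) x) powr p) \<le> N" for n using LINT_test(2)[OF wT p0] by metis
  obtain r1 :: "nat \<Rightarrow> nat" where r1: "strict_mono r1"
    "\<And>e. e > 0 \<Longrightarrow> \<exists>K. \<forall>m\<ge>K. \<forall>n\<ge>K. (LINT x|lborel. \<bar>w (r1 m) x - w (r1 n) x\<bar> powr p) < e"
    by (rule Rellich_test_functions[where \<phi>=w, OF wT p open_\<Omega> bounded_\<Omega> gN']) blast
  have PhiB: "\<bar>Phi (grad (w n))\<bar> \<le> \<Lambda>2 * N" for n
  proof -
    have "(LINT x|M. norm (grad (w n) x) powr p) \<ge> 0" by simp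
    then have "0 \<le> \<Lambda>1 * (LINT x|M. norm (grad (w n) x) powr p)" using \<Lambda> by simp
    moreover have "\<Lambda>2 * (LINT x|M. norm (grad (w n) x) powr p) \<le> \<Lambda>2 * N" using gN[of n] \<Lambda> by simp
    ultimately show ?thesis using Phi_bounds[OF in_Lp_test(2)[OF wT], of n] by linarith
  qed
  \<comment> \<open>The subsequence lemma treats countably many sequences; here all of them are the
    same sequence of values of \<Phi>.\<close>
  obtain r2 :: "nat \<Rightarrow> nat" and l where r2: "strict_mono r2" "\<And>i::nat. (\<lambda>n. Phi (grad (w (r1 (r2 n))))) \<longlonglongrightarrow> l i"
    by (rule simultaneous_convergent_subsequence[of "\<lambda>n i. Phi (grad (w (r1 n)))" "\<lambda>i. \<Lambda>2 * N", OF PhiB]) blast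
  define s where "s n = r1 (r2 n)" for n
  have s: "strict_mono s" unfolding s_def using strict_mono_compose[OF r1(1) r2(1)] by simp
  define W where "W n = w (s n)" for n
  have WT: "W n \<in> T" for n by (simp add: W_def wT)
  note WL = in_Lp_test(1)[OF WT] in_Lp_test(2)[OF WT]
  have WC: "\<exists>K. \<forall>m\<ge>K. \<forall>n\<ge>K. (LINT x|M. \<bar>W m x - W n x\<bar> powr p) < e" if e: "e > 0" for e
  proof -
    obtain K where K: "\<And>m n. m \<ge> K \<Longrightarrow> n \<ge> K \<Longrightarrow> (LINT x|lborel. \<bar>w (r1 m) x - w (r1 n) x\<bar> powr p) < e" using r1(2)[OF e] by blast
    have "(LINT x|M. \<bar>W m x - W n x\<bar> powr p) < e" if "m \<ge> K" "n \<ge> K" for m n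
      using K[of "r2 m" "r2 n"] that order_trans[OF _ seq_suble[OF r2(1)]]
      unfolding LINT_test(1)[OF test_functions_diff[OF WT WT] p0] by (simp add: W_def s_def)
    then show ?thesis by blast
  qed
  obtain R where R: "\<Omega> \<subseteq> cball 0 R" "R > 0"
    using bounded_\<Omega> unfolding bounded_pos by (auto simp: subset_iff)
  define B2 where "B2 = (2 * R + 1) powr p * N"
  have WB: "(LINT x|M. \<bar>W n x\<bar> powr p) \<le> B2" for n
    unfolding B2_def LINT_test(1)[OF WT p0]
    by (rule order_trans[OF Poincare_test_functions[OF WT p R] mult_left_mono]) (auto simp: W_def gN')
  obtain k0 where k0: "k0 > 0" "\<And>U V. in_Lp \<Omega> p U \<Longrightarrow> in_Lp \<Omega> p V \<Longrightarrow>
    k0 * (LINT x|M. norm (V x - U x) powr p) \<le> (Phi V - Phi U) - (LINT x|M. a x (U x) \<bullet> (V x - U x))"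
    using Phi_uniformly_convex by blast
  obtain c where c: "c > 0"
    "\<And>x \<xi> \<eta>. x \<in> \<Omega> \<Longrightarrow> \<bar>a x \<xi> \<bullet> \<eta>\<bar> \<le> c * ((1 + norm \<xi> powr (p - 1)) * norm \<eta>)"
    "\<And>x t d. x \<in> \<Omega> \<Longrightarrow> \<bar>k x * f t * d\<bar> \<le> c * ((1 + \<bar>t\<bar> powr (p - 1)) * \<bar>d\<bar>)"
    using a_pairing_bound by blast
  have gd: "grad (\<lambda>x. W m x - W n x) = (\<lambda>x. grad (W m) x - grad (W n) x)" for m n
    by (rule ext) (rule grad_diff[OF test_functions_smooth[OF WT] test_functions_smooth[OF WT]])
  \<comment> \<open>For m \<le> n the function W m lies in the space in which W n is critical, so
    their difference may be used as a test function. This replaces the flux term in the convexity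
    estimate by one without gradients.\<close>
  have key: "k0 * (LINT x|M. norm (grad (W m) x - grad (W n) x) powr p)
      \<le> (Phi (grad (W m)) - Phi (grad (W n))) + \<mu> * (c * (LINT x|M. (1 + norm (W n x) powr (p - 1)) * norm (W m x - W n x)))" if mn: "m \<le> n" for m n
  proof -
    have "s m \<le> s n" using s mn by (simp add: strict_mono_less_eq)
    then have "W m \<in> E (s n)" using mono wE[of "s m"] by (auto simp: W_def)
    then have "L (W n) (grad (W n)) (\<lambda>x. W m x - W n x) (grad (\<lambda>x. W m x - W n x)) = 0"
      using crit[OF diff[OF _ wE], of "W m" "s n"] by (simp add: W_def)
    then have L0: "L (W n) (grad (W n)) (\<lambda>x. W m x - W n x) (\<lambda>x. grad (W m) x - grad (W n) x) = 0" by (simp add: gd)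
    note d = in_Lp_diff[OF p0 WL(1)[of m] WL(1)[of n]] in_Lp_diff[OF p0 WL(2)[of m] WL(2)[of n]]
    note i = L_integrable[OF WL(1)[of n] WL(2)[of n] d]
    have e: "(LINT x|M. a x (grad (W n) x) \<bullet> (grad (W m) x - grad (W n) x)) = \<mu> * (LINT x|M. k x * f (W n x) * (W m x - W n x))"
      using L0 i by (simp add: L_def)
    have "\<bar>LINT x|M. k x * f (W n x) * (W m x - W n x)\<bar> \<le> (LINT x|M. \<bar>k x * f (W n x) * (W m x - W n x)\<bar>)" by (rule integral_abs_bound)
    also have "\<dots> \<le> (LINT x|M. c * ((1 + norm (W n x) powr (p - 1)) * norm (W m x - W n x)))"
      using i pairing_integrable[OF WL(1)[of n] d(1)] c(3) by (intro integral_mono integrable_abs) (auto simp: space_M)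
    finally have "\<bar>LINT x|M. k x * f (W n x) * (W m x - W n x)\<bar> \<le> c * (LINT x|M. (1 + norm (W n x) powr (p - 1)) * norm (W m x - W n x))" by simp
    then have "\<mu> * \<bar>LINT x|M. k x * f (W n x) * (W m x - W n x)\<bar> \<le> \<mu> * (c * (LINT x|M. (1 + norm (W n x) powr (p - 1)) * norm (W m x - W n x)))"
      using \<mu>_pos by (intro mult_left_mono) auto
    moreover have "- (\<mu> * (LINT x|M. k x * f (W n x) * (W m x - W n x))) \<le> \<mu> * \<bar>LINT x|M. k x * f (W n x) * (W m x - W n x)\<bar>"
      using \<mu>_pos abs_ge_minus_self[of "\<mu> * (LINT x|M. k x * f (W n x) * (W m x - W n x))"] by (simp add: abs_mult)
    ultimately have "- (\<mu> * (LINT x|M. k x * f (W n x) * (W m x - W n x))) \<le> \<mu> * (c * (LINT x|M. (1 + norm (W n x) powr (p - 1)) * norm (W m x - W n x)))"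
      by linarith
    then show ?thesis using k0(2)[OF WL(2)[of n] WL(2)[of m]] unfolding e by linarith
  qed
  have "convergent (\<lambda>n. Phi (grad (W n)))" using r2(2)[of 0] by (auto simp: convergent_def W_def s_def)
  then have CPhi: "Cauchy (\<lambda>n. Phi (grad (W n)))" by (rule convergent_Cauchy)
  have GC: "\<exists>K. \<forall>m\<ge>K. \<forall>n\<ge>K. (LINT x|M. norm (grad (W m) x - grad (W n) x) powr p) < e" if e: "e > 0" for e
  proof -
    define e1 where "e1 = k0 * e / 2"
    have e1: "e1 > 0" using e k0 by (simp add: e1_def)
    have e2: "e1 / (\<mu> * c) > 0" using e1 \<mu>_pos c by simp
    obtain \<eta> where \<eta>: "\<eta> > 0" "\<And>(U :: 'a \<Rightarrow> real) (V :: 'a \<Rightarrow> real). in_Lp \<Omega> p U \<Longrightarrow> in_Lp \<Omega> p V \<Longrightarrow>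
      (LINT x|M. norm (U x) powr p) \<le> B2 \<Longrightarrow> (LINT x|M. norm (V x) powr p) < \<eta> \<Longrightarrow>
      (LINT x|M. (1 + norm (U x) powr (p - 1)) * norm (V x)) < e1 / (\<mu> * c)"
      by (rule pairing_small[OF e2, where ?'b=real and ?'c=real and C=B2]) blast
    obtain K1 where K1: "\<And>m n. m \<ge> K1 \<Longrightarrow> n \<ge> K1 \<Longrightarrow> (LINT x|M. \<bar>W m x - W n x\<bar> powr p) < \<eta>" using WC[OF \<eta>(1)] by blast
    obtain K2 where K2: "\<And>m n. m \<ge> K2 \<Longrightarrow> n \<ge> K2 \<Longrightarrow> \<bar>Phi (grad (W m)) - Phi (grad (W n))\<bar> < e1"
      using CPhi e1 unfolding Cauchy_def dist_real_def by blast
    have le: "(LINT x|M. norm (grad (W m) x - grad (W n) x) powr p) < e" if mn: "m \<le> n" "m \<ge> max K1 K2" for m n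
    proof -
      have "(LINT x|M. (1 + norm (W n x) powr (p - 1)) * norm (W m x - W n x)) < e1 / (\<mu> * c)"
        using K1[of m n] mn WB[of n] by (intro \<eta>(2) WL in_Lp_diff[OF p0]) auto
      then have "\<mu> * (c * (LINT x|M. (1 + norm (W n x) powr (p - 1)) * norm (W m x - W n x))) < e1"
        using \<mu>_pos c by (simp add: field_simps)
      then have "k0 * (LINT x|M. norm (grad (W m) x - grad (W n) x) powr p) < e1 + e1"
        using key[OF mn(1)] K2[of m n] mn by linarith
      then have "k0 * (LINT x|M. norm (grad (W m) x - grad (W n) x) powr p) < k0 * e" by (simp add: e1_def mult.commute)
      then show ?thesis using k0(1) by simp
    qed
    show ?thesis
    proof (intro exI[of _ "max K1 K2"] allI impI)
      fix m n assume "m \<ge> max K1 K2" "n \<ge> max K1 K2"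
      then show "(LINT x|M. norm (grad (W m) x - grad (W n) x) powr p) < e"
        using le[of m n] le[of n m] by (cases "m \<le> n") (simp_all add: norm_minus_commute)
    qed
  qed
  \<comment> \<open>Pairing function and gradient makes a single application of completeness yield a
    common subsequence and a common majorant.\<close>
  define F where "F n x = (W n x, grad (W n) x)" for n x
  have Fm: "F n \<in> borel_measurable M" for n
    unfolding F_def using WL[of n] by (intro borel_measurable_Pair) (auto simp: in_Lp_def)
  have nP: "norm (y, z) powr p \<le> 2 powr p * (norm y powr p + norm z powr p)" for y :: real and z :: 'a
    by (rule order_trans[OF powr_mono2[OF _ _ norm_Pair_le] powr_add_le]) (use p0 in auto)
  have iP: "integrable M (\<lambda>x. norm (y x, z x) powr p)" if "in_Lp \<Omega> p y" "in_Lp \<Omega> p z" for y :: "'a \<Rightarrow> real" and z :: "'a \<Rightarrow> 'a"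
  proof (rule Bochner_Integration.integrable_bound)
    show "integrable M (\<lambda>x. 2 powr p * (norm (y x) powr p + norm (z x) powr p))" using that by (simp add: in_Lp_def)
    show "(\<lambda>x. norm (y x, z x) powr p) \<in> borel_measurable M"
      using that by (intro borel_measurable_norm_powr borel_measurable_Pair) (auto simp: in_Lp_def)
    show "AE x in M. norm (norm (y x, z x) powr p) \<le> norm (2 powr p * (norm (y x) powr p + norm (z x) powr p))"
      using nP by (intro AE_I2) (simp add: order_trans[OF _ abs_ge_self])
  qed
  have FC: "\<exists>K. \<forall>m\<ge>K. \<forall>n\<ge>K. (LINT x|M. norm (F m x - F n x) powr p) < e" if e: "e > 0" for e
  proof -
    define e1 where "e1 = e / (2 powr p * 2)"
    have e1: "e1 > 0" using e by (simp add: e1_def)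
    obtain K1 where K1: "\<And>m n. m \<ge> K1 \<Longrightarrow> n \<ge> K1 \<Longrightarrow> (LINT x|M. \<bar>W m x - W n x\<bar> powr p) < e1" using WC[OF e1] by blast
    obtain K2 where K2: "\<And>m n. m \<ge> K2 \<Longrightarrow> n \<ge> K2 \<Longrightarrow> (LINT x|M. norm (grad (W m) x - grad (W n) x) powr p) < e1" using GC[OF e1] by blast
    have "(LINT x|M. norm (F m x - F n x) powr p) < e" if "m \<ge> max K1 K2" "n \<ge> max K1 K2" for m n
    proof -
      note d = in_Lp_diff[OF p0 WL(1)[of m] WL(1)[of n]] in_Lp_diff[OF p0 WL(2)[of m] WL(2)[of n]]
      have "(LINT x|M. norm (F m x - F n x) powr p) \<le> (LINT x|M. 2 powr p * (norm (W m x - W n x) powr p + norm (grad (W m) x - grad (W n) x) powr p))"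
        using iP[OF d] d nP by (intro integral_mono) (auto simp: F_def in_Lp_def)
      also have "\<dots> = 2 powr p * ((LINT x|M. norm (W m x - W n x) powr p) + (LINT x|M. norm (grad (W m) x - grad (W n) x) powr p))"
        using d by (simp add: in_Lp_def)
      also have "\<dots> < 2 powr p * (e1 + e1)" using K1[of m n] K2[of m n] that by (intro mult_strict_left_mono add_strict_mono) auto
      also have "\<dots> = e" by (simp add: e1_def)
      finally show ?thesis .
    qed
    then show ?thesis by blast
  qed
  have Fi: "integrable M (\<lambda>x. norm (F n x) powr p)" for n unfolding F_def by (rule iP[OF WL])
  obtain r g H where rg: "strict_mono (r :: nat \<Rightarrow> nat)" "g \<in> borel_measurable M" "integrable M H"
    "AE x in M. (\<lambda>n. F (r n) x) \<longlonglongrightarrow> g x" "AE x in M. \<forall>n. norm (F (r n) x) powr p \<le> H x"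
    "integrable M (\<lambda>x. norm (g x) powr p)" "AE x in M. norm (g x) powr p \<le> H x"
    "(\<lambda>n. LINT x|M. norm (F (r n) x - g x) powr p) \<longlonglongrightarrow> 0"
    by (rule Lp_complete[where f=F, OF p0 Fm Fi FC]) blast
  define u where "u x = fst (g x)" for x
  define U where "U x = snd (g x)" for x
  have fle: "norm (fst z) powr p \<le> norm z powr p" "norm (snd z) powr p \<le> norm z powr p" for z :: "real \<times> 'a"
    using norm_fst_le[of "fst z" "snd z"] norm_snd_le[of "snd z" "fst z"] p0 by (auto intro!: powr_mono2)
  have "fst \<in> borel_measurable (borel :: (real \<times> 'a) measure)" "snd \<in> borel_measurable (borel :: (real \<times> 'a) measure)"
    by (intro borel_measurable_continuous_onI continuous_intros)+
  then have mu: "u \<in> borel_measurable M" "U \<in> borel_measurable M"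
    unfolding u_def U_def using measurable_compose[OF rg(2)] by blast+
  have u: "in_Lp \<Omega> p u"
    unfolding in_Lp_def
  proof (intro conjI mu(1) Bochner_Integration.integrable_bound[OF rg(6)] borel_measurable_norm_powr AE_I2)
    show "norm (norm (u x) powr p) \<le> norm (norm (g x) powr p)" for x using fle(1)[of "g x"] by (simp add: u_def)
  qed
  have U: "in_Lp \<Omega> p U"
    unfolding in_Lp_def
  proof (intro conjI mu(2) Bochner_Integration.integrable_bound[OF rg(6)] borel_measurable_norm_powr AE_I2)
    show "norm (norm (U x) powr p) \<le> norm (norm (g x) powr p)" for x using fle(2)[of "g x"] by (simp add: U_def)
  qed
  have lim1: "AE x in M. (\<lambda>n. W (r n) x) \<longlonglongrightarrow> u x"
    using rg(4)
  proof eventually_elim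
    case (elim x)
    from tendsto_fst[OF elim] show ?case by (simp add: F_def u_def)
  qed
  have lim2: "AE x in M. (\<lambda>n. grad (W (r n)) x) \<longlonglongrightarrow> U x"
    using rg(4)
  proof eventually_elim
    case (elim x)
    from tendsto_snd[OF elim] show ?case by (simp add: F_def U_def)
  qed
  note lim = lim1 lim2
  have dom1: "AE x in M. \<forall>n. \<bar>W (r n) x\<bar> powr p \<le> H x"
    using rg(5)
  proof eventually_elim
    case (elim x)
    show ?case
    proof
      fix n show "\<bar>W (r n) x\<bar> powr p \<le> H x"
        using order_trans[OF fle(1)[of "F (r n) x"] elim[rule_format, of n]] by (simp add: F_def)
    qed
  qed
  have dom2: "AE x in M. \<forall>n. norm (grad (W (r n)) x) powr p \<le> H x"
    using rg(5)
  proof eventually_elim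
    case (elim x)
    show ?case
    proof
      fix n show "norm (grad (W (r n)) x) powr p \<le> H x"
        using order_trans[OF fle(2)[of "F (r n) x"] elim[rule_format, of n]] by (simp add: F_def)
    qed
  qed
  note dom = dom1 dom2
  have mW: "W (r n) \<in> borel_measurable M" "grad (W (r n)) \<in> borel_measurable M" for n
    using WL[of "r n"] by (auto simp: in_Lp_def)
  note ft = functionals_tendsto[of "\<lambda>n. W (r n)" "\<lambda>n. grad (W (r n))", OF mW mu rg(3) lim dom]
  have wg: "has_weak_gradient \<Omega> u U" by (rule weak_gradient_limit[OF WT u U rg(3) lim dom])
  have ws: "weak_solution \<Omega> p a k f \<mu> u"
  proof (rule weak_solutionI[OF u U wg, where D="\<Union>n. E n"])
    fix \<epsilon> :: real assume "\<epsilon> > 0"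
    then have "eventually (\<lambda>n. (LINT x|M. norm (F (r n) x - g x) powr p) < \<epsilon>) sequentially"
      by (rule order_tendstoD(2)[OF rg(8)])
    then obtain n where n: "(LINT x|M. norm (F (r n) x - g x) powr p) < \<epsilon>" by (auto simp: eventually_sequentially)
    let ?w = "W (r n)"
    note d = in_Lp_diff[OF p0 u WL(1)[of "r n"]] in_Lp_diff[OF p0 U WL(2)[of "r n"]]
    have eq: "norm (F (r n) x - g x) = norm (u x - ?w x, U x - grad ?w x)" for x
    proof -
      have "F (r n) x - g x = - (u x - ?w x, U x - grad ?w x)" by (simp add: F_def u_def U_def prod_eq_iff)
      then show ?thesis by (simp only: norm_minus_cancel)
    qed
    have i: "integrable M (\<lambda>x. norm (F (r n) x - g x) powr p)" unfolding eq by (rule iP[OF d])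
    have "(LINT x|M. \<bar>u x - ?w x\<bar> powr p) \<le> (LINT x|M. norm (F (r n) x - g x) powr p)"
      using d(1) fle(1)[of "(u _ - ?w _, U _ - grad ?w _)"] by (intro integral_mono i) (auto simp: in_Lp_def eq)
    moreover have "(LINT x|M. norm (U x - grad ?w x) powr p) \<le> (LINT x|M. norm (F (r n) x - g x) powr p)"
      using d(2) fle(2)[of "(u _ - ?w _, U _ - grad ?w _)"] by (intro integral_mono i) (auto simp: in_Lp_def eq)
    ultimately show "\<exists>\<phi>\<in>T. (LINT x|M. \<bar>u x - \<phi> x\<bar> powr p) < \<epsilon> \<and> (LINT x|M. norm (U x - grad \<phi> x) powr p) < \<epsilon>"
      using n WT by (intro bexI[of _ ?w]) auto
  next
    show "\<exists>\<psi>\<in>\<Union>n. E n. \<psi> \<in> T \<and> (\<forall>x\<in>\<Omega>. \<bar>\<phi> x - \<psi> x\<bar> < t \<and> norm (grad \<phi> x - grad \<psi> x) < t)" if "\<phi> \<in> T" "t > 0" for \<phi> t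
      using dense[OF that] ET by blast
  next
    fix \<psi> assume "\<psi> \<in> (\<Union>n. E n)"
    then obtain m where m: "\<psi> \<in> E m" by blast
    have "eventually (\<lambda>n. L (W (r n)) (grad (W (r n))) \<psi> (grad \<psi>) = 0) sequentially"
    proof (rule eventually_sequentiallyI[of m])
      fix n assume "m \<le> n"
      \<comment> \<open>Late members of the subsequence are critical in a space that contains
        \<psi>.\<close>
      then have "m \<le> s (r n)" using seq_suble[OF s, of "r n"] seq_suble[OF rg(1), of n] by linarith
      then show "L (W (r n)) (grad (W (r n))) \<psi> (grad \<psi>) = 0" using crit[of \<psi> "s (r n)"] mono m by (auto simp: W_def)
    qed
    then have "(\<lambda>n. L (W (r n)) (grad (W (r n))) \<psi> (grad \<psi>)) \<longlonglongrightarrow> 0" by (rule tendsto_eventually)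
    then show "L u U \<psi> (grad \<psi>) = 0" using LIMSEQ_unique[OF ft(3)[OF ET[OF m]]] by blast
  qed
  have sm: "strict_mono (\<lambda>n. s (r n))" using strict_mono_compose[OF s rg(1)] .
  show thesis
    by (rule that[OF ws wg u U sm]) (use ft(1,2) in \<open>simp_all add: W_def\<close>)
qed

end

section \<open>Galerkin spaces\<close>

context dirichlet_problem
begin

text \<open>Differentiation under the integral. Values and gradients of \<phi> and \<psi> are
  bounded, so for bounded s the derivative of the integrand is bounded by a constant, and by the
  mean value estimate so are the difference quotients.\<close>

lemma J_has_derivative:
  assumes \<phi>: "\<phi> \<in> T" and \<psi>: "\<psi> \<in> T"
  shows "((\<lambda>s. J (\<lambda>x. \<phi> x + s * \<psi> x) (\<lambda>x. grad \<phi> x + s *\<^sub>R grad \<psi> x)) has_real_derivative L \<phi> (grad \<phi>) \<psi> (grad \<psi>)) (at 0)"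
proof -
  obtain B1 where B1: "B1 > 0" "\<And>x. \<bar>\<phi> x\<bar> \<le> B1" "\<And>x. norm (grad \<phi> x) \<le> B1" using test_functions_bounded[OF \<phi>] by metis
  obtain B2 where B2: "B2 > 0" "\<And>x. \<bar>\<psi> x\<bar> \<le> B2" "\<And>x. norm (grad \<psi> x) \<le> B2" using test_functions_bounded[OF \<psi>] by metis
  obtain c where c: "c > 0"
    "\<And>x \<xi> \<eta>. x \<in> \<Omega> \<Longrightarrow> \<bar>a x \<xi> \<bullet> \<eta>\<bar> \<le> c * ((1 + norm \<xi> powr (p - 1)) * norm \<eta>)"
    "\<And>x t d. x \<in> \<Omega> \<Longrightarrow> \<bar>k x * f t * d\<bar> \<le> c * ((1 + \<bar>t\<bar> powr (p - 1)) * \<bar>d\<bar>)"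
    using a_pairing_bound by blast
  define q where "q x s = A x (grad \<phi> x + s *\<^sub>R grad \<psi> x) - \<mu> * (k x * primitive f (\<phi> x + s * \<psi> x))" for x s
  define q' where "q' x s = a x (grad \<phi> x + s *\<^sub>R grad \<psi> x) \<bullet> grad \<psi> x - \<mu> * (k x * f (\<phi> x + s * \<psi> x) * \<psi> x)" for x s
  have qd: "(q x has_real_derivative q' x s) (at s)" if "x \<in> \<Omega>" for x s
  proof -
    have "((\<lambda>s. primitive f (\<phi> x + s * \<psi> x)) has_real_derivative f (\<phi> x + s * \<psi> x) * \<psi> x) (at s)"
      by (rule DERIV_chain2[OF primitive_has_derivative[OF f_cont]]) (auto intro!: derivative_eq_intros)
    from DERIV_diff[OF A_deriv[OF \<Omega>_closure[OF that], of "grad \<phi> x" "grad \<psi> x" s] DERIV_cmult[OF DERIV_cmult[OF this], of \<mu> "k x"]]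
    show ?thesis unfolding q_def[abs_def] q'_def by (simp add: mult.assoc)
  qed
  have T1: "(\<lambda>x. \<phi> x + s * \<psi> x) \<in> T" for s by (intro test_functions_add test_functions_cmult \<phi> \<psi>)
  have g1: "grad (\<lambda>x. \<phi> x + s * \<psi> x) = (\<lambda>x. grad \<phi> x + s *\<^sub>R grad \<psi> x)" for s
    by (rule ext, rule grad_unique) (auto intro!: derivative_eq_intros smooth_has_grad test_functions_smooth[OF \<phi>] test_functions_smooth[OF \<psi>] simp: inner_add_left)
  have qi: "integrable M (\<lambda>x. q x s)" for s
    using A_integrable[OF in_Lp_test(2)[OF T1], of s] kF_integrable[OF in_Lp_test(1)[OF T1], of s] by (simp add: q_def g1)
  have q'm: "(\<lambda>x. q' x 0) \<in> borel_measurable M"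
    using borel_measurable_integrable[OF L_integrable(1)[OF in_Lp_test[OF \<phi>] in_Lp_test[OF \<psi>]]]
      borel_measurable_integrable[OF L_integrable(2)[OF in_Lp_test[OF \<phi>] in_Lp_test[OF \<psi>]]]
    unfolding q'_def by (intro borel_measurable_diff borel_measurable_times[OF borel_measurable_const]) auto
  have "((\<lambda>h. ((LINT x|M. q x (0 + h)) - (LINT x|M. q x 0)) / h) \<longlongrightarrow> (LINT x|M. q' x 0)) (at 0)"
    \<comment> \<open>Dominated convergence is about sequences, so the limit is taken along an
      arbitrary null sequence; being convergent, it is bounded by some S.\<close>
    unfolding tendsto_at_iff_sequentially comp_def
  proof (intro allI impI)
    fix X :: "nat \<Rightarrow> real" assume X: "\<forall>i. X i \<in> UNIV - {0}" "X \<longlonglongrightarrow> 0"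
    then have X0: "X n \<noteq> 0" for n by auto
    have "Bseq X" using X(2) by (intro convergent_imp_Bseq) (auto simp: convergent_def)
    then obtain S where S: "S > 0" "\<And>n. \<bar>X n\<bar> \<le> S" unfolding Bseq_def by auto
    define Q where "Q = B1 + S * B2"
    have Q: "Q \<ge> 0" using B1 B2 S by (simp add: Q_def)
    define C where "C = (c + \<mu> * c) * ((1 + Q powr (p - 1)) * B2)"
    have q'b: "\<bar>q' x s\<bar> \<le> C" if x: "x \<in> \<Omega>" and s: "\<bar>s\<bar> \<le> S" for x s
    proof -
      have "norm (grad \<phi> x + s *\<^sub>R grad \<psi> x) \<le> Q"
        unfolding Q_def using B1 B2 s by (intro norm_triangle_le add_mono) (auto intro!: mult_mono)
      then have "norm (grad \<phi> x + s *\<^sub>R grad \<psi> x) powr (p - 1) \<le> Q powr (p - 1)" using p by (intro powr_mono2) auto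
      then have "c * ((1 + norm (grad \<phi> x + s *\<^sub>R grad \<psi> x) powr (p - 1)) * norm (grad \<psi> x)) \<le> c * ((1 + Q powr (p - 1)) * B2)"
        using c(1) B2 by (intro mult_left_mono mult_mono) (auto intro: add_nonneg_nonneg)
      then have 1: "\<bar>a x (grad \<phi> x + s *\<^sub>R grad \<psi> x) \<bullet> grad \<psi> x\<bar> \<le> c * ((1 + Q powr (p - 1)) * B2)"
        using c(2)[OF x] by (rule order_trans[rotated])
      have "\<bar>\<phi> x + s * \<psi> x\<bar> \<le> Q"
        unfolding Q_def using B1 B2 s by (intro order_trans[OF abs_triangle_ineq] add_mono) (auto simp: abs_mult intro!: mult_mono)
      then have "\<bar>\<phi> x + s * \<psi> x\<bar> powr (p - 1) \<le> Q powr (p - 1)" using p by (intro powr_mono2) auto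
      then have "c * ((1 + \<bar>\<phi> x + s * \<psi> x\<bar> powr (p - 1)) * \<bar>\<psi> x\<bar>) \<le> c * ((1 + Q powr (p - 1)) * B2)"
        using c(1) B2 by (intro mult_left_mono mult_mono) (auto intro: add_nonneg_nonneg)
      then have "\<bar>k x * f (\<phi> x + s * \<psi> x) * \<psi> x\<bar> \<le> c * ((1 + Q powr (p - 1)) * B2)"
        using c(3)[OF x] by (rule order_trans[rotated])
      then have "\<bar>\<mu> * (k x * f (\<phi> x + s * \<psi> x) * \<psi> x)\<bar> \<le> \<mu> * (c * ((1 + Q powr (p - 1)) * B2))"
        unfolding abs_mult[of \<mu>] using \<mu>_pos by simp
      moreover have "C = c * ((1 + Q powr (p - 1)) * B2) + \<mu> * (c * ((1 + Q powr (p - 1)) * B2))" by (simp add: C_def algebra_simps)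
      ultimately show ?thesis using 1 unfolding q'_def by linarith
    qed
    have qb: "\<bar>(q x (X n) - q x 0) / X n\<bar> \<le> C" if x: "x \<in> \<Omega>" for x n
    proof -
      have "norm (q x (X n) - q x 0) \<le> C * norm (X n - 0)"
      proof (rule field_differentiable_bound[of "cball 0 S" "q x" "q' x"])
        show "(q x has_field_derivative q' x z) (at z within cball 0 S)" for z
          by (rule has_field_derivative_at_within[OF qd[OF x]])
        show "norm (q' x z) \<le> C" if "z \<in> cball 0 S" for z using q'b[OF x, of z] that by (simp add: dist_real_def)
      qed (use S(1) S(2)[of n] in \<open>auto simp: dist_real_def\<close>)
      then show ?thesis using X0[of n] by (simp add: abs_divide field_simps)
    qed
    have "(\<lambda>n. LINT x|M. (q x (X n) - q x 0) / X n) \<longlonglongrightarrow> (LINT x|M. q' x 0)"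
    proof (rule integral_dominated_convergence[OF q'm, where w="\<lambda>_. C"])
      show "(\<lambda>x. (q x (X n) - q x 0) / X n) \<in> borel_measurable M" for n
        using qi by (intro borel_measurable_integrable) auto
      show "integrable M (\<lambda>_. C)" by (rule integrable_const_M)
      show "AE x in M. (\<lambda>n. (q x (X n) - q x 0) / X n) \<longlonglongrightarrow> q' x 0"
      proof (rule AE_M_I)
        fix x assume "x \<in> \<Omega>"
        from qd[OF this, of 0] have "((\<lambda>h. (q x h - q x 0) / h) \<longlongrightarrow> q' x 0) (at 0)" by (simp add: DERIV_def)
        then show "(\<lambda>n. (q x (X n) - q x 0) / X n) \<longlonglongrightarrow> q' x 0"
          unfolding tendsto_at_iff_sequentially comp_def using X by blast
      qed
      show "AE x in M. norm ((q x (X n) - q x 0) / X n) \<le> C" for n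
        using qb by (intro AE_M_I) auto
    qed
    then show "(\<lambda>n. ((LINT x|M. q x (0 + X n)) - (LINT x|M. q x 0)) / X n) \<longlonglongrightarrow> (LINT x|M. q' x 0)"
      using qi by simp
  qed
  then show ?thesis
    unfolding DERIV_def by (simp add: J_def L_def q_def q'_def)
qed

lemma L_sum:
  assumes u: "in_Lp \<Omega> p u" and U: "in_Lp \<Omega> p U" and e: "\<And>i. i \<in> I \<Longrightarrow> e i \<in> T"
  shows "L u U (\<lambda>x. \<Sum>i\<in>I. d i * e i x) (\<lambda>x. \<Sum>i\<in>I. d i *\<^sub>R grad (e i) x) = (\<Sum>i\<in>I. L u U (e i) (grad (e i)) * d i)"
proof -
  have i: "integrable M (\<lambda>x. a x (U x) \<bullet> grad (e i) x - \<mu> * (k x * f (u x) * e i x))" if "i \<in> I" for i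
    using L_integrable[OF u U in_Lp_test[OF e[OF that]]] by simp
  have "L u U (\<lambda>x. \<Sum>i\<in>I. d i * e i x) (\<lambda>x. \<Sum>i\<in>I. d i *\<^sub>R grad (e i) x)
      = (LINT x|M. (\<Sum>i\<in>I. d i * (a x (U x) \<bullet> grad (e i) x - \<mu> * (k x * f (u x) * e i x))))"
    unfolding L_def by (intro Bochner_Integration.integral_cong refl)
      (simp add: inner_sum_right sum_distrib_left sum_subtractf right_diff_distrib mult_ac)
  also have "\<dots> = (\<Sum>i\<in>I. d i * L u U (e i) (grad (e i)))"
    unfolding L_def using i by (subst Bochner_Integration.integral_sum) auto
  finally show ?thesis by (simp add: mult.commute)
qed

end

text \<open>Coefficient vectors are functions on \<open>nat\<close> that vanish off I, so spaces of
  all dimensions share one type and are nested. Independence makes coefficients recoverable from the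
  function, which boundedness of the coefficients relies on.\<close>

locale galerkin_space = dirichlet_problem +
  fixes I :: "nat set" and e :: "nat \<Rightarrow> 'a \<Rightarrow> real" and V :: "(nat \<Rightarrow> real) set" and comb :: "(nat \<Rightarrow> real) \<Rightarrow> 'a \<Rightarrow> real"
  assumes finI: "finite I" and eT: "\<And>i. e i \<in> T"
    and V_def: "V = {c. \<forall>i. i \<notin> I \<longrightarrow> c i = 0}"
    and comb_def: "comb = (\<lambda>c x. \<Sum>i\<in>I. c i * e i x)"
    and indep: "\<And>c. c \<in> V \<Longrightarrow> (\<And>x. comb c x = 0) \<Longrightarrow> c = (\<lambda>_. 0)"
begin

lemma comb_T: "comb c \<in> T"
  unfolding comb_def by (rule test_functions_sum) (rule eT)

lemma grad_comb: "grad (comb c) = (\<lambda>x. \<Sum>i\<in>I. c i *\<^sub>R grad (e i) x)"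
  unfolding comb_def by (rule ext) (rule grad_sum[OF test_functions_smooth[OF eT]])

lemma comb_line:
  "comb (\<lambda>i. c i + s * d i) = (\<lambda>x. comb c x + s * comb d x)"
  "grad (comb (\<lambda>i. c i + s * d i)) = (\<lambda>x. grad (comb c) x + s *\<^sub>R grad (comb d) x)"
  unfolding grad_comb unfolding comb_def
  by (auto simp: fun_eq_iff distrib_right sum.distrib sum_distrib_left scaleR_sum_right scaleR_add_left mult.assoc)

text \<open>Convergent coefficients are bounded, so all combinations and their gradients lie below
  one constant, whose p-th power serves as majorant.\<close>

lemma comb_functionals_tendsto:
  fixes C :: "nat \<Rightarrow> nat \<Rightarrow> real"
  assumes C: "\<And>i. (\<lambda>n. C n i) \<longlonglongrightarrow> c i"
  shows "(\<lambda>n. Phi (grad (comb (C n)))) \<longlonglongrightarrow> Phi (grad (comb c))"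
    "(\<lambda>n. J (comb (C n)) (grad (comb (C n)))) \<longlonglongrightarrow> J (comb c) (grad (comb c))"
    "\<phi> \<in> T \<Longrightarrow> (\<lambda>n. L (comb (C n)) (grad (comb (C n))) \<phi> (grad \<phi>)) \<longlonglongrightarrow> L (comb c) (grad (comb c)) \<phi> (grad \<phi>)"
proof -
  have "\<exists>R. \<forall>n. \<bar>C n i\<bar> \<le> R" for i
    using convergent_imp_Bseq[of "\<lambda>n. C n i"] C[of i] unfolding Bseq_def convergent_def by auto
  then obtain R where R: "\<And>i n. \<bar>C n i\<bar> \<le> R i" by metis
  have R0: "R i \<ge> 0" for i using order_trans[OF abs_ge_zero R] .
  have "\<exists>B. \<forall>x. \<bar>e i x\<bar> \<le> B \<and> norm (grad (e i) x) \<le> B" for i using test_functions_bounded[OF eT[of i]] by metis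
  then obtain B where B: "\<And>i x. \<bar>e i x\<bar> \<le> B i" "\<And>i x. norm (grad (e i) x) \<le> B i" by metis
  define Q where "Q = (\<Sum>i\<in>I. R i * B i)"
  have le: "\<bar>comb (C n) x\<bar> \<le> Q" "norm (grad (comb (C n)) x) \<le> Q" for n x
  proof -
    show "\<bar>comb (C n) x\<bar> \<le> Q" unfolding comb_def Q_def
      by (rule order_trans[OF sum_abs sum_mono]) (auto simp: abs_mult intro!: mult_mono R B R0)
    show "norm (grad (comb (C n)) x) \<le> Q" unfolding grad_comb Q_def
      by (rule order_trans[OF norm_sum sum_mono]) (auto intro!: mult_mono R B R0)
  qed
  have m: "comb c \<in> borel_measurable M" "grad (comb c) \<in> borel_measurable M" for c
    using in_Lp_test[OF comb_T[of c]] by (auto simp: in_Lp_def)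
  have lim: "(\<lambda>n. comb (C n) x) \<longlonglongrightarrow> comb c x" "(\<lambda>n. grad (comb (C n)) x) \<longlonglongrightarrow> grad (comb c) x" for x
    unfolding grad_comb unfolding comb_def by (intro tendsto_intros C)+
  note ft = functionals_tendsto[of "\<lambda>n. comb (C n)" "\<lambda>n. grad (comb (C n))" "comb c" "grad (comb c)" "\<lambda>_. Q powr p"]
  have dom: "AE x in M. \<forall>n. \<bar>comb (C n) x\<bar> powr p \<le> Q powr p" "AE x in M. \<forall>n. norm (grad (comb (C n)) x) powr p \<le> Q powr p"
    using le p0 by (auto intro!: powr_mono2)
  show "(\<lambda>n. Phi (grad (comb (C n)))) \<longlonglongrightarrow> Phi (grad (comb c))"
    "(\<lambda>n. J (comb (C n)) (grad (comb (C n)))) \<longlonglongrightarrow> J (comb c) (grad (comb c))"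
    "\<phi> \<in> T \<Longrightarrow> (\<lambda>n. L (comb (C n)) (grad (comb (C n))) \<phi> (grad \<phi>)) \<longlonglongrightarrow> L (comb c) (grad (comb c)) \<phi> (grad \<phi>)"
    using ft[OF m m integrable_const_M AE_I2[OF lim(1)] AE_I2[OF lim(2)] dom] by auto
qed

text \<open>Convergence of coefficient vectors is coordinatewise, and continuity is checked on
  sequences.\<close>

lemma comb_continuous:
  "continuous_on V (\<lambda>c. Phi (grad (comb c)))"
  "continuous_on V (\<lambda>c. J (comb c) (grad (comb c)))"
  "\<phi> \<in> T \<Longrightarrow> continuous_on V (\<lambda>c. L (comb c) (grad (comb c)) \<phi> (grad \<phi>))"
proof -
  have coord: "(\<lambda>n. X n i) \<longlonglongrightarrow> c i" if "X \<longlonglongrightarrow> c" for X :: "nat \<Rightarrow> nat \<Rightarrow> real" and c i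
  proof -
    have "continuous_on UNIV (\<lambda>c :: nat \<Rightarrow> real. c i)" by (rule continuous_on_product_coordinates)
    then have "isCont (\<lambda>c :: nat \<Rightarrow> real. c i) c" unfolding continuous_on_eq_continuous_at[OF open_UNIV] by blast
    then show ?thesis using that by (rule isCont_tendsto_compose)
  qed
  show "continuous_on V (\<lambda>c. Phi (grad (comb c)))"
    unfolding continuous_on_sequentially comp_def using comb_functionals_tendsto(1) coord by blast
  show "continuous_on V (\<lambda>c. J (comb c) (grad (comb c)))"
    unfolding continuous_on_sequentially comp_def using comb_functionals_tendsto(2) coord by blast
  show "\<phi> \<in> T \<Longrightarrow> continuous_on V (\<lambda>c. L (comb c) (grad (comb c)) \<phi> (grad \<phi>))"
    unfolding continuous_on_sequentially comp_def using comb_functionals_tendsto(3) coord by blast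
qed

text \<open>By Poincare's inequality \<phi> vanishes almost everywhere; the set where it does not
  vanish is open, and a nonempty open set is not negligible.\<close>

lemma test_function_eq_0:
  assumes \<phi>: "\<phi> \<in> T" and 0: "(LINT x|M. norm (grad \<phi> x) powr p) = 0"
  shows "\<phi> x = 0"
proof (rule ccontr)
  assume nz: "\<phi> x \<noteq> 0"
  obtain R where R: "\<Omega> \<subseteq> cball 0 R" "R > 0"
    using bounded_\<Omega> unfolding bounded_pos by (auto simp: subset_iff)
  have "(LINT x|lborel. \<bar>\<phi> x\<bar> powr p) \<le> 0"
    using Poincare_test_functions[OF \<phi> p R] 0 unfolding LINT_test(2)[OF \<phi> p0] by simp
  then have "(LINT x|lborel. \<bar>\<phi> x\<bar> powr p) = 0" by (intro antisym) simp_all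
  then have "AE x in lborel. \<bar>\<phi> x\<bar> powr p = 0"
    by (subst (asm) integral_nonneg_eq_0_iff_AE[OF test_functions_integrable_powr(1)[OF \<phi> p0]]) auto
  then have "AE x in lborel. x \<notin> {x. \<phi> x \<noteq> 0}" by eventually_elim simp
  moreover have op: "open {x. \<phi> x \<noteq> 0}"
    by (rule open_Collect_neq) (auto intro: smooth_continuous_on[OF test_functions_smooth[OF \<phi>]])
  ultimately have "{x. \<phi> x \<noteq> 0} \<in> null_sets lborel" by (subst AE_iff_null_sets) auto
  then have "negligible {x. \<phi> x \<noteq> 0}" by (simp add: negligible_iff_null_sets null_sets_completionI)
  then show False using open_not_negligible[OF op] nz by blast
qed

text \<open>On a compact set containing all normalised coefficients, \<Phi> is positive by
  independence, hence at least some \<alpha> > 0. Homogeneity of the gradient energy carries this to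
  all coefficients, and coercivity bounds that energy. \<Phi> is minimised instead of the energy
  because its continuity is at hand; \<open>alpha5\<close> makes the two comparable.\<close>

lemma coefficients_bounded: "\<exists>R. \<forall>c\<in>V. J (comb c) (grad (comb c)) \<le> B \<longrightarrow> (\<forall>i\<in>I. \<bar>c i\<bar> \<le> R)"
proof -
  define N where "N c = (LINT x|M. norm (grad (comb c) x) powr p)" for c
  obtain C1 C2 where C12: "C1 > 0" "\<And>\<phi>. \<phi> \<in> T \<Longrightarrow> (LINT x|M. norm (grad \<phi> x) powr p) \<le> C1 * J \<phi> (grad \<phi>) + C2"
    using J_coercive by blast
  let ?K = "{c :: nat \<Rightarrow> real. \<forall>i. \<bar>c i\<bar> \<le> (if i \<in> I then 1 else 0)}"
  let ?S = "?K \<inter> {c. (\<Sum>i\<in>I. \<bar>c i\<bar>) \<ge> 1}"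
  have KV: "?K \<subseteq> V" unfolding V_def
  proof (intro subsetI CollectI allI impI)
    fix c :: "nat \<Rightarrow> real" and i assume "c \<in> ?K" "i \<notin> I"
    then show "c i = 0" by (auto dest: spec[of _ i])
  qed
  have "closed {c :: nat \<Rightarrow> real. (\<Sum>i\<in>I. \<bar>c i\<bar>) \<ge> 1}"
    by (intro closed_Collect_le continuous_on_const continuous_on_sum continuous_on_rabs continuous_on_product_coordinates)
  then have S: "compact ?S" by (rule compact_Int_closed[OF compact_coordinate_box])
  have cPhi: "continuous_on ?S (\<lambda>c. Phi (grad (comb c)))" by (rule continuous_on_subset[OF comb_continuous(1)]) (use KV in blast)
  have PhiN: "Phi (grad (comb c)) \<le> \<Lambda>2 * N c" "\<Lambda>1 * N c \<le> Phi (grad (comb c))" for c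
    unfolding N_def using Phi_bounds[OF in_Lp_test(2)[OF comb_T]] by auto
  have N0: "N c \<ge> 0" for c by (simp add: N_def)
  obtain \<alpha> where \<alpha>: "\<alpha> > 0" "\<And>c. c \<in> ?S \<Longrightarrow> \<alpha> \<le> Phi (grad (comb c))"
  proof (cases "?S = {}")
    case True
    \<comment> \<open>This occurs when I is empty; any positive \<alpha> then serves.\<close>
    then show thesis using that[of 1] by auto
  next
    case False
    obtain c0 where c0: "c0 \<in> ?S" "\<And>c. c \<in> ?S \<Longrightarrow> Phi (grad (comb c0)) \<le> Phi (grad (comb c))"
      using continuous_attains_inf[OF S False cPhi] by blast
    have "Phi (grad (comb c0)) \<noteq> 0"
    proof
      assume "Phi (grad (comb c0)) = 0"
      then have "\<Lambda>1 * N c0 \<le> 0" using PhiN(2)[of c0] by simp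
      then have "N c0 = 0" using N0[of c0] \<Lambda> by (simp add: mult_le_0_iff)
      then have "comb c0 x = 0" for x using test_function_eq_0[OF comb_T] by (simp add: N_def)
      then have "c0 = (\<lambda>_. 0)" using indep[of c0] c0(1) KV by blast
      then show False using c0(1) by simp
    qed
    moreover have "Phi (grad (comb c0)) \<ge> 0" using PhiN(2)[of c0] N0[of c0] \<Lambda> by (meson less_imp_le mult_nonneg_nonneg order_trans)
    ultimately show thesis using that[of "Phi (grad (comb c0))"] c0(2) by auto
  qed
  define R where "R = ((C1 * B + C2) * \<Lambda>2 / \<alpha>) powr (1 / p)"
  have "\<bar>c i\<bar> \<le> R" if c: "c \<in> V" "J (comb c) (grad (comb c)) \<le> B" and i: "i \<in> I" for c i
  proof -
    define t where "t = (\<Sum>i\<in>I. \<bar>c i\<bar>)"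
    have ci: "\<bar>c j\<bar> \<le> t" if "j \<in> I" for j unfolding t_def using member_le_sum[OF that, of "\<lambda>i. \<bar>c i\<bar>"] finI by auto
    show ?thesis
    proof (cases "t = 0")
      case True
      then show ?thesis using ci[OF i] by (simp add: R_def)
    next
      case False
      have "t \<ge> 0" unfolding t_def by (simp add: sum_nonneg)
      then have t: "t > 0" using False by simp
      define d where "d j = c j / t" for j
      have "\<bar>d j\<bar> \<le> (if j \<in> I then 1 else 0)" for j
        using ci[of j] t c(1) by (auto simp: d_def V_def abs_divide)
      moreover have "(\<Sum>i\<in>I. \<bar>d i\<bar>) = 1" using t by (simp add: d_def abs_divide sum_divide_distrib[symmetric]) (simp add: t_def)
      ultimately have "d \<in> ?S" by simp
      then have "\<alpha> \<le> \<Lambda>2 * N d" using \<alpha>(2) PhiN(1) order_trans by blast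
      moreover have "N c = t powr p * N d"
      proof -
        have "grad (comb c) x = t *\<^sub>R grad (comb d) x" for x
          unfolding grad_comb scaleR_sum_right using t by (simp add: d_def)
        then show ?thesis using t by (simp add: N_def powr_mult)
      qed
      ultimately have "\<alpha> * t powr p \<le> \<Lambda>2 * N c" using mult_right_mono[of \<alpha> "\<Lambda>2 * N d" "t powr p"] by (simp add: mult_ac)
      moreover have "N c \<le> C1 * B + C2"
        using C12(2)[OF comb_T, of c] mult_left_mono[OF c(2) less_imp_le[OF C12(1)]] by (simp add: N_def)
      then have "\<Lambda>2 * N c \<le> \<Lambda>2 * (C1 * B + C2)" using \<Lambda> by simp
      ultimately have "t powr p \<le> (C1 * B + C2) * \<Lambda>2 / \<alpha>" using \<alpha>(1) by (simp add: field_simps)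
      then have "(t powr p) powr (1 / p) \<le> R" unfolding R_def using p0 by (intro powr_mono2) auto
      then have "t \<le> R" using t p0 by (simp add: powr_powr)
      then show ?thesis using ci[OF i] by linarith
    qed
  qed
  then show ?thesis by blast
qed

sublocale coefficient_functional I "\<lambda>c. J (comb c) (grad (comb c))" "\<lambda>c i. L (comb c) (grad (comb c)) (e i) (grad (e i))" V
proof
  show "finite I" by (rule finI)
  show "V = {c. \<forall>i. i \<notin> I \<longrightarrow> c i = 0}" by (rule V_def)
  show "continuous_on V (\<lambda>c. J (comb c) (grad (comb c)))" by (rule comb_continuous)
  show "continuous_on V (\<lambda>c. L (comb c) (grad (comb c)) (e i) (grad (e i)))" for i by (rule comb_continuous(3)[OF eT])
  show "\<exists>R. \<forall>c\<in>V. J (comb c) (grad (comb c)) \<le> B \<longrightarrow> (\<forall>i\<in>I. \<bar>c i\<bar> \<le> R)" for B by (rule coefficients_bounded)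
  show "((\<lambda>s. J (comb (\<lambda>i. c i + s * d i)) (grad (comb (\<lambda>i. c i + s * d i)))) has_real_derivative
      (\<Sum>i\<in>I. L (comb c) (grad (comb c)) (e i) (grad (e i)) * d i)) (at 0)" for c d
  proof -
    have "L (comb c) (grad (comb c)) (comb d) (grad (comb d)) = (\<Sum>i\<in>I. L (comb c) (grad (comb c)) (e i) (grad (e i)) * d i)"
      using L_sum[OF in_Lp_test[OF comb_T[of c]], of I e d] eT unfolding grad_comb[of d] unfolding comb_def by simp
    then show ?thesis using J_has_derivative[OF comb_T[of c] comb_T[of d]]
      unfolding comb_line(2) unfolding comb_line(1) by simp
  qed
qed

lemma critical_comb:
  assumes "\<And>i. i \<in> I \<Longrightarrow> L (comb c) (grad (comb c)) (e i) (grad (e i)) = 0"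
  shows "L (comb c) (grad (comb c)) (comb d) (grad (comb d)) = 0"
  using L_sum[OF in_Lp_test[OF comb_T[of c]], of I e d] eT assms unfolding grad_comb[of d] unfolding comb_def by simp

end

section \<open>Three weak solutions\<close>

text \<open>I keeps the indices whose function is not a combination of earlier ones. Each truncation
  is independent and spans all members of the family up to the same index.\<close>

lemma independent_subfamily:
  fixes e :: "nat \<Rightarrow> 'b \<Rightarrow> real"
  obtains I :: "nat set" where
    "\<And>n c. (\<And>i. i \<notin> I \<inter> {..n} \<Longrightarrow> c i = 0) \<Longrightarrow> (\<And>x. (\<Sum>i\<in>I \<inter> {..n}. c i * e i x) = 0) \<Longrightarrow> c = (\<lambda>_. 0)"
    "\<And>i. \<exists>c. (\<forall>j. j \<notin> I \<inter> {..i} \<longrightarrow> c j = 0) \<and> (\<forall>x. e i x = (\<Sum>j\<in>I \<inter> {..i}. c j * e j x))"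
proof -
  define I where "I = {i. \<not> (\<exists>c. \<forall>x. e i x = (\<Sum>j<i. c j * e j x))}"
  have 1: "c = (\<lambda>_. 0)" if c: "\<And>i. i \<notin> I \<inter> {..n} \<Longrightarrow> c i = 0" and s0: "\<And>x. (\<Sum>i\<in>I \<inter> {..n}. c i * e i x) = 0" for n c
  proof (rule ccontr)
    assume "c \<noteq> (\<lambda>_. 0)"
    then have ne: "{i. c i \<noteq> 0} \<noteq> {}" by auto
    have sub: "{i. c i \<noteq> 0} \<subseteq> I \<inter> {..n}" using c by blast
    then have fin: "finite {i. c i \<noteq> 0}" by (rule finite_subset) simp
    \<comment> \<open>The function with the largest index among the nonzero coefficients can be
      solved for, and would be a combination of earlier ones.\<close>
    define m where "m = Max {i. c i \<noteq> 0}"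
    have m: "c m \<noteq> 0" "m \<in> I" using Max_in[OF fin ne] sub by (auto simp: m_def)
    have mx: "i \<le> m" if "c i \<noteq> 0" for i using Max_ge[OF fin] that by (simp add: m_def)
    have "e m x = (\<Sum>j<m. (- c j / c m) * e j x)" for x
    proof -
      have "0 = (\<Sum>i\<in>I \<inter> {..n}. c i * e i x)" using s0 by simp
      also have "\<dots> = (\<Sum>i\<in>{i. c i \<noteq> 0}. c i * e i x)" using sub by (intro sum.mono_neutral_right) auto
      also have "\<dots> = (\<Sum>i\<le>m. c i * e i x)" using mx by (intro sum.mono_neutral_left) auto
      also have "\<dots> = (\<Sum>i<m. c i * e i x) + c m * e m x" by (simp add: lessThan_Suc_atMost[symmetric])
      finally have "e m x = - (\<Sum>i<m. c i * e i x) / c m" using m(1) by (simp add: field_simps)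
      then show ?thesis by (simp add: sum_negf[symmetric] sum_divide_distrib)
    qed
    then have "\<exists>c. \<forall>x. e m x = (\<Sum>j<m. c j * e j x)" by (intro exI[of _ "\<lambda>j. - c j / c m"] allI)
    then show False using m(2) unfolding I_def by blast
  qed
  have 2: "\<exists>c. (\<forall>j. j \<notin> I \<inter> {..i} \<longrightarrow> c j = 0) \<and> (\<forall>x. e i x = (\<Sum>j\<in>I \<inter> {..i}. c j * e j x))" for i
  proof (induction i rule: less_induct)
    case (less i)
    show ?case
    proof (cases "i \<in> I")
      case True
      have "(\<Sum>j\<in>I \<inter> {..i}. (if j = i then 1 else 0) * e j x) = e i x" for x
        using True by (simp add: if_distrib[of "\<lambda>c. c * _"] sum.delta cong: if_cong)
      then show ?thesis using True by (intro exI[of _ "\<lambda>j. if j = i then 1 else 0"]) auto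
    next
      case False
      then obtain c where c: "\<And>x. e i x = (\<Sum>j<i. c j * e j x)" by (auto simp: I_def)
      obtain C where C: "\<And>j l. j < i \<Longrightarrow> l \<notin> I \<inter> {..j} \<Longrightarrow> C j l = 0"
        "\<And>j x. j < i \<Longrightarrow> e j x = (\<Sum>l\<in>I \<inter> {..j}. C j l * e l x)"
        using less.IH by metis
      have "e i x = (\<Sum>l\<in>I \<inter> {..i}. (\<Sum>j<i. c j * C j l) * e l x)" for x
      proof -
        have "e i x = (\<Sum>j<i. \<Sum>l\<in>I \<inter> {..i}. c j * C j l * e l x)"
          unfolding c[of x]
        proof (rule sum.cong[OF refl])
          fix j assume j: "j \<in> {..<i}"
          have "e j x = (\<Sum>l\<in>I \<inter> {..i}. C j l * e l x)"
            unfolding C(2)[of j x, OF j[unfolded lessThan_iff]] using j C(1)[of j] by (intro sum.mono_neutral_left) auto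
          then show "c j * e j x = (\<Sum>l\<in>I \<inter> {..i}. c j * C j l * e l x)" by (simp add: sum_distrib_left mult.assoc)
        qed
        also have "\<dots> = (\<Sum>l\<in>I \<inter> {..i}. \<Sum>j<i. c j * C j l * e l x)" by (rule sum.swap)
        finally show ?thesis by (simp add: sum_distrib_right)
      qed
      moreover have "(\<Sum>j<i. c j * C j l) = 0" if "l \<notin> I \<inter> {..i}" for l
        using that C(1) by (intro sum.neutral) auto
      ultimately show ?thesis by (intro exI[of _ "\<lambda>l. \<Sum>j<i. c j * C j l"]) auto
    qed
  qed
  show thesis
  proof (rule that[of I])
    show "c = (\<lambda>_. 0)" if "\<And>i. i \<notin> I \<inter> {..n} \<Longrightarrow> c i = 0" "\<And>x. (\<Sum>i\<in>I \<inter> {..n}. c i * e i x) = 0" for n c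
      by (rule 1[OF that])
    show "\<exists>c. (\<forall>j. j \<notin> I \<inter> {..i} \<longrightarrow> c j = 0) \<and> (\<forall>x. e i x = (\<Sum>j\<in>I \<inter> {..i}. c j * e j x))" for i
      by (rule 2)
  qed
qed

context dirichlet_problem
begin

lemma zero_values: "Phi (grad (\<lambda>_. 0)) = 0" "J (\<lambda>_. 0) (grad (\<lambda>_. 0)) = 0"
proof -
  have g: "grad (\<lambda>_::'a. 0) = (\<lambda>_. 0)" by (rule ext, rule grad_unique) simp
  have z: "in_Lp \<Omega> p (\<lambda>_::'a. 0::'a)" "in_Lp \<Omega> p (\<lambda>_::'a. 0::real)" using p0 by (auto simp: in_Lp_def)
  show P: "Phi (grad (\<lambda>_. 0)) = 0" unfolding g using Phi_bounds[OF z(1)] p0 by simp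
  show "J (\<lambda>_. 0) (grad (\<lambda>_. 0)) = 0" using J_eq[OF z(2,1)] P unfolding g by (simp add: primitive_0)
qed

end

context galerkin_space
begin

text \<open>0 lies inside the barrier and v beyond it. \<open>minimum_below\<close> is applied to
  \<Phi> with r1 and to -\<Phi> with -r2; the mountain pass crosses the level r1.\<close>

lemma three_critical:
  assumes r: "0 < r1" "r1 < r2" and \<rho>: "\<rho> > 0"
    and bar: "\<And>\<phi>. \<phi> \<in> T \<Longrightarrow> r1 \<le> Phi (grad \<phi>) \<Longrightarrow> Phi (grad \<phi>) \<le> r2 \<Longrightarrow> J \<phi> (grad \<phi>) \<ge> \<rho>"
    and v: "cv \<in> V" "Phi (grad (comb cv)) > r2" "J (comb cv) (grad (comb cv)) < 0"
    and B: "\<And>t. t \<in> {0..1} \<Longrightarrow> J (comb (\<lambda>i. t * cv i)) (grad (comb (\<lambda>i. t * cv i))) \<le> B"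
  obtains c1 c2 c3 where "c1 \<in> V" "c2 \<in> V" "c3 \<in> V"
    "\<And>c d. c \<in> {c1, c2, c3} \<Longrightarrow> L (comb c) (grad (comb c)) (comb d) (grad (comb d)) = 0"
    "Phi (grad (comb c1)) \<le> r1" "J (comb c1) (grad (comb c1)) \<le> 0"
    "Phi (grad (comb c2)) \<ge> r2" "J (comb c2) (grad (comb c2)) \<le> 0"
    "J (comb c3) (grad (comb c3)) \<ge> \<rho>" "J (comb c3) (grad (comb c3)) \<le> B"
proof -
  let ?f = "\<lambda>c. Phi (grad (comb c))" and ?j = "\<lambda>c. J (comb c) (grad (comb c))"
  have z: "comb (\<lambda>_. 0) = (\<lambda>_. 0)" by (simp add: comb_def)
  have zV: "(\<lambda>_. 0) \<in> V" by (simp add: V_def)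
  have z0: "?f (\<lambda>_. 0) = 0" "?j (\<lambda>_. 0) = 0" unfolding z using zero_values by auto
  have bar1: "?j c \<ge> \<rho>" if "?f c = r1" for c using bar[OF comb_T, of c] that r by auto
  have bar2: "?j c \<ge> \<rho>" if "?f c = r2" for c using bar[OF comb_T, of c] that r by auto
  obtain c1 where c1: "c1 \<in> V" "?f c1 \<le> r1" "?j c1 \<le> ?j (\<lambda>_. 0)" "\<And>i. i \<in> I \<Longrightarrow> L (comb c1) (grad (comb c1)) (e i) (grad (e i)) = 0"
    by (rule minimum_below[OF comb_continuous(1), of r1 "\<lambda>_. 0"])
      (use bar1 \<rho> zV z0 r in \<open>auto intro: less_le_trans\<close>)
  have cf: "continuous_on V (\<lambda>c. - ?f c)" by (intro continuous_intros comb_continuous)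
  obtain c2 where c2: "c2 \<in> V" "- ?f c2 \<le> - r2" "?j c2 \<le> ?j cv" "\<And>i. i \<in> I \<Longrightarrow> L (comb c2) (grad (comb c2)) (e i) (grad (e i)) = 0"
    by (rule minimum_below[OF cf, of "- r2" cv])
      (use bar2 \<rho> v in \<open>auto intro: less_le_trans\<close>)
  obtain c3 where c3: "c3 \<in> V" "?j c3 \<ge> \<rho>" "?j c3 \<le> B" "\<And>i. i \<in> I \<Longrightarrow> L (comb c3) (grad (comb c3)) (e i) (grad (e i)) = 0"
    by (rule mountain_pass[OF comb_continuous(1), of r1 cv \<rho> B])
      (use bar1 \<rho> v z0 r B in auto)
  show thesis
  proof (rule that[OF c1(1) c2(1) c3(1)])
    show "L (comb c) (grad (comb c)) (comb d) (grad (comb d)) = 0" if "c \<in> {c1, c2, c3}" for c d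
      using critical_comb c1(4) c2(4) c3(4) that by blast
  qed (use c1 c2 c3 z0 v in auto)
qed

end

context dirichlet_problem
begin

text \<open>The barrier is a shell and not a single level because limits keep only weak
  inequalities: \<Phi> \<le> r1 on one side and \<Phi> \<ge> r2 on the other still separate the two
  minima. The third solution is kept apart by J \<ge> \<rho> > 0.\<close>

theorem three_weak_solutions:
  assumes r: "0 < r1" "r1 < r2" and \<rho>: "\<rho> > 0"
    and bar: "\<And>\<phi>. \<phi> \<in> T \<Longrightarrow> r1 \<le> Phi (grad \<phi>) \<Longrightarrow> Phi (grad \<phi>) \<le> r2 \<Longrightarrow> J \<phi> (grad \<phi>) \<ge> \<rho>"
    and v: "v \<in> T" "Phi (grad v) > r2" "J v (grad v) < 0"
  shows "\<exists>u1 u2 u3. weak_solution \<Omega> p a k f \<mu> u1 \<and> weak_solution \<Omega> p a k f \<mu> u2 \<and> weak_solution \<Omega> p a k f \<mu> u3 \<and>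
    \<not> (AE x in M. u1 x = u2 x) \<and> \<not> (AE x in M. u1 x = u3 x) \<and> \<not> (AE x in M. u2 x = u3 x)"
proof -
  obtain R where R: "\<Omega> \<subseteq> cball 0 R"
    using bounded_\<Omega> unfolding bounded_iff by (auto simp: subset_iff)
  obtain e0 :: "nat \<Rightarrow> 'a \<Rightarrow> real" where e0: "\<And>i. e0 i \<in> T"
    "\<And>\<phi> \<epsilon>. \<phi> \<in> T \<Longrightarrow> \<epsilon> > 0 \<Longrightarrow> \<exists>i. \<forall>x\<in>cball 0 R. \<bar>\<phi> x - e0 i x\<bar> < \<epsilon> \<and> norm (grad \<phi> x - grad (e0 i) x) < \<epsilon>"
    by (rule uniformly_separable_test_functions[where \<Omega>=\<Omega> and R=R]) blast
  \<comment> \<open>v is put first, so that it belongs to every Galerkin space and the segment from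
    0 to v bounds all mountain pass levels by one B independent of n.\<close>
  define e where "e n = (case n of 0 \<Rightarrow> v | Suc i \<Rightarrow> e0 i)" for n
  have eT: "e i \<in> T" for i using v(1) e0(1) by (cases i) (auto simp: e_def)
  obtain I :: "nat set" where
    ind: "\<And>n c. (\<And>i. i \<notin> I \<inter> {..n} \<Longrightarrow> c i = 0) \<Longrightarrow> (\<And>x. (\<Sum>i\<in>I \<inter> {..n}. c i * e i x) = 0) \<Longrightarrow> c = (\<lambda>_. 0)" and
    rep: "\<And>i. \<exists>c. (\<forall>j. j \<notin> I \<inter> {..i} \<longrightarrow> c j = 0) \<and> (\<forall>x. e i x = (\<Sum>j\<in>I \<inter> {..i}. c j * e j x))"
    by (rule independent_subfamily[where e=e]) blast
  define V where "V n = {c :: nat \<Rightarrow> real. \<forall>i. i \<notin> I \<inter> {..n} \<longrightarrow> c i = 0}" for n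
  define comb where "comb n c x = (\<Sum>i\<in>I \<inter> {..n}. c i * e i x)" for n :: nat and c :: "nat \<Rightarrow> real" and x
  have gs: "galerkin_space \<Omega> p \<mu> \<Lambda>1 \<Lambda>2 k A a f (I \<inter> {..n}) e (V n) (comb n)" for n
  proof unfold_locales
    show "finite (I \<inter> {..n})" by simp
    show "e i \<in> T" for i by (rule eT)
    show "V n = {c. \<forall>i. i \<notin> I \<inter> {..n} \<longrightarrow> c i = 0}" by (simp add: V_def)
    show "comb n = (\<lambda>c x. \<Sum>i\<in>I \<inter> {..n}. c i * e i x)" by (simp add: comb_def fun_eq_iff)
    show "c = (\<lambda>_. 0)" if "c \<in> V n" "\<And>x. comb n c x = 0" for c
      by (rule ind[of n]) (use that in \<open>auto simp: V_def comb_def\<close>)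
  qed
  have Vmono: "V m \<subseteq> V n" if "m \<le> n" for m n using that by (auto simp: V_def)
  have comb_mono: "comb n c = comb m c" if "m \<le> n" "c \<in> V m" for m n c
    unfolding comb_def fun_eq_iff using that by (intro allI sum.mono_neutral_right) (auto simp: V_def)
  obtain cv where cv: "cv \<in> V 0" "comb 0 cv = v"
    using rep[of 0] unfolding V_def comb_def by (auto simp: e_def fun_eq_iff)
  have cvn: "cv \<in> V n" "comb n cv = v" for n using Vmono[of 0 n] comb_mono[of 0 n cv] cv by auto
  have "comb n (\<lambda>i. t * cv i) x = t * comb n cv x" for n t x by (simp add: comb_def sum_distrib_left mult.assoc)
  then have cvt: "(\<lambda>i. t * cv i) \<in> V n" "comb n (\<lambda>i. t * cv i) = (\<lambda>x. t * v x)" for n t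
    using cvn[of n] by (auto simp: V_def)
  obtain B where B: "\<And>t. t \<in> {0..1} \<Longrightarrow> J (\<lambda>x. t * v x) (grad (\<lambda>x. t * v x)) \<le> B"
  proof -
    interpret G: galerkin_space \<Omega> p \<mu> \<Lambda>1 \<Lambda>2 k A a f "I \<inter> {..0}" e "V 0" "comb 0" by (rule gs)
    have "continuous_on {0..1} (\<lambda>t. J (comb 0 (\<lambda>i. t * cv i)) (grad (comb 0 (\<lambda>i. t * cv i))))"
      by (rule continuous_on_compose2[OF G.comb_continuous(2)])
        (use cvt(1) in \<open>auto intro!: continuous_on_coordinatewise_then_product continuous_intros\<close>)
    then have "bounded ((\<lambda>t. J (\<lambda>x. t * v x) (grad (\<lambda>x. t * v x))) ` {0..1})"
      unfolding cvt(2) by (intro compact_imp_bounded compact_continuous_image) auto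
    then obtain B where "\<And>t. t \<in> {0..1} \<Longrightarrow> \<bar>J (\<lambda>x. t * v x) (grad (\<lambda>x. t * v x))\<bar> \<le> B"
      unfolding bounded_iff real_norm_def by (meson imageI)
    then show thesis using that[of B] abs_le_D1 by blast
  qed
  define E where "E n = comb n ` V n" for n
  have "\<exists>w1 w2 w3. {w1, w2, w3} \<subseteq> E n \<and> (\<forall>w\<in>{w1, w2, w3}. \<forall>\<phi>\<in>E n. L w (grad w) \<phi> (grad \<phi>) = 0) \<and>
      Phi (grad w1) \<le> r1 \<and> J w1 (grad w1) \<le> 0 \<and> Phi (grad w2) \<ge> r2 \<and> J w2 (grad w2) \<le> 0 \<and> J w3 (grad w3) \<ge> \<rho> \<and> J w3 (grad w3) \<le> B" for n
  proof -
    interpret G: galerkin_space \<Omega> p \<mu> \<Lambda>1 \<Lambda>2 k A a f "I \<inter> {..n}" e "V n" "comb n" by (rule gs)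
    obtain c1 c2 c3 where c: "c1 \<in> V n" "c2 \<in> V n" "c3 \<in> V n"
      "\<And>c d. c \<in> {c1, c2, c3} \<Longrightarrow> L (comb n c) (grad (comb n c)) (comb n d) (grad (comb n d)) = 0"
      "Phi (grad (comb n c1)) \<le> r1" "J (comb n c1) (grad (comb n c1)) \<le> 0"
      "Phi (grad (comb n c2)) \<ge> r2" "J (comb n c2) (grad (comb n c2)) \<le> 0"
      "J (comb n c3) (grad (comb n c3)) \<ge> \<rho>" "J (comb n c3) (grad (comb n c3)) \<le> B"
      by (rule G.three_critical[OF r \<rho> bar cvn(1), unfolded cvn(2) cvt(2), OF _ _ _ v(2,3) B]) blast+
    show ?thesis
      by (rule exI[of _ "comb n c1"], rule exI[of _ "comb n c2"], rule exI[of _ "comb n c3"]) (use c in \<open>auto simp: E_def\<close>)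
  qed
  then obtain w1 w2 w3 where w: "\<And>n. {w1 n, w2 n, w3 n} \<subseteq> E n"
    "\<And>n w \<phi>. w \<in> {w1 n, w2 n, w3 n} \<Longrightarrow> \<phi> \<in> E n \<Longrightarrow> L w (grad w) \<phi> (grad \<phi>) = 0"
    "\<And>n. Phi (grad (w1 n)) \<le> r1" "\<And>n. J (w1 n) (grad (w1 n)) \<le> 0"
    "\<And>n. Phi (grad (w2 n)) \<ge> r2" "\<And>n. J (w2 n) (grad (w2 n)) \<le> 0"
    "\<And>n. J (w3 n) (grad (w3 n)) \<ge> \<rho>" "\<And>n. J (w3 n) (grad (w3 n)) \<le> B"
    by metis
  have ET: "\<phi> \<in> T" if "\<phi> \<in> E n" for n \<phi>
  proof -
    interpret G: galerkin_space \<Omega> p \<mu> \<Lambda>1 \<Lambda>2 k A a f "I \<inter> {..n}" e "V n" "comb n" by (rule gs)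
    show ?thesis using that G.comb_T by (auto simp: E_def)
  qed
  have Emono: "E m \<subseteq> E n" if "m \<le> n" for m n
  proof (rule image_subsetI[of "V m" "comb m" "E n", folded E_def])
    fix c assume "c \<in> V m"
    then have "comb m c = comb n c" "c \<in> V n" using Vmono[OF that] comb_mono[OF that] by auto
    then show "comb m c \<in> E n" by (simp add: E_def)
  qed
  have Ediff: "(\<lambda>x. \<phi> x - \<psi> x) \<in> E n" if h: "\<phi> \<in> E n" "\<psi> \<in> E n" for n \<phi> \<psi>
  proof -
    obtain c d where cd: "c \<in> V n" "d \<in> V n" "\<phi> = comb n c" "\<psi> = comb n d" using h by (auto simp: E_def)
    have "(\<lambda>x. \<phi> x - \<psi> x) = comb n (\<lambda>i. c i - d i)" "(\<lambda>i. c i - d i) \<in> V n"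
      using cd by (auto simp: comb_def V_def sum_subtractf left_diff_distrib)
    then show ?thesis by (simp add: E_def)
  qed
  have Edense: "\<exists>n. \<exists>\<psi>\<in>E n. \<forall>x\<in>\<Omega>. \<bar>\<phi> x - \<psi> x\<bar> < s \<and> norm (grad \<phi> x - grad \<psi> x) < s" if h: "\<phi> \<in> T" "s > 0" for \<phi> s
  proof -
    obtain i where i: "\<forall>x\<in>cball 0 R. \<bar>\<phi> x - e0 i x\<bar> < s \<and> norm (grad \<phi> x - grad (e0 i) x) < s" using e0(2)[OF h] by blast
    obtain c where c: "\<forall>j. j \<notin> I \<inter> {..Suc i} \<longrightarrow> c j = 0" "\<forall>x. e (Suc i) x = (\<Sum>j\<in>I \<inter> {..Suc i}. c j * e j x)"
      using rep[of "Suc i"] by blast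
    have "e0 i = comb (Suc i) c" using c(2) by (simp add: comb_def fun_eq_iff e_def)
    moreover have "c \<in> V (Suc i)" using c(1) by (simp add: V_def)
    ultimately have "e0 i \<in> E (Suc i)" by (auto simp: E_def)
    then show ?thesis using i R by blast
  qed
  have wE: "w1 n \<in> E n" "w2 n \<in> E n" "w3 n \<in> E n" for n using w(1)[of n] by auto
  have crit: "\<phi> \<in> E n \<Longrightarrow> L (w1 n) (grad (w1 n)) \<phi> (grad \<phi>) = 0" "\<phi> \<in> E n \<Longrightarrow> L (w2 n) (grad (w2 n)) \<phi> (grad \<phi>) = 0"
    "\<phi> \<in> E n \<Longrightarrow> L (w3 n) (grad (w3 n)) \<phi> (grad \<phi>) = 0" for n \<phi>
    using w(2)[of "w1 n" n \<phi>] w(2)[of "w2 n" n \<phi>] w(2)[of "w3 n" n \<phi>] by auto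
  have lim: "\<exists>u U r. weak_solution \<Omega> p a k f \<mu> u \<and> has_weak_gradient \<Omega> u U \<and> in_Lp \<Omega> p u \<and> in_Lp \<Omega> p U \<and>
      (\<lambda>n. J (w (r n)) (grad (w (r n)))) \<longlonglongrightarrow> J u U \<and> (\<lambda>n. Phi (grad (w (r n)))) \<longlonglongrightarrow> Phi U"
    if h: "\<forall>n. w n \<in> E n" "\<forall>n. \<forall>\<phi>\<in>E n. L (w n) (grad (w n)) \<phi> (grad \<phi>) = 0" "\<forall>n. J (w n) (grad (w n)) \<le> B'" for w B'
  proof -
    obtain u U and r :: "nat \<Rightarrow> nat" where "weak_solution \<Omega> p a k f \<mu> u" "has_weak_gradient \<Omega> u U" "in_Lp \<Omega> p u" "in_Lp \<Omega> p U"
      "(\<lambda>n. J (w (r n)) (grad (w (r n)))) \<longlonglongrightarrow> J u U" "(\<lambda>n. Phi (grad (w (r n)))) \<longlonglongrightarrow> Phi U"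
    proof (rule galerkin_limit[of E w B'])
      show "\<phi> \<in> T" if "\<phi> \<in> E n" for n \<phi> by (rule ET[OF that])
      show "E m \<subseteq> E n" if "m \<le> n" for m n by (rule Emono[OF that])
      show "(\<lambda>x. \<phi> x - \<psi> x) \<in> E n" if "\<phi> \<in> E n" "\<psi> \<in> E n" for n \<phi> \<psi> by (rule Ediff[OF that])
      show "\<exists>n. \<exists>\<psi>\<in>E n. \<forall>x\<in>\<Omega>. \<bar>\<phi> x - \<psi> x\<bar> < s \<and> norm (grad \<phi> x - grad \<psi> x) < s" if "\<phi> \<in> T" "s > 0" for \<phi> s
        by (rule Edense[OF that])
    qed (use h in blast)+
    then show ?thesis by blast
  qed
  obtain u1 U1 s1 where u1: "weak_solution \<Omega> p a k f \<mu> u1" "has_weak_gradient \<Omega> u1 U1" "in_Lp \<Omega> p u1" "in_Lp \<Omega> p U1"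
    "(\<lambda>n. J (w1 (s1 n)) (grad (w1 (s1 n)))) \<longlonglongrightarrow> J u1 U1" "(\<lambda>n. Phi (grad (w1 (s1 n)))) \<longlonglongrightarrow> Phi U1"
    using lim[of w1 "0"] wE(1) crit(1) w(4) by blast
  obtain u2 U2 s2 where u2: "weak_solution \<Omega> p a k f \<mu> u2" "has_weak_gradient \<Omega> u2 U2" "in_Lp \<Omega> p u2" "in_Lp \<Omega> p U2"
    "(\<lambda>n. J (w2 (s2 n)) (grad (w2 (s2 n)))) \<longlonglongrightarrow> J u2 U2" "(\<lambda>n. Phi (grad (w2 (s2 n)))) \<longlonglongrightarrow> Phi U2"
    using lim[of w2 "0"] wE(2) crit(2) w(6) by blast
  obtain u3 U3 s3 where u3: "weak_solution \<Omega> p a k f \<mu> u3" "has_weak_gradient \<Omega> u3 U3" "in_Lp \<Omega> p u3" "in_Lp \<Omega> p U3"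
    "(\<lambda>n. J (w3 (s3 n)) (grad (w3 (s3 n)))) \<longlonglongrightarrow> J u3 U3" "(\<lambda>n. Phi (grad (w3 (s3 n)))) \<longlonglongrightarrow> Phi U3"
    using lim[of w3 "B"] wE(3) crit(3) w(8) by blast
  have P1: "Phi U1 \<le> r1" by (rule LIMSEQ_le_const2[OF u1(6)]) (use w in auto)
  have J1: "J u1 U1 \<le> 0" by (rule LIMSEQ_le_const2[OF u1(5)]) (use w in auto)
  have P2: "Phi U2 \<ge> r2" by (rule LIMSEQ_le_const[OF u2(6)]) (use w in auto)
  have J2: "J u2 U2 \<le> 0" by (rule LIMSEQ_le_const2[OF u2(5)]) (use w in auto)
  have J3: "J u3 U3 \<ge> \<rho>" by (rule LIMSEQ_le_const[OF u3(5)]) (use w in auto)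
  \<comment> \<open>Solutions that agree almost everywhere have gradients that agree almost
    everywhere, hence equal values of \<Phi> and J.\<close>
  have same: "Phi U = Phi U'" "J u U = J u' U'"
    if ae: "AE x in M. u x = u' x" and g: "has_weak_gradient \<Omega> u U" "has_weak_gradient \<Omega> u' U'"
      and Lp: "in_Lp \<Omega> p u" "in_Lp \<Omega> p U" "in_Lp \<Omega> p u'" "in_Lp \<Omega> p U'" for u u' U U'
  proof -
    have aeU: "AE x in M. U x = U' x" by (rule weak_gradient_unique[OF open_\<Omega> g ae])
    show P: "Phi U = Phi U'" unfolding Phi_def
      by (rule integral_cong_AE) (use A_integrable Lp aeU in \<open>auto elim!: eventually_mono\<close>)
    have "(LINT x|M. k x * primitive f (u x)) = (LINT x|M. k x * primitive f (u' x))"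
      by (rule integral_cong_AE) (use kF_integrable Lp ae in \<open>auto elim!: eventually_mono\<close>)
    then show "J u U = J u' U'" using J_eq[OF Lp(1,2)] J_eq[OF Lp(3,4)] P by simp
  qed
  have "\<not> (AE x in M. u1 x = u2 x)" using same(1)[OF _ u1(2) u2(2) u1(3,4) u2(3,4)] P1 P2 r by auto
  moreover have "\<not> (AE x in M. u1 x = u3 x)" using same(2)[OF _ u1(2) u3(2) u1(3,4) u3(3,4)] J1 J3 \<rho> by auto
  moreover have "\<not> (AE x in M. u2 x = u3 x)" using same(2)[OF _ u2(2) u3(2) u2(3,4) u3(3,4)] J2 J3 \<rho> by auto
  ultimately show ?thesis using u1(1) u2(1) u3(1) by blast
qed

end

section \<open>The explicit constants\<close>

text \<open>A ball is connected, so it would have to meet the frontier in order to leave \<Omega>.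
  Radii strictly below the supremum avoid the question whether it is attained.\<close>

lemma inradius_ball:
  fixes \<Omega> :: "'a::euclidean_space set"
  assumes \<Omega>: "open \<Omega>" "bounded \<Omega>" "\<Omega> \<noteq> {}"
  shows "inradius \<Omega> > 0" "\<rho> < inradius \<Omega> \<Longrightarrow> \<exists>x0. cball x0 \<rho> \<subseteq> \<Omega>"
proof -
  have "\<Omega> \<noteq> UNIV" using \<Omega>(2) not_bounded_UNIV by auto
  then have fne: "frontier \<Omega> \<noteq> {}" using \<Omega>(3) frontier_not_empty by blast
  then obtain y where y: "y \<in> frontier \<Omega>" by blast
  obtain R where R: "\<And>x. x \<in> \<Omega> \<Longrightarrow> dist y x \<le> R" using \<Omega>(2) unfolding bounded_any_center[of \<Omega> y] by blast
  have bdd: "bdd_above ((\<lambda>x. infdist x (frontier \<Omega>)) ` \<Omega>)"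
    using R infdist_le[OF y] by (auto simp: bdd_above_def dist_commute intro!: exI[of _ R] intro: order_trans)
  obtain x where x: "x \<in> \<Omega>" using \<Omega>(3) by blast
  have "x \<notin> frontier \<Omega>" using x \<Omega>(1) by (simp add: frontier_def interior_open)
  then have "infdist x (frontier \<Omega>) > 0" using fne by (simp add: infdist_pos_not_in_closed)
  then show "inradius \<Omega> > 0" unfolding inradius_def using cSUP_upper[OF x bdd] by linarith
  assume "\<rho> < inradius \<Omega>"
  then obtain x0 where x0: "x0 \<in> \<Omega>" "\<rho> < infdist x0 (frontier \<Omega>)"
    unfolding inradius_def using less_cSUP_iff[OF \<Omega>(3) bdd] by blast
  have "cball x0 \<rho> \<subseteq> \<Omega>"
  proof (rule ccontr)
    assume n: "\<not> cball x0 \<rho> \<subseteq> \<Omega>"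
    then obtain z where "z \<in> cball x0 \<rho>" by blast
    then have "x0 \<in> cball x0 \<rho>" using order_trans[OF zero_le_dist] by simp
    then have "cball x0 \<rho> \<inter> frontier \<Omega> \<noteq> {}"
    proof (intro connected_Int_frontier connected_cball)
      show "cball x0 \<rho> \<inter> \<Omega> \<noteq> {}" using \<open>x0 \<in> cball x0 \<rho>\<close> x0(1) by blast
      show "cball x0 \<rho> - \<Omega> \<noteq> {}" using n by blast
    qed
    then obtain z where "dist x0 z \<le> \<rho>" "z \<in> frontier \<Omega>" by auto
    then show False using infdist_le[of z "frontier \<Omega>" x0] x0(2) by linarith
  qed
  then show "\<exists>x0. cball x0 \<rho> \<subseteq> \<Omega>" by blast
qed

section \<open>Volumes and extrema in the constants\<close>

lemma ball_volume_eq: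
  "ball_volume \<Omega> = inradius \<Omega> ^ DIM('a) * unit_ball_vol (real DIM('a))" for \<Omega> :: "'a::euclidean_space set"
  by (simp add: ball_volume_def unit_ball_vol_def add.commute)

lemma measure_annulus:
  fixes x0 :: "'a::euclidean_space"
  assumes "\<rho> > 0"
  shows "measure lborel (ball x0 \<rho> - cball x0 (\<rho> / 2)) = unit_ball_vol (real DIM('a)) * \<rho> ^ DIM('a) * (1 - 1 / 2 ^ DIM('a))"
proof -
  have "measure lborel (ball x0 \<rho> - cball x0 (\<rho> / 2)) = measure lborel (ball x0 \<rho>) - measure lborel (cball x0 (\<rho> / 2))"
    using emeasure_lborel_ball_finite[of x0 \<rho>] assms by (intro measure_Diff) auto
  then show ?thesis using assms by (simp add: content_ball content_cball power_divide algebra_simps)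
qed

lemma continuous_on_closure_extrema:
  fixes k :: "'a::euclidean_space \<Rightarrow> real"
  assumes \<Omega>: "bounded \<Omega>" "\<Omega> \<noteq> {}" and k: "continuous_on (closure \<Omega>) k" "\<forall>x\<in>closure \<Omega>. k x > 0"
  shows "min_on_closure \<Omega> k > 0" "\<And>x. x \<in> closure \<Omega> \<Longrightarrow> min_on_closure \<Omega> k \<le> k x"
    "max_norm \<Omega> k > 0" "\<And>x. x \<in> closure \<Omega> \<Longrightarrow> k x \<le> max_norm \<Omega> k"
proof -
  have c: "compact (closure \<Omega>)" "closure \<Omega> \<noteq> {}" using \<Omega> by (auto simp: compact_closure)
  obtain x0 where x0: "x0 \<in> closure \<Omega>" "\<And>y. y \<in> closure \<Omega> \<Longrightarrow> k x0 \<le> k y" using continuous_attains_inf[OF c k(1)] by blast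
  obtain x1 where x1: "x1 \<in> closure \<Omega>" "\<And>y. y \<in> closure \<Omega> \<Longrightarrow> k y \<le> k x1" using continuous_attains_sup[OF c k(1)] by blast
  have "min_on_closure \<Omega> k = k x0" unfolding min_on_closure_def using x0 by (intro cInf_eq_minimum) auto
  then show "min_on_closure \<Omega> k > 0" "\<And>x. x \<in> closure \<Omega> \<Longrightarrow> min_on_closure \<Omega> k \<le> k x" using x0 k(2) by auto
  have "max_norm \<Omega> k = k x1" unfolding max_norm_def using x1 k(2) by (intro cSup_eq_maximum) (auto simp: abs_of_pos)
  then show "max_norm \<Omega> k > 0" "\<And>x. x \<in> closure \<Omega> \<Longrightarrow> k x \<le> max_norm \<Omega> k" using x1 k(2) by auto
qed

context dirichlet_problem
begin

lemma test_function_W1p_0: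
  assumes \<phi>: "\<phi> \<in> T"
  shows "\<phi> \<in> W1p_0 \<Omega> p" "W1p_0_norm \<Omega> p \<phi> = (LINT x|M. norm (grad \<phi> x) powr p) powr (1 / p)"
proof -
  note g = has_weak_gradient_test_function[OF open_\<Omega> \<phi>]
  show "\<phi> \<in> W1p_0 \<Omega> p"
    by (rule W1p_0_memI[OF in_Lp_test(1)[OF \<phi>] in_Lp_test(2)[OF \<phi>] g]) (use \<phi> p0 in \<open>intro bexI[of _ \<phi>], auto\<close>)
  show "W1p_0_norm \<Omega> p \<phi> = (LINT x|M. norm (grad \<phi> x) powr p) powr (1 / p)"
    by (simp add: W1p_0_norm_def weak_grad_props(4)[OF open_\<Omega> g in_Lp_test(2)[OF \<phi>]])
qed

text \<open>The bound depends on \<phi> through the value of \<Phi> only, which makes it a barrier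
  estimate. \<open>alpha5\<close> bounds the gradient norm by \<Phi>, and the embedding constants
  bound the two terms that dominate the primitive.\<close>

lemma J_lower_bound:
  assumes \<phi>: "\<phi> \<in> T" and K: "\<And>x. x \<in> closure \<Omega> \<Longrightarrow> k x \<le> K" and K0: "K > 0" and q: "q > 1" and a12: "a1 \<ge> 0" "a2 \<ge> 0"
    and f_growth: "\<forall>t. \<bar>f t\<bar> \<le> a1 + a2 * \<bar>t\<bar> powr (q - 1)"
    and c1: "embedding_constant \<Omega> p 1 c1" and cq: "embedding_constant \<Omega> p q cq"
  shows "J \<phi> (grad \<phi>) \<ge> Phi (grad \<phi>) - \<mu> * (K * (a1 * (c1 * (Phi (grad \<phi>) / \<Lambda>1) powr (1 / p)) + a2 / q * (cq powr q * (Phi (grad \<phi>) / \<Lambda>1) powr (q / p))))"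
proof -
  define N where "N = (LINT x|M. norm (grad \<phi> x) powr p)"
  define P where "P = Phi (grad \<phi>) / \<Lambda>1"
  have N0: "N \<ge> 0" by (simp add: N_def)
  have NP: "N \<le> P" using Phi_bounds(1)[OF in_Lp_test(2)[OF \<phi>]] \<Lambda> by (simp add: N_def P_def field_simps)
  note W = test_function_W1p_0[OF \<phi>]
  have e1: "integrable M (\<lambda>x. \<bar>\<phi> x\<bar> powr 1)" "(LINT x|M. \<bar>\<phi> x\<bar> powr 1) powr 1 \<le> c1 * N powr (1 / p)" "c1 > 0"
    using c1 W by (auto simp: embedding_constant_def in_Lp_def Lp_norm_def N_def)
  have i1: "integrable M (\<lambda>x. \<bar>\<phi> x\<bar>)" "(LINT x|M. \<bar>\<phi> x\<bar>) \<le> c1 * N powr (1 / p)"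
    using e1 by (simp_all add: powr_one)
  have eq: "integrable M (\<lambda>x. \<bar>\<phi> x\<bar> powr q)" "(LINT x|M. \<bar>\<phi> x\<bar> powr q) powr (1 / q) \<le> cq * N powr (1 / p)" "cq > 0"
    using cq W by (auto simp: embedding_constant_def in_Lp_def Lp_norm_def N_def)
  have "((LINT x|M. \<bar>\<phi> x\<bar> powr q) powr (1 / q)) powr q \<le> (cq * N powr (1 / p)) powr q"
    using eq q by (intro powr_mono2) auto
  then have iq: "(LINT x|M. \<bar>\<phi> x\<bar> powr q) \<le> cq powr q * N powr (q / p)"
    using q by (simp add: powr_powr powr_mult)
  have "(LINT x|M. k x * primitive f (\<phi> x)) \<le> (LINT x|M. K * (a1 * \<bar>\<phi> x\<bar> + a2 / q * \<bar>\<phi> x\<bar> powr q))"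
  proof (rule integral_mono[OF kF_integrable[OF in_Lp_test(1)[OF \<phi>]]])
    show "integrable M (\<lambda>x. K * (a1 * \<bar>\<phi> x\<bar> + a2 / q * \<bar>\<phi> x\<bar> powr q))" using i1 eq by simp
    fix x assume "x \<in> space M"
    then have x: "x \<in> closure \<Omega>" using \<Omega>_closure by (simp add: space_M)
    have "primitive f (\<phi> x) \<le> a1 * \<bar>\<phi> x\<bar> + a2 / q * \<bar>\<phi> x\<bar> powr q"
      using primitive_bound[OF f_cont q a12(2), of a1 "\<phi> x"] f_growth by auto
    then have "k x * primitive f (\<phi> x) \<le> k x * (a1 * \<bar>\<phi> x\<bar> + a2 / q * \<bar>\<phi> x\<bar> powr q)"
      using k_pos x by (intro mult_left_mono) (auto simp: less_imp_le)
    also have "\<dots> \<le> K * (a1 * \<bar>\<phi> x\<bar> + a2 / q * \<bar>\<phi> x\<bar> powr q)"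
      using K[OF x] a12 q by (intro mult_right_mono) auto
    finally show "k x * primitive f (\<phi> x) \<le> K * (a1 * \<bar>\<phi> x\<bar> + a2 / q * \<bar>\<phi> x\<bar> powr q)" .
  qed
  also have "\<dots> = K * (a1 * (LINT x|M. \<bar>\<phi> x\<bar>) + a2 / q * (LINT x|M. \<bar>\<phi> x\<bar> powr q))"
    using i1 eq by simp
  also have "\<dots> \<le> K * (a1 * (c1 * P powr (1 / p)) + a2 / q * (cq powr q * P powr (q / p)))"
  proof (intro mult_left_mono add_mono)
    show "(LINT x|M. \<bar>\<phi> x\<bar>) \<le> c1 * P powr (1 / p)"
      by (rule order_trans[OF i1(2)]) (use e1(3) N0 NP p0 in \<open>auto intro!: mult_left_mono powr_mono2\<close>)
    show "(LINT x|M. \<bar>\<phi> x\<bar> powr q) \<le> cq powr q * P powr (q / p)"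
      by (rule order_trans[OF iq]) (use N0 NP p0 q in \<open>auto intro!: mult_left_mono powr_mono2\<close>)
  qed (use K0 a12 q in auto)
  finally have "\<mu> * (LINT x|M. k x * primitive f (\<phi> x)) \<le> \<mu> * (K * (a1 * (c1 * P powr (1 / p)) + a2 / q * (cq powr q * P powr (q / p))))"
    using \<mu>_pos by (intro mult_left_mono) auto
  then show ?thesis unfolding J_eq[OF in_Lp_test[OF \<phi>]] P_def by linarith
qed

text \<open>F is nonnegative on the range of v, so the reaction integral may be cut down to the ball
  on which v = \<delta>.\<close>

lemma J_tent_upper_bound:
  assumes v: "v \<in> T" "\<And>x. v x \<ge> 0" "\<And>x. x \<in> cball x0 s \<Longrightarrow> v x = \<delta>" and s: "cball x0 s \<subseteq> \<Omega>" "s \<ge> 0"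
    and k0: "\<And>x. x \<in> closure \<Omega> \<Longrightarrow> k0 \<le> k x" "k0 > 0" and F: "\<forall>t>0. primitive f t \<ge> 0"
  shows "J v (grad v) \<le> \<Lambda>2 * (LINT x|lborel. norm (grad v x) powr p) - \<mu> * (k0 * primitive f \<delta> * (unit_ball_vol (real DIM('a)) * s ^ DIM('a)))"
proof -
  have mi: "(indicator (cball x0 s) :: 'a \<Rightarrow> real) \<in> borel_measurable borel" by (intro borel_measurable_indicator) simp
  have out: "(indicator (cball x0 s) x :: real) = 0" if "x \<notin> \<Omega>" for x using that s(1) by (auto simp: indicator_def)
  have fin: "emeasure lborel (cball x0 s) < \<infinity>" by (rule emeasure_lborel_cball_finite)
  have il: "(LINT x|M. indicator (cball x0 s) x) = (LINT x|lborel. indicator (cball x0 s) x :: real)"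
    "integrable M (indicator (cball x0 s) :: 'a \<Rightarrow> real) \<longleftrightarrow> integrable lborel (indicator (cball x0 s) :: 'a \<Rightarrow> real)"
    by (rule integral_lebesgue_on_eq_lborel[OF mi _ \<Omega>_lebesgue], rule out, assumption)+
  have ind1: "integrable M (indicator (cball x0 s) :: 'a \<Rightarrow> real)" unfolding il(2) using fin by simp
  have ind2: "(LINT x|M. indicator (cball x0 s) x) = unit_ball_vol (real DIM('a)) * s ^ DIM('a)"
    unfolding il(1) using s(2) by (simp add: content_cball)
  note ind = ind2 ind1
  have "(LINT x|M. k0 * primitive f \<delta> * indicator (cball x0 s) x) \<le> (LINT x|M. k x * primitive f (v x))"
  proof (rule integral_mono[OF _ kF_integrable[OF in_Lp_test(1)[OF v(1)]]])
    show "integrable M (\<lambda>x. k0 * primitive f \<delta> * indicator (cball x0 s) x)" using ind by simp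
    fix x assume "x \<in> space M"
    then have x: "x \<in> closure \<Omega>" using \<Omega>_closure by (simp add: space_M)
    have F0: "primitive f (v x) \<ge> 0" using F v(2)[of x] by (cases "v x = 0") (auto simp: primitive_0)
    show "k0 * primitive f \<delta> * indicator (cball x0 s) x \<le> k x * primitive f (v x)"
    proof (cases "x \<in> cball x0 s")
      case True
      then show ?thesis using F0 v(3)[OF True] k0(1)[OF x] by (simp add: mult_right_mono)
    next
      case False
      then show ?thesis using F0 k0(1)[OF x] k0(2) by simp
    qed
  qed
  then have "k0 * primitive f \<delta> * (unit_ball_vol (real DIM('a)) * s ^ DIM('a)) \<le> (LINT x|M. k x * primitive f (v x))"
    using ind by simp
  then have "\<mu> * (k0 * primitive f \<delta> * (unit_ball_vol (real DIM('a)) * s ^ DIM('a))) \<le> \<mu> * (LINT x|M. k x * primitive f (v x))"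
    using \<mu>_pos by (intro mult_left_mono) auto
  then show ?thesis
    unfolding J_eq[OF in_Lp_test[OF v(1)]] using Phi_bounds(2)[OF in_Lp_test(2)[OF v(1)]] unfolding LINT_test(2)[OF v(1) p0] by linarith
qed

end

theorem theorem3p5:
  fixes \<Omega> :: "(real ^ 'n) set"
    and p q a1 a2 \<Lambda>1 \<Lambda>2 c1 cq \<gamma> \<delta> \<mu> :: real
    and k :: "real ^ 'n \<Rightarrow> real"
    and A :: "real ^ 'n \<Rightarrow> real ^ 'n \<Rightarrow> real"
    and a :: "real ^ 'n \<Rightarrow> real ^ 'n \<Rightarrow> real ^ 'n"
    and f :: "real \<Rightarrow> real"
  assumes N: "CARD('n) \<ge> 2"
    and p: "p > 1"
    and \<Omega>: "smooth_bounded_domain \<Omega>"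
    and k_cont: "continuous_on (closure \<Omega>) k"
    and k_pos: "\<forall>x\<in>closure \<Omega>. k x > 0"
    and A_cont: "continuous_on (closure \<Omega> \<times> UNIV) (\<lambda>(x, \<xi>). A x \<xi>)"
    and A_grad: "\<forall>x\<in>closure \<Omega>. \<forall>\<xi>. GDERIV (A x) \<xi> :> a x \<xi>"
    and a_cont: "continuous_on (closure \<Omega> \<times> UNIV) (\<lambda>(x, \<xi>). a x \<xi>)"
    and alpha1: "\<forall>x\<in>\<Omega>. A x 0 = 0"
    and alpha2: "\<exists>c>0. \<forall>x\<in>\<Omega>. \<forall>\<xi>. norm (a x \<xi>) \<le> c * (1 + norm \<xi> powr (p - 1))"
    and alpha3: "\<exists>k0>0. \<forall>x\<in>closure \<Omega>. \<forall>\<xi> \<eta>.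
        A x ((1/2) *\<^sub>R (\<xi> + \<eta>)) \<le> 1/2 * A x \<xi> + 1/2 * A x \<eta> - k0 * norm (\<xi> - \<eta>) powr p"
    and alpha4: "\<forall>x\<in>closure \<Omega>. \<forall>\<xi>. 0 \<le> a x \<xi> \<bullet> \<xi> \<and> a x \<xi> \<bullet> \<xi> \<le> p * A x \<xi>"
    and \<Lambda>: "\<Lambda>1 > 0" "\<Lambda>2 > 0"
    and alpha5: "\<forall>x\<in>closure \<Omega>. \<forall>\<xi>.
        \<Lambda>1 * norm \<xi> powr p \<le> A x \<xi> \<and> A x \<xi> \<le> \<Lambda>2 * norm \<xi> powr p"
    and f_cont: "continuous_on UNIV f"
    and a12: "a1 \<ge> 0" "a2 \<ge> 0"
    and q: "q > 1" "p < real CARD('n) \<Longrightarrow> q < p * real CARD('n) / (real CARD('n) - p)"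
    and f_growth: "\<forall>t. \<bar>f t\<bar> \<le> a1 + a2 * \<bar>t\<bar> powr (q - 1)"
    and c1: "embedding_constant \<Omega> p 1 c1"
    and cq: "embedding_constant \<Omega> p q cq"
    and hyp_i: "\<forall>s>0. primitive f s \<ge> 0"
    and hyp_ii: "((\<lambda>t. f t / \<bar>t\<bar> powr (p - 1)) \<longlongrightarrow> 0) at_infinity"
    and \<gamma>: "\<gamma> > 0" and \<delta>: "\<delta> > 0" "\<delta> > \<gamma> * kappa \<Omega> p \<Lambda>1"
    and hyp_iii: "primitive f \<delta> / \<delta> powr p
        > a1 * (G1 \<Omega> p k \<Lambda>1 \<Lambda>2 c1 / \<gamma> powr (p - 1))
          + a2 * G2 \<Omega> p q k \<Lambda>1 \<Lambda>2 cq * \<gamma> powr (q - p)"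
    and \<mu>: "\<mu> \<in> {prefactor \<Omega> p k \<Lambda>2 * (\<delta> powr p / primitive f \<delta>) <..<
        prefactor \<Omega> p k \<Lambda>2 * (1 / (a1 * (G1 \<Omega> p k \<Lambda>1 \<Lambda>2 c1 / \<gamma> powr (p - 1))
          + a2 * G2 \<Omega> p q k \<Lambda>1 \<Lambda>2 cq * \<gamma> powr (q - p)))}"
  shows "\<exists>u1 u2 u3.
      weak_solution \<Omega> p a k f \<mu> u1 \<and> weak_solution \<Omega> p a k f \<mu> u2 \<and>
      weak_solution \<Omega> p a k f \<mu> u3 \<and>
      \<not> (AE x in lebesgue_on \<Omega>. u1 x = u2 x) \<and>
      \<not> (AE x in lebesgue_on \<Omega>. u1 x = u3 x) \<and>
      \<not> (AE x in lebesgue_on \<Omega>. u2 x = u3 x)"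
proof -
  have \<Omega>': "open \<Omega>" "bounded \<Omega>" "\<Omega> \<noteq> {}" using \<Omega> by (auto simp: smooth_bounded_domain_def)
  define N where "N = CARD('n)"
  have DIM: "DIM(real ^ 'n) = N" by (simp add: N_def)
  have N1: "N \<ge> 2" using N by (simp add: N_def)
  define \<tau> where "\<tau> = inradius \<Omega>"
  have \<tau>: "\<tau> > 0" unfolding \<tau>_def by (rule inradius_ball[OF \<Omega>'])
  define u where "u = unit_ball_vol (real N)"
  have u: "u > 0" by (simp add: u_def)
  define k0 where "k0 = min_on_closure \<Omega> k"
  define K where "K = max_norm \<Omega> k"
  note ke = continuous_on_closure_extrema[OF \<Omega>'(2,3) k_cont k_pos, folded k0_def K_def]
  define E where "E = (2 :: real) ^ N - 1"
  have E: "E > 0" unfolding E_def using N1 by (simp add: one_less_power)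
  define F where "F = primitive f \<delta>"
  define pf where "pf = prefactor \<Omega> p k \<Lambda>2"
  have pf_eq: "pf = 2 powr p * E * \<Lambda>2 / (\<tau> powr p * k0)"
    by (simp add: pf_def prefactor_def N_def E_def \<tau>_def k0_def)
  have pf: "pf > 0" unfolding pf_eq using E \<Lambda> \<tau> ke(1) by simp
  have cpos: "c1 > 0" "cq > 0" using c1 cq by (auto simp: embedding_constant_def)
  define D where "D = a1 * (G1 \<Omega> p k \<Lambda>1 \<Lambda>2 c1 / \<gamma> powr (p - 1)) + a2 * G2 \<Omega> p q k \<Lambda>1 \<Lambda>2 cq * \<gamma> powr (q - p)"
  \<comment> \<open>S t is the bound on the integral of k F(u) at the level \<Phi> = t that appears
    in \<open>J_lower_bound\<close>.\<close>
  define S where "S t = K * (a1 * (c1 * (t / \<Lambda>1) powr (1 / p)) + a2 / q * (cq powr q * (t / \<Lambda>1) powr (q / p)))" for t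
  define r where "r = \<gamma> powr p"
  have r: "r > 0" using \<gamma> by (simp add: r_def)
  \<comment> \<open>G1 and G2 are made for this identity: for positive D it says that the upper end
    pf / D of the interval for \<mu> is r / S r.\<close>
  have D_eq: "D * r = pf * S r"
  proof -
    have 1: "(r / \<Lambda>1) powr (1 / p) = \<gamma> / \<Lambda>1 powr (1 / p)"
      using p \<gamma> by (simp add: r_def powr_divide powr_powr)
    have 2: "(r / \<Lambda>1) powr (q / p) = \<gamma> powr q / \<Lambda>1 powr (q / p)"
      using p \<gamma> by (simp add: r_def powr_divide powr_powr)
    have 3: "r / \<gamma> powr (p - 1) = \<gamma>" using \<gamma> by (simp add: r_def powr_diff[symmetric] powr_one)
    have 4: "\<gamma> powr (q - p) * r = \<gamma> powr q" using \<gamma> by (simp add: r_def powr_add[symmetric])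
    have "D * r = a1 * G1 \<Omega> p k \<Lambda>1 \<Lambda>2 c1 * (r / \<gamma> powr (p - 1)) + a2 * G2 \<Omega> p q k \<Lambda>1 \<Lambda>2 cq * (\<gamma> powr (q - p) * r)"
      by (simp add: D_def algebra_simps)
    also have "\<dots> = pf * S r"
      unfolding 3 4 S_def 1 2 G1_def G2_def pf_def[symmetric] K_def[symmetric] by (simp add: field_simps)
    finally show ?thesis .
  qed
  have D0: "D \<ge> 0"
  proof -
    have "S r \<ge> 0" unfolding S_def using ke(3) a12 cpos q by (intro mult_nonneg_nonneg add_nonneg_nonneg) auto
    then have "D * r \<ge> 0" unfolding D_eq using pf by simp
    then show ?thesis using r by (simp add: zero_le_mult_iff)
  qed
  have F: "F > 0"
  proof -
    have "F / \<delta> powr p > 0" using hyp_iii D0 unfolding D_def[symmetric] F_def by linarith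
    then show ?thesis using \<delta>(1) by (simp add: zero_less_divide_iff)
  qed
  have \<mu>1: "pf * (\<delta> powr p / F) < \<mu>" and \<mu>2: "\<mu> < pf * (1 / D)"
    using \<mu> by (simp_all add: pf_def F_def D_def)
  have \<mu>0: "\<mu> > 0" using \<mu>1 pf F \<delta>(1) by (smt (verit) divide_pos_pos mult_pos_pos powr_gt_zero)
  \<comment> \<open>Division by 0 gives 0, so D = 0 would make the upper end of the interval 0,
    against \<mu> > 0.\<close>
  have Dpos: "D > 0"
  proof (rule ccontr)
    assume "\<not> D > 0"
    then have "D = 0" using D0 by simp
    then show False using \<mu>2 \<mu>0 by simp
  qed
  have \<mu>S: "\<mu> * S r < r"
  proof -
    have "\<mu> * D < pf" using \<mu>2 Dpos by (simp add: field_simps)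
    then have "\<mu> * D * r < pf * r" using r by simp
    moreover have "pf * (\<mu> * S r) = \<mu> * (D * r)" unfolding D_eq by (simp add: mult_ac)
    ultimately have "pf * (\<mu> * S r) < pf * r" by (simp only: mult.assoc)
    then show ?thesis using pf by simp
  qed
  interpret dirichlet_problem \<Omega> p \<mu> \<Lambda>1 \<Lambda>2 k A a f
    by unfold_locales (use \<Omega>' p \<mu>0 k_cont k_pos A_cont A_grad a_cont alpha2 alpha3 \<Lambda> alpha5 f_cont hyp_ii in auto)
  \<comment> \<open>The p-energy of the tent of height \<delta> over a ball of radius
    \<rho>.\<close>
  define X where "X \<rho> = (2 * \<delta> / \<rho>) powr p * (u * \<rho> ^ N * (1 - 1 / 2 ^ N))" for \<rho>
  have X\<tau>: "X \<tau> = 2 powr p * \<delta> powr p / \<tau> powr p * (u * \<tau> ^ N) * E / 2 ^ N"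
    using \<delta>(1) \<tau> by (simp add: X_def E_def powr_divide powr_mult field_simps)
  \<comment> \<open>This is \<delta> > \<gamma>\<kappa> raised to the power p: at radius \<tau> the
    energy of the tent exceeds what is needed to pass the barrier level r.\<close>
  have XA: "\<Lambda>1 * X \<tau> > r"
  proof -
    define Z where "Z = 2 powr (real N - p) / (u * \<tau> ^ N * E * \<Lambda>1)"
    have Z: "Z > 0" using u \<tau> E \<Lambda> by (simp add: Z_def)
    have kap: "kappa \<Omega> p \<Lambda>1 = Z powr (1 / p) * \<tau>"
      by (simp add: kappa_def ball_volume_eq DIM Z_def E_def \<tau>_def u_def N_def mult.commute)
    have "(\<gamma> * (Z powr (1 / p) * \<tau>)) powr p < \<delta> powr p"
      using \<delta>(2) \<gamma> p \<tau> unfolding kap by (intro powr_less_mono2) auto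
    then have "r * (Z * \<tau> powr p) < \<delta> powr p"
      using p Z by (simp add: powr_mult powr_powr r_def)
    moreover have "Z = 2 ^ N / (2 powr p * (u * \<tau> ^ N * E * \<Lambda>1))"
      by (simp add: Z_def powr_diff powr_realpow field_simps)
    ultimately have "r * (2 ^ N * \<tau> powr p) < \<delta> powr p * (2 powr p * (u * \<tau> ^ N * E * \<Lambda>1))"
      using u \<tau> E \<Lambda> by (simp add: field_simps)
    then show ?thesis unfolding X\<tau> using \<tau> by (simp add: field_simps)
  qed
  \<comment> \<open>This is the lower bound on \<mu> multiplied by the positive volume u\<tau>^N; at
    radius \<tau> it says that the upper bound for J at the tent is negative.\<close>
  have XB: "\<Lambda>2 * X \<tau> < \<mu> * (k0 * F * (u * (\<tau> / 2) ^ N))"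
  proof -
    have "2 powr p * E * \<Lambda>2 * \<delta> powr p < \<mu> * (\<tau> powr p * k0 * F)"
      using \<mu>1 F \<tau> ke(1) by (simp add: pf_eq field_simps)
    then have "2 powr p * E * \<Lambda>2 * \<delta> powr p * (u * \<tau> ^ N) < \<mu> * (\<tau> powr p * k0 * F) * (u * \<tau> ^ N)"
      using u \<tau> by (intro mult_strict_right_mono) auto
    then show ?thesis unfolding X\<tau> using \<tau> by (simp add: field_simps power_divide)
  qed
  \<comment> \<open>A closed ball of radius \<tau> need not fit into \<Omega>, so both strict
    inequalities are moved to some \<rho> < \<tau> by continuity.\<close>
  have cX: "isCont X \<tau>"
    unfolding X_def using \<tau> \<delta>(1) by (auto intro!: continuous_intros)
  have "((\<lambda>\<rho>. \<Lambda>1 * X \<rho>) \<longlongrightarrow> \<Lambda>1 * X \<tau>) (at_left \<tau>)"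
    using cX by (intro tendsto_intros) (auto simp: isCont_def intro: filterlim_at_split[THEN iffD1, THEN conjunct1])
  then have ev1: "eventually (\<lambda>\<rho>. \<Lambda>1 * X \<rho> > r) (at_left \<tau>)" using XA by (rule order_tendstoD)
  have "((\<lambda>\<rho>. \<mu> * (k0 * F * (u * (\<rho> / 2) ^ N)) - \<Lambda>2 * X \<rho>) \<longlongrightarrow> \<mu> * (k0 * F * (u * (\<tau> / 2) ^ N)) - \<Lambda>2 * X \<tau>) (at_left \<tau>)"
    using cX by (intro tendsto_intros) (auto simp: isCont_def intro: filterlim_at_split[THEN iffD1, THEN conjunct1])
  then have ev2: "eventually (\<lambda>\<rho>. \<mu> * (k0 * F * (u * (\<rho> / 2) ^ N)) - \<Lambda>2 * X \<rho> > 0) (at_left \<tau>)" using XB by (intro order_tendstoD) auto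
  have ev3: "eventually (\<lambda>\<rho>. \<rho> \<in> {0<..<\<tau>}) (at_left \<tau>)" using \<tau> by (rule eventually_at_left_real)
  obtain \<rho> where \<rho>: "\<Lambda>1 * X \<rho> > r" "\<mu> * (k0 * F * (u * (\<rho> / 2) ^ N)) - \<Lambda>2 * X \<rho> > 0" "0 < \<rho>" "\<rho> < \<tau>"
    using eventually_happens[OF eventually_conj[OF ev1 eventually_conj[OF ev2 ev3]]] by (auto simp: trivial_limit_at_left_real)
  obtain x0 where x0: "cball x0 \<rho> \<subseteq> \<Omega>" using inradius_ball(2)[OF \<Omega>'] \<rho>(4) unfolding \<tau>_def by blast
  have p0: "p > 0" using p by simp
  obtain w where w: "\<And>j. w j \<in> T" "\<And>j x. w j x \<ge> 0" "\<And>j x. x \<in> cball x0 (\<rho> / 2) \<Longrightarrow> w j x = \<delta>"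
    "(\<lambda>j. LINT x|lborel. norm (grad (w j) x) powr p) \<longlonglongrightarrow> (2 * \<delta> / \<rho>) powr p * measure lborel (ball x0 \<rho> - cball x0 (\<rho> / 2))"
    using tent_functions[OF x0 \<rho>(3) \<delta>(1) p0] by blast
  have Xlim: "(\<lambda>j. LINT x|lborel. norm (grad (w j) x) powr p) \<longlonglongrightarrow> X \<rho>"
    using w(4) unfolding measure_annulus[OF \<rho>(3)] DIM by (simp add: X_def u_def)
  have "eventually (\<lambda>j. \<Lambda>1 * (LINT x|lborel. norm (grad (w j) x) powr p) > r) sequentially"
    using \<rho>(1) by (intro order_tendstoD(1)[OF tendsto_mult_left[OF Xlim]])
  moreover have "eventually (\<lambda>j. \<Lambda>2 * (LINT x|lborel. norm (grad (w j) x) powr p) < \<mu> * (k0 * F * (u * (\<rho> / 2) ^ N))) sequentially"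
    using \<rho>(2) by (intro order_tendstoD(2)[OF tendsto_mult_left[OF Xlim]]) simp
  ultimately obtain j where j: "\<Lambda>1 * (LINT x|lborel. norm (grad (w j) x) powr p) > r"
    "\<Lambda>2 * (LINT x|lborel. norm (grad (w j) x) powr p) < \<mu> * (k0 * F * (u * (\<rho> / 2) ^ N))"
    using eventually_happens[OF eventually_conj] by (metis (no_types, lifting) trivial_limit_sequentially)
  define v where "v = w j"
  have Phiv: "Phi (grad v) > r"
    using Phi_bounds(1)[OF in_Lp_test(2)[OF w(1)], of j] j(1) unfolding LINT_test(2)[OF w(1) p0] v_def by linarith
  have x0': "cball x0 (\<rho> / 2) \<subseteq> \<Omega>" using x0 \<rho>(3) subset_cball[of "\<rho> / 2" \<rho> x0] by auto
  have Jv: "J v (grad v) < 0"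
    using J_tent_upper_bound[OF w(1) w(2) w(3) x0' _ ke(2) ke(1) hyp_i, of j] \<rho>(3) j(2)
    unfolding v_def DIM u_def[symmetric] F_def[symmetric] by simp
  \<comment> \<open>The lower bound for J as a function of the level t. It is positive at r because
    \<mu> S r < r, hence bounded below near r.\<close>
  define g where "g t = t - \<mu> * S t" for t
  have "isCont g r" unfolding g_def S_def using r p q(1) \<Lambda> by (auto intro!: continuous_intros)
  then have "(g \<longlongrightarrow> g r) (at r)" by (simp add: isCont_def)
  moreover have gr: "g r > 0" using \<mu>S by (simp add: g_def)
  ultimately have "eventually (\<lambda>t. g t > g r / 2) (at r)" by (intro order_tendstoD) auto
  then obtain d where d: "d > 0" "\<And>t. t \<noteq> r \<Longrightarrow> \<bar>t - r\<bar> < d \<Longrightarrow> g t > g r / 2"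
    unfolding eventually_at by (auto simp: dist_real_def)
  \<comment> \<open>Three conditions on the half-width of the shell: it stays where g > g r / 2, its
    inner level is positive, and v lies beyond its outer level.\<close>
  define \<epsilon> where "\<epsilon> = min (d / 2) (min (r / 2) ((Phi (grad v) - r) / 2))"
  have \<epsilon>: "\<epsilon> > 0" "\<epsilon> < d" "\<epsilon> < r" "r + \<epsilon> < Phi (grad v)"
    using d(1) r Phiv by (auto simp: \<epsilon>_def min_def field_simps)
  show ?thesis
  proof (rule three_weak_solutions[of "r - \<epsilon>" "r + \<epsilon>" "g r / 2" v])
    show "0 < r - \<epsilon>" "r - \<epsilon> < r + \<epsilon>" "0 < g r / 2" "v \<in> T" "r + \<epsilon> < Phi (grad v)" "J v (grad v) < 0"
      using \<epsilon> gr w(1) Jv by (auto simp: v_def)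
    fix \<phi> assume \<phi>: "\<phi> \<in> T" "r - \<epsilon> \<le> Phi (grad \<phi>)" "Phi (grad \<phi>) \<le> r + \<epsilon>"
    have "\<bar>Phi (grad \<phi>) - r\<bar> < d" using \<phi> \<epsilon> by linarith
    then have "g (Phi (grad \<phi>)) \<ge> g r / 2" using d(2)[of "Phi (grad \<phi>)"] gr by (cases "Phi (grad \<phi>) = r") auto
    also have "g (Phi (grad \<phi>)) \<le> J \<phi> (grad \<phi>)"
      unfolding g_def S_def by (rule J_lower_bound[OF \<phi>(1) ke(4) ke(3) q(1) a12 f_growth c1 cq])
    finally show "g r / 2 \<le> J \<phi> (grad \<phi>)" .
  qed
qed

end
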